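(* Let $v$ satisfy $Av\in L^2(\Omega)$, let $f=0$ and $v_h=R_hv$, and let $u_h$ be the semidiscrete solution, i.e. $\partial_t^\alpha u_h(t)+A_hu_h(t)=0$ for $t>0$, $u_h(0)=v_h$. Let $(U_h^n)_{n=0}^N$, $U_h^n\equiv U_h^{n,M_n}$, be produced by the incomplete iterative scheme (defined in the context) with $f=0$, this $v_h$, with exact solves $U_h^n=\overline U_h^n$ for $n=1,2$, and with an iterative solver satisfying the contraction property with constants $c_0>0$, $\kappa\in(0,1)$. Let $\ell_n=\ln(1+t_n/\tau)$. Then there exists a $\delta>0$ such that, if $$c_0\kappa^{M_n}\le\delta\,\ell_n^{-1}\min(t_n^{\frac\alpha2},1)$$ (at all time levels $n\ge 3$), then for $n=1,\dots,N$ $$\|U_h^n-u_h(t_n)\|_{L^2(\Omega)}\le c\,\tau\, t_n^{\alpha-1}\,\ell_n\,\|Av\|_{L^2(\Omega)},$$ where $\delta$ and $c$ are independent of $h$ and $\tau$ (and of $v$ and $n$).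
   Context: Setting: $\Omega\subset\mathbb R^d$ ($d=1,2,3$) is a convex polyhedral domain, $T>0$, $\alpha\in(0,1)$, $A=-\Delta$ with domain $D(A)=H_0^1(\Omega)\cap H^2(\Omega)$ (zero Dirichlet condition). $\partial_t^\alpha u(t)=\frac1{\Gamma(1-\alpha)}\int_0^t(t-s)^{-\alpha}u'(s)\,ds$ is the Caputo derivative. Space discretization: $\mathcal T_h$ is a shape regular quasi-uniform triangulation of $\Omega$ into $d$-simplexes with mesh size $h$; $X_h\subset H_0^1(\Omega)$ is the space of continuous piecewise linear functions on $\mathcal T_h$ vanishing on $\partial\Omega$. $P_h:L^2(\Omega)\to X_h$ is the $L^2(\Omega)$-orthogonal projection; $R_h:H_0^1(\Omega)\to X_h$ is the Ritz projection, $(\nabla R_h\varphi,\nabla\chi)=(\nabla\varphi,\nabla\chi)$ for all $\chi\in X_h$; $A_h:X_h\to X_h$ is defined by $(A_h\varphi_h,\chi)=(\nabla\varphi_h,\nabla\chi)$ for all $\varphi_h,\chi\in X_h$. Time discretization: $\tau=T/N$, $t_n=n\tau$, $n=0,\dots,N$. The weights $b_j^{(\alpha)}$ are given by $(1-\xi)^\alpha=\sum_{j\ge0}b_j^{(\alpha)}\xi^j$. Put $f_h^n=P_hf(t_n)$. Incomplete iterative scheme: $U_h^0=v_h\in X_h$. Given $U_h^0,\dots,U_h^{n-1}$, let $\overline U_h^n\in X_h$ be the exact solution of $$(I+\tau^\alpha A_h)\overline U_h^n=\tau^\alpha f_h^n-\sum_{j=1}^nb_j^{(\alpha)}U_h^{n-j}+\sum_{j=0}^nb_j^{(\alpha)}U_h^0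 .$$ For $n\ge2$ the starting guess is $U_h^{n,0}=2U_h^{n-1}-U_h^{n-2}$; an iterative solver produces from it a sequence $U_h^{n,m}\in X_h$, $m\ge 1$, of approximations of $\overline U_h^n$, and one sets $U_h^n=U_h^{n,M_n}$ for a chosen $M_n\in\mathbb N$ (at levels where an exact solve is prescribed, $U_h^n=\overline U_h^n$). Contraction property: with the norm $|\psi|=\|(I+\tau^\alpha A_h)^{1/2}\psi\|_{L^2(\Omega)}$ on $X_h$, there are $\kappa\in(0,1)$ and $c_0>0$ such that $|U_h^{n,m}-\overline U_h^n|\le c_0\kappa^m|U_h^{n,0}-\overline U_h^n|$ for all $m\ge1$ (at every level $n$ where the solver is used). *)

theory Defs
  imports "HOL-Analysis.Analysis"
begin

section \<open>The spaces \<open>L\<^sup>2\<close>, \<open>H\<^sup>1\<close>, \<open>H\<^sup>2\<close> and \<open>H\<^sub>0\<^sup>1\<close>\<close>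

text \<open>
  Elements of these spaces are represented by functions on the whole space of which only the values
  on \<open>\<Omega>\<close>, up to null sets, matter; there is no quotient by equality almost everywhere.
\<close>

definition L2 :: "'a::euclidean_space set \<Rightarrow> ('a \<Rightarrow> real) set" where
  "L2 \<Omega> = {f \<in> borel_measurable (lebesgue_on \<Omega>). integrable (lebesgue_on \<Omega>) (\<lambda>x. (f x)\<^sup>2)}"

definition L2_inner :: "'a::euclidean_space set \<Rightarrow> ('a \<Rightarrow> real) \<Rightarrow> ('a \<Rightarrow> real) \<Rightarrow> real" where
  "L2_inner \<Omega> f g = (\<integral>x. f x * g x \<partial>(lebesgue_on \<Omega>))"

definition L2_norm :: "'a::euclidean_space set \<Rightarrow> ('a \<Rightarrow> real) \<Rightarrow> real" where
  "L2_norm \<Omega> f = sqrt (L2_inner \<Omega> f f)"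

definition partial :: "'a::euclidean_space \<Rightarrow> ('a \<Rightarrow> real) \<Rightarrow> 'a \<Rightarrow> real" where
  "partial i f x = frechet_derivative f (at x) i"

primrec Ck :: "nat \<Rightarrow> ('a::euclidean_space \<Rightarrow> real) \<Rightarrow> bool" where
  "Ck 0 f \<longleftrightarrow> continuous_on UNIV f"
| "Ck (Suc k) f \<longleftrightarrow> (\<forall>x. f differentiable (at x)) \<and> (\<forall>i\<in>Basis. Ck k (partial i f))"

definition test_functions :: "'a::euclidean_space set \<Rightarrow> ('a \<Rightarrow> real) set" where
  "test_functions \<Omega> =
     {\<phi>. (\<forall>k. Ck k \<phi>) \<and> compact (closure {x. \<phi> x \<noteq> 0}) \<and> closure {x. \<phi> x \<noteq> 0} \<subseteq> \<Omega>}"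

definition is_weak_partial ::
    "'a::euclidean_space set \<Rightarrow> 'a \<Rightarrow> ('a \<Rightarrow> real) \<Rightarrow> ('a \<Rightarrow> real) \<Rightarrow> bool" where
  "is_weak_partial \<Omega> i f g \<longleftrightarrow>
     (\<forall>\<phi>\<in>test_functions \<Omega>. L2_inner \<Omega> f (partial i \<phi>) = - L2_inner \<Omega> g \<phi>)"

definition H1 :: "'a::euclidean_space set \<Rightarrow> ('a \<Rightarrow> real) set" where
  "H1 \<Omega> = {f \<in> L2 \<Omega>. \<forall>i\<in>Basis. \<exists>g\<in>L2 \<Omega>. is_weak_partial \<Omega> i f g}"

text \<open>For \<open>f\<close> in \<open>H1 \<Omega>\<close> the chosen weak derivative is unique up to a null set.\<close>

definition weak_partial :: "'a::euclidean_space set \<Rightarrow> 'a \<Rightarrow> ('a \<Rightarrow> real) \<Rightarrow> 'a \<Rightarrow> real" where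
  "weak_partial \<Omega> i f = (SOME g. g \<in> L2 \<Omega> \<and> is_weak_partial \<Omega> i f g)"

definition grad_inner :: "'a::euclidean_space set \<Rightarrow> ('a \<Rightarrow> real) \<Rightarrow> ('a \<Rightarrow> real) \<Rightarrow> real" where
  "grad_inner \<Omega> f g = (\<Sum>i\<in>Basis. L2_inner \<Omega> (weak_partial \<Omega> i f) (weak_partial \<Omega> i g))"

definition H1_norm :: "'a::euclidean_space set \<Rightarrow> ('a \<Rightarrow> real) \<Rightarrow> real" where
  "H1_norm \<Omega> f = sqrt (L2_inner \<Omega> f f + grad_inner \<Omega> f f)"

definition H10 :: "'a::euclidean_space set \<Rightarrow> ('a \<Rightarrow> real) set" where
  "H10 \<Omega> = {f \<in> H1 \<Omega>. \<exists>\<phi> :: nat \<Rightarrow> 'a \<Rightarrow> real.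
     (\<forall>n. \<phi> n \<in> test_functions \<Omega>) \<and> (\<lambda>n. H1_norm \<Omega> (\<lambda>x. f x - \<phi> n x)) \<longlonglongrightarrow> 0}"

definition H2 :: "'a::euclidean_space set \<Rightarrow> ('a \<Rightarrow> real) set" where
  "H2 \<Omega> = {f \<in> H1 \<Omega>. \<forall>i\<in>Basis. weak_partial \<Omega> i f \<in> H1 \<Omega>}"

definition dom_A :: "'a::euclidean_space set \<Rightarrow> ('a \<Rightarrow> real) set" where
  "dom_A \<Omega> = H10 \<Omega> \<inter> H2 \<Omega>"

definition op_A :: "'a::euclidean_space set \<Rightarrow> ('a \<Rightarrow> real) \<Rightarrow> 'a \<Rightarrow> real" where
  "op_A \<Omega> f = (\<lambda>x. - (\<Sum>i\<in>Basis. weak_partial \<Omega> i (weak_partial \<Omega> i f) x))"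

section \<open>Domain, triangulations and finite elements\<close>

definition convex_polyhedral_domain :: "'a::euclidean_space set \<Rightarrow> bool" where
  "convex_polyhedral_domain \<Omega> \<longleftrightarrow> open \<Omega> \<and> \<Omega> \<noteq> {} \<and> convex \<Omega> \<and> polytope (closure \<Omega>)"

definition triangulation_of :: "'a::euclidean_space set \<Rightarrow> 'a set set \<Rightarrow> bool" where
  "triangulation_of \<Omega> \<T> \<longleftrightarrow>
     triangulation \<T> \<and> (\<forall>K\<in>\<T>. int DIM('a) simplex K) \<and> \<Union>\<T> = closure \<Omega>"

definition mesh_size :: "'a::euclidean_space set set \<Rightarrow> real" where
  "mesh_size \<T> = Max (diameter ` \<T>)"

definition inball_diameter :: "'a::euclidean_space set \<Rightarrow> real" where
  "inball_diameter K = Sup {2 * r | r x. 0 \<le> r \<and> cball x r \<subseteq> K}"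

text \<open>
  Shape regularity and quasi-uniformity are properties of a family of triangulations: their
  constants do not depend on the member of the family.
\<close>

definition shape_regular :: "'a::euclidean_space set set set \<Rightarrow> bool" where
  "shape_regular F \<longleftrightarrow> (\<exists>\<sigma>. \<forall>\<T>\<in>F. \<forall>K\<in>\<T>. diameter K \<le> \<sigma> * inball_diameter K)"

definition quasi_uniform :: "'a::euclidean_space set set set \<Rightarrow> bool" where
  "quasi_uniform F \<longleftrightarrow> (\<exists>\<rho>. \<forall>\<T>\<in>F. \<forall>K\<in>\<T>. mesh_size \<T> \<le> \<rho> * diameter K)"

text \<open>
  Finite element functions are extended by \<open>0\<close> outside \<open>\<Omega>\<close> (which includes the boundary condition,
  \<open>\<Omega>\<close> being open), so that equality in \<open>X\<^sub>h\<close> is equality of functions.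
\<close>

definition Xh :: "'a::euclidean_space set \<Rightarrow> 'a set set \<Rightarrow> ('a \<Rightarrow> real) set" where
  "Xh \<Omega> \<T> = {\<eta>. continuous_on (closure \<Omega>) \<eta> \<and>
     (\<forall>K\<in>\<T>. \<exists>a b. \<forall>x\<in>K. \<eta> x = a \<bullet> x + b) \<and> (\<forall>x. x \<notin> \<Omega> \<longrightarrow> \<eta> x = 0)}"

definition L2_projection ::
    "'a::euclidean_space set \<Rightarrow> 'a set set \<Rightarrow> ('a \<Rightarrow> real) \<Rightarrow> 'a \<Rightarrow> real" where
  "L2_projection \<Omega> \<T> f =
     (THE p. p \<in> Xh \<Omega> \<T> \<and> (\<forall>\<eta>\<in>Xh \<Omega> \<T>. L2_inner \<Omega> p \<eta> = L2_inner \<Omega> f \<eta>))"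

definition Ritz_projection ::
    "'a::euclidean_space set \<Rightarrow> 'a set set \<Rightarrow> ('a \<Rightarrow> real) \<Rightarrow> 'a \<Rightarrow> real" where
  "Ritz_projection \<Omega> \<T> f =
     (THE p. p \<in> Xh \<Omega> \<T> \<and> (\<forall>\<eta>\<in>Xh \<Omega> \<T>. grad_inner \<Omega> p \<eta> = grad_inner \<Omega> f \<eta>))"

definition op_Ah :: "'a::euclidean_space set \<Rightarrow> 'a set set \<Rightarrow> ('a \<Rightarrow> real) \<Rightarrow> 'a \<Rightarrow> real" where
  "op_Ah \<Omega> \<T> \<phi> =
     (THE p. p \<in> Xh \<Omega> \<T> \<and> (\<forall>\<eta>\<in>Xh \<Omega> \<T>. L2_inner \<Omega> p \<eta> = grad_inner \<Omega> \<phi> \<eta>))"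

text \<open>
  \<open>is_pos_sqrt \<Omega> X S B\<close>: on the space \<open>X\<close>, the operator \<open>B\<close> is the square root of \<open>S\<close> that is
  self-adjoint and positive semidefinite for the \<open>L\<^sup>2(\<Omega>)\<close> inner product.  It is unique on \<open>X\<close> but
  arbitrary elsewhere, hence \<open>SOME\<close> rather than \<open>THE\<close> in \<open>pos_sqrt\<close>.
\<close>

definition is_pos_sqrt ::
    "'a::euclidean_space set \<Rightarrow> ('a \<Rightarrow> real) set \<Rightarrow> (('a \<Rightarrow> real) \<Rightarrow> 'a \<Rightarrow> real) \<Rightarrow>
     (('a \<Rightarrow> real) \<Rightarrow> 'a \<Rightarrow> real) \<Rightarrow> bool" where
  "is_pos_sqrt \<Omega> X S B \<longleftrightarrow>
     (\<forall>\<phi>\<in>X. B \<phi> \<in> X) \<and>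
     (\<forall>\<phi>\<in>X. \<forall>\<psi>\<in>X. \<forall>a b. B (\<lambda>x. a * \<phi> x + b * \<psi> x) = (\<lambda>x. a * B \<phi> x + b * B \<psi> x)) \<and>
     (\<forall>\<phi>\<in>X. \<forall>\<psi>\<in>X. L2_inner \<Omega> (B \<phi>) \<psi> = L2_inner \<Omega> \<phi> (B \<psi>)) \<and>
     (\<forall>\<phi>\<in>X. 0 \<le> L2_inner \<Omega> (B \<phi>) \<phi>) \<and>
     (\<forall>\<phi>\<in>X. B (B \<phi>) = S \<phi>)"

definition pos_sqrt ::
    "'a::euclidean_space set \<Rightarrow> ('a \<Rightarrow> real) set \<Rightarrow> (('a \<Rightarrow> real) \<Rightarrow> 'a \<Rightarrow> real) \<Rightarrow>
     ('a \<Rightarrow> real) \<Rightarrow> 'a \<Rightarrow> real" where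
  "pos_sqrt \<Omega> X S = (SOME B. is_pos_sqrt \<Omega> X S B)"

text \<open>\<open>shifted_op \<Omega> \<T> \<alpha> \<tau>\<close> is \<open>I + \<tau>\<^sup>\<alpha> A\<^sub>h\<close>.\<close>

definition shifted_op ::
    "'a::euclidean_space set \<Rightarrow> 'a set set \<Rightarrow> real \<Rightarrow> real \<Rightarrow> ('a \<Rightarrow> real) \<Rightarrow> 'a \<Rightarrow> real" where
  "shifted_op \<Omega> \<T> \<alpha> \<tau> \<phi> = (\<lambda>x. \<phi> x + \<tau> powr \<alpha> * op_Ah \<Omega> \<T> \<phi> x)"

definition energy_norm ::
    "'a::euclidean_space set \<Rightarrow> 'a set set \<Rightarrow> real \<Rightarrow> real \<Rightarrow> ('a \<Rightarrow> real) \<Rightarrow> real" where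
  "energy_norm \<Omega> \<T> \<alpha> \<tau> \<psi> = L2_norm \<Omega> (pos_sqrt \<Omega> (Xh \<Omega> \<T>) (shifted_op \<Omega> \<T> \<alpha> \<tau>) \<psi>)"

section \<open>Semidiscrete problem\<close>

definition caputo :: "real \<Rightarrow> (real \<Rightarrow> real) \<Rightarrow> real \<Rightarrow> real" where
  "caputo \<alpha> u t =
     1 / Gamma (1 - \<alpha>) * (LINT s:{0<..<t}|lborel. (t - s) powr (- \<alpha>) * deriv u s)"

text \<open>
  \<open>X\<^sub>h\<close> being finite-dimensional, time derivatives and integrals of \<open>X\<^sub>h\<close>-valued functions are taken
  pointwise in \<open>x\<close>.  The derivative of the solution is in general unbounded as \<open>t\<close> tends to \<open>0\<close>;
  only continuity is asked for at \<open>t = 0\<close>, together with integrability of the Caputo integrand.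
\<close>

definition semidiscrete_solution ::
    "'a::euclidean_space set \<Rightarrow> 'a set set \<Rightarrow> real \<Rightarrow> ('a \<Rightarrow> real) \<Rightarrow> (real \<Rightarrow> 'a \<Rightarrow> real) \<Rightarrow> bool" where
  "semidiscrete_solution \<Omega> \<T> \<alpha> vh u \<longleftrightarrow>
     (\<forall>t\<ge>0. u t \<in> Xh \<Omega> \<T>) \<and>
     u 0 = vh \<and>
     (\<forall>x. continuous_on {0..} (\<lambda>t. u t x)) \<and>
     (\<forall>t>0. \<forall>x.
        (\<lambda>s. u s x) field_differentiable (at t) \<and>
        set_integrable lborel {0<..<t} (\<lambda>s. (t - s) powr (- \<alpha>) * deriv (\<lambda>r. u r x) s) \<and>
        caputo \<alpha> (\<lambda>s. u s x) t + op_Ah \<Omega> \<T> (u t) x = 0)"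

section \<open>Incomplete iterative scheme\<close>

definition cq_weight :: "real \<Rightarrow> nat \<Rightarrow> real" where
  "cq_weight \<alpha> = (THE b. \<forall>\<xi>. \<bar>\<xi>\<bar> < 1 \<longrightarrow> (\<lambda>j. b j * \<xi> ^ j) sums ((1 - \<xi>) powr \<alpha>))"

lemma cq_weight_eq: "cq_weight \<alpha> = (\<lambda>j. (- 1) ^ j * (\<alpha> gchoose j))"
  unfolding cq_weight_def
proof (rule the_equality)
  have *: "(\<lambda>j. (- 1) ^ j * (\<alpha> gchoose j) * \<xi> ^ j) sums ((1 - \<xi>) powr \<alpha>)"
    if "\<bar>\<xi>\<bar> < 1" for \<xi> :: real
  proof -
    have "(\<lambda>j. (\<alpha> gchoose j) * (- \<xi>) ^ j) sums ((1 + - \<xi>) powr \<alpha>)"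
      by (rule gen_binomial_real) (use that in simp)
    moreover have "(\<alpha> gchoose j) * (- \<xi>) ^ j = (- 1) ^ j * (\<alpha> gchoose j) * \<xi> ^ j" for j
      by (simp add: power_minus[of \<xi>])
    ultimately show ?thesis by simp
  qed
  then show "\<forall>\<xi>. \<bar>\<xi>\<bar> < 1 \<longrightarrow> (\<lambda>j. (- 1) ^ j * (\<alpha> gchoose j) * \<xi> ^ j) sums ((1 - \<xi>) powr \<alpha>)"
    by blast
  fix b :: "nat \<Rightarrow> real"
  assume b: "\<forall>\<xi>. \<bar>\<xi>\<bar> < 1 \<longrightarrow> (\<lambda>j. b j * \<xi> ^ j) sums ((1 - \<xi>) powr \<alpha>)"
  define d where "d = (\<lambda>j. b j - (- 1) ^ j * (\<alpha> gchoose j))"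
  have d: "(\<lambda>j. d j * \<xi> ^ j) sums 0" if "norm \<xi> < 1" for \<xi> :: real
    using sums_diff[OF b[rule_format, of \<xi>] *[of \<xi>]] that
    by (simp add: d_def algebra_simps)
  have "d j = 0" for j
  proof (induction j rule: less_induct)
    case (less j)
    have "(\<lambda>n. d (n + j) * x ^ n) sums 0" if "x \<noteq> 0" "norm x < 1" for x :: real
    proof -
      have "(\<lambda>n. d (n + j) * x ^ (n + j)) sums 0"
        by (subst sums_zero_iff_shift) (use less d that in auto)
      from sums_mult[OF this, of "inverse (x ^ j)"] show ?thesis
        using that by (simp add: power_add field_simps)
    qed
    then have "((\<lambda>_. 0) \<longlongrightarrow> d (0 + j)) (at (0::real))"
      by (intro powser_limit_0_strong[where s = 1]) auto
    then show ?case
      by (simp add: tendsto_const_iff)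
  qed
  then show "b = (\<lambda>j. (- 1) ^ j * (\<alpha> gchoose j))"
    by (auto simp: d_def fun_eq_iff)
qed

text \<open>
  \<open>U n\<close> is the computed solution at level \<open>n\<close>, \<open>Ubar n\<close> the exact solution of the linear system at
  that level, \<open>W n m\<close> the \<open>m\<close>-th iterate of the solver and \<open>M n\<close> the number of iterations performed.
  \<open>E\<close> is the set of levels at which an exact solve is prescribed; it must contain \<open>1\<close>, where
  there is no starting guess.
\<close>

definition incomplete_scheme ::
    "'a::euclidean_space set \<Rightarrow> 'a set set \<Rightarrow> real \<Rightarrow> real \<Rightarrow> nat \<Rightarrow> (real \<Rightarrow> 'a \<Rightarrow> real) \<Rightarrow>
     ('a \<Rightarrow> real) \<Rightarrow> nat set \<Rightarrow> (nat \<Rightarrow> 'a \<Rightarrow> real) \<Rightarrow> (nat \<Rightarrow> 'a \<Rightarrow> real) \<Rightarrow>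
     (nat \<Rightarrow> nat \<Rightarrow> 'a \<Rightarrow> real) \<Rightarrow> (nat \<Rightarrow> nat) \<Rightarrow> bool" where
  "incomplete_scheme \<Omega> \<T> \<alpha> \<tau> N f vh E U Ubar W M \<longleftrightarrow>
     1 \<in> E \<and> vh \<in> Xh \<Omega> \<T> \<and> U 0 = vh \<and>
     (\<forall>n\<in>{1..N}.
        Ubar n \<in> Xh \<Omega> \<T> \<and>
        shifted_op \<Omega> \<T> \<alpha> \<tau> (Ubar n) =
          (\<lambda>x. \<tau> powr \<alpha> * L2_projection \<Omega> \<T> (f (real n * \<tau>)) x
               - (\<Sum>j=1..n. cq_weight \<alpha> j * U (n - j) x)
               + (\<Sum>j=0..n. cq_weight \<alpha> j * U 0 x)) \<and>
        (if n \<in> E then U n = Ubar n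
         else W n 0 = (\<lambda>x. 2 * U (n - 1) x - U (n - 2) x) \<and>
              (\<forall>m\<ge>1. W n m \<in> Xh \<Omega> \<T>) \<and>
              1 \<le> M n \<and> U n = W n (M n)))"

definition contraction_property ::
    "'a::euclidean_space set \<Rightarrow> 'a set set \<Rightarrow> real \<Rightarrow> real \<Rightarrow> nat set \<Rightarrow> real \<Rightarrow> real \<Rightarrow>
     (nat \<Rightarrow> 'a \<Rightarrow> real) \<Rightarrow> (nat \<Rightarrow> nat \<Rightarrow> 'a \<Rightarrow> real) \<Rightarrow> bool" where
  "contraction_property \<Omega> \<T> \<alpha> \<tau> L c0 \<kappa> Ubar W \<longleftrightarrow>
     (\<forall>n\<in>L. \<forall>m\<ge>1.
        energy_norm \<Omega> \<T> \<alpha> \<tau> (\<lambda>x. W n m x - Ubar n x)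
          \<le> c0 * \<kappa> ^ m * energy_norm \<Omega> \<T> \<alpha> \<tau> (\<lambda>x. W n 0 x - Ubar n x))"

end

theory Submission
  imports Defs "HOL-Computational_Algebra.Formal_Power_Series" "Jordan_Normal_Form.Spectral_Radius"
begin

text \<open>
  In the coordinates of an eigenbasis of \<open>A\<^sub>h\<close> everything is scalar, with constants that must not depend on
  the eigenvalue \<open>\<lambda>\<close>.  Put \<open>\<mu> = \<tau>\<^sup>\<alpha> \<lambda>\<close> and \<open>R = 1 / ((1 - X)\<^sup>\<alpha> + \<mu>)\<close> as formal power series.  The identity
  \<open>(1 - X) R' = \<alpha> R - \<alpha> \<mu> R\<^sup>2\<close> shows that the coefficients of \<open>R\<close> are nonnegative and decreasing and
  yields, uniformly in \<open>\<mu>\<close>, that \<open>(1 + \<mu>) R\<close> decays like \<open>n\<^sup>\<alpha> / n\<close> and its first two differences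
  like \<open>n\<^sup>\<alpha> / n\<^sup>2\<close>.  The error of the exactly solved scheme is a quadrature error of the Volterra form of
  the Caputo equation, propagated by \<open>1 - \<mu> R\<close>; it is bounded by comparing the
  quadrature weights with the exact ones, using that the scalar solution is monotone.  The solver residuals are driven by second differences of
  \<open>U\<close>, which are summable convolutions of earlier residuals, so that a small constant tolerance closes an
  induction.  In space one only needs \<open>\<parallel>A\<^sub>h R\<^sub>h v\<parallel> \<le> \<parallel>A v\<parallel>\<close>, i.e. \<open>(\<nabla>v, \<nabla>\<eta>) = (A v, \<eta>)\<close> for \<open>\<eta>\<close> in
  \<open>X\<^sub>h\<close>, which follows by approximating \<open>\<eta>\<close> with test functions.
\<close>

section \<open>Symmetric operators on finite-dimensional function spaces\<close>

text \<open>Every error bound has to be linear in the eigenvalue: only \<lambda> times the initial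
  coefficient sums up to the norm of \<open>A\<^sub>h v\<^sub>h\<close>, and the eigenvalues are
  unbounded as the mesh is refined. The weight 1 + \<mu> in front of R is forced as well, since a
  solver residual is measured on the solution of a system with matrix 1 + \<mu> and therefore enters
  U through (1 + \<mu>) R. The semidiscrete solution is only known to be continuous, differentiable
  for t > 0 and to have an integrable Caputo integrand, which shapes the consistency estimate. It
  takes two rounds: uniform continuity gives convergence without a rate on ever finer grids; sign,
  monotonicity and size of the increments then pass from the discrete solutions to the limit, and
  these properties give the rate. Logarithms are avoided by using two bounds for the increments
  together, 1 / j for each and 1 for their sum. The estimate comes out as a constant times \<tau>
  t_n^(\<alpha> - 1) times the norm of A v, and 1 \<le> 2 ln (1 + n) leads to the stated
  form.\<close>

no_notation scalar_prod (infix \<open>\<bullet>\<close> 70)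

text \<open>X is a carrier set and not a type because the finite element space depends on \<Omega>
  and \<T>. Finiteness of dimension will enter through finite sets of points that separate
  X.\<close>

locale fun_space =
  fixes X :: "('a \<Rightarrow> real) set"
  assumes zero_closed: "(\<lambda>_. 0) \<in> X"
    and comb_closed: "\<phi> \<in> X \<Longrightarrow> \<psi> \<in> X \<Longrightarrow> (\<lambda>x. a * \<phi> x + b * \<psi> x) \<in> X"
begin

lemma scale_closed: "\<phi> \<in> X \<Longrightarrow> (\<lambda>x. a * \<phi> x) \<in> X"
  using comb_closed[of \<phi> \<phi> a 0] by simp

lemma diff_closed: "\<phi> \<in> X \<Longrightarrow> \<psi> \<in> X \<Longrightarrow> (\<lambda>x. \<phi> x - \<psi> x) \<in> X"
  using comb_closed[of \<phi> \<psi> 1 "-1"] by simp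

lemma sum_closed:
  assumes "finite J" "\<And>j. j \<in> J \<Longrightarrow> f j \<in> X"
  shows "(\<lambda>x. \<Sum>j\<in>J. c j * f j x) \<in> X"
  using assms
proof (induction J rule: finite_induct)
  case empty
  show ?case by (simp add: zero_closed)
next
  case (insert k J)
  then have "(\<lambda>x. c k * f k x + 1 * (\<Sum>j\<in>J. c j * f j x)) \<in> X"
    by (intro comb_closed) auto
  with insert show ?case by simp
qed

definition functional :: "(('a \<Rightarrow> real) \<Rightarrow> real) \<Rightarrow> bool" where
  "functional g \<longleftrightarrow> (\<forall>\<phi>\<in>X. \<forall>\<psi>\<in>X. \<forall>a b. g (\<lambda>x. a * \<phi> x + b * \<psi> x) = a * g \<phi> + b * g \<psi>)"

definition operator :: "(('a \<Rightarrow> real) \<Rightarrow> 'a \<Rightarrow> real) \<Rightarrow> bool" where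
  "operator S \<longleftrightarrow> (\<forall>\<phi>\<in>X. S \<phi> \<in> X) \<and>
    (\<forall>\<phi>\<in>X. \<forall>\<psi>\<in>X. \<forall>a b. S (\<lambda>x. a * \<phi> x + b * \<psi> x) = (\<lambda>x. a * S \<phi> x + b * S \<psi> x))"

lemma functionalD: "functional g \<Longrightarrow> \<phi> \<in> X \<Longrightarrow> \<psi> \<in> X \<Longrightarrow> g (\<lambda>x. a * \<phi> x + b * \<psi> x) = a * g \<phi> + b * g \<psi>"
  and operatorD: "operator S \<Longrightarrow> \<phi> \<in> X \<Longrightarrow> S \<phi> \<in> X"
    "operator S \<Longrightarrow> \<phi> \<in> X \<Longrightarrow> \<psi> \<in> X \<Longrightarrow> S (\<lambda>x. a * \<phi> x + b * \<psi> x) = (\<lambda>x. a * S \<phi> x + b * S \<psi> x)"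
  by (simp_all add: functional_def operator_def)

lemma functional_zero: "functional g \<Longrightarrow> g (\<lambda>_. 0) = 0"
  using functionalD[OF _ zero_closed zero_closed, of g 0 0] by simp

lemma functional_sum:
  assumes "functional g" "finite J" "\<And>j. j \<in> J \<Longrightarrow> f j \<in> X"
  shows "g (\<lambda>x. \<Sum>j\<in>J. c j * f j x) = (\<Sum>j\<in>J. c j * g (f j))"
  using assms(2,3)
proof (induction J rule: finite_induct)
  case empty
  show ?case using functional_zero[OF assms(1)] by simp
next
  case (insert k J)
  have "g (\<lambda>x. c k * f k x + 1 * (\<Sum>j\<in>J. c j * f j x)) = c k * g (f k) + 1 * g (\<lambda>x. \<Sum>j\<in>J. c j * f j x)"
    using insert by (intro functionalD[OF assms(1)] sum_closed) auto
  with insert show ?case by simp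
qed

lemma operator_functional: "operator S \<Longrightarrow> functional (\<lambda>\<phi>. S \<phi> x)"
  unfolding operator_def functional_def by simp

lemma operator_sum:
  assumes "operator S" "finite J" "\<And>j. j \<in> J \<Longrightarrow> f j \<in> X"
  shows "S (\<lambda>x. \<Sum>j\<in>J. c j * f j x) = (\<lambda>x. \<Sum>j\<in>J. c j * S (f j) x)"
  using functional_sum[OF operator_functional[OF assms(1)] assms(2,3)] by auto

end

text \<open>Induction on the separating points: the functions of X vanishing at p are separated by
  the remaining points, and if not all functions vanish at p, one basis function for p is added. The
  delta property makes the coordinates of a function its values at Q.\<close>

lemma nodal_basis:
  assumes "finite P" "fun_space X" "\<And>\<phi>. \<phi> \<in> X \<Longrightarrow> (\<And>p. p \<in> P \<Longrightarrow> \<phi> p = 0) \<Longrightarrow> \<phi> = (\<lambda>_. 0)"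
  shows "\<exists>Q f. Q \<subseteq> P \<and> (\<forall>q\<in>Q. f q \<in> X) \<and> (\<forall>\<phi>\<in>X. \<phi> = (\<lambda>x. \<Sum>q\<in>Q. \<phi> q * f q x)) \<and>
    (\<forall>q\<in>Q. \<forall>p\<in>Q. f q p = (if p = q then 1 else 0))"
  using assms
proof (induction P arbitrary: X rule: finite_induct)
  case empty
  then show ?case by (intro exI[of _ "{}"]) auto
next
  case (insert p P X)
  interpret fun_space X by fact
  define X' where "X' = {\<phi> \<in> X. \<phi> p = 0}"
  interpret X': fun_space X'
    by unfold_locales (auto simp: X'_def zero_closed comb_closed)
  have "\<exists>Q f. Q \<subseteq> P \<and> (\<forall>q\<in>Q. f q \<in> X') \<and> (\<forall>\<phi>\<in>X'. \<phi> = (\<lambda>x. \<Sum>q\<in>Q. \<phi> q * f q x)) \<and>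
    (\<forall>q\<in>Q. \<forall>p\<in>Q. f q p = (if p = q then 1 else 0))"
    by (rule insert.IH) (use X'.fun_space_axioms insert.prems(2) in \<open>auto simp: X'_def\<close>)
  then obtain Q f where Q: "Q \<subseteq> P" and f: "\<And>q. q \<in> Q \<Longrightarrow> f q \<in> X'"
    and rep: "\<And>\<phi>. \<phi> \<in> X' \<Longrightarrow> \<phi> = (\<lambda>x. \<Sum>q\<in>Q. \<phi> q * f q x)"
    and del: "\<And>q r. q \<in> Q \<Longrightarrow> r \<in> Q \<Longrightarrow> f q r = (if r = q then 1 else 0)"
    by blast
  have fQ: "finite Q" using Q insert.hyps finite_subset by blast
  have pQ: "p \<notin> Q" using Q insert.hyps by auto
  show ?case
  proof (cases "X' = X")
    case True
    then show ?thesis using Q f rep del by (intro exI[of _ Q] exI[of _ f]) blast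
  next
    case False
    then obtain \<psi>0 where \<psi>0: "\<psi>0 \<in> X" "\<psi>0 p \<noteq> 0" by (auto simp: X'_def)
    define \<psi>1 where "\<psi>1 = (\<lambda>x. (1 / \<psi>0 p) * \<psi>0 x)"
    have \<psi>1: "\<psi>1 \<in> X" "\<psi>1 p = 1"
      using \<psi>0(2) scale_closed[OF \<psi>0(1), of "1 / \<psi>0 p"] by (auto simp: \<psi>1_def)
    have fX: "\<And>q. q \<in> Q \<Longrightarrow> f q \<in> X" "\<And>q. q \<in> Q \<Longrightarrow> f q p = 0" using f by (auto simp: X'_def)
    \<comment> \<open>Subtracting the interpolant at the points of Q makes \<psi> vanish there and
      keeps its value 1 at p, where all \<open>f q\<close> vanish.\<close>
    define \<psi> where "\<psi> = (\<lambda>x. \<psi>1 x - (\<Sum>q\<in>Q. \<psi>1 q * f q x))"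
    have \<psi>: "\<psi> \<in> X" "\<psi> p = 1"
      using \<psi>1 fX by (auto simp: \<psi>_def intro!: diff_closed sum_closed fQ)
    have \<psi>Q: "\<psi> r = 0" if "r \<in> Q" for r
    proof -
      have "(\<Sum>q\<in>Q. \<psi>1 q * f q r) = (\<Sum>q\<in>Q. if q = r then \<psi>1 q else 0)"
        using that by (intro sum.cong) (auto simp: del)
      then show ?thesis using that fQ by (simp add: \<psi>_def)
    qed
    let ?f = "f(p := \<psi>)"
    have "\<phi> = (\<lambda>x. \<Sum>q\<in>insert p Q. \<phi> q * ?f q x)" if \<phi>: "\<phi> \<in> X" for \<phi>
    proof -
      have "(\<lambda>x. \<phi> x - \<phi> p * \<psi> x) \<in> X'"
        unfolding X'_def using \<phi> \<psi> diff_closed[OF \<phi> scale_closed[OF \<psi>(1)]] by auto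
      from rep[OF this] have ex: "\<phi> x - \<phi> p * \<psi> x = (\<Sum>q\<in>Q. (\<phi> q - \<phi> p * \<psi> q) * f q x)" for x
        by meson
      have "(\<Sum>q\<in>Q. (\<phi> q - \<phi> p * \<psi> q) * f q x) = (\<Sum>q\<in>Q. \<phi> q * f q x)" for x
        by (rule sum.cong[OF refl]) (simp add: \<psi>Q)
      then have l: "\<phi> x = \<phi> p * \<psi> x + (\<Sum>q\<in>Q. \<phi> q * f q x)" for x
        using ex[of x] by (simp only: diff_eq_eq add.commute)
      have r: "(\<Sum>q\<in>insert p Q. \<phi> q * ?f q x) = \<phi> p * \<psi> x + (\<Sum>q\<in>Q. \<phi> q * f q x)" for x
      proof -
        have "(\<Sum>q\<in>Q. \<phi> q * ?f q x) = (\<Sum>q\<in>Q. \<phi> q * f q x)"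
          using pQ by (intro sum.cong) auto
        then show ?thesis using fQ pQ by simp
      qed
      show ?thesis by (rule ext) (rule trans[OF l r[symmetric]])
    qed
    moreover have "\<forall>q\<in>insert p Q. \<forall>r\<in>insert p Q. ?f q r = (if r = q then 1 else 0)"
      using pQ \<psi> \<psi>Q del fX by auto
    ultimately show ?thesis
      using Q \<psi> fX by (intro exI[of _ "insert p Q"] exI[of _ ?f]) auto
  qed
qed

text \<open>The form is a parameter since the finite element space carries two of them, the L2
  product and the Dirichlet energy. The laws are required on X only; definiteness, for one, fails
  for general functions that vanish almost everywhere.\<close>

locale fun_inner_space = fun_space X for X :: "('a \<Rightarrow> real) set" +
  fixes ip :: "('a \<Rightarrow> real) \<Rightarrow> ('a \<Rightarrow> real) \<Rightarrow> real"
  assumes ip_comb: "\<phi> \<in> X \<Longrightarrow> \<psi> \<in> X \<Longrightarrow> \<zeta> \<in> X \<Longrightarrow> ip (\<lambda>x. a * \<phi> x + b * \<psi> x) \<zeta> = a * ip \<phi> \<zeta> + b * ip \<psi> \<zeta>"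
    and ip_sym: "\<phi> \<in> X \<Longrightarrow> \<psi> \<in> X \<Longrightarrow> ip \<phi> \<psi> = ip \<psi> \<phi>"
    and ip_nonneg: "\<phi> \<in> X \<Longrightarrow> 0 \<le> ip \<phi> \<phi>"
    and ip_definite: "\<phi> \<in> X \<Longrightarrow> ip \<phi> \<phi> = 0 \<Longrightarrow> \<phi> = (\<lambda>_. 0)"
begin

lemma ip_functional: "\<zeta> \<in> X \<Longrightarrow> functional (\<lambda>\<phi>. ip \<phi> \<zeta>)"
  unfolding functional_def using ip_comb by simp

lemma ip_sum:
  assumes "finite J" "\<And>j. j \<in> J \<Longrightarrow> f j \<in> X" "\<zeta> \<in> X"
  shows "ip (\<lambda>x. \<Sum>j\<in>J. c j * f j x) \<zeta> = (\<Sum>j\<in>J. c j * ip (f j) \<zeta>)"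
  using functional_sum[OF ip_functional[OF assms(3)] assms(1,2)] .

lemma ip_scale: "\<phi> \<in> X \<Longrightarrow> \<zeta> \<in> X \<Longrightarrow> ip (\<lambda>x. a * \<phi> x) \<zeta> = a * ip \<phi> \<zeta>"
  using ip_comb[of \<phi> \<phi> \<zeta> a 0] by simp

lemma ip_scale_right: "\<phi> \<in> X \<Longrightarrow> \<zeta> \<in> X \<Longrightarrow> ip \<zeta> (\<lambda>x. a * \<phi> x) = a * ip \<zeta> \<phi>"
  using ip_scale[of \<phi> \<zeta> a] ip_sym[of \<zeta>] scale_closed by simp

lemma ip_diff: "\<phi> \<in> X \<Longrightarrow> \<psi> \<in> X \<Longrightarrow> \<zeta> \<in> X \<Longrightarrow> ip (\<lambda>x. \<phi> x - \<psi> x) \<zeta> = ip \<phi> \<zeta> - ip \<psi> \<zeta>"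
  using ip_comb[of \<phi> \<psi> \<zeta> 1 "-1"] by simp

lemma ip_zero: "\<zeta> \<in> X \<Longrightarrow> ip (\<lambda>_. 0) \<zeta> = 0"
  using functional_zero[OF ip_functional] .

lemma ip_eqI:
  assumes "\<phi> \<in> X" "\<psi> \<in> X" "\<And>\<zeta>. \<zeta> \<in> X \<Longrightarrow> ip \<phi> \<zeta> = ip \<psi> \<zeta>"
  shows "\<phi> = \<psi>"
proof -
  have d: "(\<lambda>x. \<phi> x - \<psi> x) \<in> X" by (intro diff_closed assms)
  then have "ip (\<lambda>x. \<phi> x - \<psi> x) (\<lambda>x. \<phi> x - \<psi> x) = 0"
    using ip_diff[OF assms(1,2) d] assms(3)[OF d] by simp
  then have "(\<lambda>x. \<phi> x - \<psi> x) = (\<lambda>_. 0)" by (rule ip_definite[OF d])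
  then show ?thesis by (metis eq_iff_diff_eq_0 ext)
qed

lemma ip_pos: "\<phi> \<in> X \<Longrightarrow> \<phi> \<noteq> (\<lambda>_. 0) \<Longrightarrow> 0 < ip \<phi> \<phi>"
  using ip_nonneg ip_definite by (metis less_eq_real_def)

text \<open>
  An eigenvector of the matrix in the nodal basis may be complex; the real or imaginary part of the
  function it represents is an eigenfunction.
\<close>

lemma exists_eigenvector:
  assumes P: "finite P" "\<And>\<phi>. \<phi> \<in> X \<Longrightarrow> (\<And>p. p \<in> P \<Longrightarrow> \<phi> p = 0) \<Longrightarrow> \<phi> = (\<lambda>_. 0)"
    and S: "operator S" and sym: "\<And>\<phi> \<psi>. \<phi> \<in> X \<Longrightarrow> \<psi> \<in> X \<Longrightarrow> ip (S \<phi>) \<psi> = ip \<phi> (S \<psi>)"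
    and nz: "\<phi>0 \<in> X" "\<phi>0 \<noteq> (\<lambda>_. 0)"
  shows "\<exists>e\<in>X. e \<noteq> (\<lambda>_. 0) \<and> (\<exists>l. S e = (\<lambda>x. l * e x))"
proof -
  obtain Q f where Q: "Q \<subseteq> P" and f: "\<And>q. q \<in> Q \<Longrightarrow> f q \<in> X"
    and rep: "\<And>\<phi>. \<phi> \<in> X \<Longrightarrow> \<phi> = (\<lambda>x. \<Sum>q\<in>Q. \<phi> q * f q x)"
    and del: "\<And>q r. q \<in> Q \<Longrightarrow> r \<in> Q \<Longrightarrow> f q r = (if r = q then 1 else 0)"
    using nodal_basis[OF P(1) fun_space_axioms P(2)] by blast
  have fQ: "finite Q" using Q P finite_subset by blast
  have "Q \<noteq> {}" using rep[OF nz(1)] nz(2) by auto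
  obtain qs where qs: "distinct qs" "set qs = Q" using finite_distinct_list[OF fQ] by blast
  define n where "n = length qs"
  have n: "0 < n" using \<open>Q \<noteq> {}\<close> qs by (auto simp: n_def)
  have qsQ: "i < n \<Longrightarrow> qs ! i \<in> Q" for i using qs by (auto simp: n_def)
  \<comment> \<open>Coordinates are nodal values, so column j of the matrix of S lists the values of
    \<open>S (f (qs ! j))\<close> at the nodes.\<close>
  define M :: "complex mat" where "M = mat n n (\<lambda>(i, j). complex_of_real (S (f (qs ! j)) (qs ! i)))"
  have M: "M \<in> carrier_mat n n" by (simp add: M_def)
  obtain \<mu> v where "eigenvector M v \<mu>"
    using spectrum_non_empty[OF M n] by (auto simp: spectrum_def eigenvalue_def)
  then have v: "v \<in> carrier_vec n" "v \<noteq> 0\<^sub>v n" "M *\<^sub>v v = \<mu> \<cdot>\<^sub>v v"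
    using M by (auto simp: eigenvector_def)
  have Mv: "(\<Sum>j<n. complex_of_real (S (f (qs ! j)) (qs ! i)) * vec_index v j) = \<mu> * vec_index v i" if i: "i < n" for i
  proof -
    have "vec_index (M *\<^sub>v v) i = (\<Sum>j<n. complex_of_real (S (f (qs ! j)) (qs ! i)) * vec_index v j)"
      using i v(1) M by (simp add: M_def scalar_prod_def atLeast0LessThan)
    then show ?thesis using v i by simp
  qed
  define comb where "comb c = (\<lambda>x. \<Sum>j<n. c j * f (qs ! j) x)" for c :: "nat \<Rightarrow> real"
  have combX: "comb c \<in> X" for c
    unfolding comb_def using f qsQ by (intro sum_closed) auto
  have comb_node: "comb c (qs ! i) = c i" if i: "i < n" for c i
  proof -
    have "comb c (qs ! i) = (\<Sum>j<n. if j = i then c j else 0)"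
      unfolding comb_def using i qs(1) qsQ by (intro sum.cong) (auto simp: del nth_eq_iff_index_eq n_def)
    then show ?thesis using i by simp
  qed
  have eqX: "\<phi> = \<psi>" if "\<phi> \<in> X" "\<psi> \<in> X" "\<And>i. i < n \<Longrightarrow> \<phi> (qs ! i) = \<psi> (qs ! i)" for \<phi> \<psi>
  proof -
    have "\<phi> q = \<psi> q" if "q \<in> Q" for q
      using that \<open>\<And>i. i < n \<Longrightarrow> \<phi> (qs ! i) = \<psi> (qs ! i)\<close> qs by (metis in_set_conv_nth n_def)
    then have "(\<lambda>x. \<Sum>q\<in>Q. \<phi> q * f q x) = (\<lambda>x. \<Sum>q\<in>Q. \<psi> q * f q x)" by (intro ext sum.cong) auto
    then show ?thesis using rep[OF that(1)] rep[OF that(2)] by simp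
  qed
  have Scomb: "S (comb c) (qs ! i) = (\<Sum>j<n. c j * S (f (qs ! j)) (qs ! i))" for c i
    unfolding comb_def using f qsQ by (subst operator_sum[OF S]) auto
  define x y where "x = comb (\<lambda>j. Re (vec_index v j))" and "y = comb (\<lambda>j. Im (vec_index v j))"
  have xy: "x \<in> X" "y \<in> X" by (auto simp: x_def y_def combX)
  have SX: "S x \<in> X" "S y \<in> X" using S xy by (auto simp: operator_def)
  define a b where "a = Re \<mu>" and "b = Im \<mu>"
  have Sx: "S x = (\<lambda>z. a * x z + (- b) * y z)"
  proof (rule eqX)
    fix i assume i: "i < n"
    have "S x (qs ! i) = Re (\<Sum>j<n. complex_of_real (S (f (qs ! j)) (qs ! i)) * vec_index v j)"
      by (simp add: x_def Scomb mult.commute)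
    then show "S x (qs ! i) = a * x (qs ! i) + (- b) * y (qs ! i)"
      by (simp add: Mv i x_def y_def comb_node a_def b_def)
  qed (rule SX(1), rule comb_closed[OF xy])
  have Sy: "S y = (\<lambda>z. b * x z + a * y z)"
  proof (rule eqX)
    fix i assume i: "i < n"
    have "S y (qs ! i) = Im (\<Sum>j<n. complex_of_real (S (f (qs ! j)) (qs ! i)) * vec_index v j)"
      by (simp add: y_def Scomb mult.commute)
    then show "S y (qs ! i) = b * x (qs ! i) + a * y (qs ! i)"
      by (simp add: Mv i x_def y_def comb_node a_def b_def)
  qed (rule SX(2), rule comb_closed[OF xy])
  have nz': "x \<noteq> (\<lambda>_. 0) \<or> y \<noteq> (\<lambda>_. 0)"
  proof (rule ccontr)
    assume "\<not> ?thesis"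
    then have "x = (\<lambda>_. 0)" "y = (\<lambda>_. 0)" by auto
    then have "vec_index v i = 0" if "i < n" for i
      using comb_node[OF that, of "\<lambda>j. Re (vec_index v j)"] comb_node[OF that, of "\<lambda>j. Im (vec_index v j)"]
      by (auto simp: x_def y_def complex_eq_iff)
    then have "v = 0\<^sub>v n" using v(1) by (intro eq_vecI) auto
    then show False using v(2) by simp
  qed
  \<comment> \<open>Comparing \<open>ip (S x) y\<close> with \<open>ip x (S y)\<close> leaves b (ip
    x x + ip y y) = 0, so the eigenvalue is real.\<close>
  have "ip (S x) y = a * ip x y + (- b) * ip y y" unfolding Sx using xy by (intro ip_comb)
  moreover have "ip x (S y) = ip (S y) x" using xy SX by (intro ip_sym)
  moreover have "ip (S y) x = b * ip x x + a * ip y x" unfolding Sy using xy by (intro ip_comb)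
  ultimately have "b * (ip x x + ip y y) = 0"
    using sym[OF xy] ip_sym[OF xy] by (simp add: algebra_simps)
  moreover have "0 < ip x x + ip y y"
    using nz'
  proof
    assume "x \<noteq> (\<lambda>_. 0)"
    then show ?thesis by (intro add_pos_nonneg ip_pos ip_nonneg xy)
  next
    assume "y \<noteq> (\<lambda>_. 0)"
    then show ?thesis by (intro add_nonneg_pos ip_pos ip_nonneg xy)
  qed
  ultimately have b: "b = 0" by simp
  have "S x = (\<lambda>z. a * x z)" "S y = (\<lambda>z. a * y z)"
    unfolding Sx Sy b by simp_all
  then show ?thesis using nz' xy by blast
qed

end

definition orthonormal_eigenbasis ::
    "('a \<Rightarrow> real) set \<Rightarrow> (('a \<Rightarrow> real) \<Rightarrow> ('a \<Rightarrow> real) \<Rightarrow> real) \<Rightarrow> (('a \<Rightarrow> real) \<Rightarrow> 'a \<Rightarrow> real) \<Rightarrow>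
     nat \<Rightarrow> (nat \<Rightarrow> 'a \<Rightarrow> real) \<Rightarrow> (nat \<Rightarrow> real) \<Rightarrow> bool" where
  "orthonormal_eigenbasis X ip S n e l \<longleftrightarrow>
     (\<forall>i<n. e i \<in> X \<and> S (e i) = (\<lambda>x. l i * e i x)) \<and>
     (\<forall>i<n. \<forall>j<n. ip (e i) (e j) = (if i = j then 1 else 0)) \<and>
     (\<forall>\<phi>\<in>X. \<phi> = (\<lambda>x. \<Sum>i<n. ip \<phi> (e i) * e i x))"

text \<open>Induction on the number of separating points, which plays the role of the dimension: an
  eigenvector e is split off, symmetry makes its orthogonal complement invariant under S, and the
  complement is separated by fewer points.\<close>

lemma exists_eigenbasis:
  assumes "fun_inner_space X ip" "finite P" "\<And>\<phi>. \<phi> \<in> X \<Longrightarrow> (\<And>p. p \<in> P \<Longrightarrow> \<phi> p = 0) \<Longrightarrow> \<phi> = (\<lambda>_. 0)"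
    and "fun_space.operator X S" "\<And>\<phi> \<psi>. \<phi> \<in> X \<Longrightarrow> \<psi> \<in> X \<Longrightarrow> ip (S \<phi>) \<psi> = ip \<phi> (S \<psi>)"
  shows "\<exists>n e l. orthonormal_eigenbasis X ip S n e l"
  using assms
proof (induction "card P" arbitrary: P X rule: less_induct)
  case less
  interpret fun_inner_space X ip by fact
  note S = less.prems(4) and sym = less.prems(5) and P = less.prems(2,3)
  show ?case
  proof (cases "X = {\<lambda>_. 0}")
    case True
    then show ?thesis by (intro exI[of _ "0 :: nat"] exI[of _ "\<lambda>_ _. 0"] exI[of _ "\<lambda>_. 0"]) (auto simp: orthonormal_eigenbasis_def)
  next
    case False
    then obtain \<phi>0 where "\<phi>0 \<in> X" "\<phi>0 \<noteq> (\<lambda>_. 0)" using zero_closed by auto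
    then obtain e0 l where e0: "e0 \<in> X" "e0 \<noteq> (\<lambda>_. 0)" "S e0 = (\<lambda>x. l * e0 x)"
      using exists_eigenvector[OF P S sym] by blast
    define e where "e = (\<lambda>x. (1 / sqrt (ip e0 e0)) * e0 x)"
    have pos: "0 < ip e0 e0" using e0 by (intro ip_pos)
    have eX: "e \<in> X" unfolding e_def using e0 by (intro scale_closed)
    have "ip e e = (1 / sqrt (ip e0 e0)) * ip e0 e"
      using e0 eX unfolding e_def by (subst ip_scale) auto
    also have "ip e0 e = (1 / sqrt (ip e0 e0)) * ip e0 e0"
      using e0 unfolding e_def by (intro ip_scale_right)
    finally have ee: "ip e e = 1" using pos by simp
    have Se: "S e = (\<lambda>x. l * e x)"
    proof -
      have "S (\<lambda>x. (1 / sqrt (ip e0 e0)) * e0 x + 0 * e0 x) = (\<lambda>x. (1 / sqrt (ip e0 e0)) * S e0 x + 0 * S e0 x)"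
        by (rule operatorD(2)[OF S e0(1) e0(1)])
      then show ?thesis by (simp add: e_def e0(3) mult_ac)
    qed
    define X' where "X' = {\<phi> \<in> X. ip \<phi> e = 0}"
    have X'X: "X' \<subseteq> X" by (auto simp: X'_def)
    interpret X': fun_inner_space X' ip
      by unfold_locales (use X'X eX in \<open>auto simp: X'_def zero_closed comb_closed ip_zero ip_comb ip_nonneg ip_definite intro: ip_sym\<close>)
    have S': "X'.operator S"
      unfolding X'.operator_def
    proof (intro conjI ballI allI)
      fix \<phi> assume "\<phi> \<in> X'"
      then have \<phi>: "\<phi> \<in> X" "ip \<phi> e = 0" by (auto simp: X'_def)
      have "ip (S \<phi>) e = ip \<phi> (S e)" by (rule sym[OF \<phi>(1) eX])
      also have "\<dots> = l * ip \<phi> e" unfolding Se using \<phi> eX by (intro ip_scale_right)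
      finally show "S \<phi> \<in> X'" using \<phi> S by (auto simp: X'_def operator_def)
    next
      fix \<phi> \<psi> a b assume "\<phi> \<in> X'" "\<psi> \<in> X'"
      then show "S (\<lambda>x. a * \<phi> x + b * \<psi> x) = (\<lambda>x. a * S \<phi> x + b * S \<psi> x)"
        using X'X by (intro operatorD(2)[OF S]) auto
    qed
    obtain Q f where Q: "Q \<subseteq> P" and f: "\<And>q. q \<in> Q \<Longrightarrow> f q \<in> X"
      and rep: "\<And>\<phi>. \<phi> \<in> X \<Longrightarrow> \<phi> = (\<lambda>x. \<Sum>q\<in>Q. \<phi> q * f q x)"
      using nodal_basis[OF P(1) fun_space_axioms P(2)] by blast
    have fQ: "finite Q" using Q P finite_subset by blast
    \<comment> \<open>The point to be dropped must belong to a basis function not orthogonal to e;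
      were all of them orthogonal to e, then so would be e itself.\<close>
    have "\<exists>q\<in>Q. ip (f q) e \<noteq> 0"
    proof (rule ccontr)
      assume "\<not> ?thesis"
      then have "(\<Sum>q\<in>Q. e q * ip (f q) e) = 0" by simp
      moreover have "ip (\<lambda>x. \<Sum>q\<in>Q. e q * f q x) e = (\<Sum>q\<in>Q. e q * ip (f q) e)"
        using fQ f eX by (intro ip_sum)
      ultimately show False using ee by (simp flip: rep[OF eX])
    qed
    then obtain q where q: "q \<in> Q" "ip (f q) e \<noteq> 0" by blast
    \<comment> \<open>Vanishing at all other nodes leaves a multiple of \<open>f q\<close>, and
      orthogonality to e makes the factor 0.\<close>
    have sep: "\<phi> = (\<lambda>_. 0)" if \<phi>: "\<phi> \<in> X'" and z: "\<And>p. p \<in> Q - {q} \<Longrightarrow> \<phi> p = 0" for \<phi>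
    proof -
      have \<phi>X: "\<phi> \<in> X" "ip \<phi> e = 0" using \<phi> by (auto simp: X'_def)
      have "(\<Sum>r\<in>Q. \<phi> r * f r x) = \<phi> q * f q x" for x
        using q fQ z by (subst sum.remove[of _ q]) auto
      then have r: "\<phi> = (\<lambda>x. \<phi> q * f q x)" using rep[OF \<phi>X(1)] by simp
      have "ip (\<lambda>x. \<phi> q * f q x) e = \<phi> q * ip (f q) e" using f q eX by (intro ip_scale) auto
      then have "\<phi> q * ip (f q) e = 0" using \<phi>X(2) r by simp
      then have "\<phi> q = 0" using q by simp
      then show ?thesis using r by simp
    qed
    have "card (Q - {q}) < card P"
    proof -
      have "card (Q - {q}) < card Q" using q fQ by (intro psubset_card_mono) auto
      also have "\<dots> \<le> card P" using Q P by (intro card_mono)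
      finally show ?thesis .
    qed
    then have "\<exists>n e l. orthonormal_eigenbasis X' ip S n e l"
      by (rule less.hyps[OF _ X'.fun_inner_space_axioms _ _ S']) (use fQ sep sym X'X in auto)
    then obtain n e' l' where eb: "orthonormal_eigenbasis X' ip S n e' l'" by blast
    then have e': "\<And>i. i < n \<Longrightarrow> e' i \<in> X'" "\<And>i. i < n \<Longrightarrow> S (e' i) = (\<lambda>x. l' i * e' i x)"
      "\<And>i j. i < n \<Longrightarrow> j < n \<Longrightarrow> ip (e' i) (e' j) = (if i = j then 1 else 0)"
      "\<And>\<phi>. \<phi> \<in> X' \<Longrightarrow> \<phi> = (\<lambda>x. \<Sum>i<n. ip \<phi> (e' i) * e' i x)"
      by (auto simp: orthonormal_eigenbasis_def)
    have e'X: "i < n \<Longrightarrow> e' i \<in> X" "i < n \<Longrightarrow> ip (e' i) e = 0" "i < n \<Longrightarrow> ip e (e' i) = 0" for i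
      using e'(1)[of i] eX ip_sym[of e "e' i"] by (auto simp: X'_def)
    have rep': "\<phi> = (\<lambda>x. \<Sum>i<Suc n. ip \<phi> ((e'(n := e)) i) * (e'(n := e)) i x)" if \<phi>: "\<phi> \<in> X" for \<phi>
    proof -
      let ?\<psi> = "\<lambda>x. \<phi> x - ip \<phi> e * e x"
      have \<psi>: "?\<psi> \<in> X" by (intro diff_closed scale_closed \<phi> eX)
      have se: "(\<lambda>x. ip \<phi> e * e x) \<in> X" by (intro scale_closed eX)
      have "ip ?\<psi> e = ip \<phi> e - ip \<phi> e * ip e e"
        by (simp add: ip_diff[OF \<phi> se eX] ip_scale[OF eX eX])
      then have "?\<psi> \<in> X'" using \<psi> ee by (simp add: X'_def)
      from e'(4)[OF this] have ex: "?\<psi> x = (\<Sum>i<n. ip ?\<psi> (e' i) * e' i x)" for x by meson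
      have co: "ip ?\<psi> (e' i) = ip \<phi> (e' i)" if "i < n" for i
        using ip_diff[OF \<phi> se, of "e' i"] ip_scale[OF eX, of "e' i" "ip \<phi> e"] e'X[OF that] by simp
      have "(\<Sum>i<n. ip ?\<psi> (e' i) * e' i x) = (\<Sum>i<n. ip \<phi> (e' i) * e' i x)" for x
        by (rule sum.cong[OF refl]) (simp only: co lessThan_iff)
      then have l: "\<phi> x = (\<Sum>i<n. ip \<phi> (e' i) * e' i x) + ip \<phi> e * e x" for x
        using ex[of x] by (simp only: diff_eq_eq)
      have r: "(\<Sum>i<Suc n. ip \<phi> ((e'(n := e)) i) * (e'(n := e)) i x) = (\<Sum>i<n. ip \<phi> (e' i) * e' i x) + ip \<phi> e * e x" for x
        by simp
      show ?thesis by (rule ext) (rule trans[OF l r[symmetric]])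
    qed
    have "orthonormal_eigenbasis X ip S (Suc n) (e'(n := e)) (l'(n := l))"
      unfolding orthonormal_eigenbasis_def
      using rep' e' e'X eX Se ee by (auto simp: less_Suc_eq)
    then show ?thesis by blast
  qed
qed

locale eigenbasis = fun_inner_space X ip for X :: "('a \<Rightarrow> real) set" and ip +
  fixes S :: "('a \<Rightarrow> real) \<Rightarrow> 'a \<Rightarrow> real" and n :: nat and e :: "nat \<Rightarrow> 'a \<Rightarrow> real" and l :: "nat \<Rightarrow> real"
  assumes op: "operator S" and basis: "orthonormal_eigenbasis X ip S n e l"
begin

lemma e_closed: "i < n \<Longrightarrow> e i \<in> X" and S_e: "i < n \<Longrightarrow> S (e i) = (\<lambda>x. l i * e i x)"
  and orthonormal: "i < n \<Longrightarrow> j < n \<Longrightarrow> ip (e i) (e j) = (if i = j then 1 else 0)"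
  and expansion: "\<phi> \<in> X \<Longrightarrow> \<phi> = (\<lambda>x. \<Sum>i<n. ip \<phi> (e i) * e i x)"
  using basis by (auto simp: orthonormal_eigenbasis_def)

lemma expand_closed: "(\<lambda>x. \<Sum>i<n. c i * e i x) \<in> X"
  using e_closed by (intro sum_closed) auto

lemma coeff_expand: "j < n \<Longrightarrow> ip (\<lambda>x. \<Sum>i<n. c i * e i x) (e j) = c j"
proof -
  assume j: "j < n"
  have "ip (\<lambda>x. \<Sum>i<n. c i * e i x) (e j) = (\<Sum>i<n. c i * ip (e i) (e j))"
    using e_closed j by (intro ip_sum) auto
  also have "\<dots> = (\<Sum>i<n. if i = j then c i else 0)"
    using j by (intro sum.cong) (auto simp: orthonormal)
  finally show ?thesis using j by simp
qed

lemma functional_expansion: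
  assumes "functional g" "\<phi> \<in> X"
  shows "g \<phi> = (\<Sum>i<n. ip \<phi> (e i) * g (e i))"
proof -
  have "g \<phi> = g (\<lambda>x. \<Sum>i<n. ip \<phi> (e i) * e i x)" using expansion[OF assms(2)] by simp
  also have "\<dots> = (\<Sum>i<n. ip \<phi> (e i) * g (e i))"
    using e_closed by (intro functional_sum[OF assms(1)]) auto
  finally show ?thesis .
qed

lemma parseval: "\<phi> \<in> X \<Longrightarrow> \<psi> \<in> X \<Longrightarrow> ip \<phi> \<psi> = (\<Sum>i<n. ip \<phi> (e i) * ip \<psi> (e i))"
proof -
  assume \<phi>: "\<phi> \<in> X" and \<psi>: "\<psi> \<in> X"
  have "ip \<phi> \<psi> = (\<Sum>i<n. ip \<phi> (e i) * ip (e i) \<psi>)"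
    by (rule functional_expansion[OF ip_functional[OF \<psi>] \<phi>])
  also have "\<dots> = (\<Sum>i<n. ip \<phi> (e i) * ip \<psi> (e i))"
  proof (rule sum.cong[OF refl])
    fix i assume "i \<in> {..<n}"
    then show "ip \<phi> (e i) * ip (e i) \<psi> = ip \<phi> (e i) * ip \<psi> (e i)"
      using ip_sym[OF e_closed \<psi>, of i] by simp
  qed
  finally show ?thesis .
qed

lemma coeff_S:
  assumes "\<phi> \<in> X" "j < n"
  shows "ip (S \<phi>) (e j) = l j * ip \<phi> (e j)"
proof -
  have "S \<phi> = S (\<lambda>x. \<Sum>i<n. ip \<phi> (e i) * e i x)" using expansion[OF assms(1)] by simp
  also have "\<dots> = (\<lambda>x. \<Sum>i<n. ip \<phi> (e i) * S (e i) x)"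
    using e_closed by (intro operator_sum[OF op]) auto
  also have "\<dots> = (\<lambda>x. \<Sum>i<n. (l i * ip \<phi> (e i)) * e i x)"
    by (intro ext sum.cong) (auto simp: S_e)
  finally show ?thesis by (simp add: coeff_expand[OF assms(2)])
qed

text \<open>The representer has the coefficients \<open>g (e i)\<close>. This supplies the existence
  and uniqueness behind the \<open>THE\<close> in \<open>op_Ah\<close> and
  \<open>Ritz_projection\<close>, for the L2 product and for the energy.\<close>

lemma riesz:
  assumes "functional g"
  shows "\<exists>!p. p \<in> X \<and> (\<forall>\<eta>\<in>X. ip p \<eta> = g \<eta>)"
proof (rule ex_ex1I)
  let ?p = "\<lambda>x. \<Sum>i<n. g (e i) * e i x"
  have "ip ?p \<eta> = g \<eta>" if \<eta>: "\<eta> \<in> X" for \<eta>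
  proof -
    have "ip ?p \<eta> = (\<Sum>i<n. ip ?p (e i) * ip \<eta> (e i))" by (rule parseval[OF expand_closed \<eta>])
    also have "\<dots> = (\<Sum>i<n. ip \<eta> (e i) * g (e i))"
      by (rule sum.cong[OF refl], subst coeff_expand) auto
    also have "\<dots> = g \<eta>" by (rule functional_expansion[OF assms \<eta>, symmetric])
    finally show ?thesis .
  qed
  then have "?p \<in> X \<and> (\<forall>\<eta>\<in>X. ip ?p \<eta> = g \<eta>)"
    by (intro conjI ballI expand_closed)
  then show "\<exists>p. p \<in> X \<and> (\<forall>\<eta>\<in>X. ip p \<eta> = g \<eta>)" by (rule exI[where x = ?p])
next
  fix p q assume "p \<in> X \<and> (\<forall>\<eta>\<in>X. ip p \<eta> = g \<eta>)" "q \<in> X \<and> (\<forall>\<eta>\<in>X. ip q \<eta> = g \<eta>)"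
  then show "p = q" by (intro ip_eqI) auto
qed

end

text \<open>\<open>pos_sqrt\<close> is a \<open>SOME\<close>, so one root has to be exhibited before
  the chosen one satisfies its specification: take square roots of the eigenvalues.\<close>

lemma exists_pos_sqrt:
  assumes "eigenbasis X (L2_inner \<Omega>) S n e l" "\<And>i. i < n \<Longrightarrow> 0 \<le> l i"
  shows "\<exists>B. is_pos_sqrt \<Omega> X S B"
proof -
  let ?ip = "L2_inner \<Omega>"
  interpret eigenbasis X ?ip S n e l by fact
  define B where "B \<phi> = (\<lambda>x. \<Sum>i<n. (sqrt (l i) * ?ip \<phi> (e i)) * e i x)" for \<phi>
  have BX: "B \<phi> \<in> X" for \<phi> unfolding B_def by (rule expand_closed)
  have cB: "?ip (B \<phi>) (e j) = sqrt (l j) * ?ip \<phi> (e j)" if "j < n" for \<phi> j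
    unfolding B_def by (rule coeff_expand[OF that])
  have "is_pos_sqrt \<Omega> X S B"
    unfolding is_pos_sqrt_def
  proof (intro conjI ballI allI)
    fix \<phi> \<psi> a b assume \<phi>: "\<phi> \<in> X" and \<psi>: "\<psi> \<in> X"
    show "B (\<lambda>x. a * \<phi> x + b * \<psi> x) = (\<lambda>x. a * B \<phi> x + b * B \<psi> x)"
    proof (rule ext)
      fix x
      have "B (\<lambda>x. a * \<phi> x + b * \<psi> x) x = (\<Sum>i<n. (sqrt (l i) * (a * ?ip \<phi> (e i) + b * ?ip \<psi> (e i))) * e i x)"
        unfolding B_def by (rule sum.cong[OF refl], subst ip_comb[OF \<phi> \<psi>]) (auto intro: e_closed)
      also have "\<dots> = (\<Sum>i<n. a * ((sqrt (l i) * ?ip \<phi> (e i)) * e i x) + b * ((sqrt (l i) * ?ip \<psi> (e i)) * e i x))"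
        by (rule sum.cong[OF refl]) (simp add: algebra_simps)
      also have "\<dots> = a * B \<phi> x + b * B \<psi> x"
        unfolding B_def by (simp only: sum.distrib sum_distrib_left)
      finally show "B (\<lambda>x. a * \<phi> x + b * \<psi> x) x = a * B \<phi> x + b * B \<psi> x" .
    qed
    show "?ip (B \<phi>) \<psi> = ?ip \<phi> (B \<psi>)"
    proof -
      have "?ip (B \<phi>) \<psi> = (\<Sum>i<n. sqrt (l i) * ?ip \<phi> (e i) * ?ip \<psi> (e i))"
        by (subst parseval[OF BX \<psi>]) (rule sum.cong[OF refl], simp add: cB)
      moreover have "?ip \<phi> (B \<psi>) = (\<Sum>i<n. sqrt (l i) * ?ip \<phi> (e i) * ?ip \<psi> (e i))"
        by (subst parseval[OF \<phi> BX]) (rule sum.cong[OF refl], simp add: cB)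
      ultimately show ?thesis by simp
    qed
  next
    fix \<phi> assume \<phi>: "\<phi> \<in> X"
    show "0 \<le> ?ip (B \<phi>) \<phi>"
      by (subst parseval[OF BX \<phi>]) (rule sum_nonneg, simp add: cB assms(2) mult.assoc)
    have SX: "S \<phi> \<in> X" using op \<phi> by (auto simp: operator_def)
    show "B (B \<phi>) = S \<phi>"
    proof -
      have "B (B \<phi>) = (\<lambda>x. \<Sum>i<n. ?ip (S \<phi>) (e i) * e i x)"
      proof (rule ext)
        fix x
        show "B (B \<phi>) x = (\<Sum>i<n. ?ip (S \<phi>) (e i) * e i x)"
          unfolding B_def[of "B \<phi>"]
          by (rule sum.cong[OF refl]) (simp add: cB coeff_S[OF \<phi>] assms(2) flip: mult.assoc)
      qed
      also have "\<dots> = S \<phi>" by (rule expansion[OF SX, symmetric])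
      finally show ?thesis .
    qed
  qed (rule BX)
  then show ?thesis by blast
qed

section \<open>Weights of the scheme and their resolvent\<close>

lemma cq_weight_0 [simp]: "cq_weight \<alpha> 0 = 1"
  by (simp add: cq_weight_eq)

lemma cq_weight_Suc: "real (Suc k) * cq_weight \<alpha> (Suc k) = (real k - \<alpha>) * cq_weight \<alpha> k"
proof -
  have "real (Suc k) * (\<alpha> gchoose Suc k) = (\<alpha> - real k) * (\<alpha> gchoose k)"
    using gbinomial_mult_1[of \<alpha> k] by (simp add: algebra_simps)
  then have "(-1) ^ Suc k * (real (Suc k) * (\<alpha> gchoose Suc k)) = (-1) ^ Suc k * ((\<alpha> - real k) * (\<alpha> gchoose k))"
    by simp
  then show ?thesis
    by (simp add: cq_weight_eq algebra_simps)
qed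

section \<open>Powers at neighbouring integers and discrete convolutions\<close>

locale fractional_order =
  fixes \<alpha> :: real
  assumes order_pos: "0 < \<alpha>" and order_less_1: "\<alpha> < 1"
begin

text \<open>Young's inequality for u and 1. With u a quotient of neighbouring integers, these two
  estimates are the source of the comparisons of powers below.\<close>

lemma bernoulli_powr:
  assumes "0 < u"
  shows "u powr \<alpha> \<le> 1 + \<alpha> * (u - 1)" "u powr (1 - \<alpha>) \<le> 1 + (1 - \<alpha>) * (u - 1)"
  using Youngs_inequality_0[of \<alpha> "1 - \<alpha>" u 1] Youngs_inequality_0[of "1 - \<alpha>" \<alpha> u 1]
    assms order_pos order_less_1 by (auto simp: algebra_simps)

lemma powr_step_lower: "\<alpha> * real (Suc n) powr (\<alpha> - 1) \<le> real (Suc n) powr \<alpha> - real n powr \<alpha>"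
proof (cases "n = 0")
  case True
  then show ?thesis using order_pos order_less_1 by simp
next
  case False
  then have n: "real n > 0" by simp
  have "(real n / real (Suc n)) powr \<alpha> \<le> 1 + \<alpha> * (real n / real (Suc n) - 1)"
    by (rule bernoulli_powr) (use n in simp)
  also have "\<dots> = 1 - \<alpha> / real (Suc n)"
    by (simp add: field_simps)
  finally have "real (Suc n) powr \<alpha> * (real n / real (Suc n)) powr \<alpha> \<le> real (Suc n) powr \<alpha> * (1 - \<alpha> / real (Suc n))"
    by (intro mult_left_mono) auto
  moreover have "real (Suc n) powr \<alpha> * (real n / real (Suc n)) powr \<alpha> = real n powr \<alpha>"
    using n by (simp add: powr_divide)
  moreover have "real (Suc n) powr (\<alpha> - 1) = real (Suc n) powr \<alpha> / real (Suc n)"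
    by (simp add: powr_diff)
  ultimately show ?thesis by (simp add: algebra_simps)
qed

lemma sum_powr_le: "(\<Sum>k=1..n. real k powr (\<alpha> - 1)) \<le> real n powr \<alpha> / \<alpha>"
proof (induction n)
  case (Suc n)
  have "real (Suc n) powr (\<alpha> - 1) \<le> (real (Suc n) powr \<alpha> - real n powr \<alpha>) / \<alpha>"
    using powr_step_lower[of n] order_pos by (simp add: field_simps)
  with Suc show ?case by (simp add: diff_divide_distrib)
qed simp

text \<open>2 and 4 / \<alpha> are the contributions of the two halves of the sum in
  \<open>powr1_convolution_le\<close>.\<close>

definition conv_const :: real where "conv_const = 2 + 4 / \<alpha>"

lemma half_powr_le:
  fixes x :: real
  assumes "0 < n" "real n / 2 \<le> x" "-1 \<le> p" "p \<le> 0"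
  shows "x powr p \<le> 2 * real n powr p"
proof -
  have "x powr p \<le> (real n / 2) powr p"
    using assms by (intro powr_mono2') auto
  also have "\<dots> = 2 powr (- p) * real n powr p"
    using assms by (simp add: powr_divide powr_minus_divide)
  also have "2 powr (- p) \<le> 2 powr (1::real)"
    using assms by (intro powr_mono) auto
  finally show ?thesis by (simp add: mult_right_mono)
qed

text \<open>Split at n / 2. In the first half the kernel is at most 2 n^(\<alpha> - 1) and d has
  mass at most 1; in the second d is at most 4 / n and the kernel sums to at most n^\<alpha> /
  \<alpha>. In the first half d j \<le> 2 / j alone would produce a logarithm; the mass bound avoids
  it.\<close>

lemma powr1_convolution_le:
  assumes "1 \<le> n" and d0: "\<And>j. j \<in> {1..n} \<Longrightarrow> 0 \<le> d j"
    and d1: "\<And>j. j \<in> {1..n} \<Longrightarrow> d j \<le> 2 / real j" and s: "(\<Sum>j=1..n. d j) \<le> 1"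
  shows "(\<Sum>j=1..n. real (n - j + 1) powr (\<alpha> - 1) * d j) \<le> conv_const * real n powr (\<alpha> - 1)"
proof -
  have n: "real n > 0" using assms by simp
  have "real (n - j + 1) powr (\<alpha> - 1) * d j \<le>
      2 * real n powr (\<alpha> - 1) * d j + 4 / real n * real (n - j + 1) powr (\<alpha> - 1)" if j: "j \<in> {1..n}" for j
  proof (cases "real j \<le> real n / 2")
    case True
    then have "real (n - j + 1) powr (\<alpha> - 1) \<le> 2 * real n powr (\<alpha> - 1)"
      using n j order_pos order_less_1 by (intro half_powr_le) (auto simp: of_nat_diff)
    then have "real (n - j + 1) powr (\<alpha> - 1) * d j \<le> 2 * real n powr (\<alpha> - 1) * d j"
      using d0[OF j] by (intro mult_right_mono) auto
    then show ?thesis using n by (simp add: add_increasing2)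
  next
    case False
    have "d j \<le> 2 / real j" by (rule d1[OF j])
    also have "\<dots> \<le> 4 / real n" using False j n by (simp add: field_simps)
    finally have "d j * real (n - j + 1) powr (\<alpha> - 1) \<le> 4 / real n * real (n - j + 1) powr (\<alpha> - 1)"
      by (intro mult_right_mono) auto
    then show ?thesis using d0[OF j] by (simp add: mult.commute add_increasing)
  qed
  then have "(\<Sum>j=1..n. real (n - j + 1) powr (\<alpha> - 1) * d j) \<le>
      (\<Sum>j=1..n. 2 * real n powr (\<alpha> - 1) * d j + 4 / real n * real (n - j + 1) powr (\<alpha> - 1))"
    by (intro sum_mono) auto
  also have "\<dots> = 2 * real n powr (\<alpha> - 1) * (\<Sum>j=1..n. d j) + 4 / real n * (\<Sum>j=1..n. real (n - j + 1) powr (\<alpha> - 1))"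
    by (simp add: sum.distrib sum_distrib_left)
  also have "(\<Sum>j=1..n. real (n - j + 1) powr (\<alpha> - 1)) = (\<Sum>k=1..n. real k powr (\<alpha> - 1))"
    by (rule sum.reindex_bij_witness[of _ "\<lambda>k. n - k + 1" "\<lambda>k. n - k + 1"]) auto
  also have "2 * real n powr (\<alpha> - 1) * (\<Sum>j=1..n. d j) + 4 / real n * (\<Sum>k=1..n. real k powr (\<alpha> - 1))
      \<le> 2 * real n powr (\<alpha> - 1) * 1 + 4 / real n * (real n powr \<alpha> / \<alpha>)"
    using s sum_powr_le[of n] n by (intro add_mono mult_left_mono) auto
  also have "\<dots> = conv_const * real n powr (\<alpha> - 1)"
    using n by (simp add: conv_const_def powr_diff field_simps)
  finally show ?thesis .
qed

text \<open>The value zeta (2 - \<alpha>): the term at j = 0 is 0 because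
  \<open>0 powr x = 0\<close>.\<close>

definition zeta_const :: real where "zeta_const = (\<Sum>j. real j powr (\<alpha> - 2))"

lemma sum_powr2_le: "(\<Sum>j=1..n. real j powr (\<alpha> - 2)) \<le> zeta_const"
  and zeta_const_ge_1: "1 \<le> zeta_const"
proof -
  have s: "summable (\<lambda>j. real j powr (\<alpha> - 2))"
    using order_less_1 by (simp add: summable_real_powr_iff)
  show *: "(\<Sum>j=1..n. real j powr (\<alpha> - 2)) \<le> zeta_const" for n
    unfolding zeta_const_def by (intro sum_le_suminf s) auto
  show "1 \<le> zeta_const" using *[of 1] by simp
qed

text \<open>In every term one of the two indices is at least n / 2, which costs 2^(2 - \<alpha>)
  \<le> 4, and the other factor is summable. That this rate is closed under convolution lets the
  induction over the solver residuals reproduce its own bound.\<close>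

lemma powr2_powr2_convolution_le:
  assumes "1 \<le> n"
  shows "(\<Sum>j=1..n. real (n - j + 1) powr (\<alpha> - 2) * real j powr (\<alpha> - 2)) \<le>
    8 * zeta_const * real n powr (\<alpha> - 2)"
proof -
  have n: "real n > 0" using assms by simp
  have half: "x powr (\<alpha> - 2) \<le> 4 * real n powr (\<alpha> - 2)" if "real n / 2 \<le> x" for x :: real
  proof -
    have "x powr (\<alpha> - 2) \<le> (real n / 2) powr (\<alpha> - 2)"
      using n that order_less_1 by (intro powr_mono2') auto
    also have "\<dots> = 2 powr (2 - \<alpha>) * real n powr (\<alpha> - 2)"
      using n by (simp add: powr_divide powr_minus_divide[symmetric] powr_diff)
    also have "2 powr (2 - \<alpha>) \<le> 2 powr (2::real)"
      using order_pos by (intro powr_mono) auto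
    finally show ?thesis by (simp add: mult_right_mono)
  qed
  let ?f = "\<lambda>j. real (n - j + 1) powr (\<alpha> - 2)" and ?g = "\<lambda>j. real j powr (\<alpha> - 2)"
  have "?f j * ?g j \<le> 4 * real n powr (\<alpha> - 2) * (?g j + ?f j)" if j: "j \<in> {1..n}" for j
  proof (cases "real j \<le> real n / 2")
    case True
    then have "?f j \<le> 4 * real n powr (\<alpha> - 2)"
      using j by (intro half) (auto simp: of_nat_diff)
    then have "?f j * ?g j \<le> 4 * real n powr (\<alpha> - 2) * ?g j"
      by (intro mult_right_mono) auto
    then show ?thesis by (simp add: algebra_simps add_increasing2)
  next
    case False
    then have "?g j \<le> 4 * real n powr (\<alpha> - 2)"
      by (intro half) auto
    then have "?f j * ?g j \<le> ?f j * (4 * real n powr (\<alpha> - 2))"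
      by (intro mult_left_mono) auto
    also have "\<dots> \<le> 4 * real n powr (\<alpha> - 2) * (?g j + ?f j)"
      by (simp add: algebra_simps)
    finally show ?thesis .
  qed
  then have "(\<Sum>j=1..n. ?f j * ?g j) \<le> (\<Sum>j=1..n. 4 * real n powr (\<alpha> - 2) * (?g j + ?f j))"
    by (intro sum_mono) auto
  also have "\<dots> = 4 * real n powr (\<alpha> - 2) * ((\<Sum>j=1..n. ?g j) + (\<Sum>j=1..n. ?f j))"
    by (subst sum_distrib_left[symmetric]) (simp only: sum.distrib)
  also have "(\<Sum>j=1..n. ?f j) = (\<Sum>j=1..n. ?g j)"
    by (rule sum.reindex_bij_witness[of _ "\<lambda>k. n - k + 1" "\<lambda>k. n - k + 1"]) auto
  also have "4 * real n powr (\<alpha> - 2) * ((\<Sum>j=1..n. ?g j) + (\<Sum>j=1..n. ?g j)) \<le>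
      4 * real n powr (\<alpha> - 2) * (zeta_const + zeta_const)"
    using sum_powr2_le[of n] by (intro mult_left_mono add_mono) auto
  finally show ?thesis by (simp add: algebra_simps)
qed

text \<open>Divided by \<open>zeta_const\<close>, the summable factor has mass at most 1 and stays
  below 2 / j, so the general convolution bound applies.\<close>

lemma powr1_powr2_convolution_le:
  assumes "1 \<le> n"
  shows "(\<Sum>j=1..n. real (n - j + 1) powr (\<alpha> - 1) * real j powr (\<alpha> - 2)) \<le>
    conv_const * zeta_const * real n powr (\<alpha> - 1)"
proof -
  have z: "zeta_const > 0" using zeta_const_ge_1 by simp
  have "(\<Sum>j=1..n. real (n - j + 1) powr (\<alpha> - 1) * (real j powr (\<alpha> - 2) / zeta_const)) \<le>
      conv_const * real n powr (\<alpha> - 1)"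
  proof (rule powr1_convolution_le[OF assms])
    fix j assume j: "j \<in> {1..n}"
    have "real j powr (\<alpha> - 2) \<le> real j powr (-1)"
      using j order_less_1 by (intro powr_mono) auto
    also have "\<dots> = 1 / real j" using j by (simp add: powr_minus_divide)
    also have "\<dots> \<le> 2 / real j * zeta_const"
      using zeta_const_ge_1 j by (simp add: field_simps)
    finally show "real j powr (\<alpha> - 2) / zeta_const \<le> 2 / real j"
      using z by (simp add: field_simps)
  next
    show "(\<Sum>j=1..n. real j powr (\<alpha> - 2) / zeta_const) \<le> 1"
      using sum_powr2_le[of n] z by (simp add: sum_divide_distrib[symmetric])
  qed (use z in auto)
  then have "zeta_const * (\<Sum>j=1..n. real (n - j + 1) powr (\<alpha> - 1) * (real j powr (\<alpha> - 2) / zeta_const)) \<le>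
      zeta_const * (conv_const * real n powr (\<alpha> - 1))"
    using z by (intro mult_left_mono) auto
  then show ?thesis using z by (simp add: sum_distrib_left mult_ac)
qed

section \<open>Signs of the quadrature weights\<close>

lemma cq_weight_nonpos: "1 \<le> j \<Longrightarrow> cq_weight \<alpha> j \<le> 0"
proof (induction j rule: dec_induct)
  case base
  show ?case using cq_weight_Suc[of 0 \<alpha>] order_pos by simp
next
  case (step k)
  have "cq_weight \<alpha> (Suc k) = (real k - \<alpha>) * cq_weight \<alpha> k / real (Suc k)"
    using cq_weight_Suc[of k \<alpha>] by (simp add: field_simps)
  then show ?case using step order_less_1 by (simp add: divide_nonpos_pos mult_nonneg_nonpos)
qed

text \<open>The partial sums are the coefficients of (1 - X)^(\<alpha> - 1). By the recursion of the
  weights, \<alpha> times the sum is -(n + 1) times the next weight, whose sign is known.\<close>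

lemma cq_weight_sum_nonneg: "0 \<le> (\<Sum>j\<le>n. cq_weight \<alpha> j)"
proof -
  have "(\<Sum>j\<le>n. cq_weight \<alpha> j) * \<alpha> = - real (Suc n) * cq_weight \<alpha> (Suc n)"
  proof (induction n)
    case 0
    show ?case using cq_weight_Suc[of 0 \<alpha>] by simp
  next
    case (Suc n)
    then show ?case using cq_weight_Suc[of "Suc n" \<alpha>] by (simp add: algebra_simps)
  qed
  moreover have "- real (Suc n) * cq_weight \<alpha> (Suc n) \<ge> 0"
    using cq_weight_nonpos[of "Suc n"] by (intro mult_nonpos_nonpos) auto
  ultimately have "0 \<le> (\<Sum>j\<le>n. cq_weight \<alpha> j) * \<alpha>" by simp
  then show ?thesis using order_pos by (simp add: zero_le_mult_iff)
qed

section \<open>The resolvent and uniform bounds for its coefficients\<close>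

definition cq_fps :: "real fps" where "cq_fps = Abs_fps (cq_weight \<alpha>)"

text \<open>In a mode with eigenvalue \<lambda> and \<mu> = \<tau>^\<alpha> \<lambda>, the scheme
  multiplies the generating function of U by \<open>cq_fps + fps_const \<mu>\<close>; this series
  undoes the multiplication.\<close>

definition resolvent :: "real \<Rightarrow> real fps" where
  "resolvent \<mu> = inverse (cq_fps + fps_const \<mu>)"

lemma cq_fps_nth [simp]: "fps_nth cq_fps n = cq_weight \<alpha> n"
  by (simp add: cq_fps_def)

lemma resolvent_mult: "0 \<le> \<mu> \<Longrightarrow> (cq_fps + fps_const \<mu>) * resolvent \<mu> = 1"
  unfolding resolvent_def by (intro inverse_mult_eq_1') simp

lemma cq_fps_deriv: "(1 - fps_X) * fps_deriv cq_fps = - fps_const \<alpha> * cq_fps"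
proof (rule fps_ext)
  fix n
  show "fps_nth ((1 - fps_X) * fps_deriv cq_fps) n = fps_nth (- fps_const \<alpha> * cq_fps) n"
    using cq_weight_Suc[of n \<alpha>]
    by (cases n) (auto simp: left_diff_distrib algebra_simps)
qed

text \<open>With b for \<open>cq_fps\<close>, differentiating the inverse leaves b R^2, and b R = 1
  - \<mu> R eliminates b. The resulting Riccati equation contains no weights, so its coefficients
  give a recursion for R alone in which the quadratic term has a known sign.\<close>

lemma resolvent_deriv:
  assumes "0 \<le> \<mu>"
  shows "(1 - fps_X) * fps_deriv (resolvent \<mu>) =
    fps_const \<alpha> * resolvent \<mu> - fps_const (\<alpha> * \<mu>) * (resolvent \<mu> * resolvent \<mu>)"
proof -
  let ?R = "resolvent \<mu>"
  have "fps_deriv ?R = - fps_deriv (cq_fps + fps_const \<mu>) * ?R\<^sup>2"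
    unfolding resolvent_def by (rule fps_inverse_deriv) (use assms in simp)
  then have "(1 - fps_X) * fps_deriv ?R = - ((1 - fps_X) * fps_deriv cq_fps) * ?R\<^sup>2"
    by (simp add: algebra_simps)
  also have "\<dots> = fps_const \<alpha> * cq_fps * ?R\<^sup>2"
    by (simp only: cq_fps_deriv mult_minus_left minus_minus)
  also have "\<dots> = fps_const \<alpha> * (((cq_fps + fps_const \<mu>) * ?R) * ?R) - fps_const \<alpha> * fps_const \<mu> * (?R * ?R)"
    by (simp add: algebra_simps power2_eq_square)
  finally show ?thesis using assms by (simp add: resolvent_mult del: fps_const_mult flip: fps_const_mult)
qed

lemma resolvent_Suc:
  assumes "0 \<le> \<mu>"
  shows "real (Suc k) * fps_nth (resolvent \<mu>) (Suc k) = (real k + \<alpha>) * fps_nth (resolvent \<mu>) k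
    - \<alpha> * \<mu> * (\<Sum>j=0..k. fps_nth (resolvent \<mu>) j * fps_nth (resolvent \<mu>) (k - j))"
proof -
  have "fps_nth ((1 - fps_X) * fps_deriv (resolvent \<mu>)) k =
      real (Suc k) * fps_nth (resolvent \<mu>) (Suc k) - real k * fps_nth (resolvent \<mu>) k"
    by (cases k) (auto simp: left_diff_distrib)
  then show ?thesis
    unfolding resolvent_deriv[OF assms] fps_sub_nth fps_mult_left_const_nth by (simp add: fps_mult_nth algebra_simps)
qed

lemma resolvent_0: "0 \<le> \<mu> \<Longrightarrow> (1 + \<mu>) * fps_nth (resolvent \<mu>) 0 = 1"
  by (simp add: resolvent_def)

text \<open>All weights but the first are nonpositive, so solving (b + \<mu>) R = 1 for the newest
  coefficient only adds up nonnegative terms.\<close>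

lemma resolvent_nonneg:
  assumes "0 \<le> \<mu>"
  shows "0 \<le> fps_nth (resolvent \<mu>) n"
proof (induction n rule: less_induct)
  case (less n)
  show ?case
  proof (cases n)
    case 0
    then show ?thesis using resolvent_0[OF assms] assms by (simp add: resolvent_def)
  next
    case (Suc m)
    have "fps_nth ((cq_fps + fps_const \<mu>) * resolvent \<mu>) n = 0"
      by (simp add: resolvent_mult[OF assms] Suc)
    moreover have "fps_nth ((cq_fps + fps_const \<mu>) * resolvent \<mu>) n =
        (1 + \<mu>) * fps_nth (resolvent \<mu>) n + (\<Sum>j=1..n. cq_weight \<alpha> j * fps_nth (resolvent \<mu>) (n - j))"
      by (simp add: distrib_right fps_mult_nth sum.atLeast_Suc_atMost[of 0 n])
    moreover have "(\<Sum>j=1..n. cq_weight \<alpha> j * fps_nth (resolvent \<mu>) (n - j)) \<le> 0"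
      using less Suc by (intro sum_nonpos mult_nonpos_nonneg cq_weight_nonpos) auto
    ultimately show ?thesis using assms
      by (smt (verit, ccfv_SIG) mult_neg_pos mult_pos_neg)
  qed
qed

lemma resolvent_step:
  assumes "0 \<le> \<mu>"
  shows "real (Suc k) * fps_nth (resolvent \<mu>) (Suc k) \<le> (real k + \<alpha>) * fps_nth (resolvent \<mu>) k"
proof -
  have "0 \<le> \<alpha> * \<mu> * (\<Sum>j=0..k. fps_nth (resolvent \<mu>) j * fps_nth (resolvent \<mu>) (k - j))"
    using assms order_pos by (intro mult_nonneg_nonneg sum_nonneg resolvent_nonneg) auto
  then show ?thesis using resolvent_Suc[OF assms, of k] by linarith
qed

lemma resolvent_antimono:
  assumes "0 \<le> \<mu>" "j \<le> k"
  shows "fps_nth (resolvent \<mu>) k \<le> fps_nth (resolvent \<mu>) j"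
  using \<open>j \<le> k\<close>
proof (induction k rule: dec_induct)
  case (step k)
  have "real (Suc k) * fps_nth (resolvent \<mu>) (Suc k) \<le> (real k + \<alpha>) * fps_nth (resolvent \<mu>) k"
    by (rule resolvent_step[OF assms(1)])
  also have "\<dots> \<le> real (Suc k) * fps_nth (resolvent \<mu>) k"
    using order_less_1 resolvent_nonneg[OF assms(1)] by (intro mult_right_mono) auto
  finally show ?case using step by simp
qed simp

text \<open>Dropping the quadratic term of the recursion frees the bound from \<mu>. The step ratio
  (k + \<alpha>) / (k + 1) is below that of the powers, since Bernoulli's inequality leads to (k +
  1) - (1 - \<alpha>)^2 / (k + 1) \<le> k + 1.\<close>

lemma resolvent_le_powr:
  assumes "0 \<le> \<mu>"
  shows "fps_nth (resolvent \<mu>) k \<le> real (Suc k) powr (\<alpha> - 1)"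
proof (induction k)
  case 0
  show ?case using resolvent_0[OF assms] assms resolvent_nonneg[OF assms, of 0]
    by (simp add: resolvent_def divide_simps)
next
  case (Suc k)
  have k: "real (Suc k) > 0" by simp
  have "(real (Suc (Suc k)) / real (Suc k)) powr (1 - \<alpha>) \<le> 1 + (1 - \<alpha>) / real (Suc k)"
    using bernoulli_powr(2)[of "real (Suc (Suc k)) / real (Suc k)"] by (simp add: field_simps)
  then have "(real k + \<alpha>) * (real (Suc (Suc k)) / real (Suc k)) powr (1 - \<alpha>) \<le>
      (real k + \<alpha>) * (1 + (1 - \<alpha>) / real (Suc k))"
    using order_pos by (intro mult_left_mono) auto
  also have "\<dots> = real (Suc k) - (1 - \<alpha>)\<^sup>2 / real (Suc k)"
    by (simp add: field_simps power2_eq_square)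
  also have "\<dots> \<le> real (Suc k)" by simp
  finally have *: "(real k + \<alpha>) * (real (Suc (Suc k)) / real (Suc k)) powr (1 - \<alpha>) \<le> real (Suc k)" .
  have eq: "real (Suc k) powr (\<alpha> - 1) =
      (real (Suc (Suc k)) / real (Suc k)) powr (1 - \<alpha>) * real (Suc (Suc k)) powr (\<alpha> - 1)"
  proof -
    have "real (Suc k) powr (1 - \<alpha>) * real (Suc k) powr (\<alpha> - 1) = 1"
      "real (Suc (Suc k)) powr (1 - \<alpha>) * real (Suc (Suc k)) powr (\<alpha> - 1) = 1"
      by (simp_all flip: powr_add)
    then show ?thesis by (simp add: powr_divide field_simps)
  qed
  have "real (Suc k) * fps_nth (resolvent \<mu>) (Suc k) \<le> (real k + \<alpha>) * fps_nth (resolvent \<mu>) k"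
    by (rule resolvent_step[OF assms])
  also have "\<dots> \<le> (real k + \<alpha>) * real (Suc k) powr (\<alpha> - 1)"
    using Suc order_pos by (intro mult_left_mono) auto
  also have "\<dots> = (real k + \<alpha>) * (real (Suc (Suc k)) / real (Suc k)) powr (1 - \<alpha>) * real (Suc (Suc k)) powr (\<alpha> - 1)"
    by (subst eq) (simp only: mult.assoc)
  also have "\<dots> \<le> real (Suc k) * real (Suc (Suc k)) powr (\<alpha> - 1)"
    using * by (intro mult_right_mono) auto
  finally show ?case using k by simp
qed

text \<open>The generating function of the scheme with exact solves and initial value \<open>1\<close>.\<close>

definition exact_fps :: "real \<Rightarrow> real fps" where
  "exact_fps \<mu> = resolvent \<mu> * (cq_fps * Abs_fps (\<lambda>_. 1) + fps_const \<mu>)"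

lemma one_minus_X_mult_ones: "(1 - fps_X) * Abs_fps (\<lambda>_. 1 :: real) = 1"
  by (rule fps_ext) (simp add: left_diff_distrib)

lemma exact_fps_diff:
  assumes "0 \<le> \<mu>"
  shows "(1 - fps_X) * exact_fps \<mu> = 1 - fps_const \<mu> * fps_X * resolvent \<mu>"
proof -
  have "(1 - fps_X) * exact_fps \<mu> =
      resolvent \<mu> * (cq_fps * ((1 - fps_X) * Abs_fps (\<lambda>_. 1)) + fps_const \<mu> * (1 - fps_X))"
    unfolding exact_fps_def by (simp add: algebra_simps)
  also have "\<dots> = (cq_fps + fps_const \<mu>) * resolvent \<mu> - fps_const \<mu> * fps_X * resolvent \<mu>"
    unfolding one_minus_X_mult_ones by (simp add: algebra_simps)
  finally show ?thesis by (simp add: resolvent_mult[OF assms])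
qed

lemma exact_fps_step:
  assumes "0 \<le> \<mu>"
  shows "fps_nth (exact_fps \<mu>) n - fps_nth (exact_fps \<mu>) (Suc n) = \<mu> * fps_nth (resolvent \<mu>) n"
proof -
  have "fps_nth ((1 - fps_X) * exact_fps \<mu>) (Suc n) = fps_nth (1 - fps_const \<mu> * fps_X * resolvent \<mu>) (Suc n)"
    by (simp only: exact_fps_diff[OF assms])
  then show ?thesis by (simp add: left_diff_distrib mult.assoc)
qed

lemma exact_fps_0: "0 \<le> \<mu> \<Longrightarrow> fps_nth (exact_fps \<mu>) 0 = 1"
  by (simp add: exact_fps_def resolvent_def)

lemma exact_fps_eq:
  assumes "0 \<le> \<mu>"
  shows "fps_nth (exact_fps \<mu>) n = 1 - (\<Sum>k<n. \<mu> * fps_nth (resolvent \<mu>) k)"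
proof (induction n)
  case (Suc n)
  then show ?case using exact_fps_step[OF assms, of n] by simp
qed (simp add: exact_fps_0 assms)

text \<open>Both factors of \<open>exact_fps\<close> have nonnegative coefficients: the resolvent,
  and the partial sums of the weights, with \<mu> added at index 0.\<close>

lemma exact_fps_nonneg:
  assumes "0 \<le> \<mu>"
  shows "0 \<le> fps_nth (exact_fps \<mu>) n"
proof -
  have *: "0 \<le> fps_nth (cq_fps * Abs_fps (\<lambda>_. 1) + fps_const \<mu>) k" for k
    using cq_weight_sum_nonneg[of k] assms by (cases k) (auto simp: fps_mult_nth atLeast0AtMost)
  show ?thesis
    unfolding exact_fps_def fps_mult_nth[of "resolvent \<mu>"]
    by (intro sum_nonneg mult_nonneg_nonneg resolvent_nonneg assms *)
qed

text \<open>Discrete maximum principle: 1 minus this sum is the discrete solution with initial value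
  1, which stays nonnegative. This is the mass bound, uniform in \<mu>, that the convolution
  estimates ask for.\<close>

lemma resolvent_sum_le: "0 \<le> \<mu> \<Longrightarrow> (\<Sum>k<n. \<mu> * fps_nth (resolvent \<mu>) k) \<le> 1"
  using exact_fps_eq[of \<mu> n] exact_fps_nonneg[of \<mu> n] by linarith

text \<open>In a decreasing sequence of mass at most 1, k + 1 copies of the term with index k stay
  below the mass of the terms up to it.\<close>

lemma resolvent_le_inverse:
  assumes "0 \<le> \<mu>"
  shows "\<mu> * fps_nth (resolvent \<mu>) k \<le> 1 / real (Suc k)"
proof -
  have "real (Suc k) * (\<mu> * fps_nth (resolvent \<mu>) k) = (\<Sum>j<Suc k. \<mu> * fps_nth (resolvent \<mu>) k)"
    by simp
  also have "\<dots> \<le> (\<Sum>j<Suc k. \<mu> * fps_nth (resolvent \<mu>) j)"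
    using assms by (intro sum_mono mult_left_mono resolvent_antimono) auto
  also have "\<dots> \<le> 1" by (rule resolvent_sum_le[OF assms])
  finally show ?thesis by (simp add: field_simps)
qed

lemma resolvent_bound:
  assumes "0 \<le> \<mu>"
  shows "(1 + \<mu>) * fps_nth (resolvent \<mu>) k \<le> 2 * real (Suc k) powr (\<alpha> - 1)"
proof -
  have "1 / real (Suc k) = real (Suc k) powr (-1)" by (simp add: powr_minus_divide)
  also have "\<dots> \<le> real (Suc k) powr (\<alpha> - 1)"
    using order_pos by (intro powr_mono) auto
  finally show ?thesis
    using resolvent_le_inverse[OF assms, of k] resolvent_le_powr[OF assms, of k] by (simp add: algebra_simps)
qed

definition diff_const :: real where "diff_const = 2 + 2 * conv_const"

lemma conv_const_pos: "0 < conv_const" and diff_const_pos: "0 < diff_const"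
  using order_pos by (auto simp: diff_const_def conv_const_def intro!: add_pos_pos)

lemma resolvent_conv_bound:
  assumes "0 \<le> \<mu>"
  shows "(\<Sum>j=1..n. real (n - j + 1) powr (\<alpha> - 1) * (\<mu> * fps_nth (resolvent \<mu>) (j - 1))) \<le>
    conv_const * real n powr (\<alpha> - 1)"
proof (cases "n = 0")
  case False
  show ?thesis
  proof (rule powr1_convolution_le)
    fix j assume j: "j \<in> {1..n}"
    show "0 \<le> \<mu> * fps_nth (resolvent \<mu>) (j - 1)"
      using assms by (simp add: resolvent_nonneg)
    have "\<mu> * fps_nth (resolvent \<mu>) (j - 1) \<le> 1 / real j"
      using resolvent_le_inverse[OF assms, of "j - 1"] j by simp
    also have "\<dots> \<le> 2 / real j" using j by (simp add: divide_right_mono)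
    finally show "\<mu> * fps_nth (resolvent \<mu>) (j - 1) \<le> 2 / real j" .
  next
    have "(\<Sum>j=1..n. \<mu> * fps_nth (resolvent \<mu>) (j - 1)) = (\<Sum>k<n. \<mu> * fps_nth (resolvent \<mu>) k)"
      by (rule sum.reindex_bij_witness[of _ Suc "\<lambda>k. k - 1"]) auto
    then show "(\<Sum>j=1..n. \<mu> * fps_nth (resolvent \<mu>) (j - 1)) \<le> 1"
      using resolvent_sum_le[OF assms] by simp
  qed (use False in simp)
qed (use conv_const_pos in simp)

text \<open>The Riccati recursion expresses (k + 1) (E_k - E_(k+1)) through E_k and the convolution
  of E with \<mu> E, both of order (k + 1)^(\<alpha> - 1) after multiplication by 1 + \<mu>;
  dividing by k + 1 gains a power. In the convolution one factor receives 1 + \<mu> and the other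
  \<mu>, so that both are bounded uniformly.\<close>

lemma resolvent_diff_bound:
  assumes "0 \<le> \<mu>"
  shows "(1 + \<mu>) * (fps_nth (resolvent \<mu>) k - fps_nth (resolvent \<mu>) (Suc k)) \<le>
    diff_const * real (Suc k) powr (\<alpha> - 2)"
proof -
  let ?E = "fps_nth (resolvent \<mu>)"
  have "real (Suc k) * ((1 + \<mu>) * (?E k - ?E (Suc k))) =
      (1 + \<mu>) * (real (Suc k) * ?E k - real (Suc k) * ?E (Suc k))"
    by (simp add: algebra_simps)
  also have "real (Suc k) * ?E k - real (Suc k) * ?E (Suc k) =
      (1 - \<alpha>) * ?E k + \<alpha> * \<mu> * (\<Sum>j=0..k. ?E j * ?E (k - j))"
    using resolvent_Suc[OF assms, of k] by (simp add: algebra_simps)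
  also have "(1 + \<mu>) * ((1 - \<alpha>) * ?E k + \<alpha> * \<mu> * (\<Sum>j=0..k. ?E j * ?E (k - j))) =
      (1 - \<alpha>) * ((1 + \<mu>) * ?E k) + \<alpha> * (\<Sum>j=0..k. ((1 + \<mu>) * ?E (k - j)) * (\<mu> * ?E j))"
    by (simp add: algebra_simps sum_distrib_left sum.distrib)
  also have "\<dots> \<le> 1 * (2 * real (Suc k) powr (\<alpha> - 1)) + 1 * (2 * (conv_const * real (Suc k) powr (\<alpha> - 1)))"
  proof (intro add_mono)
    show "(1 - \<alpha>) * ((1 + \<mu>) * ?E k) \<le> 1 * (2 * real (Suc k) powr (\<alpha> - 1))"
      using assms order_pos order_less_1
      by (intro mult_mono[OF _ resolvent_bound]) (auto intro!: mult_nonneg_nonneg resolvent_nonneg)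
    have "(\<Sum>j=0..k. ((1 + \<mu>) * ?E (k - j)) * (\<mu> * ?E j)) \<le>
        (\<Sum>j=0..k. (2 * real (Suc (k - j)) powr (\<alpha> - 1)) * (\<mu> * ?E j))"
      using assms by (intro sum_mono mult_right_mono resolvent_bound mult_nonneg_nonneg resolvent_nonneg) auto
    also have "\<dots> = 2 * (\<Sum>j=1..Suc k. real (Suc k - j + 1) powr (\<alpha> - 1) * (\<mu> * ?E (j - 1)))"
      unfolding sum_distrib_left
      by (rule sum.reindex_bij_witness[of _ "\<lambda>k. k - 1" Suc]) (auto simp: algebra_simps Suc_diff_le)
    also have "\<dots> \<le> 2 * (conv_const * real (Suc k) powr (\<alpha> - 1))"
      using resolvent_conv_bound[OF assms, of "Suc k"] by simp
    finally show "\<alpha> * (\<Sum>j=0..k. ((1 + \<mu>) * ?E (k - j)) * (\<mu> * ?E j)) \<le>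
        1 * (2 * (conv_const * real (Suc k) powr (\<alpha> - 1)))"
      using assms order_pos order_less_1
      by (intro mult_mono) (auto intro!: sum_nonneg mult_nonneg_nonneg resolvent_nonneg)
  qed
  also have "\<dots> = diff_const * real (Suc k) powr (\<alpha> - 1)"
    by (simp add: diff_const_def algebra_simps)
  also have "\<dots> = real (Suc k) * (diff_const * real (Suc k) powr (\<alpha> - 2))"
    using powr_mult_base[of "real (Suc k)" "\<alpha> - 2"] by simp
  finally show ?thesis by simp
qed

text \<open>A difference of two nonnegative first differences is at most the larger of their bounds,
  which is already summable. The factor 9 = 3^2 pays for the index shift, as m + 1 \<ge> (k + 1) / 3
  for k = m + 2; for k = 0 and k = 1 some of the shifted terms are absent.\<close>

lemma resolvent_second_diff_bound:
  assumes "0 \<le> \<mu>"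
  shows "\<bar>(1 + \<mu>) * fps_nth ((1 - fps_X)\<^sup>2 * resolvent \<mu>) k\<bar> \<le> 9 * (diff_const + 1) * real (Suc k) powr (\<alpha> - 2)"
proof -
  let ?E = "fps_nth (resolvent \<mu>)"
  have "(1 - fps_X)\<^sup>2 * resolvent \<mu> = resolvent \<mu> - 2 * (fps_X * resolvent \<mu>) + fps_X * (fps_X * resolvent \<mu>)"
    by (simp add: power2_eq_square algebra_simps)
  then have nth: "fps_nth ((1 - fps_X)\<^sup>2 * resolvent \<mu>) k =
      ?E k - 2 * (if k = 0 then 0 else ?E (k - 1)) + (if k = 0 then 0 else if k - 1 = 0 then 0 else ?E (k - 1 - 1))"
    by (simp add: numeral_fps_const)
  have E0: "(1 + \<mu>) * ?E 0 = 1" by (rule resolvent_0[OF assms])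
  have d: "0 \<le> (1 + \<mu>) * (?E j - ?E (Suc j))" for j
    using assms by (intro mult_nonneg_nonneg) (auto simp: resolvent_antimono)
  have E1: "0 \<le> (1 + \<mu>) * ?E 1" using assms by (intro mult_nonneg_nonneg resolvent_nonneg) auto
  consider "k = 0" | "k = 1" | m where "k = Suc (Suc m)"
    by (metis One_nat_def not0_implies_Suc)
  then show ?thesis
  proof cases
    case 1
    show ?thesis unfolding nth using E0 diff_const_pos by (simp add: 1)
  next
    case 2
    have "\<bar>(1 + \<mu>) * fps_nth ((1 - fps_X)\<^sup>2 * resolvent \<mu>) k\<bar> = \<bar>(1 + \<mu>) * ?E 1 - 2 * ((1 + \<mu>) * ?E 0)\<bar>"
      unfolding nth by (simp add: 2 algebra_simps)
    also have "\<dots> \<le> 2" using E0 E1 d[of 0] by (simp add: algebra_simps)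
    also have "\<dots> \<le> 9 * (diff_const + 1) * 2 powr (\<alpha> - 2)"
    proof -
      have "(1/4::real) = 2 powr (-2)" by (simp add: powr_minus_divide)
      also have "\<dots> \<le> 2 powr (\<alpha> - 2)" using order_pos by (intro powr_mono) auto
      finally have p: "1/4 \<le> 2 powr (\<alpha> - 2)" .
      have d2: "diff_const \<ge> 2" using conv_const_pos by (simp add: diff_const_def)
      have "27 * (1/4) \<le> 9 * (diff_const + 1) * 2 powr (\<alpha> - 2)"
        by (rule mult_mono) (use p d2 in auto)
      then show ?thesis by simp
    qed
    finally show ?thesis by (simp add: 2)
  next
    case 3
    have "(1 + \<mu>) * fps_nth ((1 - fps_X)\<^sup>2 * resolvent \<mu>) k =
        (1 + \<mu>) * (?E m - ?E (Suc m)) - (1 + \<mu>) * (?E (Suc m) - ?E (Suc (Suc m)))"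
      unfolding nth by (simp add: 3 algebra_simps)
    moreover have "(1 + \<mu>) * (?E m - ?E (Suc m)) \<le> diff_const * real (Suc m) powr (\<alpha> - 2)"
      by (rule resolvent_diff_bound[OF assms])
    moreover have "(1 + \<mu>) * (?E (Suc m) - ?E (Suc (Suc m))) \<le> diff_const * real (Suc (Suc m)) powr (\<alpha> - 2)"
      by (rule resolvent_diff_bound[OF assms])
    moreover have "real (Suc (Suc m)) powr (\<alpha> - 2) \<le> real (Suc m) powr (\<alpha> - 2)"
      using order_less_1 by (intro powr_mono2') auto
    ultimately have "\<bar>(1 + \<mu>) * fps_nth ((1 - fps_X)\<^sup>2 * resolvent \<mu>) k\<bar> \<le> diff_const * real (Suc m) powr (\<alpha> - 2)"
      using d[of m] d[of "Suc m"] diff_const_pos by (smt (verit, best) mult_left_mono)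
    also have "real (Suc m) powr (\<alpha> - 2) \<le> 9 * real (Suc k) powr (\<alpha> - 2)"
    proof -
      have "real (Suc m) powr (\<alpha> - 2) \<le> (real (Suc k) / 3) powr (\<alpha> - 2)"
        using order_less_1 by (intro powr_mono2') (auto simp: 3)
      also have "\<dots> = 3 powr (2 - \<alpha>) * real (Suc k) powr (\<alpha> - 2)"
        by (simp add: powr_divide powr_diff field_simps)
      also have "3 powr (2 - \<alpha>) \<le> 3 powr (2::real)"
        using order_pos by (intro powr_mono) auto
      finally show ?thesis by (simp add: mult_right_mono)
    qed
    finally show ?thesis using diff_const_pos by (simp add: algebra_simps add_increasing)
  qed
qed

end

section \<open>Comparison with the weights of the exact integral\<close>

context fractional_order
begin

text \<open>
  The weights of the exact integral of \<open>(t\<^sub>n - s) powr (\<alpha> - 1) / Gamma \<alpha>\<close> over the subintervals;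
  \<open>resolvent 0\<close> contains those of its convolution quadrature.
\<close>

definition int_weight :: "nat \<Rightarrow> real" where
  "int_weight k = (real (Suc k) powr \<alpha> - real k powr \<alpha>) / Gamma (\<alpha> + 1)"

lemma Gamma_order_pos: "0 < Gamma \<alpha>" and Gamma_order_Suc: "Gamma (\<alpha> + 1) = \<alpha> * Gamma \<alpha>"
  using order_pos by (auto intro!: Gamma_real_pos Gamma_plus1 elim!: nonpos_Ints_cases)

lemma sum_int_weight: "(\<Sum>k<n. int_weight k) = real n powr \<alpha> / Gamma (\<alpha> + 1)"
  using sum_lessThan_telescope[of "\<lambda>k. real k powr \<alpha> / Gamma (\<alpha> + 1)" n]
  by (simp add: int_weight_def diff_divide_distrib)

lemma int_weight_nonneg: "0 \<le> int_weight k"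
  unfolding int_weight_def using order_pos Gamma_order_pos Gamma_order_Suc
  by (intro divide_nonneg_nonneg) (auto intro!: powr_mono2)

text \<open>Mean value bounds for the integral of s^(\<alpha> - 1) over [k, k + 1], obtained from
  Bernoulli's inequality. The upper one excludes k = 0, where \<open>0 powr (\<alpha> - 1)\<close>
  is 0.\<close>

lemma int_weight_bounds:
  shows "real (Suc k) powr (\<alpha> - 1) \<le> Gamma \<alpha> * int_weight k"
    and "1 \<le> k \<Longrightarrow> Gamma \<alpha> * int_weight k \<le> real k powr (\<alpha> - 1)"
proof -
  have G: "Gamma \<alpha> * int_weight k = (real (Suc k) powr \<alpha> - real k powr \<alpha>) / \<alpha>"
    using Gamma_order_pos by (simp add: int_weight_def Gamma_order_Suc)
  show "real (Suc k) powr (\<alpha> - 1) \<le> Gamma \<alpha> * int_weight k"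
    using powr_step_lower[of k] order_pos by (simp add: G field_simps)
  assume k: "1 \<le> k"
  have "(real (Suc k) / real k) powr \<alpha> \<le> 1 + \<alpha> / real k"
    using bernoulli_powr(1)[of "real (Suc k) / real k"] k by (simp add: field_simps)
  then have "real k powr \<alpha> * (real (Suc k) / real k) powr \<alpha> \<le> real k powr \<alpha> * (1 + \<alpha> / real k)"
    by (intro mult_left_mono) auto
  moreover have "real k powr \<alpha> * (real (Suc k) / real k) powr \<alpha> = real (Suc k) powr \<alpha>"
    using k by (simp add: powr_divide)
  moreover have "real k powr (\<alpha> - 1) = real k powr \<alpha> / real k" using k by (simp add: powr_diff)
  ultimately show "Gamma \<alpha> * int_weight k \<le> real k powr (\<alpha> - 1)"
    using order_pos by (simp add: G field_simps)
qed

section \<open>The coefficients of (1 - X)^(-\<alpha>)\<close>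

lemma resolvent_zero_Suc:
  "real (Suc k) * fps_nth (resolvent 0) (Suc k) = (real k + \<alpha>) * fps_nth (resolvent 0) k"
  using resolvent_Suc[of 0 k] by simp

lemma resolvent_zero_eq: "fps_nth (resolvent 0) k = cq_weight (- \<alpha>) k"
proof (induction k)
  case 0
  show ?case using resolvent_0[of 0] by simp
next
  case (Suc k)
  have "real (Suc k) * fps_nth (resolvent 0) (Suc k) = real (Suc k) * cq_weight (- \<alpha>) (Suc k)"
    using resolvent_zero_Suc[of k] cq_weight_Suc[of k "- \<alpha>"] Suc by simp
  then show ?case by simp
qed

text \<open>Asymptotics of binomial coefficients. The limit 1 / Gamma \<alpha> matches the constant
  of the fractional integral, which is why the quadrature is consistent.\<close>

lemma resolvent_zero_lim: "(\<lambda>k. fps_nth (resolvent 0) k * real k powr (1 - \<alpha>)) \<longlonglongrightarrow> 1 / Gamma \<alpha>"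
proof -
  have "(\<lambda>n. ((- \<alpha>) gchoose n) / ((-1) ^ n / exp ((- \<alpha> + 1) * ln (real n)))) \<longlonglongrightarrow> inverse (Gamma (- (- \<alpha>)))"
    using gbinomial_asymptotic[of "- \<alpha>"] by simp
  moreover have "eventually (\<lambda>n. ((- \<alpha>) gchoose n) / ((-1) ^ n / exp ((- \<alpha> + 1) * ln (real n))) =
      fps_nth (resolvent 0) n * real n powr (1 - \<alpha>)) sequentially"
    using eventually_gt_at_top[of 0]
  proof eventually_elim
    case (elim n)
    have "(1::real) / (-1) ^ n = (-1) ^ n" by (cases "even n") auto
    then show ?case using elim
      by (simp add: resolvent_zero_eq cq_weight_eq powr_def divide_simps mult_ac)
  qed
  ultimately show ?thesis
    by (simp add: inverse_eq_divide filterlim_cong)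
qed

text \<open>With c_k the coefficients, c_k k^(1 - \<alpha>) increases and c_k (k + 1)^(1 - \<alpha>)
  decreases, both to 1 / Gamma \<alpha>. The bounds are those of \<open>int_weight_bounds\<close>,
  so the two weight sequences differ by at most a difference of neighbouring powers.\<close>

lemma resolvent_zero_bounds:
  shows "real (Suc k) powr (\<alpha> - 1) \<le> Gamma \<alpha> * fps_nth (resolvent 0) k"
    and "1 \<le> k \<Longrightarrow> Gamma \<alpha> * fps_nth (resolvent 0) k \<le> real k powr (\<alpha> - 1)"
proof -
  let ?c = "fps_nth (resolvent 0)"
  have inc: "?c k * real k powr (1 - \<alpha>) \<le> ?c (Suc k) * real (Suc k) powr (1 - \<alpha>)" if k: "1 \<le> k" for k
  proof -
    have "(real (Suc k) / real k) powr \<alpha> \<le> 1 + \<alpha> / real k"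
      using bernoulli_powr(1)[of "real (Suc k) / real k"] k by (simp add: field_simps)
    then have "real k * (real (Suc k) / real k) powr \<alpha> \<le> real k + \<alpha>"
      using k by (simp add: field_simps)
    then have "?c k * (real k * (real (Suc k) / real k) powr \<alpha>) \<le> ?c k * (real k + \<alpha>)"
      by (intro mult_left_mono resolvent_nonneg) auto
    also have "\<dots> = real (Suc k) * ?c (Suc k)"
      using resolvent_zero_Suc[of k] by (simp add: mult.commute)
    finally have "?c k * (real k * (real (Suc k) / real k) powr \<alpha>) * real (Suc k) powr (- \<alpha>) \<le>
        real (Suc k) * ?c (Suc k) * real (Suc k) powr (- \<alpha>)"
      by (intro mult_right_mono) auto
    moreover have "real k * (real (Suc k) / real k) powr \<alpha> * real (Suc k) powr (- \<alpha>) = real k powr (1 - \<alpha>)"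
      using k by (simp add: powr_divide powr_minus powr_diff field_simps)
    moreover have "real (Suc k) * real (Suc k) powr (- \<alpha>) = real (Suc k) powr (1 - \<alpha>)"
      by (simp add: powr_mult_base del: of_nat_Suc)
    ultimately show ?thesis by (metis (no_types, lifting) mult.assoc mult.left_commute)
  qed
  have dec: "?c (Suc k) * real (Suc (Suc k)) powr (1 - \<alpha>) \<le> ?c k * real (Suc k) powr (1 - \<alpha>)" for k
  proof -
    have "(real (Suc (Suc k)) / real (Suc k)) powr (1 - \<alpha>) \<le> 1 + (1 - \<alpha>) / real (Suc k)"
      using bernoulli_powr(2)[of "real (Suc (Suc k)) / real (Suc k)"] by (simp add: field_simps)
    then have "(real k + \<alpha>) * (real (Suc (Suc k)) / real (Suc k)) powr (1 - \<alpha>) \<le>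
        (real k + \<alpha>) * (1 + (1 - \<alpha>) / real (Suc k))"
      using order_pos by (intro mult_left_mono) auto
    also have "\<dots> = real (Suc k) - (1 - \<alpha>)\<^sup>2 / real (Suc k)"
      by (simp add: field_simps power2_eq_square)
    also have "\<dots> \<le> real (Suc k)" by simp
    finally have "?c k * ((real k + \<alpha>) * (real (Suc (Suc k)) / real (Suc k)) powr (1 - \<alpha>)) \<le> ?c k * real (Suc k)"
      by (intro mult_left_mono resolvent_nonneg) auto
    then have "(real (Suc k) * ?c (Suc k)) * (real (Suc (Suc k)) / real (Suc k)) powr (1 - \<alpha>) \<le> ?c k * real (Suc k)"
      unfolding resolvent_zero_Suc by (simp only: mult_ac)
    then have "?c (Suc k) * (real (Suc (Suc k)) / real (Suc k)) powr (1 - \<alpha>) \<le> ?c k"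
      by (simp add: mult_ac del: of_nat_Suc)
    then have "?c (Suc k) * (real (Suc (Suc k)) / real (Suc k)) powr (1 - \<alpha>) * real (Suc k) powr (1 - \<alpha>) \<le>
       ?c k * real (Suc k) powr (1 - \<alpha>)"
      by (intro mult_right_mono) auto
    moreover have "(real (Suc (Suc k)) / real (Suc k)) powr (1 - \<alpha>) * real (Suc k) powr (1 - \<alpha>) =
        real (Suc (Suc k)) powr (1 - \<alpha>)"
      by (simp add: powr_divide)
    ultimately show ?thesis by (simp only: mult.assoc)
  qed
  have lim': "(\<lambda>k. ?c k * real (Suc k) powr (1 - \<alpha>)) \<longlonglongrightarrow> 1 / Gamma \<alpha>"
  proof -
    have "(\<lambda>k. (real (Suc k) / real k) powr (1 - \<alpha>)) \<longlonglongrightarrow> 1 powr (1 - \<alpha>)"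
      by (intro tendsto_powr tendsto_const LIMSEQ_Suc_n_over_n) auto
    then have t1: "(\<lambda>k. (?c k * real k powr (1 - \<alpha>)) * (real (Suc k) / real k) powr (1 - \<alpha>)) \<longlonglongrightarrow> (1 / Gamma \<alpha>) * 1"
      by (intro tendsto_mult resolvent_zero_lim) simp
    have t2: "eventually (\<lambda>k. (?c k * real k powr (1 - \<alpha>)) * (real (Suc k) / real k) powr (1 - \<alpha>) =
        ?c k * real (Suc k) powr (1 - \<alpha>)) sequentially"
      using eventually_gt_at_top[of 0] by eventually_elim (simp add: powr_divide)
    show ?thesis using Lim_transform_eventually[OF t1 t2] by simp
  qed
  have "decseq (\<lambda>k. ?c k * real (Suc k) powr (1 - \<alpha>))"
    by (rule decseq_SucI) (rule dec)
  then have "1 / Gamma \<alpha> \<le> ?c k * real (Suc k) powr (1 - \<alpha>)"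
    using lim' by (rule decseq_ge)
  then have "1 / Gamma \<alpha> * real (Suc k) powr (\<alpha> - 1) \<le> ?c k * real (Suc k) powr (1 - \<alpha>) * real (Suc k) powr (\<alpha> - 1)"
    by (intro mult_right_mono) auto
  also have "real (Suc k) powr (1 - \<alpha>) * real (Suc k) powr (\<alpha> - 1) = 1" by (simp flip: powr_add)
  then have "?c k * real (Suc k) powr (1 - \<alpha>) * real (Suc k) powr (\<alpha> - 1) = ?c k"
    by (simp add: mult.assoc)
  finally show "real (Suc k) powr (\<alpha> - 1) \<le> Gamma \<alpha> * ?c k"
    using Gamma_order_pos by (simp add: field_simps)
  assume k: "1 \<le> k"
  have "incseq (\<lambda>k. ?c (Suc k) * real (Suc k) powr (1 - \<alpha>))"
    by (rule incseq_SucI) (rule inc, simp)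
  then have "?c (Suc (k - 1)) * real (Suc (k - 1)) powr (1 - \<alpha>) \<le> 1 / Gamma \<alpha>"
    using LIMSEQ_Suc[OF resolvent_zero_lim] by (rule incseq_le)
  then have "?c k * real k powr (1 - \<alpha>) * real k powr (\<alpha> - 1) \<le> 1 / Gamma \<alpha> * real k powr (\<alpha> - 1)"
    using k by (intro mult_right_mono) auto
  moreover have "real k powr (1 - \<alpha>) * real k powr (\<alpha> - 1) = 1" using k by (simp flip: powr_add)
  then have "?c k * real k powr (1 - \<alpha>) * real k powr (\<alpha> - 1) = ?c k"
    by (simp add: mult.assoc)
  ultimately have "?c k \<le> 1 / Gamma \<alpha> * real k powr (\<alpha> - 1)" by (simp only:)
  then show "Gamma \<alpha> * ?c k \<le> real k powr (\<alpha> - 1)"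
    using Gamma_order_pos by (simp add: field_simps)
qed

text \<open>Cumulative, because summation by parts will shift the differencing from the weights to
  the solution, whose increments are under control.\<close>

definition weight_defect :: "nat \<Rightarrow> real" where
  "weight_defect m = (\<Sum>k<m. fps_nth (resolvent 0) k - int_weight k)"

lemma powr_diff_bound: "1 \<le> k \<Longrightarrow> real k powr (\<alpha> - 1) - real (Suc k) powr (\<alpha> - 1) \<le> real k powr (\<alpha> - 2)"
proof -
  assume k: "1 \<le> k"
  have "(real (Suc k) / real k) powr (1 - \<alpha>) \<le> 1 + (1 - \<alpha>) / real k"
    using bernoulli_powr(2)[of "real (Suc k) / real k"] k by (simp add: field_simps)
  also have "\<dots> \<le> 1 + 1 / real k" using order_pos by (simp add: divide_right_mono)
  finally have a: "(real (Suc k) / real k) powr (1 - \<alpha>) \<le> 1 + 1 / real k" .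
  have b: "(1 - 1 / real k) * (1 + 1 / real k) \<le> 1"
    by (simp add: algebra_simps)
  have "(1 - 1 / real k) * (real (Suc k) / real k) powr (1 - \<alpha>) \<le> (1 - 1 / real k) * (1 + 1 / real k)"
    using k a by (intro mult_left_mono) auto
  with b have "(1 - 1 / real k) * (real (Suc k) / real k) powr (1 - \<alpha>) \<le> 1" by linarith
  then have "(1 - 1 / real k) * (real (Suc k) / real k) powr (1 - \<alpha>) * real (Suc k) powr (\<alpha> - 1) \<le>
      1 * real (Suc k) powr (\<alpha> - 1)"
    by (intro mult_right_mono) auto
  moreover have "(real (Suc k) / real k) powr (1 - \<alpha>) * real (Suc k) powr (\<alpha> - 1) = real k powr (\<alpha> - 1)"
  proof -
    have "real k powr (1 - \<alpha>) * real k powr (\<alpha> - 1) = 1"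
      "real (Suc k) powr (1 - \<alpha>) * real (Suc k) powr (\<alpha> - 1) = 1"
      using k by (simp_all flip: powr_add)
    then show ?thesis using k by (simp add: powr_divide field_simps del: of_nat_Suc)
  qed
  moreover have "real k powr (\<alpha> - 1) = real k * real k powr (\<alpha> - 2)"
    using powr_mult_base[of "real k" "\<alpha> - 2"] by simp
  moreover have "(1 - 1 / real k) * (real k * real k powr (\<alpha> - 2)) = real k * real k powr (\<alpha> - 2) - real k powr (\<alpha> - 2)"
    using k by (simp add: left_diff_distrib)
  ultimately show ?thesis by (metis diff_le_eq add.commute mult.assoc mult_1)
qed

lemma weight_defect_abs_sum:
  "(\<Sum>k<n. \<bar>fps_nth (resolvent 0) k - int_weight k\<bar>) \<le> 1 + int_weight 0 + 1 / Gamma \<alpha>"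
proof -
  have "\<bar>fps_nth (resolvent 0) k - int_weight k\<bar> \<le>
      (real k powr (\<alpha> - 1) - real (Suc k) powr (\<alpha> - 1)) / Gamma \<alpha>" if k: "1 \<le> k" for k
  proof -
    have "\<bar>Gamma \<alpha> * fps_nth (resolvent 0) k - Gamma \<alpha> * int_weight k\<bar> \<le>
        real k powr (\<alpha> - 1) - real (Suc k) powr (\<alpha> - 1)"
      using resolvent_zero_bounds[of k] int_weight_bounds[of k] k by linarith
    moreover have "\<bar>Gamma \<alpha> * fps_nth (resolvent 0) k - Gamma \<alpha> * int_weight k\<bar> =
        Gamma \<alpha> * \<bar>fps_nth (resolvent 0) k - int_weight k\<bar>"
      using Gamma_order_pos by (simp add: abs_mult flip: right_diff_distrib)
    ultimately show ?thesis using Gamma_order_pos by (simp add: field_simps)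
  qed
  note * = this
  show ?thesis
  proof (cases n)
    case 0
    then show ?thesis using int_weight_nonneg Gamma_order_pos by (simp add: add_nonneg_nonneg)
  next
    case (Suc m)
    have "(\<Sum>k<n. \<bar>fps_nth (resolvent 0) k - int_weight k\<bar>) =
        \<bar>fps_nth (resolvent 0) 0 - int_weight 0\<bar> + (\<Sum>k<m. \<bar>fps_nth (resolvent 0) (Suc k) - int_weight (Suc k)\<bar>)"
      by (simp only: Suc sum.lessThan_Suc_shift)
    also have "\<bar>fps_nth (resolvent 0) 0 - int_weight 0\<bar> \<le> 1 + int_weight 0"
      using resolvent_0[of 0] int_weight_nonneg[of 0] by simp
    also have "(\<Sum>k<m. \<bar>fps_nth (resolvent 0) (Suc k) - int_weight (Suc k)\<bar>) \<le>
        (\<Sum>k<m. (real (Suc k) powr (\<alpha> - 1) - real (Suc (Suc k)) powr (\<alpha> - 1)) / Gamma \<alpha>)"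
      by (intro sum_mono *) auto
    also have "\<dots> = (1 - real (Suc m) powr (\<alpha> - 1)) / Gamma \<alpha>"
      using sum_lessThan_telescope'[of "\<lambda>k. real (Suc k) powr (\<alpha> - 1)" m]
      by (simp add: sum_divide_distrib[symmetric])
    also have "\<dots> \<le> 1 / Gamma \<alpha>" using Gamma_order_pos by (intro divide_right_mono) auto
    finally show ?thesis by simp
  qed
qed

text \<open>Both partial sums are explicit: \<alpha> times the sum of the c_k is m c_m, and the
  integral weights telescope. Hence the defect is m (Gamma \<alpha> c_m - m^(\<alpha> - 1)) / Gamma
  (\<alpha> + 1), and the bracket is at most m^(\<alpha> - 2) in modulus.\<close>

lemma weight_defect_bound:
  assumes "1 \<le> m"
  shows "\<bar>weight_defect m\<bar> \<le> real m powr (\<alpha> - 1) / Gamma (\<alpha> + 1)"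
proof -
  let ?c = "fps_nth (resolvent 0)"
  have sum: "\<alpha> * (\<Sum>k<n. ?c k) = real n * ?c n" for n
  proof (induction n)
    case (Suc n)
    then show ?case using resolvent_zero_Suc[of n] by (simp add: algebra_simps)
  qed simp
  have m: "real m > 0" using assms by simp
  have G: "Gamma (\<alpha> + 1) * (\<Sum>k<m. ?c k) = real m * (Gamma \<alpha> * ?c m)"
    
  proof -
    have "Gamma (\<alpha> + 1) * (\<Sum>k<m. ?c k) = Gamma \<alpha> * (\<alpha> * (\<Sum>k<m. ?c k))"
      by (simp only: Gamma_order_Suc mult_ac)
    also have "\<dots> = Gamma \<alpha> * (real m * ?c m)" by (simp only: sum)
    finally show ?thesis by (simp only: mult_ac)
  qed
  have pm: "real m powr \<alpha> = real m * real m powr (\<alpha> - 1)"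
    using powr_mult_base[of "real m" "\<alpha> - 1"] m by simp
  have eq: "Gamma (\<alpha> + 1) * weight_defect m = real m * (Gamma \<alpha> * ?c m - real m powr (\<alpha> - 1))"
  proof -
    have "0 < Gamma (\<alpha> + 1)"
      unfolding Gamma_order_Suc by (intro mult_pos_pos order_pos Gamma_order_pos)
    then have "Gamma (\<alpha> + 1) \<noteq> 0" by linarith
    then have "Gamma (\<alpha> + 1) * weight_defect m = Gamma (\<alpha> + 1) * (\<Sum>k<m. ?c k) - real m powr \<alpha>"
      by (simp add: weight_defect_def sum_subtractf sum_int_weight right_diff_distrib)
    then show ?thesis unfolding G pm by (simp only: right_diff_distrib)
  qed
  have "\<bar>Gamma \<alpha> * ?c m - real m powr (\<alpha> - 1)\<bar> \<le> real m powr (\<alpha> - 2)"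
    using resolvent_zero_bounds[of m] powr_diff_bound[OF assms] assms by linarith
  then have "\<bar>Gamma (\<alpha> + 1) * weight_defect m\<bar> \<le> real m * real m powr (\<alpha> - 2)"
    unfolding eq abs_mult using m by (intro mult_mono) auto
  also have "\<dots> = real m powr (\<alpha> - 1)"
    using powr_mult_base[of "real m" "\<alpha> - 2"] m by simp
  finally show ?thesis
    using Gamma_order_pos Gamma_order_Suc order_pos by (simp add: abs_mult field_simps)
qed

end

section \<open>The Caputo equation in Volterra form\<close>

text \<open>The substitution s = r + (t - r) x removes r and t, since the powers of t - r cancel
  against the Jacobian. The nonnegative integral is used because the value serves to prove
  integrability in the plane before the integrals may be interchanged.\<close>

lemma beta_integral_subinterval:
  fixes \<alpha> r t :: real
  assumes "0 < \<alpha>" "\<alpha> < 1" "r < t"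
  shows "(\<integral>\<^sup>+s. ennreal (indicator {r<..<t} s * ((t - s) powr (\<alpha> - 1) * (s - r) powr (- \<alpha>))) \<partial>lborel) =
    ennreal (Beta \<alpha> (1 - \<alpha>))"
proof -
  have "((\<lambda>x. x powr ((1 - \<alpha>) - 1) * (1 - x) powr (\<alpha> - 1)) has_integral Beta (1 - \<alpha>) \<alpha>) {0..1}"
    using assms by (intro has_integral_Beta_real) auto
  then have "((\<lambda>x. if x \<in> {0..1} then x powr (- \<alpha>) * (1 - x) powr (\<alpha> - 1) else 0) has_integral Beta (1 - \<alpha>) \<alpha>) UNIV"
    unfolding has_integral_restrict_UNIV by simp
  then have "((\<lambda>x. indicator {0..1} x * (x powr (- \<alpha>) * (1 - x) powr (\<alpha> - 1))) has_integral Beta (1 - \<alpha>) \<alpha>) UNIV"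
    by (rule has_integral_eq[rotated]) auto
  then have "(\<integral>\<^sup>+x. ennreal (indicator {0..1} x * (x powr (- \<alpha>) * (1 - x) powr (\<alpha> - 1))) \<partial>lborel) =
      ennreal (Beta (1 - \<alpha>) \<alpha>)"
    by (intro nn_integral_has_integral_lborel) auto
  also have "(\<integral>\<^sup>+x. ennreal (indicator {0..1} x * (x powr (- \<alpha>) * (1 - x) powr (\<alpha> - 1))) \<partial>lborel) =
    (\<integral>\<^sup>+x. ennreal (indicator {0<..<1} x * (x powr (- \<alpha>) * (1 - x) powr (\<alpha> - 1))) \<partial>lborel)"
    by (intro nn_integral_cong) (auto simp: indicator_def)
  finally have base: "(\<integral>\<^sup>+x. ennreal (indicator {0<..<1} x * (x powr (- \<alpha>) * (1 - x) powr (\<alpha> - 1))) \<partial>lborel) =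
      ennreal (Beta \<alpha> (1 - \<alpha>))" by (simp add: Beta_commute)
  let ?c = "t - r"
  have c: "?c > 0" using assms by simp
  have "(\<integral>\<^sup>+s. ennreal (indicator {r<..<t} s * ((t - s) powr (\<alpha> - 1) * (s - r) powr (- \<alpha>))) \<partial>lborel) =
     \<bar>?c\<bar> * (\<integral>\<^sup>+x. ennreal (indicator {r<..<t} (r + ?c * x) * ((t - (r + ?c * x)) powr (\<alpha> - 1) * ((r + ?c * x) - r) powr (- \<alpha>))) \<partial>lborel)"
    by (rule nn_integral_real_affine) (use c in auto)
  also have "(\<integral>\<^sup>+x. ennreal (indicator {r<..<t} (r + ?c * x) * ((t - (r + ?c * x)) powr (\<alpha> - 1) * ((r + ?c * x) - r) powr (- \<alpha>))) \<partial>lborel) =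
     (\<integral>\<^sup>+x. ennreal (1 / ?c) * ennreal (indicator {0<..<1} x * (x powr (- \<alpha>) * (1 - x) powr (\<alpha> - 1))) \<partial>lborel)"
  proof (intro nn_integral_cong)
    fix x
    have i: "indicator {r<..<t} (r + ?c * x) = (indicator {0<..<1} x :: real)"
      using c by (auto simp: indicator_def zero_less_mult_iff mult_less_cancel_left_disj
         dest: mult_strict_left_mono[of x 1 ?c] simp: not_less) (smt (verit) mult_le_cancel_left1)+
    show "ennreal (indicator {r<..<t} (r + ?c * x) * ((t - (r + ?c * x)) powr (\<alpha> - 1) * ((r + ?c * x) - r) powr (- \<alpha>))) =
      ennreal (1 / ?c) * ennreal (indicator {0<..<1} x * (x powr (- \<alpha>) * (1 - x) powr (\<alpha> - 1)))"
    proof (cases "x \<in> {0<..<1}")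
      case True
      have "t - (r + ?c * x) = ?c * (1 - x)" by (simp add: algebra_simps)
      moreover have "(?c * (1 - x)) powr (\<alpha> - 1) = ?c powr (\<alpha> - 1) * (1 - x) powr (\<alpha> - 1)"
        "(?c * x) powr (- \<alpha>) = ?c powr (- \<alpha>) * x powr (- \<alpha>)"
        using c True by (auto simp: powr_mult)
      moreover have "?c powr (\<alpha> - 1) * ?c powr (- \<alpha>) = 1 / ?c"
      proof -
        have "?c powr (\<alpha> - 1) * ?c powr (- \<alpha>) = ?c powr (-1)" by (simp flip: powr_add)
        also have "\<dots> = 1 / ?c" using c by (subst powr_minus_divide) auto
        finally show ?thesis .
      qed
      ultimately have "(t - (r + ?c * x)) powr (\<alpha> - 1) * ((r + ?c * x) - r) powr (- \<alpha>) =
          1 / ?c * (x powr (- \<alpha>) * (1 - x) powr (\<alpha> - 1))"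
        by (simp add: mult_ac)
      then show ?thesis using True c by (simp only: i) (simp flip: ennreal_mult')
    qed (simp add: i)
  qed
  also have "\<dots> = ennreal (1 / ?c) * ennreal (Beta \<alpha> (1 - \<alpha>))"
    by (subst nn_integral_cmult) (simp_all add: base)
  finally show ?thesis
    using c by (simp add: ennreal_mult'[symmetric] mult.assoc[symmetric] flip: ennreal_1)
qed

lemma Gamma_complement_pos:
  fixes \<alpha> :: real
  assumes "0 < \<alpha>" "\<alpha> < 1"
  shows "0 < Gamma \<alpha>" "0 < Gamma (1 - \<alpha>)" "Beta \<alpha> (1 - \<alpha>) = Gamma \<alpha> * Gamma (1 - \<alpha>)"
  using assms by (auto intro: Gamma_real_pos simp: Beta_def)

text \<open>Abel: interchange the integrals; the inner one is a Beta integral.\<close>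

lemma abel_inversion:
  fixes y :: "real \<Rightarrow> real"
  assumes \<alpha>: "0 < \<alpha>" "\<alpha> < 1" and t: "0 < t"
    and cont: "continuous_on {0..t} y"
    and diff: "\<And>s. 0 < s \<Longrightarrow> y field_differentiable (at s)"
    and int: "\<And>s. 0 < s \<Longrightarrow> set_integrable lborel {0<..<s} (\<lambda>r. (s - r) powr (- \<alpha>) * deriv y r)"
  shows "(LINT s:{0<..<t}|lborel. (t - s) powr (\<alpha> - 1) * caputo \<alpha> y s) = Gamma \<alpha> * (y t - y 0)"
proof -
  note G = Gamma_complement_pos[OF \<alpha>]
  define T where "T = t + 1"
  define w where "w r = indicator {0<..<T} r * deriv y r" for r
  define k where "k s r = indicator {r<..<t} s * ((t - s) powr (\<alpha> - 1) * (s - r) powr (- \<alpha>))" for s r :: real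
  have T: "0 < T" "t < T" using t by (auto simp: T_def)
  \<comment> \<open>Measurability of the derivative is not given; it is extracted from the Caputo
    integrand by multiplying with the inverse of the kernel.\<close>
  have mw: "w \<in> borel_measurable lborel"
  proof -
    have "(\<lambda>r. indicator {0<..<T} r * ((T - r) powr (- \<alpha>) * deriv y r)) \<in> borel_measurable lborel"
      using int[OF T(1)] unfolding set_integrable_def by (auto dest: borel_measurable_integrable)
    then have "(\<lambda>r. (T - r) powr \<alpha> * (indicator {0<..<T} r * ((T - r) powr (- \<alpha>) * deriv y r))) \<in> borel_measurable lborel"
      by measurable
    also have "(\<lambda>r. (T - r) powr \<alpha> * (indicator {0<..<T} r * ((T - r) powr (- \<alpha>) * deriv y r))) = w"
    proof
      fix r
      have "(T - r) powr \<alpha> * (T - r) powr (- \<alpha>) = 1" if "r < T" using that by (simp flip: powr_add)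
      then show "(T - r) powr \<alpha> * (indicator {0<..<T} r * ((T - r) powr (- \<alpha>) * deriv y r)) = w r"
        by (auto simp: w_def indicator_def mult.assoc[symmetric])
    qed
    finally show ?thesis .
  qed
  have mw': "w \<in> borel_measurable borel" using mw by simp
  \<comment> \<open>On (0, t) the kernel (t - r)^(-\<alpha>) is at least t^(-\<alpha>), so the
    derivative inherits integrability from the Caputo integrand.\<close>
  have iw: "integrable lborel (\<lambda>r. indicator {0<..<t} r * w r)"
  proof (rule Bochner_Integration.integrable_bound)
    show "integrable lborel (\<lambda>r. t powr \<alpha> * (indicator {0<..<t} r *\<^sub>R ((t - r) powr (- \<alpha>) * deriv y r)))"
      using int[OF t] unfolding set_integrable_def by (intro integrable_mult_right)
    show "AE r in lborel. norm (indicator {0<..<t} r * w r) \<le>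
        norm (t powr \<alpha> * (indicator {0<..<t} r *\<^sub>R ((t - r) powr (- \<alpha>) * deriv y r)))"
    proof (intro AE_I2)
      fix r
      have "1 \<le> t powr \<alpha> * (t - r) powr (- \<alpha>)" if "0 < r" "r < t"
      proof -
        have "t powr (- \<alpha>) \<le> (t - r) powr (- \<alpha>)" using that \<alpha> by (intro powr_mono2') auto
        then have "t powr \<alpha> * t powr (- \<alpha>) \<le> t powr \<alpha> * (t - r) powr (- \<alpha>)" by (intro mult_left_mono) auto
        moreover have "t powr \<alpha> * t powr (- \<alpha>) = 1" using t by (simp flip: powr_add)
        ultimately show ?thesis by simp
      qed
      then have "1 * \<bar>deriv y r\<bar> \<le> (t powr \<alpha> * (t - r) powr (- \<alpha>)) * \<bar>deriv y r\<bar>" if "0 < r" "r < t"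
        using that by (intro mult_right_mono) auto
      then show "norm (indicator {0<..<t} r * w r) \<le>
        norm (t powr \<alpha> * (indicator {0<..<t} r *\<^sub>R ((t - r) powr (- \<alpha>) * deriv y r)))"
        using T by (auto simp: w_def indicator_def abs_mult mult.assoc)
    qed
  qed (use mw in measurable)
  have mk: "(\<lambda>(s, r). k s r) \<in> borel_measurable (lborel \<Otimes>\<^sub>M lborel)"
  proof -
    have "(\<lambda>(s, r). k s r) \<in> borel_measurable (borel \<Otimes>\<^sub>M borel)"
      unfolding k_def case_prod_beta indicator_def greaterThanLessThan_iff by measurable
    then show ?thesis
      by (simp add: measurable_cong_sets[OF sets_pair_measure_cong[OF sets_lborel sets_lborel] refl])
  qed
  have mk1: "(\<lambda>s. k s r) \<in> borel_measurable borel" for r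
    unfolding k_def by measurable
  have k0: "0 \<le> k s r" for s r by (simp add: k_def)
  have kint: "(\<integral>\<^sup>+s. ennreal (k s r) \<partial>lborel) = ennreal (Gamma \<alpha> * Gamma (1 - \<alpha>))" if "r < t" for r
    unfolding k_def using beta_integral_subinterval[OF \<alpha> that] G by simp
  define F where "F = (\<lambda>(s, r). k s r * (indicator {0<..<t} r * w r))"
  have mF: "F \<in> borel_measurable (lborel \<Otimes>\<^sub>M lborel)"
    unfolding F_def using mk mw by measurable
  \<comment> \<open>Tonelli: integrating over s first turns the kernel into the constant Gamma
    \<alpha> Gamma (1 - \<alpha>) and leaves the integral of the modulus of the derivative.\<close>
  have intF: "integrable (lborel \<Otimes>\<^sub>M lborel) F"
  proof (rule integrableI_bounded[OF mF])
    have "(\<integral>\<^sup>+x. norm (F x) \<partial>(lborel \<Otimes>\<^sub>M lborel)) = (\<integral>\<^sup>+r. \<integral>\<^sup>+s. norm (F (s, r)) \<partial>lborel \<partial>lborel)"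
      using mF by (subst lborel_pair.nn_integral_snd[symmetric]) (auto)
    also have "\<dots> = (\<integral>\<^sup>+r. ennreal (Gamma \<alpha> * Gamma (1 - \<alpha>)) * ennreal (norm (indicator {0<..<t} r * w r)) \<partial>lborel)"
    proof (intro nn_integral_cong)
      fix r
      have "(\<integral>\<^sup>+s. norm (F (s, r)) \<partial>lborel) = (\<integral>\<^sup>+s. ennreal (k s r) * ennreal (norm (indicator {0<..<t} r * w r)) \<partial>lborel)"
        by (intro nn_integral_cong) (simp add: F_def abs_mult k0 ennreal_mult)
      also have "\<dots> = (\<integral>\<^sup>+s. ennreal (k s r) \<partial>lborel) * ennreal (norm (indicator {0<..<t} r * w r))"
        using mk1 by (intro nn_integral_multc) measurable
      finally show "(\<integral>\<^sup>+s. norm (F (s, r)) \<partial>lborel) =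
         ennreal (Gamma \<alpha> * Gamma (1 - \<alpha>)) * ennreal (norm (indicator {0<..<t} r * w r))"
        by (cases "r < t") (auto simp: kint)
    qed
    also have "\<dots> = ennreal (Gamma \<alpha> * Gamma (1 - \<alpha>)) * (\<integral>\<^sup>+r. ennreal (norm (indicator {0<..<t} r * w r)) \<partial>lborel)"
      using mw' by (intro nn_integral_cmult) measurable
    also have "\<dots> < \<infinity>"
      using iw unfolding integrable_iff_bounded by (auto simp: ennreal_mult_less_top)
    finally show "(\<integral>\<^sup>+x. norm (F x) \<partial>(lborel \<Otimes>\<^sub>M lborel)) < \<infinity>" .
  qed
  have "(LINT s:{0<..<t}|lborel. (t - s) powr (\<alpha> - 1) * caputo \<alpha> y s) =
      (\<integral>s. (\<integral>r. F (s, r) \<partial>lborel) / Gamma (1 - \<alpha>) \<partial>lborel)"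
    unfolding set_lebesgue_integral_def
  proof (intro Bochner_Integration.integral_cong refl)
    fix s
    have "(\<integral>r. F (s, r) \<partial>lborel) =
       (\<integral>r. (indicator {0<..<t} s * (t - s) powr (\<alpha> - 1)) * (indicator {0<..<s} r *\<^sub>R ((s - r) powr (- \<alpha>) * deriv y r)) \<partial>lborel)"
      by (intro Bochner_Integration.integral_cong) (use T in \<open>auto simp: F_def k_def w_def indicator_def\<close>)
    also have "\<dots> = (indicator {0<..<t} s * (t - s) powr (\<alpha> - 1)) * (\<integral>r. indicator {0<..<s} r *\<^sub>R ((s - r) powr (- \<alpha>) * deriv y r) \<partial>lborel)"
      by (rule integral_mult_right_zero)
    finally show "indicator {0<..<t} s *\<^sub>R ((t - s) powr (\<alpha> - 1) * caputo \<alpha> y s) = (\<integral>r. F (s, r) \<partial>lborel) / Gamma (1 - \<alpha>)"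
      by (simp add: caputo_def set_lebesgue_integral_def)
  qed
  also have "\<dots> = (\<integral>s. (\<integral>r. F (s, r) \<partial>lborel) \<partial>lborel) / Gamma (1 - \<alpha>)"
    by simp
  also have "(\<integral>s. (\<integral>r. F (s, r) \<partial>lborel) \<partial>lborel) = (\<integral>r. (\<integral>s. F (s, r) \<partial>lborel) \<partial>lborel)"
    using lborel_pair.Fubini_integral[of "\<lambda>s r. F (s, r)"] intF by simp
  also have "\<dots> = (\<integral>r. Gamma \<alpha> * Gamma (1 - \<alpha>) * (indicator {0<..<t} r * w r) \<partial>lborel)"
  proof (intro Bochner_Integration.integral_cong refl)
    fix r
    have "(\<integral>s. k s r \<partial>lborel) = Gamma \<alpha> * Gamma (1 - \<alpha>)" if "r < t"
      using kint[OF that] k0 G mk1 by (subst integral_eq_nn_integral) auto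
    then show "(\<integral>s. F (s, r) \<partial>lborel) = Gamma \<alpha> * Gamma (1 - \<alpha>) * (indicator {0<..<t} r * w r)"
      unfolding F_def by (cases "r < t") auto
  qed
  also have "\<dots> = Gamma \<alpha> * Gamma (1 - \<alpha>) * (\<integral>r. indicator {0<..<t} r * w r \<partial>lborel)"
    by (rule integral_mult_right_zero)
  \<comment> \<open>The derivative may be unbounded at 0, so the fundamental theorem is used in its
    form for the gauge integral with interior differentiability; by \<open>iw\<close> the Lebesgue
    integral exists, and uniqueness identifies the two.\<close>
  also have "(\<integral>r. indicator {0<..<t} r * w r \<partial>lborel) = y t - y 0"
  proof -
    have "(deriv y has_integral (y t - y 0)) {0..t}"
      using t cont diff
      by (intro fundamental_theorem_of_calculus_interior)
         (auto simp: has_real_derivative_iff_has_vector_derivative[symmetric] DERIV_deriv_iff_field_differentiable)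
    then have "((\<lambda>r. if r \<in> {0<..<t} then deriv y r else 0) has_integral (y t - y 0)) UNIV"
      unfolding has_integral_restrict_UNIV by (simp add: has_integral_Icc_iff_Ioo)
    then have "((\<lambda>r. indicator {0<..<t} r * w r) has_integral (y t - y 0)) UNIV"
      by (rule has_integral_eq[rotated]) (use T in \<open>auto simp: w_def\<close>)
    moreover have "((\<lambda>r. indicator {0<..<t} r * w r) has_integral (\<integral>r. indicator {0<..<t} r * w r \<partial>lborel)) UNIV"
      by (rule has_integral_integral_lborel[OF iw])
    ultimately show ?thesis by (rule has_integral_unique[symmetric])
  qed
  finally show ?thesis using G by simp
qed

section \<open>Error of the exactly solved scheme\<close>

context fractional_order
begin

lemma kernel_integral:
  assumes "0 \<le> a" "a < b" "b \<le> t"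
  shows "((\<lambda>s. (t - s) powr (\<alpha> - 1)) has_integral ((t - a) powr \<alpha> - (t - b) powr \<alpha>) / \<alpha>) {a..b}"
proof -
  have "((\<lambda>s. (t - s) powr (\<alpha> - 1)) has_integral (- ((t - b) powr \<alpha> / \<alpha>) - (- ((t - a) powr \<alpha> / \<alpha>)))) {a..b}"
  proof (rule fundamental_theorem_of_calculus_interior)
    show "continuous_on {a..b} (\<lambda>s. - ((t - s) powr \<alpha> / \<alpha>))"
      using assms order_pos by (intro continuous_intros continuous_on_powr') (auto)
    fix s assume "s \<in> {a<..<b}"
    then have s: "0 < t - s" using assms by auto
    have "((\<lambda>s. - ((t - s) powr \<alpha> / \<alpha>)) has_real_derivative (t - s) powr (\<alpha> - 1)) (at s)"
      using s order_pos by (auto intro!: derivative_eq_intros simp: field_simps powr_diff)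
    then show "((\<lambda>s. - ((t - s) powr \<alpha> / \<alpha>)) has_vector_derivative (t - s) powr (\<alpha> - 1)) (at s)"
      by (simp add: has_real_derivative_iff_has_vector_derivative)
  qed (use assms in auto)
  then show ?thesis by (simp add: diff_divide_distrib)
qed

lemma kernel_absolutely_integrable:
  assumes "0 \<le> a" "a < b" "b \<le> t" "continuous_on {a..b} y"
  shows "(\<lambda>s. (t - s) powr (\<alpha> - 1) * y s) absolutely_integrable_on {a..b}"
proof -
  have k: "(\<lambda>s. (t - s) powr (\<alpha> - 1)) absolutely_integrable_on {a..b}"
    by (rule nonnegative_absolutely_integrable_1)
      (use kernel_integral[OF assms(1-3)] in \<open>auto simp: has_integral_integrable\<close>)
  have "(\<lambda>s. y s * (t - s) powr (\<alpha> - 1)) absolutely_integrable_on {a..b}"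
  proof (rule absolutely_integrable_bounded_measurable_product_real)
    show "y \<in> borel_measurable (lebesgue_on {a..b})"
      using assms(4) by (intro continuous_imp_measurable_on_sets_lebesgue) auto
    show "bounded (y ` {a..b})"
      by (intro compact_imp_bounded compact_continuous_image assms) auto
  qed (use k in auto)
  then show ?thesis by (simp add: mult.commute)
qed

lemma kernel_integral_mono:
  assumes "0 \<le> a" "a < b" "b \<le> t" "continuous_on {a..b} y" "\<And>s. a \<le> s \<Longrightarrow> s \<le> b \<Longrightarrow> \<bar>y s - c\<bar> \<le> e"
  shows "\<bar>integral {a..b} (\<lambda>s. (t - s) powr (\<alpha> - 1) * y s) - ((t - a) powr \<alpha> - (t - b) powr \<alpha>) / \<alpha> * c\<bar> \<le>
    ((t - a) powr \<alpha> - (t - b) powr \<alpha>) / \<alpha> * e"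
proof -
  let ?K = "((t - a) powr \<alpha> - (t - b) powr \<alpha>) / \<alpha>"
  note k = kernel_integral[OF assms(1-3)]
  have y: "((\<lambda>s. (t - s) powr (\<alpha> - 1) * y s) has_integral integral {a..b} (\<lambda>s. (t - s) powr (\<alpha> - 1) * y s)) {a..b}"
    using kernel_absolutely_integrable[OF assms(1-4)]
    by (intro integrable_integral) (simp add: absolutely_integrable_on_def)
  have d: "((\<lambda>s. (t - s) powr (\<alpha> - 1) * y s - (t - s) powr (\<alpha> - 1) * c) has_integral
      integral {a..b} (\<lambda>s. (t - s) powr (\<alpha> - 1) * y s) - ?K * c) {a..b}"
    by (intro has_integral_diff y has_integral_mult_left k)
  have e: "((\<lambda>s. (t - s) powr (\<alpha> - 1) * e) has_integral ?K * e) {a..b}"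
    by (intro has_integral_mult_left k)
  have "norm (integral {a..b} (\<lambda>s. (t - s) powr (\<alpha> - 1) * y s - (t - s) powr (\<alpha> - 1) * c)) \<le>
      integral {a..b} (\<lambda>s. (t - s) powr (\<alpha> - 1) * e)"
  proof (rule integral_norm_bound_integral)
    fix s assume s: "s \<in> {a..b}"
    have "\<bar>(t - s) powr (\<alpha> - 1) * (y s - c)\<bar> \<le> (t - s) powr (\<alpha> - 1) * e"
      using assms(5)[of s] s by (simp add: abs_mult mult_left_mono)
    then show "norm ((t - s) powr (\<alpha> - 1) * y s - (t - s) powr (\<alpha> - 1) * c) \<le> (t - s) powr (\<alpha> - 1) * e"
      by (simp add: right_diff_distrib)
  qed (use d e in \<open>auto simp: has_integral_integrable\<close>)
  then show ?thesis unfolding integral_unique[OF d] integral_unique[OF e] real_norm_def .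
qed

lemma kernel_integral_split:
  assumes \<tau>: "0 < \<tau>" and cont: "continuous_on {0..real n * \<tau>} y"
  shows "integral {0..real n * \<tau>} (\<lambda>s. (real n * \<tau> - s) powr (\<alpha> - 1) * y s) =
    (\<Sum>j=1..n. integral {real (j - 1) * \<tau>..real j * \<tau>} (\<lambda>s. (real n * \<tau> - s) powr (\<alpha> - 1) * y s))"
proof -
  let ?f = "\<lambda>s. (real n * \<tau> - s) powr (\<alpha> - 1) * y s"
  have "m \<le> n \<Longrightarrow> integral {0..real m * \<tau>} ?f = (\<Sum>j=1..m. integral {real (j - 1) * \<tau>..real j * \<tau>} ?f)" for m
  proof (induction m)
    case (Suc m)
    have "?f absolutely_integrable_on {0..real (Suc m) * \<tau>}"
      using \<tau> Suc.prems by (intro kernel_absolutely_integrable continuous_on_subset[OF cont]) (auto simp: mult_right_mono simp del: of_nat_Suc)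
    then have "integral {0..real m * \<tau>} ?f + integral {real m * \<tau>..real (Suc m) * \<tau>} ?f = integral {0..real (Suc m) * \<tau>} ?f"
      using \<tau> by (intro Henstock_Kurzweil_Integration.integral_combine) (auto simp: absolutely_integrable_on_def algebra_simps)
    then show ?case using Suc by simp
  qed simp
  then show ?thesis by simp
qed

lemma kernel_subinterval:
  assumes \<tau>: "0 < \<tau>" and j: "j \<in> {1..n}"
  shows "((real n * \<tau> - real (j - 1) * \<tau>) powr \<alpha> - (real n * \<tau> - real j * \<tau>) powr \<alpha>) / \<alpha> =
    \<tau> powr \<alpha> * Gamma \<alpha> * int_weight (n - j)"
proof -
  have AB: "real n * \<tau> - real (j - 1) * \<tau> = \<tau> * real (Suc (n - j))" "real n * \<tau> - real j * \<tau> = \<tau> * real (n - j)"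
    using j by (auto simp: of_nat_diff algebra_simps)
  have "Gamma \<alpha> \<noteq> 0" using Gamma_order_pos by linarith
  then show ?thesis using \<tau> order_pos
    unfolding AB by (simp add: powr_mult int_weight_def Gamma_order_Suc right_diff_distrib diff_divide_distrib del: of_nat_Suc)
qed

text \<open>Freezing y at the right end of each subinterval produces exactly the weights
  \<open>int_weight\<close>, so what remains is the oscillation of y against a nonnegative
  kernel.\<close>

lemma quadrature_local:
  assumes \<tau>: "0 < \<tau>" and cont: "continuous_on {0..real n * \<tau>} y"
    and osc: "\<And>j s. j \<in> {1..n} \<Longrightarrow> real (j - 1) * \<tau> \<le> s \<Longrightarrow> s \<le> real j * \<tau> \<Longrightarrow> \<bar>y s - y (real j * \<tau>)\<bar> \<le> e j"
  shows "\<bar>integral {0..real n * \<tau>} (\<lambda>s. (real n * \<tau> - s) powr (\<alpha> - 1) * y s) / Gamma \<alpha> -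
      \<tau> powr \<alpha> * (\<Sum>j=1..n. int_weight (n - j) * y (real j * \<tau>))\<bar> \<le>
    \<tau> powr \<alpha> * (\<Sum>j=1..n. int_weight (n - j) * e j)"
proof -
  let ?f = "\<lambda>s. (real n * \<tau> - s) powr (\<alpha> - 1) * y s"
  let ?I = "\<lambda>j. integral {real (j - 1) * \<tau>..real j * \<tau>} ?f"
  have G: "0 < Gamma \<alpha>" by (rule Gamma_order_pos)
  have loc: "\<bar>?I j / Gamma \<alpha> - \<tau> powr \<alpha> * (int_weight (n - j) * y (real j * \<tau>))\<bar> \<le> \<tau> powr \<alpha> * (int_weight (n - j) * e j)"
    if j: "j \<in> {1..n}" for j
  proof -
    have "real j * \<tau> \<le> real n * \<tau>" "real (j - 1) * \<tau> < real j * \<tau>" "0 \<le> real (j - 1) * \<tau>"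
      using j \<tau> by auto
    moreover then have "continuous_on {real (j - 1) * \<tau>..real j * \<tau>} y"
      by (intro continuous_on_subset[OF cont]) auto
    ultimately have "\<bar>?I j - \<tau> powr \<alpha> * Gamma \<alpha> * int_weight (n - j) * y (real j * \<tau>)\<bar> \<le> \<tau> powr \<alpha> * Gamma \<alpha> * int_weight (n - j) * e j"
      unfolding kernel_subinterval[OF \<tau> j, symmetric]
      by (intro kernel_integral_mono osc[OF j]) auto
    then have "\<bar>?I j - \<tau> powr \<alpha> * Gamma \<alpha> * int_weight (n - j) * y (real j * \<tau>)\<bar> / Gamma \<alpha> \<le>
        \<tau> powr \<alpha> * Gamma \<alpha> * int_weight (n - j) * e j / Gamma \<alpha>"
      using G by (intro divide_right_mono) auto
    moreover have "\<bar>?I j - \<tau> powr \<alpha> * Gamma \<alpha> * int_weight (n - j) * y (real j * \<tau>)\<bar> / Gamma \<alpha> =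
       \<bar>(?I j - \<tau> powr \<alpha> * Gamma \<alpha> * int_weight (n - j) * y (real j * \<tau>)) / Gamma \<alpha>\<bar>"
      using G by simp
    ultimately show ?thesis using G by (simp add: diff_divide_distrib mult_ac)
  qed
  define g where "g j = ?I j / Gamma \<alpha> - \<tau> powr \<alpha> * (int_weight (n - j) * y (real j * \<tau>))" for j
  have e: "integral {0..real n * \<tau>} ?f / Gamma \<alpha> - \<tau> powr \<alpha> * (\<Sum>j=1..n. int_weight (n - j) * y (real j * \<tau>)) = sum g {1..n}"
    unfolding kernel_integral_split[OF \<tau> cont] g_def by (simp add: sum_subtractf sum_divide_distrib sum_distrib_left)
  have "\<bar>sum g {1..n}\<bar> \<le> (\<Sum>j=1..n. \<bar>g j\<bar>)" by (rule sum_abs)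
  also have "\<dots> \<le> (\<Sum>j=1..n. \<tau> powr \<alpha> * (int_weight (n - j) * e j))"
    unfolding g_def by (rule sum_mono) (rule loc)
  also have "\<dots> = \<tau> powr \<alpha> * (\<Sum>j=1..n. int_weight (n - j) * e j)"
    by (rule sum_distrib_left[symmetric])
  finally have "\<bar>sum g {1..n}\<bar> \<le> \<tau> powr \<alpha> * (\<Sum>j=1..n. int_weight (n - j) * e j)" .
  then show ?thesis by (simp only: e)
qed

end

section \<open>Consistency and stability for a single mode\<close>

locale volterra = fractional_order +
  fixes lam y0 :: real and y :: "real \<Rightarrow> real"
  assumes lam_pos: "0 < lam"
    and cont: "continuous_on {0..} y"
    and init: "y 0 = y0"
    and eq: "0 < t \<Longrightarrow> y t + lam / Gamma \<alpha> * integral {0..t} (\<lambda>s. (t - s) powr (\<alpha> - 1) * y s) = y0"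
begin

abbreviation mu :: "real \<Rightarrow> real" where "mu \<tau> \<equiv> \<tau> powr \<alpha> * lam"
abbreviation V :: "real \<Rightarrow> nat \<Rightarrow> real" where "V \<tau> n \<equiv> fps_nth (exact_fps (mu \<tau>)) n"

definition err :: "real \<Rightarrow> nat \<Rightarrow> real" where "err \<tau> n = y (real n * \<tau>) - y0 * V \<tau> n"

text \<open>For n \<ge> 1 the subtracted difference is, by \<open>eq\<close>, the eigenvalue times
  the fractional integral of y. So this is a pure quadrature error, in which no derivative of y
  occurs.\<close>

definition quad_err :: "real \<Rightarrow> nat \<Rightarrow> real" where
  "quad_err \<tau> n = mu \<tau> * (\<Sum>j=1..n. fps_nth (resolvent 0) (n - j) * y (real j * \<tau>)) - (y0 - y (real n * \<tau>))"

lemma mu_nonneg: "0 \<le> mu \<tau>" using lam_pos by simp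

text \<open>
  Both \<open>y\<close> and \<open>V\<close> satisfy the convolution equation with kernel \<open>resolvent 0\<close>, whose solution
  operator is \<open>1 - \<mu> * resolvent \<mu>\<close>.
\<close>

lemma err_eq: "err \<tau> n = quad_err \<tau> n - (\<Sum>j=1..n. mu \<tau> * fps_nth (resolvent (mu \<tau>)) (n - j) * quad_err \<tau> j)"
proof -
  define C R where "C = resolvent 0" and "R = resolvent (mu \<tau>)"
  let ?m = "fps_const (mu \<tau>)" and ?k = "fps_const y0"
  have mult_nth': "fps_nth (f * g) n = (\<Sum>j=0..n. fps_nth f (n - j) * fps_nth g j)" for f g :: "real fps" and n
    using fps_mult_nth[of g f n] by (simp only: mult.commute)
  \<comment> \<open>The constant series touches only the coefficient 0, which becomes 0, in
    accordance with the quadrature sum starting at j = 1.\<close>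
  define Y where "Y = Abs_fps (\<lambda>n. y (real n * \<tau>)) - ?k"
  define Q where "Q = Abs_fps (quad_err \<tau>)"
  let ?one = "Abs_fps (\<lambda>_. 1 :: real)"
  have c1: "cq_fps * C = 1" using resolvent_mult[of 0] by (simp add: C_def)
  have c2: "(cq_fps + ?m) * R = 1" unfolding R_def by (rule resolvent_mult[OF mu_nonneg])
  have Q: "Q = ?m * (C * Y) - (?k * ?one - Y - ?k)"
  proof (rule fps_ext)
    fix n
    have Y0: "fps_nth Y 0 = 0" by (simp add: Y_def init)
    have "fps_nth (C * Y) n = (\<Sum>j=0..n. fps_nth C (n - j) * fps_nth Y j)"
      by (rule mult_nth')
    also have "\<dots> = (\<Sum>j=1..n. fps_nth C (n - j) * fps_nth Y j)"
      by (simp add: sum.atLeast_Suc_atMost[of 0 n] Y0)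
    also have "\<dots> = (\<Sum>j=1..n. fps_nth C (n - j) * y (real j * \<tau>))"
      by (intro sum.cong) (auto simp: Y_def)
    finally show "fps_nth Q n = fps_nth (?m * (C * Y) - (?k * ?one - Y - ?k)) n"
      by (cases n) (auto simp: Q_def quad_err_def C_def Y_def init)
  qed
  \<comment> \<open>With b for \<open>cq_fps\<close>, 1 - \<mu> R = b R and 1 + \<mu> C = (b +
    \<mu>) C, and the four factors cancel in pairs.\<close>
  have "(1 - ?m * R) * (1 + ?m * C) = 1"
  proof -
    have "(1 - ?m * R) = cq_fps * R" using c2 by (simp add: algebra_simps)
    moreover have "1 + ?m * C = (cq_fps + ?m) * C" using c1 by (simp add: algebra_simps)
    ultimately have "(1 - ?m * R) * (1 + ?m * C) = (cq_fps * C) * ((cq_fps + ?m) * R)" by (simp add: mult_ac)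
    then show ?thesis by (simp add: c1 c2)
  qed
  then have yf: "Y = (1 - ?m * R) * (Q + ?k * ?one - ?k)"
  proof -
    assume *: "(1 - ?m * R) * (1 + ?m * C) = 1"
    have "Q + ?k * ?one - ?k = (1 + ?m * C) * Y" unfolding Q by (simp add: algebra_simps)
    then have "(1 - ?m * R) * (Q + ?k * ?one - ?k) = ((1 - ?m * R) * (1 + ?m * C)) * Y" by (simp only: mult.assoc)
    then show ?thesis using * by simp
  qed
  have ef: "exact_fps (mu \<tau>) = (1 - ?m * R) * ?one + ?m * R"
  proof -
    have *: "(1 - ?m * R) = cq_fps * R" using c2 by (simp add: algebra_simps)
    show ?thesis unfolding * by (simp add: exact_fps_def R_def algebra_simps)
  qed
  have "(1 - ?m * R) * (Q + ?k * ?one - ?k) + ?k - ?k * ((1 - ?m * R) * ?one + ?m * R) = Q - ?m * (R * Q)"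
    by (simp add: algebra_simps)
  then have "Y + ?k - ?k * exact_fps (mu \<tau>) = Q - ?m * (R * Q)"
    by (simp only: yf[symmetric] ef[symmetric])
  then have "fps_nth (Y + ?k - ?k * exact_fps (mu \<tau>)) n = fps_nth (Q - ?m * (R * Q)) n" by simp
  moreover have "fps_nth (R * Q) n = (\<Sum>j=1..n. fps_nth R (n - j) * quad_err \<tau> j)"
  proof -
    have "fps_nth (R * Q) n = (\<Sum>j=0..n. fps_nth R (n - j) * quad_err \<tau> j)"
      by (simp add: mult_nth' Q_def)
    also have "\<dots> = (\<Sum>j=1..n. fps_nth R (n - j) * quad_err \<tau> j)"
      by (simp add: sum.atLeast_Suc_atMost[of 0 n]) (simp add: quad_err_def init)
    finally show ?thesis .
  qed
  ultimately show ?thesis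
    by (simp add: err_def Y_def Q_def R_def sum_distrib_left mult.assoc)
qed

lemma quad_err_split:
  assumes \<tau>: "0 < \<tau>" and n: "1 \<le> n"
    and osc: "\<And>j s. j \<in> {1..n} \<Longrightarrow> real (j - 1) * \<tau> \<le> s \<Longrightarrow> s \<le> real j * \<tau> \<Longrightarrow> \<bar>y s - y (real j * \<tau>)\<bar> \<le> e j"
  shows "\<bar>quad_err \<tau> n\<bar> \<le> mu \<tau> * (\<bar>\<Sum>j=1..n. (fps_nth (resolvent 0) (n - j) - int_weight (n - j)) * y (real j * \<tau>)\<bar> +
     (\<Sum>j=1..n. int_weight (n - j) * e j))"
proof -
  let ?J = "integral {0..real n * \<tau>} (\<lambda>s. (real n * \<tau> - s) powr (\<alpha> - 1) * y s) / Gamma \<alpha>"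
  let ?A = "\<Sum>j=1..n. fps_nth (resolvent 0) (n - j) * y (real j * \<tau>)"
  let ?B = "\<Sum>j=1..n. int_weight (n - j) * y (real j * \<tau>)"
  let ?D = "\<Sum>j=1..n. (fps_nth (resolvent 0) (n - j) - int_weight (n - j)) * y (real j * \<tau>)"
  have "0 < real n * \<tau>" using \<tau> n by simp
  from eq[OF this] have "y0 - y (real n * \<tau>) = lam * ?J" by simp
  then have "quad_err \<tau> n = mu \<tau> * ?A - lam * ?J" by (simp add: quad_err_def)
  also have "?A = ?D + ?B" by (simp add: left_diff_distrib sum_subtractf)
  also have "mu \<tau> * (?D + ?B) - lam * ?J = mu \<tau> * ?D - lam * (?J - \<tau> powr \<alpha> * ?B)"
    by (simp add: algebra_simps)
  finally have "\<bar>quad_err \<tau> n\<bar> \<le> \<bar>mu \<tau> * ?D\<bar> + \<bar>lam * (?J - \<tau> powr \<alpha> * ?B)\<bar>"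
    by (simp only: abs_triangle_ineq4)
  also have "\<bar>mu \<tau> * ?D\<bar> = mu \<tau> * \<bar>?D\<bar>" using lam_pos by (simp add: abs_mult)
  also have "\<bar>lam * (?J - \<tau> powr \<alpha> * ?B)\<bar> = lam * \<bar>?J - \<tau> powr \<alpha> * ?B\<bar>" using lam_pos by (simp add: abs_mult)
  also have "lam * \<bar>?J - \<tau> powr \<alpha> * ?B\<bar> \<le> lam * (\<tau> powr \<alpha> * (\<Sum>j=1..n. int_weight (n - j) * e j))"
    using lam_pos by (intro mult_left_mono quadrature_local[OF \<tau> continuous_on_subset[OF cont] osc]) auto
  finally show ?thesis by (simp add: algebra_simps)
qed

end

context fractional_order
begin

text \<open>The two summands cover k \<ge> 1 and k = 0 in \<open>int_weight_le\<close>.\<close>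

definition int_const :: real where "int_const = 2 / Gamma \<alpha> + 1 / Gamma (\<alpha> + 1)"

lemma Gamma_order_Suc_pos: "0 < Gamma (\<alpha> + 1)"
  unfolding Gamma_order_Suc by (intro mult_pos_pos order_pos Gamma_order_pos)

lemma int_weight_le: "int_weight k \<le> int_const * real (k + 1) powr (\<alpha> - 1)"
proof (cases "k = 0")
  case True
  then show ?thesis using Gamma_order_pos Gamma_order_Suc_pos by (simp add: int_weight_def int_const_def)
next
  case False
  have "real k powr (\<alpha> - 1) \<le> 2 * real (k + 1) powr (\<alpha> - 1)"
    using False order_pos order_less_1 by (intro half_powr_le) auto
  then have "Gamma \<alpha> * int_weight k \<le> 2 * real (k + 1) powr (\<alpha> - 1)"
    using int_weight_bounds(2)[of k] False by linarith
  then have "int_weight k \<le> 2 / Gamma \<alpha> * real (k + 1) powr (\<alpha> - 1)"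
    using Gamma_order_pos by (simp add: field_simps)
  also have "\<dots> \<le> int_const * real (k + 1) powr (\<alpha> - 1)"
    unfolding int_const_def using Gamma_order_Suc_pos by (intro mult_right_mono) auto
  finally show ?thesis .
qed

text \<open>The 1 and the first \<open>conv_const\<close> are the boundary term and the sum in the
  summation by parts for the weight defect; the last product bounds the oscillation of y.\<close>

definition quad_const :: real where
  "quad_const = (1 + conv_const) / Gamma (\<alpha> + 1) + int_const * conv_const"

text \<open>The two summands of the factor stand for the consistency error itself and for its
  convolution with \<mu> R.\<close>

definition err_const :: real where "err_const = quad_const * (1 + conv_const)"

lemma int_const_pos: "0 < int_const" and quad_const_pos: "0 < quad_const" and err_const_pos: "0 < err_const"
  using Gamma_order_pos Gamma_order_Suc_pos conv_const_pos
  by (auto simp: int_const_def quad_const_def err_const_def intro!: add_pos_pos mult_pos_pos divide_pos_pos)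

lemma sum_by_parts:
  fixes Z y :: "nat \<Rightarrow> real"
  shows "(\<Sum>j=1..n. (Z (n - j + 1) - Z (n - j)) * y j) =
    Z n * y 0 - Z 0 * y n - (\<Sum>j=1..n. Z (n - j + 1) * (y (j - 1) - y j))"
proof -
  define g where "g j = Z (n - j) * y j" for j
  have tel: "(\<Sum>j=1..m. g (j - 1) - g j) = g 0 - g m" for m
    by (induction m) auto
  have "(\<Sum>j=1..n. (Z (n - j + 1) - Z (n - j)) * y j) + (\<Sum>j=1..n. Z (n - j + 1) * (y (j - 1) - y j)) =
      (\<Sum>j=1..n. g (j - 1) - g j)"
    unfolding sum.distrib[symmetric]
  proof (rule sum.cong)
    fix j assume j: "j \<in> {1..n}"
    then have "n - (j - 1) = n - j + 1" by auto
    then show "(Z (n - j + 1) - Z (n - j)) * y j + Z (n - j + 1) * (y (j - 1) - y j) = g (j - 1) - g j"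
      by (simp add: g_def algebra_simps)
  qed simp
  also have "\<dots> = Z n * y 0 - Z 0 * y n" by (subst tel) (simp add: g_def)
  finally show ?thesis by linarith
qed

end

context volterra
begin

text \<open>The coefficients of \<mu> R are nonnegative with sum at most 1, so 1 - \<mu> R has norm
  at most 2 on bounded sequences.\<close>

lemma err_le_quad:
  assumes "\<And>j. j \<in> {1..n} \<Longrightarrow> \<bar>quad_err \<tau> j\<bar> \<le> q" "1 \<le> n"
  shows "\<bar>err \<tau> n\<bar> \<le> 2 * q"
proof -
  have q: "0 \<le> q" using assms(1)[of n] assms(2) by simp
  let ?s = "\<Sum>j=1..n. mu \<tau> * fps_nth (resolvent (mu \<tau>)) (n - j) * quad_err \<tau> j"
  have "\<bar>?s\<bar> \<le> (\<Sum>j=1..n. \<bar>mu \<tau> * fps_nth (resolvent (mu \<tau>)) (n - j) * quad_err \<tau> j\<bar>)"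
    by (rule sum_abs)
  also have "\<dots> \<le> (\<Sum>j=1..n. mu \<tau> * fps_nth (resolvent (mu \<tau>)) (n - j) * q)"
  proof (rule sum_mono)
    fix j assume "j \<in> {1..n}"
    then show "\<bar>mu \<tau> * fps_nth (resolvent (mu \<tau>)) (n - j) * quad_err \<tau> j\<bar> \<le> mu \<tau> * fps_nth (resolvent (mu \<tau>)) (n - j) * q"
      unfolding abs_mult using lam_pos assms(1)[of j] resolvent_nonneg[OF mu_nonneg]
      by (intro mult_mono) (auto simp: resolvent_nonneg)
  qed
  also have "\<dots> = (\<Sum>j=1..n. mu \<tau> * fps_nth (resolvent (mu \<tau>)) (n - j)) * q"
    by (rule sum_distrib_right[symmetric])
  also have "(\<Sum>j=1..n. mu \<tau> * fps_nth (resolvent (mu \<tau>)) (n - j)) = (\<Sum>k<n. mu \<tau> * fps_nth (resolvent (mu \<tau>)) k)"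
    by (rule sum.reindex_bij_witness[of _ "\<lambda>k. n - k" "\<lambda>j. n - j"]) auto
  also have "\<dots> * q \<le> 1 * q"
    using q resolvent_sum_le[OF mu_nonneg] by (intro mult_right_mono)
  finally have "\<bar>?s\<bar> \<le> q" by simp
  moreover have "\<bar>quad_err \<tau> n\<bar> \<le> q" using assms by auto
  ultimately show ?thesis using err_eq[of \<tau> n] by linarith
qed

text \<open>Convergence without a rate, from uniform continuity of y. The grid is refined such that
  n * Suc m steps of size \<tau> / Suc m end at the same time; the purpose is to carry qualitative
  properties of V over to y.\<close>

lemma V_tendsto_pos:
  assumes \<tau>: "0 < \<tau>" and n: "1 \<le> n"
  shows "(\<lambda>m. y0 * V (\<tau> / real (Suc m)) (n * Suc m)) \<longlonglongrightarrow> y (real n * \<tau>)"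
proof -
  define T where "T = real n * \<tau>"
  have T: "0 < T" using \<tau> n by (simp add: T_def)
  have contT: "continuous_on {0..T} y" by (rule continuous_on_subset[OF cont]) auto
  then obtain B where "\<forall>x\<in>y ` {0..T}. norm x \<le> B"
    using compact_imp_bounded[OF compact_continuous_image[OF contT compact_Icc]] unfolding bounded_iff by blast
  then have B: "\<And>s. s \<in> {0..T} \<Longrightarrow> \<bar>y s\<bar> \<le> B" by auto
  have B0: "0 \<le> B" using B[of 0] T by auto
  have uc: "uniformly_continuous_on {0..T} y"
    using contT by (rule compact_uniformly_continuous) auto
  define K where "K = 1 + int_weight 0 + 1 / Gamma \<alpha>"
  define C2 where "C2 = lam * T powr \<alpha> / Gamma (\<alpha> + 1)"
  have C2: "0 \<le> C2" using lam_pos Gamma_order_Suc_pos by (simp add: C2_def)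
  have "(\<lambda>m. err (\<tau> / real (Suc m)) (n * Suc m)) \<longlonglongrightarrow> 0"
  proof (rule tendstoI)
    fix r :: real assume r: "0 < r"
    \<comment> \<open>The oscillation and the weight defect are each to contribute less than r / 4,
      and \<open>err_le_quad\<close> doubles their sum.\<close>
    define \<epsilon> where "\<epsilon> = r / (4 * (C2 + 1))"
    have \<epsilon>: "0 < \<epsilon>" using r C2 by (simp add: \<epsilon>_def)
    have C2\<epsilon>: "C2 * \<epsilon> < r / 4" using r C2 by (simp add: \<epsilon>_def field_simps)
    obtain d where d: "0 < d" "\<And>s s'. s \<in> {0..T} \<Longrightarrow> s' \<in> {0..T} \<Longrightarrow> dist s' s < d \<Longrightarrow> dist (y s') (y s) < \<epsilon>"
      using uc \<epsilon> unfolding uniformly_continuous_on_def by metis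
    have lim: "(\<lambda>m. \<tau> / real (Suc m)) \<longlonglongrightarrow> 0"
      using LIMSEQ_Suc[OF lim_const_over_n[of \<tau>]] by simp
    \<comment> \<open>The absolute sums of the weight differences are bounded, so this part of the
      error carries a bare power \<alpha> of the step size.\<close>
    have "(\<lambda>m. (\<tau> / real (Suc m)) powr \<alpha>) \<longlonglongrightarrow> 0"
      using \<tau> order_pos by (intro tendsto_zero_powrI[OF lim tendsto_const]) auto
    then have "(\<lambda>m. lam * (B * K) * (\<tau> / real (Suc m)) powr \<alpha>) \<longlonglongrightarrow> lam * (B * K) * 0"
      by (intro tendsto_mult tendsto_const)
    then have "eventually (\<lambda>m. lam * (B * K) * (\<tau> / real (Suc m)) powr \<alpha> < r / 4) sequentially"
      using r by (intro order_tendstoD(2)) auto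
    moreover have "eventually (\<lambda>m. \<tau> / real (Suc m) < d) sequentially"
      using order_tendstoD(2)[OF lim d(1)] .
    ultimately show "eventually (\<lambda>m. dist (err (\<tau> / real (Suc m)) (n * Suc m)) 0 < r) sequentially"
    proof eventually_elim
      case (elim m)
      define h where "h = \<tau> / real (Suc m)"
      have h: "0 < h" "h < d" using \<tau> elim by (auto simp: h_def)
      have nh: "real (n * Suc m) * h = T" unfolding h_def T_def of_nat_mult by (simp del: of_nat_Suc)
      have "\<bar>quad_err h k\<bar> \<le> lam * (B * K) * h powr \<alpha> + C2 * \<epsilon>" if k: "k \<in> {1..n * Suc m}" for k
      proof -
        have kT: "real j * h \<le> T" if "j \<le> k" for j
        proof -
          have "j \<le> n * Suc m" using that k by simp
          then have "real j * h \<le> real (n * Suc m) * h" using h by (intro mult_right_mono) (simp_all only: of_nat_le_iff)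
          then show ?thesis by (simp only: nh)
        qed
        have "\<bar>quad_err h k\<bar> \<le> mu h * (\<bar>\<Sum>j=1..k. (fps_nth (resolvent 0) (k - j) - int_weight (k - j)) * y (real j * h)\<bar> +
          (\<Sum>j=1..k. int_weight (k - j) * \<epsilon>))"
        proof (rule quad_err_split[OF h(1)])
          fix j s assume j: "j \<in> {1..k}" and s: "real (j - 1) * h \<le> s" "s \<le> real j * h"
          have "0 \<le> real (j - 1) * h" using h by simp
          then have "0 \<le> s" using s by linarith
          moreover have "s \<le> T" "real j * h \<le> T" "0 \<le> real j * h"
            using s kT[of j] j h by auto
          moreover have "dist s (real j * h) < d"
            using s j h by (auto simp: dist_real_def of_nat_diff algebra_simps)
          ultimately show "\<bar>y s - y (real j * h)\<bar> \<le> \<epsilon>"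
            using d(2)[of "real j * h" s] by (auto simp: dist_real_def)
        qed (use k in auto)
        also have "\<bar>\<Sum>j=1..k. (fps_nth (resolvent 0) (k - j) - int_weight (k - j)) * y (real j * h)\<bar> \<le> B * K"
        proof -
          have "\<bar>\<Sum>j=1..k. (fps_nth (resolvent 0) (k - j) - int_weight (k - j)) * y (real j * h)\<bar> \<le>
             (\<Sum>j=1..k. \<bar>(fps_nth (resolvent 0) (k - j) - int_weight (k - j)) * y (real j * h)\<bar>)"
            by (rule sum_abs)
          also have "\<dots> \<le> (\<Sum>j=1..k. \<bar>fps_nth (resolvent 0) (k - j) - int_weight (k - j)\<bar> * B)"
          proof (rule sum_mono)
            fix j assume "j \<in> {1..k}"
            then show "\<bar>(fps_nth (resolvent 0) (k - j) - int_weight (k - j)) * y (real j * h)\<bar> \<le>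
               \<bar>fps_nth (resolvent 0) (k - j) - int_weight (k - j)\<bar> * B"
              unfolding abs_mult using h kT by (intro mult_left_mono B) auto
          qed
          also have "\<dots> = (\<Sum>j=1..k. \<bar>fps_nth (resolvent 0) (k - j) - int_weight (k - j)\<bar>) * B"
            by (rule sum_distrib_right[symmetric])
          also have "(\<Sum>j=1..k. \<bar>fps_nth (resolvent 0) (k - j) - int_weight (k - j)\<bar>) =
              (\<Sum>i<k. \<bar>fps_nth (resolvent 0) i - int_weight i\<bar>)"
            by (rule sum.reindex_bij_witness[of _ "\<lambda>i. k - i" "\<lambda>j. k - j"]) auto
          also have "\<dots> * B \<le> K * B"
            unfolding K_def using B0 by (intro mult_right_mono weight_defect_abs_sum)
          finally show ?thesis by (simp add: mult.commute)
        qed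
        also have "(\<Sum>j=1..k. int_weight (k - j) * \<epsilon>) = real k powr \<alpha> / Gamma (\<alpha> + 1) * \<epsilon>"
        proof -
          have "(\<Sum>j=1..k. int_weight (k - j)) = (\<Sum>i<k. int_weight i)"
            by (rule sum.reindex_bij_witness[of _ "\<lambda>i. k - i" "\<lambda>j. k - j"]) auto
          then show ?thesis by (simp add: sum_distrib_right[symmetric] sum_int_weight)
        qed
        finally have "\<bar>quad_err h k\<bar> \<le> mu h * (B * K + real k powr \<alpha> / Gamma (\<alpha> + 1) * \<epsilon>)"
          using mu_nonneg by (simp add: mult_left_mono)
        also have "\<dots> = lam * (B * K) * h powr \<alpha> + lam * ((real k * h) powr \<alpha>) / Gamma (\<alpha> + 1) * \<epsilon>"
          using h by (simp add: powr_mult algebra_simps)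
        also have "\<dots> \<le> lam * (B * K) * h powr \<alpha> + C2 * \<epsilon>"
          unfolding C2_def using h kT[of k] lam_pos \<epsilon> Gamma_order_Suc_pos order_pos
          by (intro add_left_mono mult_right_mono divide_right_mono mult_left_mono powr_mono2) auto
        finally show ?thesis .
      qed
      then have "\<bar>err h (n * Suc m)\<bar> \<le> 2 * (lam * (B * K) * h powr \<alpha> + C2 * \<epsilon>)"
        using n by (intro err_le_quad) auto
      also have "lam * (B * K) * h powr \<alpha> + C2 * \<epsilon> < r / 4 + r / 4"
        unfolding h_def by (intro add_strict_mono elim(1) C2\<epsilon>)
      then have "2 * (lam * (B * K) * h powr \<alpha> + C2 * \<epsilon>) < r" by simp
      finally show ?case by (simp add: h_def)
    qed
  qed
  then have "(\<lambda>m. y (real n * \<tau>) - err (\<tau> / real (Suc m)) (n * Suc m)) \<longlonglongrightarrow> y (real n * \<tau>) - 0"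
    by (intro tendsto_diff tendsto_const)
  moreover have "y (real n * \<tau>) - err (\<tau> / real (Suc m)) (n * Suc m) = y0 * V (\<tau> / real (Suc m)) (n * Suc m)" for m
  proof -
    have "real (n * Suc m) * (\<tau> / real (Suc m)) = real n * \<tau>"
      unfolding of_nat_mult by (simp del: of_nat_Suc)
    then show ?thesis by (simp add: err_def)
  qed
  ultimately show ?thesis by simp
qed

lemma V_tendsto:
  assumes \<tau>: "0 < \<tau>"
  shows "(\<lambda>m. y0 * V (\<tau> / real (Suc m)) (n * Suc m)) \<longlonglongrightarrow> y (real n * \<tau>)"
proof (cases "n = 0")
  case True
  then show ?thesis by (simp add: init exact_fps_0[OF mu_nonneg])
next
  case False
  then show ?thesis using V_tendsto_pos[OF \<tau>, of n] by simp
qed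

end

section \<open>Monotonicity of the exact solution and the rate of convergence\<close>

locale volterra_unit = volterra \<alpha> lam 1 y for \<alpha> lam y
begin

lemma V_tendsto_unit: "0 < \<tau> \<Longrightarrow> (\<lambda>m. V (\<tau> / real (Suc m)) (n * Suc m)) \<longlonglongrightarrow> y (real n * \<tau>)"
  using V_tendsto[of \<tau> n] by simp

lemma V_diff: "j \<le> k \<Longrightarrow> V \<tau> j - V \<tau> k = (\<Sum>i=j..<k. mu \<tau> * fps_nth (resolvent (mu \<tau>)) i)"
proof (induction k rule: dec_induct)
  case (step k)
  then show ?case using exact_fps_step[OF mu_nonneg, of \<tau> k] by simp
qed simp

text \<open>As a limit of the discrete solutions the exact one inherits their monotonicity.\<close>

lemma y_grid_antimono:
  assumes "0 < \<tau>" "j \<le> k"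
  shows "y (real k * \<tau>) \<le> y (real j * \<tau>)"
proof (rule LIMSEQ_le[OF V_tendsto_unit[OF assms(1)] V_tendsto_unit[OF assms(1)]])
  have "V h (k * Suc m) \<le> V h (j * Suc m)" for h m
  proof -
    have "0 \<le> V h (j * Suc m) - V h (k * Suc m)"
      unfolding V_diff[OF mult_le_mono1[OF assms(2)]]
      by (intro sum_nonneg mult_nonneg_nonneg[OF mu_nonneg resolvent_nonneg[OF mu_nonneg]])
    then show ?thesis by simp
  qed
  then show "\<exists>N. \<forall>m\<ge>N. V (\<tau> / real (Suc m)) (k * Suc m) \<le> V (\<tau> / real (Suc m)) (j * Suc m)" by blast
qed

lemma y_nonneg: "0 \<le> t \<Longrightarrow> 0 \<le> y t"
proof (cases "t = 0")
  case False
  assume "0 \<le> t"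
  with False have t: "0 < t" by simp
  have "0 \<le> y (real 1 * t)"
    by (rule LIMSEQ_le_const[OF V_tendsto_unit[OF t]]) (auto intro!: exact_fps_nonneg mu_nonneg)
  then show ?thesis by simp
qed (simp add: init)

lemma y_antimono:
  assumes "0 \<le> s" "s \<le> t"
  shows "y t \<le> y s"
proof (cases "t = 0")
  case False
  then have t: "0 < t" using assms by simp
  \<comment> \<open>The largest multiple of t / Suc m not exceeding s. As t is a multiple too,
    monotonicity on the grid compares \<open>y t\<close> with \<open>y (p m)\<close>, and continuity
    gives \<open>y s\<close> in the limit.\<close>
  define p where "p m = real (nat \<lfloor>s * real (Suc m) / t\<rfloor>) * (t / real (Suc m))" for m
  have p: "s - t / real (Suc m) \<le> p m" "p m \<le> s" "0 \<le> p m" for m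
  proof -
    define x where "x = s * real (Suc m) / t"
    have x: "0 \<le> x" using assms t by (simp add: x_def)
    have "real (nat \<lfloor>x\<rfloor>) \<le> x" "x - 1 \<le> real (nat \<lfloor>x\<rfloor>)" using x by linarith+
    then have "real (nat \<lfloor>x\<rfloor>) * (t / real (Suc m)) \<le> x * (t / real (Suc m))"
      "(x - 1) * (t / real (Suc m)) \<le> real (nat \<lfloor>x\<rfloor>) * (t / real (Suc m))"
      using t by (intro mult_right_mono; simp)+
    moreover have "x * (t / real (Suc m)) = s" using t by (simp add: x_def)
    ultimately show "s - t / real (Suc m) \<le> p m" "p m \<le> s" "0 \<le> p m"
      using t by (auto simp: p_def x_def[symmetric] left_diff_distrib diff_divide_distrib)
  qed
  have "p \<longlonglongrightarrow> s"
  proof (rule tendsto_sandwich[where f = "\<lambda>m. s - t / real (Suc m)" and h = "\<lambda>_. s"])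
    have "(\<lambda>m. s - t / real (Suc m)) \<longlonglongrightarrow> s - 0"
      by (intro tendsto_diff tendsto_const LIMSEQ_Suc[OF lim_const_over_n[of t]])
    then show "(\<lambda>m. s - t / real (Suc m)) \<longlonglongrightarrow> s" by simp
  qed (use p in \<open>auto intro!: always_eventually\<close>)
  then have "(\<lambda>m. y (p m)) \<longlonglongrightarrow> y s"
    by (rule continuous_on_tendsto_compose[OF cont]) (use assms p in \<open>auto intro!: always_eventually\<close>)
  moreover have "y t \<le> y (p m)" for m
  proof -
    have "nat \<lfloor>s * real (Suc m) / t\<rfloor> \<le> Suc m"
    proof -
      have "s * real (Suc m) / t \<le> real (Suc m)" using assms t by (simp add: field_simps mult_right_mono del: of_nat_Suc)
      then show ?thesis by linarith
    qed
    then have "y (real (Suc m) * (t / real (Suc m))) \<le> y (p m)"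
      unfolding p_def using t by (intro y_grid_antimono) auto
    then show ?thesis by (simp del: of_nat_Suc)
  qed
  ultimately show ?thesis by (intro LIMSEQ_le_const) auto
qed (use assms in auto)

text \<open>On the refined grid the decrement consists of Suc m coefficients of \<mu> R, each at
  most 1 / ((j - 1) Suc m), so the refinement cancels and the bound survives the limit. The case j =
  1 follows from the values of y in [0, 1], and 1 / (j - 1) \<le> 2 / j otherwise.\<close>

lemma y_decrement:
  assumes \<tau>: "0 < \<tau>" and j: "1 \<le> j"
  shows "y (real (j - 1) * \<tau>) - y (real j * \<tau>) \<le> 2 / real j"
proof (cases "j = 1")
  case True
  then show ?thesis using init y_nonneg[of \<tau>] \<tau> by simp
next
  case False
  then have j2: "2 \<le> j" using j by simp
  have "y (real (j - 1) * \<tau>) - y (real j * \<tau>) \<le> 1 / real (j - 1)"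
  proof (rule LIMSEQ_le_const2[OF tendsto_diff[OF V_tendsto_unit[OF \<tau>] V_tendsto_unit[OF \<tau>]]])
    have "V h ((j - 1) * Suc m) - V h (j * Suc m) \<le> 1 / real (j - 1)" for h m
    proof -
      have "V h ((j - 1) * Suc m) - V h (j * Suc m) = (\<Sum>i=(j - 1) * Suc m..<j * Suc m. mu h * fps_nth (resolvent (mu h)) i)"
        by (rule V_diff[OF mult_le_mono1]) simp
      also have "\<dots> \<le> (\<Sum>i=(j - 1) * Suc m..<j * Suc m. 1 / (real (j - 1) * real (Suc m)))"
      proof (rule sum_mono)
        fix i assume i: "i \<in> {(j - 1) * Suc m..<j * Suc m}"
        have "real ((j - 1) * Suc m) \<le> real (Suc i)" using i by (simp only: of_nat_le_iff) auto
        then have le: "real (j - 1) * real (Suc m) \<le> real (Suc i)" by (simp only: of_nat_mult)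
        have pos: "0 < real (j - 1) * real (Suc m)" using j2 by simp
        have "mu h * fps_nth (resolvent (mu h)) i \<le> 1 / real (Suc i)"
          by (rule resolvent_le_inverse[OF mu_nonneg])
        also have "\<dots> \<le> 1 / (real (j - 1) * real (Suc m))"
          by (rule frac_le[OF _ _ pos le]) auto
        finally show "mu h * fps_nth (resolvent (mu h)) i \<le> 1 / (real (j - 1) * real (Suc m))" .
      qed
      also have "\<dots> = real (j * Suc m - (j - 1) * Suc m) * (1 / (real (j - 1) * real (Suc m)))"
        by simp
      also have "j * Suc m - (j - 1) * Suc m = Suc m"
        using j by (cases j) auto
      also have "real (Suc m) * (1 / (real (j - 1) * real (Suc m))) = 1 / real (j - 1)"
        by (simp del: of_nat_Suc)
      finally show ?thesis .
    qed
    then show "\<exists>N. \<forall>m\<ge>N. V (\<tau> / real (Suc m)) ((j - 1) * Suc m) - V (\<tau> / real (Suc m)) (j * Suc m) \<le> 1 / real (j - 1)"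
      by blast
  qed
  also have "\<dots> \<le> 2 / real j" using j2 by (simp add: field_simps of_nat_diff)
  finally show ?thesis .
qed

text \<open>Both contributions become convolutions of (n - j + 1)^(\<alpha> - 1) with the decrements
  of y: the weight defect through summation by parts, the oscillation directly since y is monotone.
  The decrements are nonnegative, have sum at most 1 and stay below 2 / j, as
  \<open>powr1_convolution_le\<close> requires.\<close>

lemma quad_err_bound:
  assumes \<tau>: "0 < \<tau>" and n: "1 \<le> n"
  shows "\<bar>quad_err \<tau> n\<bar> \<le> quad_const * mu \<tau> * real n powr (\<alpha> - 1)"
proof -
  define Y where "Y j = y (real j * \<tau>)" for j
  define d where "d j = Y (j - 1) - Y j" for j
  have d0: "0 \<le> d j" for j
    unfolding d_def Y_def using y_grid_antimono[OF \<tau>, of "j - 1" j] by simp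
  have ds: "(\<Sum>j=1..n. d j) \<le> 1"
  proof -
    have "(\<Sum>j=1..m. d j) = Y 0 - Y m" for m
      by (induction m) (auto simp: d_def)
    then show ?thesis using y_nonneg[of "real n * \<tau>"] \<tau> init by (simp add: Y_def)
  qed
  have conv: "(\<Sum>j=1..n. real (n - j + 1) powr (\<alpha> - 1) * d j) \<le> conv_const * real n powr (\<alpha> - 1)"
    using y_decrement[OF \<tau>] by (intro powr1_convolution_le n d0 ds) (auto simp: d_def Y_def)
  have Z: "\<bar>weight_defect m\<bar> \<le> real m powr (\<alpha> - 1) / Gamma (\<alpha> + 1)" if "1 \<le> m" for m
    by (rule weight_defect_bound[OF that])
  have A: "\<bar>\<Sum>j=1..n. (fps_nth (resolvent 0) (n - j) - int_weight (n - j)) * Y j\<bar> \<le>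
      (1 + conv_const) / Gamma (\<alpha> + 1) * real n powr (\<alpha> - 1)"
  proof -
    have "(\<Sum>j=1..n. (fps_nth (resolvent 0) (n - j) - int_weight (n - j)) * Y j) =
        (\<Sum>j=1..n. (weight_defect (n - j + 1) - weight_defect (n - j)) * Y j)"
      by (intro sum.cong) (auto simp: weight_defect_def)
    \<comment> \<open>The boundary terms reduce to the defect at n because y starts at 1 and the
      defect at 0 is an empty sum.\<close>
    also have "\<dots> = weight_defect n - (\<Sum>j=1..n. weight_defect (n - j + 1) * d j)"
      by (subst sum_by_parts) (simp add: d_def Y_def init weight_defect_def)
    also have "\<bar>weight_defect n - (\<Sum>j=1..n. weight_defect (n - j + 1) * d j)\<bar> \<le>
        \<bar>weight_defect n\<bar> + \<bar>\<Sum>j=1..n. weight_defect (n - j + 1) * d j\<bar>"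
      by (rule abs_triangle_ineq4)
    also have "\<bar>\<Sum>j=1..n. weight_defect (n - j + 1) * d j\<bar> \<le> (\<Sum>j=1..n. \<bar>weight_defect (n - j + 1) * d j\<bar>)"
      by (rule sum_abs)
    also have "\<dots> \<le> (\<Sum>j=1..n. 1 / Gamma (\<alpha> + 1) * (real (n - j + 1) powr (\<alpha> - 1) * d j))"
    proof (rule sum_mono)
      fix j
      have "\<bar>weight_defect (n - j + 1)\<bar> * d j \<le> real (n - j + 1) powr (\<alpha> - 1) / Gamma (\<alpha> + 1) * d j"
        using d0 by (intro mult_right_mono Z) auto
      then show "\<bar>weight_defect (n - j + 1) * d j\<bar> \<le> 1 / Gamma (\<alpha> + 1) * (real (n - j + 1) powr (\<alpha> - 1) * d j)"
        using d0 by (simp add: abs_mult)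
    qed
    also have "\<dots> = 1 / Gamma (\<alpha> + 1) * (\<Sum>j=1..n. real (n - j + 1) powr (\<alpha> - 1) * d j)"
      by (rule sum_distrib_left[symmetric])
    also have "\<dots> \<le> 1 / Gamma (\<alpha> + 1) * (conv_const * real n powr (\<alpha> - 1))"
      using conv Gamma_order_Suc_pos by (intro mult_left_mono) auto
    finally show ?thesis using Z[OF n] by (simp add: add_divide_distrib algebra_simps)
  qed
  have B: "(\<Sum>j=1..n. int_weight (n - j) * d j) \<le> int_const * conv_const * real n powr (\<alpha> - 1)"
  proof -
    have "(\<Sum>j=1..n. int_weight (n - j) * d j) \<le> (\<Sum>j=1..n. int_const * (real (n - j + 1) powr (\<alpha> - 1) * d j))"
    proof (rule sum_mono)
      fix j
      show "int_weight (n - j) * d j \<le> int_const * (real (n - j + 1) powr (\<alpha> - 1) * d j)"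
        using mult_right_mono[OF int_weight_le d0[of j], of "n - j"] by (simp only: mult.assoc)
    qed
    also have "\<dots> = int_const * (\<Sum>j=1..n. real (n - j + 1) powr (\<alpha> - 1) * d j)"
      by (rule sum_distrib_left[symmetric])
    also have "\<dots> \<le> int_const * (conv_const * real n powr (\<alpha> - 1))"
      using conv int_const_pos by (intro mult_left_mono) auto
    finally show ?thesis by (simp only: mult.assoc)
  qed
  have "\<bar>quad_err \<tau> n\<bar> \<le> mu \<tau> * (\<bar>\<Sum>j=1..n. (fps_nth (resolvent 0) (n - j) - int_weight (n - j)) * Y j\<bar> +
     (\<Sum>j=1..n. int_weight (n - j) * d j))"
    unfolding Y_def
  proof (rule quad_err_split[OF \<tau> n])
    fix j s assume j: "j \<in> {1..n}" and s: "real (j - 1) * \<tau> \<le> s" "s \<le> real j * \<tau>"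
    have "0 \<le> real (j - 1) * \<tau>" using \<tau> by simp
    then have "y (real j * \<tau>) \<le> y s" "y s \<le> y (real (j - 1) * \<tau>)"
      using s by (auto intro!: y_antimono)
    then show "\<bar>y s - y (real j * \<tau>)\<bar> \<le> d j" by (simp add: d_def Y_def)
  qed
  also have "\<dots> \<le> mu \<tau> * ((1 + conv_const) / Gamma (\<alpha> + 1) * real n powr (\<alpha> - 1) + int_const * conv_const * real n powr (\<alpha> - 1))"
    using A B by (intro mult_left_mono add_mono mu_nonneg)
  finally show ?thesis by (simp add: quad_const_def algebra_simps)
qed

text \<open>The factor \<open>mu \<tau>\<close> is kept outside: it is the one power of the
  eigenvalue that the norm of \<open>A\<^sub>h v\<^sub>h\<close> pays for. Propagation by \<mu> R
  costs a constant that does not depend on it.\<close>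

lemma err_bound:
  assumes \<tau>: "0 < \<tau>" and n: "1 \<le> n"
  shows "\<bar>err \<tau> n\<bar> \<le> err_const * mu \<tau> * real n powr (\<alpha> - 1)"
proof -
  let ?E = "fps_nth (resolvent (mu \<tau>))"
  let ?c = "quad_const * mu \<tau>"
  have c: "0 \<le> ?c" by (rule mult_nonneg_nonneg[OF less_imp_le[OF quad_const_pos] mu_nonneg])
  have "\<bar>\<Sum>j=1..n. mu \<tau> * ?E (n - j) * quad_err \<tau> j\<bar> \<le> (\<Sum>j=1..n. \<bar>mu \<tau> * ?E (n - j) * quad_err \<tau> j\<bar>)"
    by (rule sum_abs)
  also have "\<dots> \<le> (\<Sum>j=1..n. ?c * (real j powr (\<alpha> - 1) * (mu \<tau> * ?E (n - j))))"
  proof (rule sum_mono)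
    fix j assume j: "j \<in> {1..n}"
    have E: "0 \<le> mu \<tau> * ?E (n - j)" by (rule mult_nonneg_nonneg[OF mu_nonneg resolvent_nonneg[OF mu_nonneg]])
    have "\<bar>mu \<tau> * ?E (n - j) * quad_err \<tau> j\<bar> = (mu \<tau> * ?E (n - j)) * \<bar>quad_err \<tau> j\<bar>"
      by (subst abs_mult) (simp only: abs_of_nonneg[OF E])
    also have "\<dots> \<le> (mu \<tau> * ?E (n - j)) * (?c * real j powr (\<alpha> - 1))"
      using j by (intro mult_left_mono E quad_err_bound[OF \<tau>]) auto
    finally show "\<bar>mu \<tau> * ?E (n - j) * quad_err \<tau> j\<bar> \<le> ?c * (real j powr (\<alpha> - 1) * (mu \<tau> * ?E (n - j)))"
      by (simp only: mult_ac)
  qed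
  also have "\<dots> = ?c * (\<Sum>j=1..n. real j powr (\<alpha> - 1) * (mu \<tau> * ?E (n - j)))"
    by (rule sum_distrib_left[symmetric])
  also have "(\<Sum>j=1..n. real j powr (\<alpha> - 1) * (mu \<tau> * ?E (n - j))) =
      (\<Sum>j=1..n. real (n - j + 1) powr (\<alpha> - 1) * (mu \<tau> * ?E (j - 1)))"
    by (rule sum.reindex_bij_witness[of _ "\<lambda>k. n - k + 1" "\<lambda>k. n - k + 1"]) auto
  also have "?c * (\<Sum>j=1..n. real (n - j + 1) powr (\<alpha> - 1) * (mu \<tau> * ?E (j - 1))) \<le> ?c * (conv_const * real n powr (\<alpha> - 1))"
    by (intro mult_left_mono c resolvent_conv_bound mu_nonneg)
  finally have "\<bar>\<Sum>j=1..n. mu \<tau> * ?E (n - j) * quad_err \<tau> j\<bar> \<le> ?c * (conv_const * real n powr (\<alpha> - 1))" .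
  then have "\<bar>err \<tau> n\<bar> \<le> ?c * real n powr (\<alpha> - 1) + ?c * (conv_const * real n powr (\<alpha> - 1))"
    using quad_err_bound[OF \<tau> n] unfolding err_eq[of \<tau> n] by linarith
  then show ?thesis by (simp add: err_const_def algebra_simps)
qed

end

context volterra
begin

text \<open>Scaling to initial value 1, where the sign and monotonicity statements apply. For
  \<open>y0 = 0\<close> one cannot divide, but then y is a limit of zero sequences.\<close>

lemma solution_err_bound:
  assumes \<tau>: "0 < \<tau>" and n: "1 \<le> n"
  shows "\<bar>y (real n * \<tau>) - y0 * V \<tau> n\<bar> \<le> err_const * mu \<tau> * real n powr (\<alpha> - 1) * \<bar>y0\<bar>"
proof (cases "y0 = 0")
  case True
  then have "y (real n * \<tau>) = 0"
    using V_tendsto[OF \<tau>, of n] by (simp add: LIMSEQ_const_iff)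
  then show ?thesis using True by simp
next
  case False
  interpret unit: volterra_unit \<alpha> lam "\<lambda>t. y t / y0"
  proof unfold_locales
    fix t :: real assume "0 < t"
    have "integral {0..t} (\<lambda>s. (t - s) powr (\<alpha> - 1) * (y s / y0)) =
        integral {0..t} (\<lambda>s. (t - s) powr (\<alpha> - 1) * y s) / y0"
      by simp
    then show "y t / y0 + lam / Gamma \<alpha> * integral {0..t} (\<lambda>s. (t - s) powr (\<alpha> - 1) * (y s / y0)) = 1"
      using eq[OF \<open>0 < t\<close>] False by (simp add: field_simps)
  qed (use lam_pos cont False in \<open>auto intro!: continuous_intros simp: init\<close>)
  have "\<bar>y (real n * \<tau>) / y0 - V \<tau> n\<bar> * \<bar>y0\<bar> \<le> err_const * mu \<tau> * real n powr (\<alpha> - 1) * \<bar>y0\<bar>"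
    using unit.err_bound[OF \<tau> n] by (intro mult_right_mono) (auto simp: unit.err_def)
  moreover have "\<bar>y (real n * \<tau>) / y0 - V \<tau> n\<bar> * \<bar>y0\<bar> = \<bar>y (real n * \<tau>) - y0 * V \<tau> n\<bar>"
    using False by (simp add: abs_mult[symmetric] left_diff_distrib) (simp only: mult.commute)
  ultimately show ?thesis by simp
qed

end

section \<open>Error of the incomplete scheme\<close>

lemma L2_set_bound:
  assumes "\<And>i. i \<in> I \<Longrightarrow> \<bar>f i\<bar> \<le> c * \<bar>g i\<bar>" "0 \<le> c"
  shows "L2_set f I \<le> c * L2_set g I"
proof -
  have "L2_set f I = L2_set (\<lambda>i. \<bar>f i\<bar>) I" by (simp add: L2_set_def)
  also have "\<dots> \<le> L2_set (\<lambda>i. c * \<bar>g i\<bar>) I" using assms by (intro L2_set_mono) auto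
  also have "\<dots> = c * L2_set (\<lambda>i. \<bar>g i\<bar>) I" using assms by (simp add: L2_set_right_distrib)
  also have "L2_set (\<lambda>i. \<bar>g i\<bar>) I = L2_set g I" by (simp add: L2_set_def)
  finally show ?thesis .
qed

lemma L2_set_sum_bound:
  assumes "finite J" "\<And>i j. i \<in> I \<Longrightarrow> j \<in> J \<Longrightarrow> \<bar>a j i\<bar> \<le> c j * \<bar>g j i\<bar>" "\<And>j. j \<in> J \<Longrightarrow> 0 \<le> c j"
  shows "L2_set (\<lambda>i. \<Sum>j\<in>J. a j i) I \<le> (\<Sum>j\<in>J. c j * L2_set (g j) I)"
  using assms
proof (induction J rule: finite_induct)
  case empty
  then show ?case by (simp add: L2_set_def)
next
  case (insert k J)
  have "L2_set (\<lambda>i. \<Sum>j\<in>insert k J. a j i) I = L2_set (\<lambda>i. a k i + (\<Sum>j\<in>J. a j i)) I"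
    using insert by simp
  also have "\<dots> \<le> L2_set (a k) I + L2_set (\<lambda>i. \<Sum>j\<in>J. a j i) I"
    by (rule L2_set_triangle_ineq)
  also have "\<dots> \<le> c k * L2_set (g k) I + (\<Sum>j\<in>J. c j * L2_set (g j) I)"
    using insert by (intro add_mono L2_set_bound insert.IH) auto
  finally show ?case using insert by simp
qed

context fractional_order
begin

text \<open>72 = 9 * 8: the factor of the second differences of R times that of the self-convolution
  in \<open>powr2_powr2_convolution_le\<close>.\<close>

definition solver_const :: real where "solver_const = 72 * (diff_const + 1) * zeta_const"
text \<open>Keeps \<epsilon> (\<open>solver_const\<close> + 1) at most 1 / 4, the share of each of
  the two terms in the induction for the residuals.\<close>

definition solver_tol :: real where "solver_tol = 1 / (4 * (solver_const + 1))"
text \<open>8 = 2 * 4, with 2 from \<open>resolvent_bound\<close> and 4 from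
  \<open>nrm_res_bound\<close>.\<close>

definition perturb_const :: real where "perturb_const = 8 * diff_const * conv_const * zeta_const"

lemma solver_const_ge: "9 * (diff_const + 1) \<le> solver_const" and solver_tol_pos: "0 < solver_tol"
  and perturb_const_pos: "0 < perturb_const"
proof -
  have "9 * (diff_const + 1) * 1 \<le> 9 * (diff_const + 1) * (8 * zeta_const)"
    using zeta_const_ge_1 diff_const_pos by (intro mult_left_mono) auto
  also have "9 * (diff_const + 1) * (8 * zeta_const) = solver_const" by (simp add: solver_const_def)
  finally show *: "9 * (diff_const + 1) \<le> solver_const" by (simp only: mult_1_right)
  then show "0 < solver_tol" using diff_const_pos by (simp add: solver_tol_def)
  show "0 < perturb_const" using diff_const_pos conv_const_pos zeta_const_ge_1
    by (simp add: perturb_const_def)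
qed

end

text \<open>
  The scheme in the coordinates of an eigenbasis: \<open>lam i\<close> are the eigenvalues, \<open>nrm\<close> is the
  energy norm, and \<open>\<epsilon> n\<close> stands for \<open>c0 * \<kappa> ^ M n\<close>.
\<close>

locale spectral_scheme = fractional_order +
  fixes I :: "'i set" and lam :: "'i \<Rightarrow> real" and \<tau> :: real and N :: nat
    and U Ubar :: "nat \<Rightarrow> 'i \<Rightarrow> real" and \<epsilon> :: "nat \<Rightarrow> real"
  assumes fin: "finite I" and lam_nonneg: "i \<in> I \<Longrightarrow> 0 \<le> lam i" and \<tau>_pos: "0 < \<tau>"
    and step_eq: "n \<in> {1..N} \<Longrightarrow> i \<in> I \<Longrightarrow> (1 + \<tau> powr \<alpha> * lam i) * Ubar n i =
      - (\<Sum>j=1..n. cq_weight \<alpha> j * U (n - j) i) + (\<Sum>j=0..n. cq_weight \<alpha> j * U 0 i)"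
    and exact_start: "n \<in> {1, 2} \<Longrightarrow> n \<le> N \<Longrightarrow> i \<in> I \<Longrightarrow> U n i = Ubar n i"
    and solver: "n \<in> {3..N} \<Longrightarrow> L2_set (\<lambda>i. sqrt (1 + \<tau> powr \<alpha> * lam i) * (U n i - Ubar n i)) I \<le>
      \<epsilon> n * L2_set (\<lambda>i. sqrt (1 + \<tau> powr \<alpha> * lam i) * (2 * U (n - 1) i - U (n - 2) i - Ubar n i)) I"
    and tol_nonneg: "n \<in> {3..N} \<Longrightarrow> 0 \<le> \<epsilon> n"
    and tol_le: "n \<in> {3..N} \<Longrightarrow> \<epsilon> n \<le> solver_tol"
begin

abbreviation m :: "'i \<Rightarrow> real" where "m i \<equiv> \<tau> powr \<alpha> * lam i"
definition w :: "'i \<Rightarrow> real" where "w i = sqrt (1 + m i)"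
definition nrm :: "('i \<Rightarrow> real) \<Rightarrow> real" where "nrm x = L2_set (\<lambda>i. w i * x i) I"
definition U_fps :: "'i \<Rightarrow> real fps" where "U_fps i = Abs_fps (\<lambda>n. U n i)"

text \<open>The residual; up to level \<open>N\<close> it is \<open>U n i - Ubar n i\<close>.\<close>

definition res_fps :: "'i \<Rightarrow> real fps" where
  "res_fps i = fps_const (1 / (1 + m i)) *
    ((cq_fps + fps_const (m i)) * U_fps i - fps_const (U 0 i) * (cq_fps * Abs_fps (\<lambda>_. 1) + fps_const (m i)))"

abbreviation \<eta> :: "nat \<Rightarrow> 'i \<Rightarrow> real" where "\<eta> n i \<equiv> fps_nth (res_fps i) n"

lemma m_nonneg: "i \<in> I \<Longrightarrow> 0 \<le> m i"
  using lam_nonneg by simp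

text \<open>Discrete Duhamel formula. The factor 1 + m undoes the normalisation of the residual by
  the matrix of the linear system; it is the weight carried along in the bounds for the
  resolvent.\<close>

lemma U_fps_eq:
  assumes "i \<in> I"
  shows "U_fps i = fps_const (1 + m i) * (resolvent (m i) * res_fps i) + fps_const (U 0 i) * exact_fps (m i)"
proof -
  let ?a = "cq_fps + fps_const (m i)"
  have "1 + m i \<noteq> 0" using m_nonneg[OF assms] by linarith
  then have "fps_const (1 + m i) * fps_const (1 / (1 + m i)) = 1"
    by (simp add: fps_const_mult)
  then have "fps_const (1 + m i) * res_fps i = ?a * U_fps i - fps_const (U 0 i) * (cq_fps * Abs_fps (\<lambda>_. 1) + fps_const (m i))"
    unfolding res_fps_def by (simp only: mult.assoc[symmetric] mult_1)
  then have "resolvent (m i) * (fps_const (1 + m i) * res_fps i) =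
      (?a * resolvent (m i)) * U_fps i - fps_const (U 0 i) * exact_fps (m i)"
    by (simp add: exact_fps_def right_diff_distrib mult_ac)
  then have *: "resolvent (m i) * (fps_const (1 + m i) * res_fps i) = U_fps i - fps_const (U 0 i) * exact_fps (m i)"
    by (simp only: resolvent_mult[OF m_nonneg[OF assms]] mult_1)
  show ?thesis
    by (simp only: mult.left_commute[of "fps_const (1 + m i)"] * diff_add_cancel)
qed

lemma res_0: "i \<in> I \<Longrightarrow> \<eta> 0 i = 0"
  using m_nonneg[of i] by (simp add: res_fps_def U_fps_def)

lemma res_eq:
  assumes "n \<in> {1..N}" "i \<in> I"
  shows "\<eta> n i = U n i - Ubar n i"
proof -
  have m0: "1 + m i \<noteq> 0" using m_nonneg[OF assms(2)] by linarith
  have "fps_nth (cq_fps * U_fps i) n = U n i + (\<Sum>j=1..n. cq_weight \<alpha> j * U (n - j) i)"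
    by (simp add: fps_mult_nth sum.atLeast_Suc_atMost[of 0 n] U_fps_def)
  moreover have "fps_nth (fps_const (m i) * U_fps i) n = m i * U n i" by (simp add: U_fps_def)
  moreover have "fps_nth (fps_const (U 0 i) * (cq_fps * Abs_fps (\<lambda>_. 1) + fps_const (m i))) n =
      (\<Sum>j=0..n. cq_weight \<alpha> j * U 0 i)"
    using assms(1) by (subst fps_mult_left_const_nth) (simp add: fps_mult_nth sum_distrib_left mult.commute)
  moreover have "(1 + m i) * \<eta> n i = fps_nth (cq_fps * U_fps i) n + fps_nth (fps_const (m i) * U_fps i) n -
      fps_nth (fps_const (U 0 i) * (cq_fps * Abs_fps (\<lambda>_. 1) + fps_const (m i))) n"
  proof -
    have "(1 + m i) * (1 / (1 + m i) * x) = x" for x :: real using m0 by simp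
    then show ?thesis
      unfolding res_fps_def by (simp only: distrib_right fps_add_nth fps_sub_nth fps_mult_left_const_nth)
  qed
  ultimately have "(1 + m i) * \<eta> n i = U n i + (\<Sum>j=1..n. cq_weight \<alpha> j * U (n - j) i) + m i * U n i
      - (\<Sum>j=0..n. cq_weight \<alpha> j * U 0 i)"
    by (simp only:)
  also have "\<dots> = (1 + m i) * (U n i - Ubar n i)"
    using step_eq[OF assms] by (simp add: algebra_simps)
  finally show ?thesis using m0 by simp
qed

lemma res_start: "n \<in> {1, 2} \<Longrightarrow> n \<le> N \<Longrightarrow> i \<in> I \<Longrightarrow> \<eta> n i = 0"
  using res_eq[of n i] exact_start[of n i] by auto

lemma fps_mult_nth_from_1:
  fixes f :: "real fps"
  assumes "i \<in> I"
  shows "fps_nth (f * res_fps i) n = (\<Sum>j=1..n. fps_nth f (n - j) * \<eta> j i)"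
proof -
  have "fps_nth (f * res_fps i) n = (\<Sum>j=0..n. fps_nth f (n - j) * \<eta> j i)"
    using fps_mult_nth[of "res_fps i" f n] by (simp only: mult.commute)
  then show ?thesis by (simp add: sum.atLeast_Suc_atMost[of 0 n] res_0[OF assms])
qed

lemma deviation:
  assumes "i \<in> I"
  shows "U n i - U 0 i * fps_nth (exact_fps (m i)) n = (\<Sum>j=1..n. (1 + m i) * fps_nth (resolvent (m i)) (n - j) * \<eta> j i)"
proof -
  have "U n i = fps_nth (U_fps i) n" by (simp add: U_fps_def)
  also have "\<dots> = (1 + m i) * fps_nth (resolvent (m i) * res_fps i) n + U 0 i * fps_nth (exact_fps (m i)) n"
    by (subst U_fps_eq[OF assms]) (simp only: fps_add_nth fps_mult_left_const_nth)
  finally show ?thesis by (simp add: fps_mult_nth_from_1[OF assms] sum_distrib_left mult.assoc)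
qed

text \<open>Apply (1 - X)^2 to the Duhamel formula; on the exact part the first factor 1 - X
  produces -\<mu> X R and the second a difference of it. The left-hand side is what the extrapolated
  starting guess misses.\<close>

lemma second_difference:
  assumes i: "i \<in> I" and n: "2 \<le> n"
  shows "U n i - 2 * U (n - 1) i + U (n - 2) i =
    (\<Sum>j=1..n. (1 + m i) * fps_nth ((1 - fps_X)\<^sup>2 * resolvent (m i)) (n - j) * \<eta> j i) +
    U 0 i * (m i * (fps_nth (resolvent (m i)) (n - 2) - fps_nth (resolvent (m i)) (n - 1)))"
proof -
  obtain k where k: "n = Suc (Suc k)" by (rule that[of "n - 2"]) (use n in simp)
  have sq: "(1 - fps_X)\<^sup>2 * f = f - 2 * (fps_X * f) + fps_X * (fps_X * f)" for f :: "real fps"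
    by (simp add: power2_eq_square algebra_simps)
  have "U n i - 2 * U (n - 1) i + U (n - 2) i = fps_nth ((1 - fps_X)\<^sup>2 * U_fps i) n"
    unfolding sq by (simp add: U_fps_def numeral_fps_const k)
  also have "(1 - fps_X)\<^sup>2 * U_fps i = fps_const (1 + m i) * (((1 - fps_X)\<^sup>2 * resolvent (m i)) * res_fps i) +
      fps_const (U 0 i) * ((1 - fps_X) * ((1 - fps_X) * exact_fps (m i)))"
    by (subst U_fps_eq[OF i]) (simp add: power2_eq_square distrib_left mult_ac)
  also have "fps_nth \<dots> n = (1 + m i) * (\<Sum>j=1..n. fps_nth ((1 - fps_X)\<^sup>2 * resolvent (m i)) (n - j) * \<eta> j i) +
      U 0 i * fps_nth ((1 - fps_X) * ((1 - fps_X) * exact_fps (m i))) n"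
    by (simp only: fps_add_nth fps_mult_left_const_nth fps_mult_nth_from_1[OF i])
  also have "fps_nth ((1 - fps_X) * ((1 - fps_X) * exact_fps (m i))) n =
      m i * (fps_nth (resolvent (m i)) (n - 2) - fps_nth (resolvent (m i)) (n - 1))"
    using exact_fps_step[OF m_nonneg[OF i], of k] exact_fps_step[OF m_nonneg[OF i], of "Suc k"]
    unfolding left_diff_distrib k by (simp add: algebra_simps)
  finally show ?thesis by (simp only: sum_distrib_left mult.assoc)
qed

text \<open>\<tau>^\<alpha> times the norm of \<open>A\<^sub>h v\<^sub>h\<close>, written in
  coordinates.\<close>

definition \<Lambda> :: real where "\<Lambda> = \<tau> powr \<alpha> * L2_set (\<lambda>i. lam i * U 0 i) I"

lemma \<Lambda>_nonneg: "0 \<le> \<Lambda>"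
  by (simp add: \<Lambda>_def L2_set_nonneg)

lemma w_bounds: "i \<in> I \<Longrightarrow> 1 \<le> w i" "i \<in> I \<Longrightarrow> w i \<le> 1 + m i"
proof -
  assume "i \<in> I"
  then have "0 \<le> m i" by (rule m_nonneg)
  moreover have "1 + x \<le> (1 + x)\<^sup>2" if "0 \<le> x" for x :: real
    using that by (simp add: power2_eq_square algebra_simps)
  ultimately have "1 + m i \<le> (1 + m i)\<^sup>2" "0 \<le> 1 + m i" by auto
  then show "w i \<le> 1 + m i" unfolding w_def by (intro real_le_lsqrt)
  show "1 \<le> w i" using \<open>0 \<le> m i\<close> by (simp add: w_def)
qed

lemma nrm_triangle: "nrm (\<lambda>i. x i + y i) \<le> nrm x + nrm y"
  unfolding nrm_def using L2_set_triangle_ineq[of "\<lambda>i. w i * x i" "\<lambda>i. w i * y i" I] by (simp add: distrib_left)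

lemma nrm_minus: "nrm (\<lambda>i. - x i) = nrm x"
  by (simp add: nrm_def L2_set_def)

lemma nrm_nonneg: "0 \<le> nrm x"
  by (simp add: nrm_def L2_set_nonneg)

text \<open>All operators are diagonal, so coefficient bounds that are uniform in the eigenvalue
  pass to the norm by Minkowski's inequality.\<close>

lemma nrm_second_difference:
  assumes n: "n \<in> {3..N}"
  shows "nrm (\<lambda>i. U n i - 2 * U (n - 1) i + U (n - 2) i) \<le>
    (\<Sum>j=1..n. 9 * (diff_const + 1) * real (n - j + 1) powr (\<alpha> - 2) * nrm (\<eta> j)) +
    4 * diff_const * \<Lambda> * real n powr (\<alpha> - 2)"
proof -
  let ?A = "\<lambda>i. \<Sum>j=1..n. (1 + m i) * fps_nth ((1 - fps_X)\<^sup>2 * resolvent (m i)) (n - j) * \<eta> j i"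
  let ?B = "\<lambda>i. U 0 i * (m i * (fps_nth (resolvent (m i)) (n - 2) - fps_nth (resolvent (m i)) (n - 1)))"
  have "nrm (\<lambda>i. U n i - 2 * U (n - 1) i + U (n - 2) i) = nrm (\<lambda>i. ?A i + ?B i)"
    unfolding nrm_def
  proof (intro L2_set_cong refl)
    fix i assume i: "i \<in> I"
    have n2: "2 \<le> n" using n by simp
    show "w i * (U n i - 2 * U (n - 1) i + U (n - 2) i) = w i * (?A i + ?B i)"
      by (simp only: second_difference[OF i n2])
  qed
  also have "\<dots> \<le> nrm ?A + nrm ?B" by (rule nrm_triangle)
  also have "nrm ?A \<le> (\<Sum>j=1..n. 9 * (diff_const + 1) * real (n - j + 1) powr (\<alpha> - 2) * nrm (\<eta> j))"
  proof -
    have "nrm ?A = L2_set (\<lambda>i. \<Sum>j=1..n. w i * ((1 + m i) * fps_nth ((1 - fps_X)\<^sup>2 * resolvent (m i)) (n - j) * \<eta> j i)) I"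
      by (simp only: nrm_def sum_distrib_left)
    also have "\<dots> \<le> (\<Sum>j=1..n. 9 * (diff_const + 1) * real (n - j + 1) powr (\<alpha> - 2) * L2_set (\<lambda>i. w i * \<eta> j i) I)"
    proof (rule L2_set_sum_bound)
      fix i j assume ij: "i \<in> I" "j \<in> {1..n}"
      have "\<bar>w i * ((1 + m i) * fps_nth ((1 - fps_X)\<^sup>2 * resolvent (m i)) (n - j) * \<eta> j i)\<bar> =
          \<bar>(1 + m i) * fps_nth ((1 - fps_X)\<^sup>2 * resolvent (m i)) (n - j)\<bar> * \<bar>w i * \<eta> j i\<bar>"
        by (simp only: abs_mult mult_ac)
      also have "\<dots> \<le> 9 * (diff_const + 1) * real (Suc (n - j)) powr (\<alpha> - 2) * \<bar>w i * \<eta> j i\<bar>"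
        using resolvent_second_diff_bound[OF m_nonneg[OF ij(1)], of "n - j"] by (intro mult_right_mono) auto
      finally show "\<bar>w i * ((1 + m i) * fps_nth ((1 - fps_X)\<^sup>2 * resolvent (m i)) (n - j) * \<eta> j i)\<bar> \<le>
         9 * (diff_const + 1) * real (n - j + 1) powr (\<alpha> - 2) * \<bar>w i * \<eta> j i\<bar>" by simp
    qed (use diff_const_pos in auto)
    finally show ?thesis by (simp only: nrm_def)
  qed
  also have "nrm ?B \<le> 4 * diff_const * \<Lambda> * real n powr (\<alpha> - 2)"
  proof -
    have n2: "2 \<le> n" using n by simp
    obtain k where k: "n = Suc (Suc k)" by (rule that[of "n - 2"]) (use n2 in simp)
    have "nrm ?B \<le> (4 * diff_const * \<tau> powr \<alpha> * real n powr (\<alpha> - 2)) * L2_set (\<lambda>i. lam i * U 0 i) I"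
      unfolding nrm_def
    proof (rule L2_set_bound)
      fix i assume i: "i \<in> I"
      let ?d = "fps_nth (resolvent (m i)) (n - 2) - fps_nth (resolvent (m i)) (n - 1)"
      have d0: "0 \<le> ?d" using resolvent_antimono[OF m_nonneg[OF i], of "n - 2" "n - 1"] by simp
      \<comment> \<open>The energy weight is at most 1 + m and is spent on the difference of R; the
        remaining m is \<tau>^\<alpha> times the eigenvalue and goes to the initial value.\<close>
      have "w i * ?d \<le> (1 + m i) * ?d" by (rule mult_right_mono[OF w_bounds(2)[OF i] d0])
      also have "\<dots> \<le> diff_const * real (Suc k) powr (\<alpha> - 2)"
        using resolvent_diff_bound[OF m_nonneg[OF i], of k] by (simp add: k)
      also have "real (Suc k) powr (\<alpha> - 2) \<le> 4 * real n powr (\<alpha> - 2)"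
      proof -
        have "real (Suc k) powr (\<alpha> - 2) \<le> (real n / 2) powr (\<alpha> - 2)"
          using order_less_1 by (intro powr_mono2') (auto simp: k)
        also have "\<dots> = 2 powr (2 - \<alpha>) * real n powr (\<alpha> - 2)"
          by (simp add: powr_divide powr_diff field_simps k)
        also have "2 powr (2 - \<alpha>) \<le> 2 powr (2::real)"
          using order_pos by (intro powr_mono) auto
        finally show ?thesis by (simp add: mult_right_mono)
      qed
      finally have wd: "w i * ?d \<le> 4 * diff_const * real n powr (\<alpha> - 2)"
        using diff_const_pos by (simp add: mult_left_mono)
      have w0: "0 \<le> w i" using w_bounds(1)[OF i] by simp
      have "\<bar>w i * ?B i\<bar> = (w i * ?d) * (\<tau> powr \<alpha> * \<bar>lam i * U 0 i\<bar>)"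
        using w0 d0 lam_nonneg[OF i] by (simp add: abs_mult)
      also have "\<dots> \<le> (4 * diff_const * real n powr (\<alpha> - 2)) * (\<tau> powr \<alpha> * \<bar>lam i * U 0 i\<bar>)"
        by (intro mult_right_mono wd) auto
      finally show "\<bar>w i * ?B i\<bar> \<le> (4 * diff_const * \<tau> powr \<alpha> * real n powr (\<alpha> - 2)) * \<bar>lam i * U 0 i\<bar>"
        by (simp only: mult_ac)
    qed (use diff_const_pos in auto)
    then show ?thesis by (simp only: \<Lambda>_def mult_ac)
  qed
  finally show ?thesis by simp
qed

text \<open>Contraction and extrapolation bound the residual by \<epsilon> times the sum of itself
  and the second difference of U. The latter contains the earlier residuals convolved with (n - j +
  1)^(\<alpha> - 2), which by induction reproduces the decay of the term from the initial value; a
  small fixed \<epsilon> absorbs the constants.\<close>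

lemma nrm_res_bound:
  assumes "n \<in> {1..N}"
  shows "nrm (\<eta> n) \<le> 4 * diff_const * \<Lambda> * real n powr (\<alpha> - 2)"
  using assms
proof (induction n rule: less_induct)
  case (less n)
  let ?q = "4 * diff_const * \<Lambda>" and ?D = "9 * (diff_const + 1)"
  have q0: "0 \<le> ?q" using diff_const_pos \<Lambda>_nonneg by simp
  show ?case
  proof (cases "n \<le> 2")
    case True
    then have "n \<in> {1, 2}" using less.prems by auto
    then have "nrm (\<eta> n) = 0"
      using less.prems by (auto simp: nrm_def L2_set_def res_start)
    then show ?thesis using q0 by simp
  next
    case False
    then have n: "n \<in> {3..N}" using less.prems by auto
    let ?S = "nrm (\<eta> n)" and ?DU = "nrm (\<lambda>i. U n i - 2 * U (n - 1) i + U (n - 2) i)"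
    have S0: "0 \<le> ?S" by (rule nrm_nonneg)
    have e: "0 \<le> \<epsilon> n" "\<epsilon> n \<le> solver_tol" using tol_nonneg[OF n] tol_le[OF n] by auto
    have sc: "0 < solver_const"
      by (rule less_le_trans[OF _ solver_const_ge]) (use diff_const_pos in simp)
    have tol: "4 * \<epsilon> n * (solver_const + 1) \<le> 1"
      using e sc by (simp add: solver_tol_def field_simps)
    have "?S = L2_set (\<lambda>i. sqrt (1 + m i) * (U n i - Ubar n i)) I"
      unfolding nrm_def using less.prems by (intro L2_set_cong refl) (simp add: res_eq w_def)
    also have "\<dots> \<le> \<epsilon> n * L2_set (\<lambda>i. sqrt (1 + m i) * (2 * U (n - 1) i - U (n - 2) i - Ubar n i)) I"
      by (rule solver[OF n])
    \<comment> \<open>The error of the starting guess is the residual minus the second difference: 2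
      U_(n-1) - U_(n-2) - Ubar_n = (U_n - Ubar_n) - (U_n - 2 U_(n-1) + U_(n-2)).\<close>
    also have "L2_set (\<lambda>i. sqrt (1 + m i) * (2 * U (n - 1) i - U (n - 2) i - Ubar n i)) I =
        nrm (\<lambda>i. \<eta> n i + - (U n i - 2 * U (n - 1) i + U (n - 2) i))"
      unfolding nrm_def using less.prems by (intro L2_set_cong refl) (simp add: res_eq w_def algebra_simps)
    also have "\<epsilon> n * \<dots> \<le> \<epsilon> n * (?S + ?DU)"
      using nrm_triangle[of "\<eta> n" "\<lambda>i. - (U n i - 2 * U (n - 1) i + U (n - 2) i)"] e
      unfolding nrm_minus by (intro mult_left_mono) auto
    finally have 1: "?S \<le> \<epsilon> n * (?S + ?DU)" .
    have "?DU \<le> (\<Sum>j=1..n. ?D * real (n - j + 1) powr (\<alpha> - 2) * nrm (\<eta> j)) + ?q * real n powr (\<alpha> - 2)"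
      by (rule nrm_second_difference[OF n])
    \<comment> \<open>The term j = n contains the residual that is being bounded; its kernel is
      \<open>1 powr (\<alpha> - 2) = 1\<close>, and a quarter of the left-hand side will absorb
      it.\<close>
    also have "(\<Sum>j=1..n. ?D * real (n - j + 1) powr (\<alpha> - 2) * nrm (\<eta> j)) =
        (\<Sum>j=1..<n. ?D * real (n - j + 1) powr (\<alpha> - 2) * nrm (\<eta> j)) + ?D * ?S"
      using n by (cases n) (auto simp: atLeastLessThanSuc_atLeastAtMost)
    also have "(\<Sum>j=1..<n. ?D * real (n - j + 1) powr (\<alpha> - 2) * nrm (\<eta> j)) \<le>
        (\<Sum>j=1..<n. ?D * real (n - j + 1) powr (\<alpha> - 2) * (?q * real j powr (\<alpha> - 2)))"
      using less diff_const_pos by (intro sum_mono mult_left_mono) auto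
    also have "\<dots> \<le> (\<Sum>j=1..n. ?D * real (n - j + 1) powr (\<alpha> - 2) * (?q * real j powr (\<alpha> - 2)))"
      using diff_const_pos q0 by (intro sum_mono2) auto
    also have "\<dots> = ?D * ?q * (\<Sum>j=1..n. real (n - j + 1) powr (\<alpha> - 2) * real j powr (\<alpha> - 2))"
      by (simp add: sum_distrib_left mult_ac)
    also have "\<dots> \<le> ?D * ?q * (8 * zeta_const * real n powr (\<alpha> - 2))"
      using diff_const_pos q0 n by (intro mult_left_mono powr2_powr2_convolution_le) auto
    also have "\<dots> = solver_const * (?q * real n powr (\<alpha> - 2))"
      by (simp add: solver_const_def)
    finally have 2: "?DU \<le> (solver_const + 1) * (?q * real n powr (\<alpha> - 2)) + ?D * ?S"
      by (simp add: algebra_simps)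
    have "?S \<le> \<epsilon> n * (?S + ((solver_const + 1) * (?q * real n powr (\<alpha> - 2)) + ?D * ?S))"
      using 1 2 e by (meson add_left_mono mult_left_mono order_trans)
    also have "\<dots> = \<epsilon> n * (1 + ?D) * ?S + \<epsilon> n * (solver_const + 1) * (?q * real n powr (\<alpha> - 2))"
      by (simp add: algebra_simps)
    also have "\<epsilon> n * (1 + ?D) * ?S \<le> (1 / 4) * ?S"
    proof (rule mult_right_mono[OF _ S0])
      have "\<epsilon> n * (1 + ?D) \<le> \<epsilon> n * (solver_const + 1)"
        using solver_const_ge e by (intro mult_left_mono) auto
      then show "\<epsilon> n * (1 + ?D) \<le> 1 / 4" using tol by linarith
    qed
    also have "\<epsilon> n * (solver_const + 1) * (?q * real n powr (\<alpha> - 2)) \<le> (1 / 4) * (?q * real n powr (\<alpha> - 2))"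
      using tol q0 by (intro mult_right_mono) auto
    finally have "?S \<le> (1 / 4) * ?S + (1 / 4) * (?q * real n powr (\<alpha> - 2))" by simp
    moreover have "0 \<le> ?q * real n powr (\<alpha> - 2)" using q0 by simp
    moreover have "S \<le> (1 / 4) * S + (1 / 4) * X \<Longrightarrow> 0 \<le> X \<Longrightarrow> S \<le> X" for S X :: real by simp
    ultimately show ?thesis by blast
  qed
qed

text \<open>The residuals decay like the summable j^(\<alpha> - 2), so convolution with the
  resolvent keeps the rate n^(\<alpha> - 1) of the latter. The energy weight is at least 1, whence
  the plain norm on the left.\<close>

lemma deviation_bound:
  assumes n: "n \<in> {1..N}"
  shows "L2_set (\<lambda>i. U n i - U 0 i * fps_nth (exact_fps (m i)) n) I \<le> perturb_const * \<Lambda> * real n powr (\<alpha> - 1)"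
proof -
  let ?q = "4 * diff_const * \<Lambda>"
  have q0: "0 \<le> ?q" using diff_const_pos \<Lambda>_nonneg by simp
  have "L2_set (\<lambda>i. U n i - U 0 i * fps_nth (exact_fps (m i)) n) I =
      L2_set (\<lambda>i. \<Sum>j=1..n. (1 + m i) * fps_nth (resolvent (m i)) (n - j) * \<eta> j i) I"
    by (intro L2_set_cong refl deviation)
  also have "\<dots> \<le> (\<Sum>j=1..n. 2 * real (n - j + 1) powr (\<alpha> - 1) * L2_set (\<lambda>i. w i * \<eta> j i) I)"
  proof (rule L2_set_sum_bound)
    fix i j assume ij: "i \<in> I" "j \<in> {1..n}"
    note m0 = m_nonneg[OF ij(1)]
    have R: "0 \<le> (1 + m i) * fps_nth (resolvent (m i)) (n - j)"
      using m0 resolvent_nonneg[OF m0] by simp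
    have "\<bar>(1 + m i) * fps_nth (resolvent (m i)) (n - j) * \<eta> j i\<bar> =
        (1 + m i) * fps_nth (resolvent (m i)) (n - j) * \<bar>\<eta> j i\<bar>"
      by (subst abs_mult) (simp only: abs_of_nonneg[OF R])
    also have "\<dots> \<le> (2 * real (Suc (n - j)) powr (\<alpha> - 1)) * \<bar>w i * \<eta> j i\<bar>"
    proof (rule mult_mono)
      show "(1 + m i) * fps_nth (resolvent (m i)) (n - j) \<le> 2 * real (Suc (n - j)) powr (\<alpha> - 1)"
        by (rule resolvent_bound[OF m0])
      have "1 * \<bar>\<eta> j i\<bar> \<le> \<bar>w i\<bar> * \<bar>\<eta> j i\<bar>" using w_bounds(1)[OF ij(1)] by (intro mult_right_mono) auto
      then show "\<bar>\<eta> j i\<bar> \<le> \<bar>w i * \<eta> j i\<bar>" by (simp add: abs_mult)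
    qed auto
    finally show "\<bar>(1 + m i) * fps_nth (resolvent (m i)) (n - j) * \<eta> j i\<bar> \<le> 2 * real (n - j + 1) powr (\<alpha> - 1) * \<bar>w i * \<eta> j i\<bar>"
      by simp
  qed auto
  also have "\<dots> \<le> (\<Sum>j=1..n. 2 * real (n - j + 1) powr (\<alpha> - 1) * (?q * real j powr (\<alpha> - 2)))"
    using nrm_res_bound n by (intro sum_mono mult_left_mono) (auto simp: nrm_def)
  also have "\<dots> = 2 * ?q * (\<Sum>j=1..n. real (n - j + 1) powr (\<alpha> - 1) * real j powr (\<alpha> - 2))"
    by (simp add: sum_distrib_left mult_ac)
  also have "\<dots> \<le> 2 * ?q * (conv_const * zeta_const * real n powr (\<alpha> - 1))"
    using q0 n by (intro mult_left_mono powr1_powr2_convolution_le) auto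
  also have "2 * ?q * (conv_const * zeta_const * real n powr (\<alpha> - 1)) = perturb_const * \<Lambda> * real n powr (\<alpha> - 1)"
    by (simp add: perturb_const_def)
  finally show ?thesis .
qed

end

section \<open>Smooth functions and mollification\<close>

lemma partial_eqI: "(f has_derivative D) (at x) \<Longrightarrow> partial i f x = D i"
  unfolding partial_def by (simp add: frechet_derivative_at[symmetric])

lemma differentiable_partial: "f differentiable (at x) \<Longrightarrow> (f has_derivative (\<lambda>h. partial h f x)) (at x)"
  unfolding partial_def using frechet_derivative_works by (metis eta_contract_eq)

lemma Ck_differentiable: "Ck (Suc k) f \<Longrightarrow> f differentiable (at x)"
  by simp

lemma Ck_continuous: "Ck k f \<Longrightarrow> continuous_on UNIV f"
  by (cases k) (auto simp: continuous_on_eq_continuous_at intro: differentiable_imp_continuous_within)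

lemma Ck_Suc_imp: "Ck (Suc k) f \<Longrightarrow> Ck k f"
proof (induction k arbitrary: f)
  case 0
  then show ?case using Ck_continuous[OF 0] by simp
next
  case (Suc k)
  then show ?case by simp
qed

lemma Ck_const: "Ck k (\<lambda>_. c)"
proof (induction k arbitrary: c)
  case (Suc k)
  have "partial i (\<lambda>_. c) = (\<lambda>_. 0)" for i :: 'a
    by (rule ext, rule partial_eqI) (auto intro!: derivative_eq_intros)
  with Suc show ?case by simp
qed simp

lemma Ck_add: "Ck k f \<Longrightarrow> Ck k g \<Longrightarrow> Ck k (\<lambda>x. f x + g x)"
proof (induction k arbitrary: f g)
  case (Suc k)
  have "partial i (\<lambda>x. f x + g x) = (\<lambda>x. partial i f x + partial i g x)" for i
    by (rule ext, rule partial_eqI) (intro has_derivative_add differentiable_partial Ck_differentiable[OF Suc.prems(1)] Ck_differentiable[OF Suc.prems(2)])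
  with Suc show ?case by (auto intro: differentiable_add)
qed (auto intro: continuous_intros)

lemma Ck_mult: "Ck k f \<Longrightarrow> Ck k g \<Longrightarrow> Ck k (\<lambda>x. f x * g x)"
proof (induction k arbitrary: f g)
  case (Suc k)
  have "partial i (\<lambda>x. f x * g x) = (\<lambda>x. f x * partial i g x + partial i f x * g x)" for i
    by (rule ext, rule partial_eqI) (intro has_derivative_mult differentiable_partial Ck_differentiable[OF Suc.prems(1)] Ck_differentiable[OF Suc.prems(2)])
  moreover have "Ck k (\<lambda>x. f x * partial i g x + partial i f x * g x)" if "i \<in> Basis" for i
    using Suc.prems that by (intro Ck_add Suc.IH) (auto intro: Ck_Suc_imp)
  ultimately show ?case using Suc.prems by (auto intro: differentiable_mult)
qed (auto intro: continuous_intros)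

lemma Ck_linear:
  assumes "bounded_linear f"
  shows "Ck k (f :: 'a::euclidean_space \<Rightarrow> real)"
proof (cases k)
  case 0
  then show ?thesis using assms by (auto intro: linear_continuous_on)
next
  case (Suc m)
  have "partial i f = (\<lambda>_. f i)" for i
    by (rule ext, rule partial_eqI) (rule bounded_linear_imp_has_derivative[OF assms])
  then show ?thesis
    using bounded_linear_imp_differentiable[OF assms] by (simp add: Suc Ck_const)
qed

text \<open>The induction runs over the whole family H at once, since differentiation moves from
  \<open>H n\<close> to \<open>H (Suc n)\<close>.\<close>

lemma Ck_compose:
  assumes H: "\<And>n s. (H n has_real_derivative H (Suc n) s) (at s)" and q: "\<And>k. Ck k q"
  shows "Ck k (\<lambda>x. H n (q x))"
proof (induction k arbitrary: n)
  case 0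
  have "continuous_on UNIV (H n)"
    using H by (auto simp: continuous_on_eq_continuous_at intro: DERIV_isCont)
  then have "continuous_on UNIV (\<lambda>x. H n (q x))"
    by (rule continuous_on_compose2[OF _ Ck_continuous[OF q]]) simp
  then show ?case by simp
next
  case (Suc k)
  have D: "((\<lambda>x. H n (q x)) has_derivative (\<lambda>h. H (Suc n) (q x) * partial h q x)) (at x)" for x
    using has_derivative_compose[OF differentiable_partial[OF Ck_differentiable[OF q]], of "H n"]
      H[of n] unfolding has_field_derivative_def by blast
  have "partial i (\<lambda>x. H n (q x)) = (\<lambda>x. H (Suc n) (q x) * partial i q x)" for i
    by (rule ext, rule partial_eqI) (rule D)
  moreover have "Ck k (\<lambda>x. H (Suc n) (q x) * partial i q x)" if "i \<in> Basis" for i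
    using q[of "Suc k"] that by (intro Ck_mult Suc.IH) auto
  ultimately show ?case using D by (auto simp: differentiable_def)
qed

text \<open>The derivatives of \<open>exp (- 1 / s)\<close>, continued by \<open>0\<close> to \<open>s \<le> 0\<close>.\<close>

primrec bump_poly :: "nat \<Rightarrow> real poly" where
  "bump_poly 0 = 1"
| "bump_poly (Suc n) = monom 1 2 * (bump_poly n - pderiv (bump_poly n))"

definition bump :: "nat \<Rightarrow> real \<Rightarrow> real" where
  "bump n s = (if s > 0 then poly (bump_poly n) (1 / s) * exp (- (1 / s)) else 0)"

lemma poly_exp_tendsto_0: "((\<lambda>y. poly p y * exp (- y)) \<longlongrightarrow> 0) (at_top :: real filter)"
proof -
  have "((\<lambda>y. \<Sum>i\<le>degree p. coeff p i * (y ^ i / exp y)) \<longlongrightarrow> (\<Sum>i\<le>degree p. coeff p i * 0)) at_top"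
    by (intro tendsto_intros tendsto_power_div_exp_0)
  then show ?thesis
    by (simp add: poly_altdef sum_distrib_right sum_divide_distrib exp_minus field_simps)
qed

text \<open>At 0 the right difference quotient is y p(y) exp(-y) with y = 1 / h and p the n-th
  polynomial, which tends to 0.\<close>

lemma bump_deriv: "(bump n has_real_derivative bump (Suc n) s) (at s)"
proof -
  consider "s > 0" | "s < 0" | "s = 0" by linarith
  then show ?thesis
  proof cases
    case 1
    have "((\<lambda>s. poly (bump_poly n) (1 / s) * exp (- (1 / s))) has_real_derivative bump (Suc n) s) (at s)"
      using 1 by (auto intro!: derivative_eq_intros DERIV_chain2[OF poly_DERIV]
        simp: bump_def poly_monom power2_eq_square field_simps)
    then show ?thesis
      by (rule has_field_derivative_transform_within_open[of _ _ _ "{0<..}"])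
        (use 1 in \<open>auto simp: bump_def\<close>)
  next
    case 2
    have "((\<lambda>_. 0) has_real_derivative bump (Suc n) s) (at s)" using 2 by (simp add: bump_def)
    then show ?thesis
      by (rule has_field_derivative_transform_within_open[of _ _ _ "{..<0}"])
        (use 2 in \<open>auto simp: bump_def\<close>)
  next
    case 3
    have "((\<lambda>h. (bump n (0 + h) - bump n 0) / h) \<longlongrightarrow> 0) (at 0)"
    proof (rule filterlim_split_at)
      have lt: "eventually (\<lambda>h. h < 0) (at_left (0::real))" and gt: "eventually (\<lambda>h. h > 0) (at_right (0::real))"
        by (simp_all add: eventually_at_filter)
      have ev: "eventually (\<lambda>h. 0 = (bump n (0 + h) - bump n 0) / h) (at_left (0::real))"
        using lt by eventually_elim (simp add: bump_def)
      show "((\<lambda>h. (bump n (0 + h) - bump n 0) / h) \<longlongrightarrow> 0) (at_left 0)"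
        by (rule Lim_transform_eventually[OF tendsto_const ev])
      have "filterlim (\<lambda>h::real. 1 / h) at_top (at_right 0)"
        using filterlim_inverse_at_top_right by (simp add: inverse_eq_divide)
      from filterlim_compose[OF poly_exp_tendsto_0[of "monom 1 1 * bump_poly n"] this]
      have t: "((\<lambda>h. poly (monom 1 1 * bump_poly n) (1 / h) * exp (- (1 / h))) \<longlongrightarrow> 0) (at_right 0)" .
      have ev: "eventually (\<lambda>h. poly (monom 1 1 * bump_poly n) (1 / h) * exp (- (1 / h)) = (bump n (0 + h) - bump n 0) / h) (at_right (0::real))"
        using gt by eventually_elim (simp add: bump_def poly_monom)
      show "((\<lambda>h. (bump n (0 + h) - bump n 0) / h) \<longlongrightarrow> 0) (at_right 0)"
        by (rule Lim_transform_eventually[OF t ev])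
    qed
    then show ?thesis by (simp add: 3 DERIV_def bump_def)
  qed
qed

lemma bump_0: "bump 0 s = (if s > 0 then exp (- (1 / s)) else 0)"
  by (simp add: bump_def)

section \<open>Convolution and mollification\<close>

lemma lborel_integral_reflect:
  fixes g :: "'a::euclidean_space \<Rightarrow> real"
  assumes [measurable]: "g \<in> borel_measurable borel"
  shows "(\<integral>y. g (x - y) \<partial>lborel) = (\<integral>y. g y \<partial>lborel)"
proof -
  have l: "lborel = density (distr lborel borel (\<lambda>y. x + (- 1) *\<^sub>R y)) (\<lambda>_. ennreal (\<bar>- 1\<bar> ^ DIM('a)))"
    using lborel_affine[of "- 1" x] by simp
  have "(\<integral>y. g y \<partial>lborel) = (\<integral>y. g y \<partial>(distr lborel borel (\<lambda>y. x + (- 1) *\<^sub>R y)))"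
    by (subst l) (simp add: density_1)
  also have "\<dots> = (\<integral>y. g (x - y) \<partial>lborel)"
    by (subst integral_distr) simp_all
  finally show ?thesis by simp
qed

lemma integrable_compact_support:
  fixes g :: "'a::euclidean_space \<Rightarrow> real"
  assumes "continuous_on UNIV g" "\<And>x. g x \<noteq> 0 \<Longrightarrow> norm x \<le> R"
  shows "integrable lborel g"
proof -
  have "integrable lborel (\<lambda>x. indicator (cball 0 R) x *\<^sub>R g x)"
    by (intro borel_integrable_compact continuous_on_subset[OF assms(1)]) auto
  also have "(\<lambda>x. indicator (cball 0 R) x *\<^sub>R g x) = g"
    using assms(2) by (auto simp: indicator_def fun_eq_iff)
  finally show ?thesis .
qed

text \<open>With the variable in \<rho> and the integral over a fixed box, all derivatives fall on
  \<rho> and the Leibniz rule applies; f is merely continuous.\<close>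

lemma Ck_convolution:
  fixes f \<rho> :: "'a::euclidean_space \<Rightarrow> real"
  assumes f: "continuous_on UNIV f"
  shows "Ck k \<rho> \<Longrightarrow> Ck k (\<lambda>x. integral (cbox a b) (\<lambda>y. f y * \<rho> (x - y)))"
proof (induction k arbitrary: \<rho>)
  case 0
  then have c\<rho>: "continuous_on UNIV \<rho>" by simp
  have "continuous_on (UNIV \<times> cbox a b) (\<lambda>(x, y). f y * \<rho> (x - y))"
    unfolding case_prod_beta
    by (intro continuous_intros continuous_on_compose2[OF f] continuous_on_compose2[OF c\<rho>]) auto
  then show ?case by (simp add: integral_continuous_on_param)
next
  case (Suc k)
  have diff: "(\<rho> has_derivative (\<lambda>h. partial h \<rho> x)) (at x)" for x
    by (intro differentiable_partial Ck_differentiable[OF Suc.prems])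
  have cp: "continuous_on UNIV (partial i \<rho>)" if "i \<in> Basis" for i
    using Suc.prems that by (auto intro: Ck_continuous)
  \<comment> \<open>The Leibniz rule wants a continuous operator-valued derivative, hence the
    bounded linear map whose components are the partial derivatives.\<close>
  define D where "D x = Blinfun (\<lambda>h. partial h \<rho> x)" for x
  have D: "blinfun_apply (D x) h = partial h \<rho> x" for x h
    unfolding D_def using has_derivative_bounded_linear[OF diff] by (simp add: bounded_linear_Blinfun_apply)
  have cD: "continuous_on UNIV D"
    by (rule continuous_on_blinfun_componentwise) (simp add: D cp)
  have c\<rho>: "continuous_on UNIV \<rho>" by (rule Ck_continuous[OF Suc.prems])
  have int: "(\<lambda>y. f y *\<^sub>R D (x - y)) integrable_on cbox a b" for x
    by (intro integrable_continuous continuous_intros continuous_on_compose2[OF f] continuous_on_compose2[OF cD]) auto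
  have deriv: "((\<lambda>x. integral (cbox a b) (\<lambda>y. f y * \<rho> (x - y))) has_derivative
      blinfun_apply (integral (cbox a b) (\<lambda>y. f y *\<^sub>R D (x - y)))) (at x)" for x
  proof (rule leibniz_rule[where U = UNIV, simplified])
    fix x y assume "y \<in> cbox a b"
    have "((\<lambda>x. x - y) has_derivative (\<lambda>h. h)) (at x)"
      by (auto intro!: derivative_eq_intros)
    from has_derivative_compose[OF this diff]
    have "((\<lambda>x. \<rho> (x - y)) has_derivative (\<lambda>h. partial h \<rho> (x - y))) (at x)" .
    then have "((\<lambda>x. f y * \<rho> (x - y)) has_derivative (\<lambda>h. f y * partial h \<rho> (x - y))) (at x)"
      by (intro has_derivative_mult_right)
    moreover have "blinfun_apply (f y *\<^sub>R D (x - y)) = (\<lambda>h. f y * partial h \<rho> (x - y))"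
      by (auto simp: scaleR_blinfun.rep_eq D)
    ultimately show "((\<lambda>x. f y * \<rho> (x - y)) has_derivative blinfun_apply (f y *\<^sub>R D (x - y))) (at x)"
      by simp
  next
    fix x
    show "(\<lambda>y. f y * \<rho> (x - y)) integrable_on cbox a b"
      by (intro integrable_continuous continuous_intros continuous_on_compose2[OF f] continuous_on_compose2[OF c\<rho>]) auto
  next
    show "continuous_on (UNIV \<times> cbox a b) (\<lambda>(x, y). f y *\<^sub>R D (x - y))"
      unfolding case_prod_beta
      by (intro continuous_intros continuous_on_compose2[OF f] continuous_on_compose2[OF cD]) auto
  qed
  have "partial i (\<lambda>x. integral (cbox a b) (\<lambda>y. f y * \<rho> (x - y))) = (\<lambda>x. integral (cbox a b) (\<lambda>y. f y * partial i \<rho> (x - y)))" for i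
  proof
    fix x
    have "partial i (\<lambda>x. integral (cbox a b) (\<lambda>y. f y * \<rho> (x - y))) x = blinfun_apply (integral (cbox a b) (\<lambda>y. f y *\<^sub>R D (x - y))) i"
      by (rule partial_eqI[OF deriv])
    also have "\<dots> = integral (cbox a b) ((\<lambda>B. blinfun_apply B i) \<circ> (\<lambda>y. f y *\<^sub>R D (x - y)))"
      by (rule integral_linear[OF int, symmetric]) (rule bounded_linear_intros, rule bounded_linear_ident)
    finally show "partial i (\<lambda>x. integral (cbox a b) (\<lambda>y. f y * \<rho> (x - y))) x = integral (cbox a b) (\<lambda>y. f y * partial i \<rho> (x - y))"
      by (simp add: o_def D scaleR_blinfun.rep_eq)
  qed
  moreover have "(\<lambda>x. integral (cbox a b) (\<lambda>y. f y * \<rho> (x - y))) differentiable (at x)" for x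
    using deriv unfolding differentiable_def by blast
  ultimately show ?case using Suc by simp
qed

lemma lipschitz_partial_bound:
  fixes \<psi> :: "'a::euclidean_space \<Rightarrow> real"
  assumes L: "\<And>x y. \<bar>\<psi> x - \<psi> y\<bar> \<le> L * dist x y" and d: "\<psi> differentiable (at x)" and i: "i \<in> Basis"
  shows "\<bar>partial i \<psi> x\<bar> \<le> L"
proof -
  have "((\<lambda>t. x + t *\<^sub>R i) has_derivative (\<lambda>t. t *\<^sub>R i)) (at 0)"
    by (auto intro!: derivative_eq_intros)
  from has_derivative_compose[OF this, of \<psi> "\<lambda>h. partial h \<psi> x"]
  have "((\<lambda>t. \<psi> (x + t *\<^sub>R i)) has_derivative (\<lambda>t. partial (t *\<^sub>R i) \<psi> x)) (at 0)"
    using differentiable_partial[OF d] by simp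
  moreover have "partial (t *\<^sub>R i) \<psi> x = partial i \<psi> x * t" for t
    using linear_cmul[OF has_derivative_linear[OF differentiable_partial[OF d]], of t i] by simp
  ultimately have "((\<lambda>t. \<psi> (x + t *\<^sub>R i)) has_real_derivative partial i \<psi> x) (at 0)"
    by (simp add: has_field_derivative_def mult_commute_abs)
  then have "((\<lambda>t. (\<psi> (x + t *\<^sub>R i) - \<psi> x) / t) \<longlongrightarrow> partial i \<psi> x) (at 0)"
    by (simp add: DERIV_def)
  then have "((\<lambda>t. \<bar>(\<psi> (x + t *\<^sub>R i) - \<psi> x) / t\<bar>) \<longlongrightarrow> \<bar>partial i \<psi> x\<bar>) (at 0)"
    by (rule tendsto_rabs)
  moreover have "eventually (\<lambda>t. \<bar>(\<psi> (x + t *\<^sub>R i) - \<psi> x) / t\<bar> \<le> L) (at (0::real))"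
    unfolding eventually_at
  proof (intro exI[of _ 1] conjI ballI impI)
    fix t :: real assume t: "t \<noteq> 0 \<and> dist t 0 < 1"
    have "\<bar>\<psi> (x + t *\<^sub>R i) - \<psi> x\<bar> \<le> L * \<bar>t\<bar>"
      using L[of "x + t *\<^sub>R i" x] i by (simp add: dist_norm)
    then show "\<bar>(\<psi> (x + t *\<^sub>R i) - \<psi> x) / t\<bar> \<le> L" using t by (simp add: field_simps)
  qed auto
  ultimately show ?thesis by (rule tendsto_upperbound) simp
qed

lemma abs_integral_le:
  fixes f g :: "'a \<Rightarrow> real"
  assumes "integrable M f" "integrable M g" "\<And>x. \<bar>f x\<bar> \<le> g x"
  shows "\<bar>integral\<^sup>L M f\<bar> \<le> integral\<^sup>L M g"
proof -
  have "\<bar>integral\<^sup>L M f\<bar> \<le> (\<integral>x. \<bar>f x\<bar> \<partial>M)" by (rule integral_abs_bound)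
  also have "\<dots> \<le> integral\<^sup>L M g" by (intro integral_mono integrable_abs assms)
  finally show ?thesis .
qed

text \<open>The last clause is the decisive one for piecewise affine f: averaging an affine function
  with a kernel of mass 1 changes it by a constant, so well inside a region where f is affine the
  smooth function has exactly the gradient of f.\<close>

lemma mollification:
  fixes f :: "'a::euclidean_space \<Rightarrow> real"
  assumes L: "\<And>x y. \<bar>f x - f y\<bar> \<le> L * dist x y" and supp: "\<And>x. f x \<noteq> 0 \<Longrightarrow> norm x \<le> R"
    and \<delta>: "0 < \<delta>"
  obtains \<psi> where "\<And>k. Ck k \<psi>" "\<And>x. \<bar>\<psi> x - f x\<bar> \<le> L * \<delta>"
    "\<And>x. \<psi> x \<noteq> 0 \<Longrightarrow> \<exists>y. f y \<noteq> 0 \<and> dist x y \<le> \<delta>"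
    "\<And>x i. i \<in> Basis \<Longrightarrow> \<bar>partial i \<psi> x\<bar> \<le> L"
    "\<And>x r a b i. \<delta> < r \<Longrightarrow> (\<And>y. y \<in> ball x r \<Longrightarrow> f y = a \<bullet> y + b) \<Longrightarrow> partial i \<psi> x = a \<bullet> i"
proof -
  \<comment> \<open>Positive exactly on the open ball of radius \<delta>, so that
    \<open>bump 0 (q x)\<close> is a smooth kernel concentrated there.\<close>
  define q where "q x = 1 + (- (1 / \<delta>\<^sup>2)) * (x \<bullet> x)" for x :: 'a
  have Ck_i: "Ck k (\<lambda>x::'a. x \<bullet> i)" for k i
    by (intro Ck_linear bounded_linear_inner_left)
  have Ck_sq: "Ck k (\<lambda>x::'a. \<Sum>i\<in>J. (x \<bullet> i) * (x \<bullet> i))" if "finite J" for k J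
    using that by (induction J rule: finite_induct) (auto intro!: Ck_const Ck_add Ck_mult Ck_i)
  have "Ck k (\<lambda>x::'a. x \<bullet> x)" for k
    using Ck_sq[of Basis k] by (simp add: euclidean_inner[symmetric])
  then have Ckq: "Ck k q" for k
    unfolding q_def by (intro Ck_add Ck_mult Ck_const)
  define \<rho>0 where "\<rho>0 x = bump 0 (q x)" for x
  have Ck0: "Ck k \<rho>0" for k unfolding \<rho>0_def by (rule Ck_compose[of bump q k 0, OF bump_deriv Ckq])
  have pos0: "0 \<le> \<rho>0 x" for x by (simp add: \<rho>0_def bump_0)
  have supp0: "norm x \<le> \<delta>" if "\<rho>0 x \<noteq> 0" for x
  proof -
    have "q x > 0" using that by (auto simp: \<rho>0_def bump_0 split: if_splits)
    then have "(norm x)\<^sup>2 < \<delta>\<^sup>2" using \<delta> by (simp add: q_def power2_norm_eq_inner field_simps)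
    then show ?thesis using \<delta> by (meson less_imp_le power2_less_imp_less)
  qed
  have c0: "continuous_on UNIV \<rho>0" by (rule Ck_continuous[OF Ck0])
  have i0: "integrable lborel \<rho>0" by (rule integrable_compact_support[OF c0 supp0])
  define c where "c = (\<integral>x. \<rho>0 x \<partial>lborel)"
  have c: "0 < c"
  proof -
    have "0 \<le> c" unfolding c_def by (intro Bochner_Integration.integral_nonneg pos0)
    moreover have "c \<noteq> 0"
    proof
      assume "c = 0"
      then have "AE x in lborel. \<rho>0 x = 0"
        using integral_nonneg_eq_0_iff_AE[OF i0] pos0 by (simp add: c_def)
      moreover have op: "open {x. \<rho>0 x \<noteq> 0}"
        using c0 by (intro open_Collect_neq) auto
      ultimately have "{x. \<rho>0 x \<noteq> 0} \<in> null_sets lborel"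
        using AE_iff_null_sets[of "{x. \<rho>0 x \<noteq> 0}" lborel] by auto
      then have "negligible {x. \<rho>0 x \<noteq> 0}"
        by (simp add: negligible_iff_null_sets null_sets_completionI)
      moreover note op
      moreover have "0 \<in> {x. \<rho>0 x \<noteq> 0}" by (simp add: \<rho>0_def q_def bump_0)
      ultimately show False using open_not_negligible by blast
    qed
    ultimately show ?thesis by simp
  qed
  define \<rho> where "\<rho> x = (1 / c) * \<rho>0 x" for x
  have Ck\<rho>: "Ck k \<rho>" for k unfolding \<rho>_def by (rule Ck_mult[OF Ck_const Ck0])
  have \<rho>0: "0 \<le> \<rho> x" for x using pos0 c by (simp add: \<rho>_def)
  have \<rho>s: "norm x \<le> \<delta>" if "\<rho> x \<noteq> 0" for x using that supp0 by (auto simp: \<rho>_def)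
  have c\<rho>: "continuous_on UNIV \<rho>" by (rule Ck_continuous[OF Ck\<rho>])
  have \<rho>1: "(\<integral>x. \<rho> x \<partial>lborel) = 1" using c by (simp add: \<rho>_def c_def[symmetric])
  have L0: "0 \<le> L"
  proof -
    have "dist (0::'a) (SOME i. i \<in> Basis) = 1" by (simp add: dist_norm norm_some_Basis)
    then show ?thesis using order_trans[OF abs_ge_zero L[of 0 "SOME i. i \<in> Basis"]] by simp
  qed
  have cf: "continuous_on UNIV f"
    by (rule lipschitz_on_continuous_on[of L]) (use L L0 in \<open>auto simp: lipschitz_on_def dist_real_def\<close>)
  have int: "integrable lborel (\<lambda>z. g z * \<rho> z)" if "continuous_on UNIV g" for g :: "'a \<Rightarrow> real"
  proof (rule integrable_compact_support[of _ \<delta>])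
    show "continuous_on UNIV (\<lambda>z. g z * \<rho> z)" by (intro continuous_on_mult that c\<rho>)
  qed (use \<rho>s in auto)
  have cfx: "continuous_on UNIV (\<lambda>z. f (x - z))" for x
    by (intro continuous_on_compose2[OF cf] continuous_intros) auto
  \<comment> \<open>This form suits the estimates. Reflected, with the variable moved to \<rho> and
    the integral restricted to a box containing the support of f, it takes the form of
    \<open>Ck_convolution\<close>.\<close>
  define \<psi> where "\<psi> x = (\<integral>z. f (x - z) * \<rho> z \<partial>lborel)" for x
  have Ck: "Ck k \<psi>" for k
  proof -
    obtain a0 :: 'a where "cball 0 R \<subseteq> cbox (- a0) a0"
      using bounded_subset_cbox_symmetric[OF bounded_cball] .
    then obtain a b :: 'a where ab: "cball 0 R \<subseteq> cbox a b" by blast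
    have out: "f y = 0" if "y \<notin> cbox a b" for y
      using supp[of y] ab that by (metis mem_cball_0 subsetD)
    have "\<psi> x = integral (cbox a b) (\<lambda>y. f y * \<rho> (x - y))" for x
    proof -
      let ?g = "\<lambda>y. f y * \<rho> (x - y)"
      have cg: "continuous_on UNIV ?g"
        by (intro continuous_intros cf continuous_on_compose2[OF c\<rho>]) auto
      have "integrable lborel ?g"
        by (rule integrable_compact_support[OF cg]) (use supp in auto)
      then have "(?g has_integral (\<integral>y. ?g y \<partial>lborel)) UNIV" by (rule has_integral_integral_lborel)
      then have "(?g has_integral (\<integral>y. ?g y \<partial>lborel)) (cbox a b)"
        by (subst has_integral_restrict_UNIV[symmetric], rule has_integral_eq[rotated]) (use out in auto)
      then have "integral (cbox a b) ?g = (\<integral>y. ?g y \<partial>lborel)" by (rule integral_unique)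
      also have "\<dots> = (\<integral>z. ?g (x - z) \<partial>lborel)"
        by (rule lborel_integral_reflect[symmetric]) (intro borel_measurable_continuous_onI cg)
      finally show ?thesis by (simp add: \<psi>_def)
    qed
    then have "\<psi> = (\<lambda>x. integral (cbox a b) (\<lambda>y. f y * \<rho> (x - y)))" by (rule ext)
    then show ?thesis using Ck_convolution[OF cf Ck\<rho>] by simp
  qed
  have near: "\<bar>\<psi> x - \<psi> y\<bar> \<le> L * dist x y" for x y
  proof -
    have "\<psi> x - \<psi> y = (\<integral>z. (f (x - z) - f (y - z)) * \<rho> z \<partial>lborel)"
      unfolding \<psi>_def left_diff_distrib by (rule Bochner_Integration.integral_diff[symmetric]) (intro int cfx)+
    also have "\<bar>\<dots>\<bar> \<le> (\<integral>z. L * dist x y * \<rho> z \<partial>lborel)"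
    proof (rule abs_integral_le)
      show "integrable lborel (\<lambda>z. (f (x - z) - f (y - z)) * \<rho> z)" by (intro int continuous_intros cfx)
      show "integrable lborel (\<lambda>z. L * dist x y * \<rho> z)" by (intro int continuous_intros)
      fix z
      have "\<bar>f (x - z) - f (y - z)\<bar> * \<rho> z \<le> L * dist x y * \<rho> z"
        using L[of "x - z" "y - z"] \<rho>0[of z] by (intro mult_right_mono) (auto simp: dist_norm)
      then show "\<bar>(f (x - z) - f (y - z)) * \<rho> z\<bar> \<le> L * dist x y * \<rho> z"
        using \<rho>0[of z] by (simp add: abs_mult)
    qed
    finally show ?thesis by (simp add: \<rho>1)
  qed
  show ?thesis
  proof (rule that[of \<psi>])
    show "Ck k \<psi>" for k by (rule Ck)
    show "\<bar>\<psi> x - f x\<bar> \<le> L * \<delta>" for x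
    proof -
      have "f x = (\<integral>z. f x * \<rho> z \<partial>lborel)" by (simp add: \<rho>1)
      then have "\<psi> x - f x = (\<integral>z. f (x - z) * \<rho> z \<partial>lborel) - (\<integral>z. f x * \<rho> z \<partial>lborel)" by (simp add: \<psi>_def)
      also have "\<dots> = (\<integral>z. (f (x - z) - f x) * \<rho> z \<partial>lborel)"
        unfolding left_diff_distrib by (rule Bochner_Integration.integral_diff[symmetric]) (intro int cfx continuous_intros)+
      also have "\<bar>\<dots>\<bar> \<le> (\<integral>z. L * \<delta> * \<rho> z \<partial>lborel)"
      proof (rule abs_integral_le)
        show "integrable lborel (\<lambda>z. (f (x - z) - f x) * \<rho> z)" by (intro int continuous_intros cfx)
        show "integrable lborel (\<lambda>z. L * \<delta> * \<rho> z)" by (intro int continuous_intros)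
        fix z
        have "\<bar>f (x - z) - f x\<bar> * \<rho> z \<le> L * \<delta> * \<rho> z"
        proof (cases "\<rho> z = 0")
          case False
          then have "L * dist (x - z) x \<le> L * \<delta>" using \<rho>s[of z] L0 by (intro mult_left_mono) (auto simp: dist_norm)
          then have "\<bar>f (x - z) - f x\<bar> \<le> L * \<delta>" using L[of "x - z" x] by linarith
          then show ?thesis using \<rho>0[of z] by (intro mult_right_mono)
        qed simp
        then show "\<bar>(f (x - z) - f x) * \<rho> z\<bar> \<le> L * \<delta> * \<rho> z"
          using \<rho>0[of z] by (simp add: abs_mult)
      qed
      finally show ?thesis by (simp add: \<rho>1)
    qed
    show "\<exists>y. f y \<noteq> 0 \<and> dist x y \<le> \<delta>" if "\<psi> x \<noteq> 0" for x
    proof (rule ccontr)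
      assume *: "\<not> ?thesis"
      have z: "f (x - z) * \<rho> z = 0" for z
        using *[simplified, rule_format, of "x - z"] \<rho>s[of z] by (auto simp: dist_norm)
      have "\<psi> x = 0" unfolding \<psi>_def by (simp only: z) simp
      with that show False by simp
    qed
    show "\<bar>partial i \<psi> x\<bar> \<le> L" if "i \<in> Basis" for x i
      by (rule lipschitz_partial_bound[OF near Ck_differentiable[OF Ck] that])
    show "partial i \<psi> x = a \<bullet> i" if r: "\<delta> < r" and af: "\<And>y. y \<in> ball x r \<Longrightarrow> f y = a \<bullet> y + b" for x r a b i
    proof -
      define K where "K = (\<integral>z. (b - a \<bullet> z) * \<rho> z \<partial>lborel)"
      have lin: "\<psi> w = a \<bullet> w + K" if w: "w \<in> ball x (r - \<delta>)" for w
      proof -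
        have "f (w - z) * \<rho> z = (a \<bullet> w) * \<rho> z + (b - a \<bullet> z) * \<rho> z" for z
        proof (cases "\<rho> z = 0")
          case False
          have "dist x (w - z) \<le> dist x w + norm z" 
            using norm_triangle_ineq[of "x - w" z] by (simp add: dist_norm algebra_simps)
          then have "w - z \<in> ball x r" using \<rho>s[OF False] w by simp
          from af[OF this] have "f (w - z) = a \<bullet> w + (b - a \<bullet> z)" by (simp add: inner_diff_right)
          then show ?thesis by (simp only: distrib_right)
        qed simp
        then have "\<psi> w = (\<integral>z. (a \<bullet> w) * \<rho> z + (b - a \<bullet> z) * \<rho> z \<partial>lborel)" by (simp add: \<psi>_def)
        also have "\<dots> = (\<integral>z. (a \<bullet> w) * \<rho> z \<partial>lborel) + K"
          unfolding K_def by (rule Bochner_Integration.integral_add) (intro int continuous_intros)+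
        finally show ?thesis by (simp add: \<rho>1)
      qed
      have D: "((\<lambda>w. a \<bullet> w + K) has_derivative (\<lambda>h. a \<bullet> h)) (at x)"
        by (auto intro!: derivative_eq_intros)
      have "x \<in> ball x (r - \<delta>)" using r by simp
      then have "(\<psi> has_derivative (\<lambda>h. a \<bullet> h)) (at x)"
        by (rule has_derivative_transform_within_open[OF D open_ball]) (rule lin[symmetric])
      then show ?thesis by (rule partial_eqI)
    qed
  qed
qed

section \<open>Finite element functions\<close>

locale fe_space =
  fixes \<Omega> :: "'a::euclidean_space set" and \<T> :: "'a set set"
  assumes domain: "convex_polyhedral_domain \<Omega>" and tri: "triangulation_of \<Omega> \<T>"
begin

lemma open_dom: "open \<Omega>" and dom_ne: "\<Omega> \<noteq> {}" and convex_dom: "convex \<Omega>"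
  using domain unfolding convex_polyhedral_domain_def by blast+

lemma compact_closure: "compact (closure \<Omega>)"
  using domain polytope_imp_compact unfolding convex_polyhedral_domain_def by blast

lemma bounded_dom: "bounded \<Omega>"
  using compact_closure by (meson bounded_subset closure_subset compact_imp_bounded)

lemma finite_tri: "finite \<T>" and Union_tri: "\<Union>\<T> = closure \<Omega>" and simplex_tri: "K \<in> \<T> \<Longrightarrow> int DIM('a) simplex K"
  using tri by (auto simp: triangulation_of_def triangulation_def)

lemma convex_cell: "K \<in> \<T> \<Longrightarrow> convex K" and compact_cell: "K \<in> \<T> \<Longrightarrow> compact K"
  using simplex_tri by (meson convex_simplex compact_simplex)+

text \<open>Off a null set every point has a neighbourhood on which all finite element functions are affine.\<close>

definition cells :: "'a set" where "cells = (\<Union>K\<in>\<T>. interior K) \<union> (- closure \<Omega>)"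

lemma open_cells: "open cells"
  unfolding cells_def by (intro open_Un open_UN ballI open_interior) (auto simp: open_Compl)

lemma negligible_cells: "negligible (- cells)"
proof (rule negligible_subset)
  show "negligible (\<Union>K\<in>\<T>. frontier K)"
    using finite_tri convex_cell by (intro negligible_Union) (auto intro: negligible_convex_frontier)
  show "- cells \<subseteq> (\<Union>K\<in>\<T>. frontier K)"
  proof
    fix x assume x: "x \<in> - cells"
    then have "x \<in> \<Union>\<T>" by (auto simp: cells_def Union_tri)
    then obtain K where K: "K \<in> \<T>" "x \<in> K" by blast
    moreover have "x \<notin> interior K" using x K by (auto simp: cells_def)
    ultimately have "x \<in> frontier K"
      using compact_imp_closed[OF compact_cell[OF K(1)]] by (simp add: frontier_def)
    then show "x \<in> (\<Union>K\<in>\<T>. frontier K)" using K(1) by blast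
  qed
qed

lemma AE_cells: "AE x in lebesgue_on \<Omega>. x \<in> cells"
proof -
  have "- cells \<in> null_sets lebesgue" using negligible_cells by (simp add: negligible_iff_null_sets)
  then have "AE x in lebesgue. x \<in> cells" using AE_not_in by force
  then show ?thesis using open_dom by (subst AE_restrict_space_iff) auto
qed

definition dom_bound :: real where "dom_bound = (SOME R. 0 < R \<and> (\<forall>x\<in>closure \<Omega>. norm x \<le> R))"

lemma dom_bound: "0 < dom_bound" "x \<in> closure \<Omega> \<Longrightarrow> norm x \<le> dom_bound"
proof -
  have "\<exists>R. 0 < R \<and> (\<forall>x\<in>closure \<Omega>. norm x \<le> R)"
    using compact_imp_bounded[OF compact_closure] bounded_pos by blast
  from someI_ex[OF this] show "0 < dom_bound" "x \<in> closure \<Omega> \<Longrightarrow> norm x \<le> dom_bound"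
    by (auto simp: dom_bound_def)
qed

abbreviation X :: "('a \<Rightarrow> real) set" where "X \<equiv> Xh \<Omega> \<T>"

lemma X_outside: "\<eta> \<in> X \<Longrightarrow> x \<notin> \<Omega> \<Longrightarrow> \<eta> x = 0"
  by (simp add: Xh_def)

lemma X_affine:
  assumes "\<eta> \<in> X"
  shows "\<exists>a b. \<forall>K\<in>\<T>. \<forall>x\<in>K. \<eta> x = a K \<bullet> x + b K"
proof -
  have "\<forall>K\<in>\<T>. \<exists>a b. \<forall>x\<in>K. \<eta> x = a \<bullet> x + b" using assms by (simp add: Xh_def)
  from bchoice[OF this] obtain a where "\<forall>K\<in>\<T>. \<exists>b. \<forall>x\<in>K. \<eta> x = a K \<bullet> x + b" ..
  from bchoice[OF this] show ?thesis by blast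
qed

lemma X_locally_affine:
  assumes \<eta>: "\<eta> \<in> X" and x: "x \<in> cells"
  shows "\<exists>r a b. 0 < r \<and> (\<forall>y\<in>ball x r. \<eta> y = a \<bullet> y + b)"
proof -
  consider K where "K \<in> \<T>" "x \<in> interior K" | "x \<in> - closure \<Omega>"
    using x by (auto simp: cells_def)
  then show ?thesis
  proof cases
    case 1
    obtain a b where "\<forall>K\<in>\<T>. \<forall>x\<in>K. \<eta> x = a K \<bullet> x + b K" using X_affine[OF \<eta>] by auto
  then have ab: "\<And>K x. K \<in> \<T> \<Longrightarrow> x \<in> K \<Longrightarrow> \<eta> x = a K \<bullet> x + b K" by simp
    obtain r where "0 < r" "ball x r \<subseteq> K" using 1 by (auto simp: mem_interior)
    then show ?thesis using ab[OF 1(1)] by (intro exI[of _ r] exI[of _ "a K"] exI[of _ "b K"]) auto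
  next
    case 2
    then obtain r where "0 < r" "ball x r \<subseteq> - closure \<Omega>"
      by (meson closed_closure open_Compl open_contains_ball)
    moreover then have "\<eta> y = 0" if "y \<in> ball x r" for y
      using that closure_subset[of \<Omega>] by (intro X_outside[OF \<eta>]) blast
    ultimately show ?thesis by (intro exI[of _ r] exI[of _ "0::'a"] exI[of _ "0::real"]) auto
  qed
qed

text \<open>A segment between two points is covered by finitely many closed pieces: its parts in the
  cells, where \<eta> has the gradient of the cell, and its part outside \<Omega>, where \<eta> is
  0. A common Lipschitz constant on closed pieces of an interval holds on the whole
  interval.\<close>

lemma X_lipschitz:
  assumes \<eta>: "\<eta> \<in> X"
  shows "\<exists>L>0. \<forall>x y. \<bar>\<eta> x - \<eta> y\<bar> \<le> L * dist x y"
proof -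
  obtain a b where "\<forall>K\<in>\<T>. \<forall>x\<in>K. \<eta> x = a K \<bullet> x + b K" using X_affine[OF \<eta>] by auto
  then have ab: "\<And>K x. K \<in> \<T> \<Longrightarrow> x \<in> K \<Longrightarrow> \<eta> x = a K \<bullet> x + b K" by simp
  define L where "L = 1 + (\<Sum>K\<in>\<T>. norm (a K))"
  have L: "0 < L" unfolding L_def by (intro add_pos_nonneg sum_nonneg) auto
  have aL: "norm (a K) \<le> L" if "K \<in> \<T>" for K
  proof -
    have "norm (a K) \<le> (\<Sum>K\<in>\<T>. norm (a K))" using finite_tri that by (intro member_le_sum) auto
    then show ?thesis by (simp add: L_def)
  qed
  have "\<bar>\<eta> x - \<eta> y\<bar> \<le> L * dist x y" for x y
  proof -
    define \<gamma> where "\<gamma> t = x + t *\<^sub>R (y - x)" for t :: real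
    have c\<gamma>: "continuous_on UNIV \<gamma>" unfolding \<gamma>_def by (intro continuous_intros)
    \<comment> \<open>\<open>None\<close> stands for the complement of \<Omega>,
      \<open>Some K\<close> for a cell.\<close>
    define U where "U k = (case k of None \<Rightarrow> {t. \<gamma> t \<in> - \<Omega>} | Some K \<Rightarrow> {t. \<gamma> t \<in> K})" for k
    have closedU: "closed {t. \<gamma> t \<in> K}" if "closed K" for K
      using continuous_closed_vimage[OF that] c\<gamma> by (auto simp: vimage_def continuous_on_eq_continuous_at)
    have "lipschitz_on (L * dist x y) {0..1} (\<lambda>t. \<eta> (\<gamma> t))"
    proof (rule lipschitz_on_closed_Union[where U = U and I = "insert None (Some ` \<T>)"])
      fix k assume k: "k \<in> insert None (Some ` \<T>)"
      show "lipschitz_on (L * dist x y) (U k) (\<lambda>t. \<eta> (\<gamma> t))"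
      proof (cases k)
        case None
        then show ?thesis using X_outside[OF \<eta>] L by (auto simp: U_def lipschitz_on_def)
      next
        case (Some K)
        then have K: "K \<in> \<T>" using k by auto
        show ?thesis
        proof (rule lipschitz_onI)
          fix s t assume st: "s \<in> U k" "t \<in> U k"
          have "\<eta> (\<gamma> s) - \<eta> (\<gamma> t) = a K \<bullet> (\<gamma> s - \<gamma> t)"
            using st ab[OF K] by (simp add: U_def Some inner_diff_right)
          also have "\<gamma> s - \<gamma> t = (s - t) *\<^sub>R (y - x)" by (simp add: \<gamma>_def algebra_simps)
          finally have "\<bar>\<eta> (\<gamma> s) - \<eta> (\<gamma> t)\<bar> \<le> norm (a K) * norm ((s - t) *\<^sub>R (y - x))"
            by (simp only: Cauchy_Schwarz_ineq2)
          also have "\<dots> \<le> L * norm ((s - t) *\<^sub>R (y - x))" by (intro mult_right_mono aL K) auto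
          finally show "dist (\<eta> (\<gamma> s)) (\<eta> (\<gamma> t)) \<le> L * dist x y * dist s t"
            by (simp add: dist_real_def dist_norm norm_minus_commute mult_ac)
        qed (use L in auto)
      qed
      show "closed (U k)"
        using k closedU[of "- \<Omega>"] open_dom compact_imp_closed[OF compact_cell]
        by (auto simp: U_def closed_Compl intro!: closedU)
    next
      have "\<gamma> t \<in> - \<Omega> \<or> (\<exists>K\<in>\<T>. \<gamma> t \<in> K)" for t
        using closure_subset[of \<Omega>] Union_tri by blast
      then show "{0..1} \<subseteq> (\<Union>k\<in>insert None (Some ` \<T>). U k)"
        by (auto simp: U_def)
    qed (use finite_tri L in auto)
    from lipschitz_onD[OF this, of 0 1] show ?thesis by (simp add: \<gamma>_def dist_real_def)
  qed
  with L show ?thesis by (intro exI[of _ L]) auto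
qed

lemma X_bounded_support: "\<eta> \<in> X \<Longrightarrow> \<eta> x \<noteq> 0 \<Longrightarrow> norm x \<le> dom_bound"
  using X_outside[of \<eta> x] dom_bound(2)[of x] closure_subset[of \<Omega>] by auto

lemma X_continuous: "\<eta> \<in> X \<Longrightarrow> continuous_on UNIV \<eta>"
proof -
  assume "\<eta> \<in> X"
  then obtain L where "0 < L" "\<forall>x y. \<bar>\<eta> x - \<eta> y\<bar> \<le> L * dist x y" using X_lipschitz by blast
  then show ?thesis
    by (intro lipschitz_on_continuous_on[of L]) (auto simp: lipschitz_on_def dist_real_def)
qed

lemma X_bounded:
  assumes "\<eta> \<in> X"
  shows "\<exists>B>0. \<forall>x. \<bar>\<eta> x\<bar> \<le> B"
proof -
  have "compact (\<eta> ` cball 0 dom_bound)"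
    by (intro compact_continuous_image continuous_on_subset[OF X_continuous[OF assms]]) auto
  then obtain B where B0: "0 < B" "\<forall>z\<in>\<eta> ` cball 0 dom_bound. norm z \<le> B"
    using compact_imp_bounded bounded_pos by blast
  then have B: "0 < B" "\<And>x. x \<in> cball 0 dom_bound \<Longrightarrow> \<bar>\<eta> x\<bar> \<le> B" by auto
  then have "\<bar>\<eta> x\<bar> \<le> B" for x
    using X_bounded_support[OF assms, of x] by (cases "\<eta> x = 0") auto
  with B show ?thesis by (intro exI[of _ B]) auto
qed

text \<open>A concrete representative of the weak derivative, 0 on the null set between the cells.
  Unlike the chosen \<open>weak_partial\<close> it depends linearly on \<eta> in X at every
  point.\<close>

definition grad :: "'a \<Rightarrow> ('a \<Rightarrow> real) \<Rightarrow> 'a \<Rightarrow> real" where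
  "grad i \<eta> x = (if x \<in> cells then partial i \<eta> x else 0)"

lemma grad_affine:
  assumes "x \<in> cells" "0 < r" "\<And>y. y \<in> ball x r \<Longrightarrow> \<eta> y = a \<bullet> y + b"
  shows "grad i \<eta> x = a \<bullet> i"
proof -
  have "((\<lambda>y. a \<bullet> y + b) has_derivative (\<lambda>h. a \<bullet> h)) (at x)"
    by (auto intro!: derivative_eq_intros)
  then have "(\<eta> has_derivative (\<lambda>h. a \<bullet> h)) (at x)"
    by (rule has_derivative_transform_within_open[of _ _ _ _ "ball x r"]) (use assms in auto)
  then show ?thesis using assms(1) by (simp add: grad_def partial_eqI)
qed

lemma grad_tendsto:
  assumes \<eta>: "\<eta> \<in> X" and x: "x \<in> cells"
  shows "(\<lambda>n. real (Suc n) * (\<eta> (x + (1 / real (Suc n)) *\<^sub>R i) - \<eta> x)) \<longlonglongrightarrow> grad i \<eta> x"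
    and "(\<lambda>n. real (Suc n) * (\<eta> x - \<eta> (x - (1 / real (Suc n)) *\<^sub>R i))) \<longlonglongrightarrow> grad i \<eta> x"
proof -
  obtain r a b where r: "0 < r" and ab': "\<forall>y\<in>ball x r. \<eta> y = a \<bullet> y + b"
    using X_locally_affine[OF \<eta> x] by blast
  note ab = bspec[OF ab']
  have g: "grad i \<eta> x = a \<bullet> i" by (rule grad_affine[OF x r ab])
  have "(\<lambda>n. norm i / real (Suc n)) \<longlonglongrightarrow> 0"
    using LIMSEQ_Suc[OF lim_const_over_n[of "norm i"]] by simp
  then have ev: "eventually (\<lambda>n. norm i / real (Suc n) < r) sequentially"
    by (rule order_tendstoD(2)[OF _ r])
  have "eventually (\<lambda>n. a \<bullet> i = real (Suc n) * (\<eta> (x + (1 / real (Suc n)) *\<^sub>R i) - \<eta> x)) sequentially"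
    using ev
  proof eventually_elim
    case (elim n)
    then have "\<eta> (x + (1 / real (Suc n)) *\<^sub>R i) = a \<bullet> (x + (1 / real (Suc n)) *\<^sub>R i) + b"
      by (intro ab) (simp add: dist_norm)
    then show ?case using ab[of x] r by (simp add: inner_add_right del: of_nat_Suc)
  qed
  then show "(\<lambda>n. real (Suc n) * (\<eta> (x + (1 / real (Suc n)) *\<^sub>R i) - \<eta> x)) \<longlonglongrightarrow> grad i \<eta> x"
    unfolding g by (rule Lim_transform_eventually[OF tendsto_const])
  have "eventually (\<lambda>n. a \<bullet> i = real (Suc n) * (\<eta> x - \<eta> (x - (1 / real (Suc n)) *\<^sub>R i))) sequentially"
    using ev
  proof eventually_elim
    case (elim n)
    then have "\<eta> (x - (1 / real (Suc n)) *\<^sub>R i) = a \<bullet> (x - (1 / real (Suc n)) *\<^sub>R i) + b"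
      by (intro ab) (simp add: dist_norm)
    then show ?case using ab[of x] r by (simp add: inner_diff_right del: of_nat_Suc)
  qed
  then show "(\<lambda>n. real (Suc n) * (\<eta> x - \<eta> (x - (1 / real (Suc n)) *\<^sub>R i))) \<longlonglongrightarrow> grad i \<eta> x"
    unfolding g by (rule Lim_transform_eventually[OF tendsto_const])
qed

lemma grad_measurable:
  assumes \<eta>: "\<eta> \<in> X"
  shows "grad i \<eta> \<in> borel_measurable borel"
proof (rule borel_measurable_LIMSEQ_real)
  have [measurable]: "\<eta> \<in> borel_measurable borel" "cells \<in> sets borel"
    using X_continuous[OF \<eta>] open_cells by (auto intro: borel_measurable_continuous_onI)
  show "(\<lambda>x. indicator cells x * (real (Suc n) * (\<eta> (x + (1 / real (Suc n)) *\<^sub>R i) - \<eta> x))) \<in> borel_measurable borel" for n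
    by measurable
  show "(\<lambda>n. indicator cells x * (real (Suc n) * (\<eta> (x + (1 / real (Suc n)) *\<^sub>R i) - \<eta> x))) \<longlonglongrightarrow> grad i \<eta> x" for x
  proof (cases "x \<in> cells")
    case True
    then show ?thesis using grad_tendsto(1)[OF \<eta> True, of i] by simp
  qed (simp add: grad_def)
qed

lemma grad_bounded:
  assumes L: "\<And>x y. \<bar>\<eta> x - \<eta> y\<bar> \<le> L * dist x y" and \<eta>: "\<eta> \<in> X" and i: "i \<in> Basis" and "0 \<le> L"
  shows "\<bar>grad i \<eta> x\<bar> \<le> L"
proof (cases "x \<in> cells")
  case True
  have "\<bar>real (Suc n) * (\<eta> (x + (1 / real (Suc n)) *\<^sub>R i) - \<eta> x)\<bar> \<le> L" for n
  proof -
    have "\<bar>\<eta> (x + (1 / real (Suc n)) *\<^sub>R i) - \<eta> x\<bar> \<le> L * (1 / real (Suc n))"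
      using L[of "x + (1 / real (Suc n)) *\<^sub>R i" x] i by (simp add: dist_norm)
    then show ?thesis unfolding abs_mult by (simp add: field_simps del: of_nat_Suc)
  qed
  then show ?thesis
    by (intro tendsto_upperbound[OF tendsto_rabs[OF grad_tendsto(1)[OF \<eta> True]]]) auto
qed (use assms in \<open>simp add: grad_def\<close>)

text \<open>
  Contracting towards a point of the convex domain moves the support inside; then mollify.
\<close>

lemma X_approximation:
  assumes \<eta>: "\<eta> \<in> X"
  obtains \<psi> B where "\<And>n. \<psi> n \<in> test_functions \<Omega>" "0 < B"
    "\<And>n x. \<bar>\<psi> n x\<bar> \<le> B" "\<And>n x i. i \<in> Basis \<Longrightarrow> \<bar>partial i (\<psi> n) x\<bar> \<le> B"
    "\<And>x. (\<lambda>n. \<psi> n x) \<longlonglongrightarrow> \<eta> x"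
    "\<And>x i. x \<in> cells \<Longrightarrow> i \<in> Basis \<Longrightarrow> (\<lambda>n. partial i (\<psi> n) x) \<longlonglongrightarrow> grad i \<eta> x"
proof -
  obtain L where L: "0 < L" and lip: "\<And>x y. \<bar>\<eta> x - \<eta> y\<bar> \<le> L * dist x y" using X_lipschitz[OF \<eta>] by auto
  obtain B where B: "0 < B" and bd: "\<And>x. \<bar>\<eta> x\<bar> \<le> B" using X_bounded[OF \<eta>] by auto
  obtain p where p: "p \<in> \<Omega>" using dom_ne by blast
  \<comment> \<open>Dilating the argument by a factor above 1 contracts the support towards p, into
    a compact subset of \<Omega>.\<close>
  define s where "s n = 1 + 1 / real (Suc n)" for n
  have s: "1 < s n" "s n \<le> 2" for n by (auto simp: s_def)
  define f where "f n x = \<eta> (p + s n *\<^sub>R (x - p))" for n x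
  define C where "C n = (\<lambda>z. p + (1 / s n) *\<^sub>R (z - p)) ` closure \<Omega>" for n
  have fC: "x \<in> C n" if "f n x \<noteq> 0" for n x
  proof -
    have "p + s n *\<^sub>R (x - p) \<in> closure \<Omega>"
      using that X_outside[OF \<eta>] closure_subset by (auto simp: f_def)
    moreover have "x = p + (1 / s n) *\<^sub>R ((p + s n *\<^sub>R (x - p)) - p)" using s[of n] by simp
    ultimately show ?thesis unfolding C_def by blast
  qed
  have compC: "compact (C n)" for n
    unfolding C_def by (intro compact_continuous_image continuous_intros compact_closure)
  have CO: "C n \<subseteq> \<Omega>" for n
  proof
    fix x assume "x \<in> C n"
    then obtain z where z: "z \<in> closure \<Omega>" "x = p + (1 / s n) *\<^sub>R (z - p)" by (auto simp: C_def)
    have "z - (1 - 1 / s n) *\<^sub>R (z - p) \<in> interior \<Omega>"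
      using s[of n] p z by (intro mem_interior_closure_convex_shrink convex_dom) (auto simp: interior_open[OF open_dom])
    moreover have "x = z - (1 - 1 / s n) *\<^sub>R (z - p)" by (simp add: z algebra_simps)
    ultimately show "x \<in> \<Omega>" using interior_subset by auto
  qed
  have "\<exists>e>0. (\<Union>x\<in>C n. cball x e) \<subseteq> \<Omega>" for n
    using compact_subset_open_imp_cball_epsilon_subset[OF compC open_dom CO] by metis
  then obtain e where e: "\<And>n. 0 < e n" "\<And>n. (\<Union>x\<in>C n. cball x (e n)) \<subseteq> \<Omega>" by metis
  \<comment> \<open>The mollification radius: small enough to keep the support in \<Omega>, and
    tending to 0.\<close>
  define d where "d n = min (e n) (1 / real (Suc n))" for n
  have d: "0 < d n" "d n \<le> e n" "d n \<le> 1 / real (Suc n)" for n using e(1) by (auto simp: d_def)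
  have lipf: "\<bar>f n x - f n y\<bar> \<le> 2 * L * dist x y" for n x y
  proof -
    have "\<bar>f n x - f n y\<bar> \<le> L * dist (p + s n *\<^sub>R (x - p)) (p + s n *\<^sub>R (y - p))"
      unfolding f_def by (rule lip)
    also have "dist (p + s n *\<^sub>R (x - p)) (p + s n *\<^sub>R (y - p)) = s n * dist x y"
      using s[of n] by (simp add: dist_norm flip: scaleR_diff_right)
    also have "L * (s n * dist x y) \<le> L * (2 * dist x y)"
      using s[of n] L by (intro mult_left_mono mult_right_mono) auto
    finally show ?thesis by simp
  qed
  have suppf: "norm x \<le> dom_bound" if "f n x \<noteq> 0" for n x
    using fC[OF that] CO closure_subset by (intro dom_bound(2)) blast
  have "\<exists>\<psi>. (\<forall>k. Ck k \<psi>) \<and> (\<forall>x. \<bar>\<psi> x - f n x\<bar> \<le> 2 * L * d n) \<and>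
      (\<forall>x. \<psi> x \<noteq> 0 \<longrightarrow> (\<exists>y. f n y \<noteq> 0 \<and> dist x y \<le> d n)) \<and>
      (\<forall>x. \<forall>i\<in>Basis. \<bar>partial i \<psi> x\<bar> \<le> 2 * L) \<and>
      (\<forall>x r a b i. d n < r \<longrightarrow> (\<forall>y\<in>ball x r. f n y = a \<bullet> y + b) \<longrightarrow> partial i \<psi> x = a \<bullet> i)" for n
  proof (rule mollification[of "f n" "2 * L" dom_bound "d n", OF lipf suppf d(1)])
    fix \<psi> assume a: "\<And>k. Ck k \<psi>" "\<And>x. \<bar>\<psi> x - f n x\<bar> \<le> 2 * L * d n"
      "\<And>x. \<psi> x \<noteq> 0 \<Longrightarrow> \<exists>y. f n y \<noteq> 0 \<and> dist x y \<le> d n" "\<And>x i. i \<in> Basis \<Longrightarrow> \<bar>partial i \<psi> x\<bar> \<le> 2 * L"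
      "\<And>x r a b i. d n < r \<Longrightarrow> (\<And>y. y \<in> ball x r \<Longrightarrow> f n y = a \<bullet> y + b) \<Longrightarrow> partial i \<psi> x = a \<bullet> i"
    show ?thesis
    proof (intro exI[of _ \<psi>] conjI allI ballI impI)
      show "partial i \<psi> x = a \<bullet> i" if "d n < r" "\<forall>y\<in>ball x r. f n y = a \<bullet> y + b" for x r a b i
        by (rule a(5)[OF that(1)]) (rule bspec[OF that(2)])
    qed (fact a(1) a(2) | rule a(3), assumption | rule a(4), assumption)+
  qed
  then obtain \<psi> where \<psi>1: "\<And>n k. Ck k (\<psi> n)" and \<psi>2: "\<And>n x. \<bar>\<psi> n x - f n x\<bar> \<le> 2 * L * d n"
    and \<psi>3: "\<And>n x. \<psi> n x \<noteq> 0 \<Longrightarrow> \<exists>y. f n y \<noteq> 0 \<and> dist x y \<le> d n"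
    and \<psi>4: "\<And>n x i. i \<in> Basis \<Longrightarrow> \<bar>partial i (\<psi> n) x\<bar> \<le> 2 * L"
    and \<psi>5: "\<And>n x r a b i. d n < r \<Longrightarrow> (\<And>y. y \<in> ball x r \<Longrightarrow> f n y = a \<bullet> y + b) \<Longrightarrow> partial i (\<psi> n) x = a \<bullet> i"
    by metis
  have lim1: "(\<lambda>n. c / real (Suc n)) \<longlonglongrightarrow> 0" for c
    using LIMSEQ_Suc[OF lim_const_over_n[of c]] by simp
  show ?thesis
  proof (rule that[of \<psi> "B + 2 * L"])
    show "\<psi> n \<in> test_functions \<Omega>" for n
    proof -
      let ?S = "{x + y | x y. x \<in> C n \<and> y \<in> cball 0 (d n)}"
      have S: "compact ?S" by (intro compact_sums compC) auto
      have "{x. \<psi> n x \<noteq> 0} \<subseteq> ?S"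
      proof
        fix x assume "x \<in> {x. \<psi> n x \<noteq> 0}"
        then obtain y where y: "f n y \<noteq> 0" "dist x y \<le> d n" using \<psi>3 by blast
        then have "x = y + (x - y)" "y \<in> C n" "x - y \<in> cball 0 (d n)" using fC by (auto simp: dist_norm norm_minus_commute)
        then show "x \<in> ?S" by blast
      qed
      then have cl: "closure {x. \<psi> n x \<noteq> 0} \<subseteq> ?S"
        using S by (intro closure_minimal compact_imp_closed)
      have "?S \<subseteq> \<Omega>"
      proof
        fix z assume "z \<in> ?S"
        then obtain x y where "z = x + y" "x \<in> C n" "y \<in> cball 0 (d n)" by blast
        then have "z \<in> cball x (e n)" "x \<in> C n" using d(2)[of n] by (auto simp: dist_norm)
        then show "z \<in> \<Omega>" using e(2)[of n] by blast
      qed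
      with cl have "closure {x. \<psi> n x \<noteq> 0} \<subseteq> \<Omega>" by blast
      moreover have "compact (closure {x. \<psi> n x \<noteq> 0})"
        using cl S by (meson bounded_subset closed_closure compact_eq_bounded_closed)
      ultimately show ?thesis using \<psi>1 by (auto simp: test_functions_def)
    qed
    show "0 < B + 2 * L" using B L by simp
    show "\<bar>\<psi> n x\<bar> \<le> B + 2 * L" for n x
    proof -
      have "d n \<le> 1" using d(3)[of n] by (rule order_trans) simp
      then have "2 * L * d n \<le> 2 * L * 1" using L by (intro mult_left_mono) auto
      moreover have "\<bar>f n x\<bar> \<le> B" unfolding f_def by (rule bd)
      ultimately show ?thesis using \<psi>2[of n x] by linarith
    qed
    show "\<bar>partial i (\<psi> n) x\<bar> \<le> B + 2 * L" if "i \<in> Basis" for n x i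
      using \<psi>4[OF that, of n x] B by linarith
    show "(\<lambda>n. \<psi> n x) \<longlonglongrightarrow> \<eta> x" for x
    proof (rule LIM_zero_cancel, rule Lim_null_comparison)
      show "eventually (\<lambda>n. norm (\<psi> n x - \<eta> x) \<le> (2 * L + L * norm (x - p)) / real (Suc n)) sequentially"
      proof (rule always_eventually, rule allI)
        fix n
        have "\<bar>f n x - \<eta> x\<bar> \<le> L * dist (p + s n *\<^sub>R (x - p)) x" unfolding f_def by (rule lip)
        also have "p + s n *\<^sub>R (x - p) - x = (1 / real (Suc n)) *\<^sub>R (x - p)"
          unfolding s_def by (simp only: scaleR_add_left) simp
        then have "dist (p + s n *\<^sub>R (x - p)) x = norm (x - p) / real (Suc n)"
          by (simp only: dist_norm) simp
        also have "\<bar>\<psi> n x - f n x\<bar> \<le> 2 * L * (1 / real (Suc n))"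
          using \<psi>2[of n x] mult_left_mono[OF d(3)[of n], of "2 * L"] L by linarith
        ultimately have "\<bar>\<psi> n x - \<eta> x\<bar> \<le> 2 * L * (1 / real (Suc n)) + L * (norm (x - p) / real (Suc n))"
          by linarith
        then show "norm (\<psi> n x - \<eta> x) \<le> (2 * L + L * norm (x - p)) / real (Suc n)"
          by (simp add: add_divide_distrib)
      qed
    qed (rule lim1)
    show "(\<lambda>n. partial i (\<psi> n) x) \<longlonglongrightarrow> grad i \<eta> x" if x: "x \<in> cells" and i: "i \<in> Basis" for x i
    proof -
      obtain r a b where r: "0 < r" and ab': "\<forall>y\<in>ball x r. \<eta> y = a \<bullet> y + b"
        using X_locally_affine[OF \<eta> x] by blast
      note ab = bspec[OF ab']
      have g: "grad i \<eta> x = a \<bullet> i" by (rule grad_affine[OF x r ab])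
      define M where "M = 1 + norm (x - p) + r"
      have "eventually (\<lambda>n. M / real (Suc n) < r / 4) sequentially"
        using order_tendstoD(2)[OF lim1, of "r / 4" M] r by simp
      \<comment> \<open>Once dilation moves points near x by little compared with r,
        \<open>f n\<close> is affine with gradient \<open>s n *\<^sub>R a\<close> on a ball around x
        that is wider than the mollification radius.\<close>
      then have ev: "eventually (\<lambda>n. s n * (a \<bullet> i) = partial i (\<psi> n) x) sequentially"
      proof eventually_elim
        case (elim n)
        have "1 / real (Suc n) \<le> M / real (Suc n)" using r by (intro divide_right_mono) (auto simp: M_def)
        then have dn: "d n < r / 4" using elim d(3)[of n] by linarith
        have "partial i (\<psi> n) x = (s n *\<^sub>R a) \<bullet> i"
        proof (rule \<psi>5[OF dn, where b = "a \<bullet> (p - s n *\<^sub>R p) + b"])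
          fix y assume y: "y \<in> ball x (r / 4)"
          have "norm (y - p) \<le> M"
            using y norm_triangle_ineq[of "y - x" "x - p"] r by (simp add: M_def dist_norm norm_minus_commute)
          then have "norm (y - p) / real (Suc n) \<le> M / real (Suc n)" by (intro divide_right_mono) auto
          then have *: "norm (y - p) / real (Suc n) < r / 4" using elim by linarith
          have "p + s n *\<^sub>R (y - p) - x = (y - x) + (1 / real (Suc n)) *\<^sub>R (y - p)"
            unfolding s_def by (simp only: scaleR_add_left) simp
          then have "norm (p + s n *\<^sub>R (y - p) - x) \<le> norm (y - x) + norm ((1 / real (Suc n)) *\<^sub>R (y - p))"
            by (simp only: norm_triangle_ineq)
          also have "norm ((1 / real (Suc n)) *\<^sub>R (y - p)) = norm (y - p) / real (Suc n)" by simp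
          finally have "norm (p + s n *\<^sub>R (y - p) - x) \<le> norm (y - x) + norm (y - p) / real (Suc n)" .
          moreover have "norm (y - x) < r / 4" using y by (simp add: dist_norm norm_minus_commute)
          ultimately have "norm (p + s n *\<^sub>R (y - p) - x) < r" using * r by linarith
          then have "p + s n *\<^sub>R (y - p) \<in> ball x r"
            by (simp only: mem_ball dist_norm norm_minus_commute[of x])
          from ab[OF this] show "f n y = (s n *\<^sub>R a) \<bullet> y + (a \<bullet> (p - s n *\<^sub>R p) + b)"
            by (simp add: f_def inner_add_right inner_diff_right algebra_simps)
        qed
        then show ?case by simp
      qed
      have "(\<lambda>n. s n * (a \<bullet> i)) \<longlonglongrightarrow> (1 + 0) * (a \<bullet> i)"
        unfolding s_def by (intro tendsto_intros lim1)
      from Lim_transform_eventually[OF this ev] show ?thesis by (simp only: g add_0_right mult_1)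
    qed
  qed
qed

end

section \<open>Weak derivatives of finite element functions\<close>

context fe_space
begin

lemma lborel_integral_shift:
  fixes g :: "'a \<Rightarrow> real"
  assumes [measurable]: "g \<in> borel_measurable borel"
  shows "(\<integral>x. g (x + h) \<partial>lborel) = (\<integral>x. g x \<partial>lborel)"
proof -
  have "(\<integral>x. g x \<partial>lborel) = (\<integral>x. g x \<partial>(distr lborel borel ((+) h)))" by (simp add: lborel_distr_plus)
  also have "\<dots> = (\<integral>x. g (h + x) \<partial>lborel)" by (subst integral_distr) simp_all
  finally show ?thesis by (simp add: add.commute)
qed

lemma integral_dom:
  fixes f :: "'a \<Rightarrow> real"
  assumes f: "f \<in> borel_measurable borel" and z: "\<And>x. x \<notin> \<Omega> \<Longrightarrow> f x = 0"
  shows "(\<integral>x. f x \<partial>(lebesgue_on \<Omega>)) = (\<integral>x. f x \<partial>lborel)"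
proof -
  have "(\<integral>x. f x \<partial>(lebesgue_on \<Omega>)) = (\<integral>x. indicator \<Omega> x *\<^sub>R f x \<partial>lebesgue)"
    by (intro integral_restrict_space) (use open_dom in auto)
  also have "(\<lambda>x. indicator \<Omega> x *\<^sub>R f x) = f"
    using z by (auto simp: indicator_def fun_eq_iff)
  also have "(\<integral>x. f x \<partial>lebesgue) = (\<integral>x. f x \<partial>lborel)"
    using f by (intro integral_completion) simp
  finally show ?thesis .
qed

lemma measurable_dom: "f \<in> borel_measurable borel \<Longrightarrow> f \<in> borel_measurable (lebesgue_on \<Omega>)"
  by (intro measurable_restrict_space1 measurable_completion) simp

lemma finite_dom: "emeasure (lebesgue_on \<Omega>) (space (lebesgue_on \<Omega>)) < \<infinity>"
proof -
  have "\<Omega> \<in> lmeasurable" using open_dom bounded_dom by (intro lmeasurable_open)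
  then show ?thesis using open_dom by (simp add: emeasure_restrict_space fmeasurable_def space_restrict_space)
qed

lemma integrable_bounded:
  fixes f :: "'a \<Rightarrow> real"
  assumes "f \<in> borel_measurable (lebesgue_on \<Omega>)" "\<And>x. \<bar>f x\<bar> \<le> B"
  shows "integrable (lebesgue_on \<Omega>) f"
proof (rule Bochner_Integration.integrable_bound)
  show "integrable (lebesgue_on \<Omega>) (\<lambda>_. B)"
    by (rule finite_measure.integrable_const, rule finite_measureI) (use finite_dom in auto)
qed (use assms in \<open>auto intro: order_trans[OF _ abs_ge_self]\<close>)

lemma L2_integrable:
  assumes "w \<in> L2 \<Omega>"
  shows "integrable (lebesgue_on \<Omega>) w"
proof (rule Bochner_Integration.integrable_bound)
  have "integrable (lebesgue_on \<Omega>) (\<lambda>_. 1::real)" by (rule integrable_bounded[of _ 1]) auto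
  then show "integrable (lebesgue_on \<Omega>) (\<lambda>x. 1 + (w x)\<^sup>2)"
    using assms by (intro Bochner_Integration.integrable_add) (auto simp: L2_def)
  have "\<bar>t\<bar> \<le> 1 + t\<^sup>2" for t :: real
  proof -
    have "0 \<le> (\<bar>t\<bar> - 1)\<^sup>2" by simp
    then show ?thesis by (simp add: power2_diff)
  qed
  then show "AE x in lebesgue_on \<Omega>. norm (w x) \<le> norm (1 + (w x)\<^sup>2)" by (auto simp: abs_of_nonneg add_nonneg_nonneg)
qed (use assms in \<open>auto simp: L2_def\<close>)

lemma L2_times_bounded:
  assumes "w \<in> L2 \<Omega>" "f \<in> borel_measurable (lebesgue_on \<Omega>)" "\<And>x. \<bar>f x\<bar> \<le> B"
  shows "integrable (lebesgue_on \<Omega>) (\<lambda>x. w x * f x)"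
proof (rule Bochner_Integration.integrable_bound)
  show "integrable (lebesgue_on \<Omega>) (\<lambda>x. B * w x)"
    using L2_integrable[OF assms(1)] by simp
  have "\<bar>w x\<bar> * \<bar>f x\<bar> \<le> \<bar>B\<bar> * \<bar>w x\<bar>" for x
    using assms(3)[of x] mult_right_mono[of "\<bar>f x\<bar>" "\<bar>B\<bar>" "\<bar>w x\<bar>"] by (simp add: mult.commute)
  then show "AE x in lebesgue_on \<Omega>. norm (w x * f x) \<le> norm (B * w x)" by (simp add: abs_mult)
qed (use assms in \<open>auto simp: L2_def\<close>)

lemma bounded_L2:
  assumes f: "f \<in> borel_measurable (lebesgue_on \<Omega>)" and B: "\<And>x. \<bar>f x\<bar> \<le> B"
  shows "f \<in> L2 \<Omega>"
proof -
  have "\<bar>(f x)\<^sup>2\<bar> \<le> B\<^sup>2" for x using B[of x] by (simp add: abs_le_square_iff[symmetric])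
  then have "integrable (lebesgue_on \<Omega>) (\<lambda>x. (f x)\<^sup>2)" by (intro integrable_bounded) (use f in auto)
  then show ?thesis using f by (simp add: L2_def)
qed

text \<open>\<Omega> is bounded, so w is integrable and B times its modulus is a majorant.\<close>

lemma L2_dominated:
  assumes w: "w \<in> L2 \<Omega>" and f: "\<And>n. f n \<in> borel_measurable (lebesgue_on \<Omega>)" "g \<in> borel_measurable (lebesgue_on \<Omega>)"
    and B: "\<And>n x. \<bar>f n x\<bar> \<le> B" and lim: "AE x in lebesgue_on \<Omega>. (\<lambda>n. f n x) \<longlonglongrightarrow> g x"
  shows "(\<lambda>n. L2_inner \<Omega> w (f n)) \<longlonglongrightarrow> L2_inner \<Omega> w g"
  unfolding L2_inner_def
proof (rule integral_dominated_convergence)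
  show "integrable (lebesgue_on \<Omega>) (\<lambda>x. B * \<bar>w x\<bar>)"
    using L2_integrable[OF w] by simp
  show "AE x in lebesgue_on \<Omega>. (\<lambda>n. w x * f n x) \<longlonglongrightarrow> w x * g x"
    using lim by (rule AE_mp) (auto intro!: AE_I2 tendsto_intros)
  show "AE x in lebesgue_on \<Omega>. norm (w x * f n x) \<le> B * \<bar>w x\<bar>" for n
  proof (rule AE_I2)
    fix x show "norm (w x * f n x) \<le> B * \<bar>w x\<bar>"
      using mult_right_mono[OF B[of n x], of "\<bar>w x\<bar>"] by (simp add: abs_mult mult.commute)
  qed
qed (use w f in \<open>auto simp: L2_def\<close>)

lemma test_Ck: "\<phi> \<in> test_functions \<Omega> \<Longrightarrow> Ck k \<phi>"
  by (simp add: test_functions_def)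

lemma test_continuous: "\<phi> \<in> test_functions \<Omega> \<Longrightarrow> continuous_on UNIV \<phi>"
  by (rule Ck_continuous[OF test_Ck])

lemma test_partial_continuous: "\<phi> \<in> test_functions \<Omega> \<Longrightarrow> i \<in> Basis \<Longrightarrow> continuous_on UNIV (partial i \<phi>)"
  using test_Ck[of \<phi> "Suc 0"] by simp

lemma test_outside: "\<phi> \<in> test_functions \<Omega> \<Longrightarrow> x \<notin> \<Omega> \<Longrightarrow> \<phi> x = 0"
  using closure_subset[of "{x. \<phi> x \<noteq> 0}"] by (auto simp: test_functions_def)

lemma test_partial_outside:
  assumes \<phi>: "\<phi> \<in> test_functions \<Omega>" and x: "x \<notin> \<Omega>"
  shows "partial i \<phi> x = 0"
proof -
  let ?S = "closure {x. \<phi> x \<noteq> 0}"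
  have x': "x \<in> - ?S" using \<phi> x by (auto simp: test_functions_def)
  have "((\<lambda>_. 0) has_derivative (\<lambda>_. 0)) (at x)" by simp
  then have "(\<phi> has_derivative (\<lambda>_. 0)) (at x)"
  proof (rule has_derivative_transform_within_open)
    show "open (- ?S)" by (rule open_Compl[OF closed_closure])
    show "0 = \<phi> y" if "y \<in> - ?S" for y
      using that closure_subset[of "{x. \<phi> x \<noteq> 0}"] by auto
  qed (rule x')
  then show ?thesis by (rule partial_eqI)
qed

lemma bounded_continuous_supported:
  assumes "continuous_on UNIV f" "\<And>x. x \<notin> \<Omega> \<Longrightarrow> f x = (0::real)"
  shows "\<exists>B>0. \<forall>x. \<bar>f x\<bar> \<le> B"
proof -
  have "compact (f ` closure \<Omega>)"
    by (intro compact_continuous_image continuous_on_subset[OF assms(1)] compact_closure) auto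
  then obtain B where B: "0 < B" "\<forall>z\<in>f ` closure \<Omega>. norm z \<le> B"
    using compact_imp_bounded bounded_pos by blast
  have "\<bar>f x\<bar> \<le> B" for x
  proof (cases "x \<in> \<Omega>")
    case True
    then show ?thesis using B closure_subset[of \<Omega>] by auto
  qed (use assms(2) B in simp)
  with B show ?thesis by (intro exI[of _ B]) simp
qed

lemma integrable_dom_product:
  assumes "f \<in> borel_measurable borel" "g \<in> borel_measurable borel" "\<And>x. \<bar>f x\<bar> \<le> B" "\<And>x. \<bar>g x\<bar> \<le> C"
    "\<And>x. x \<notin> \<Omega> \<Longrightarrow> g x = (0::real)"
  shows "integrable lborel (\<lambda>x. f x * g x)"
proof -
  have "\<bar>f x * g x\<bar> \<le> \<bar>B\<bar> * \<bar>C\<bar>" for x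
    unfolding abs_mult using assms(3,4)[of x] by (intro mult_mono) auto
  moreover have [measurable]: "f \<in> borel_measurable borel" "g \<in> borel_measurable borel" by fact+
  ultimately have "integrable (lebesgue_on \<Omega>) (\<lambda>x. f x * g x)"
    by (intro integrable_bounded[of _ "\<bar>B\<bar> * \<bar>C\<bar>"] measurable_dom) auto
  then have "integrable lebesgue (\<lambda>x. indicator \<Omega> x *\<^sub>R (f x * g x))"
    using open_dom by (subst (asm) integrable_restrict_space) auto
  also have "(\<lambda>x. indicator \<Omega> x *\<^sub>R (f x * g x)) = (\<lambda>x. f x * g x)"
    using assms(5) by (auto simp: indicator_def fun_eq_iff)
  finally show ?thesis by (subst (asm) integrable_completion) auto
qed

text \<open>
  Integration by parts: move the difference quotient from one factor to the other by translation
  invariance and let the step tend to \<open>0\<close>.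
\<close>

lemma X_weak_partial:
  assumes \<eta>: "\<eta> \<in> X" and i: "i \<in> Basis"
  shows "is_weak_partial \<Omega> i \<eta> (grad i \<eta>)"
  unfolding is_weak_partial_def
proof
  fix \<phi> assume \<phi>: "\<phi> \<in> test_functions \<Omega>"
  obtain L where L: "0 < L" and lip: "\<And>x y. \<bar>\<eta> x - \<eta> y\<bar> \<le> L * dist x y" using X_lipschitz[OF \<eta>] by auto
  obtain B where B: "0 < B" "\<And>x. \<bar>\<eta> x\<bar> \<le> B" using X_bounded[OF \<eta>] by auto
  obtain C where C: "0 < C" "\<And>x. \<bar>\<phi> x\<bar> \<le> C"
    using bounded_continuous_supported[OF test_continuous[OF \<phi>] test_outside[OF \<phi>]] by auto
  obtain D where D: "0 < D" "\<And>x. \<bar>partial i \<phi> x\<bar> \<le> D"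
    using bounded_continuous_supported[OF test_partial_continuous[OF \<phi> i] test_partial_outside[OF \<phi>]] by auto
  have m [measurable]: "\<eta> \<in> borel_measurable borel" "\<phi> \<in> borel_measurable borel"
    "partial i \<phi> \<in> borel_measurable borel" "grad i \<eta> \<in> borel_measurable borel"
    using X_continuous[OF \<eta>] test_continuous[OF \<phi>] test_partial_continuous[OF \<phi> i] grad_measurable[OF \<eta>]
    by (auto intro: borel_measurable_continuous_onI)
  define h where "h n = 1 / real (Suc n)" for n
  have h: "0 < h n" for n by (simp add: h_def)
  define a where "a n x = real (Suc n) * (\<eta> (x + h n *\<^sub>R i) - \<eta> x)" for n x
  define b where "b n x = real (Suc n) * (\<phi> x - \<phi> (x - h n *\<^sub>R i))" for n x
  have a_le: "\<bar>a n x\<bar> \<le> L" for n x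
  proof -
    have "\<bar>\<eta> (x + h n *\<^sub>R i) - \<eta> x\<bar> \<le> L * h n"
      using lip[of "x + h n *\<^sub>R i" x] i h[of n] by (simp add: dist_norm)
    then show ?thesis unfolding a_def abs_mult h_def by (simp add: field_simps del: of_nat_Suc)
  qed
  have der: "((\<lambda>t. \<phi> (x + t *\<^sub>R i)) has_real_derivative partial i \<phi> (x + t *\<^sub>R i)) (at t)" for x t
  proof -
    have "((\<lambda>t. x + t *\<^sub>R i) has_derivative (\<lambda>t. t *\<^sub>R i)) (at t)"
      by (auto intro!: derivative_eq_intros)
    note has_derivative_compose[OF this differentiable_partial[OF Ck_differentiable[OF test_Ck[OF \<phi>]]]]
    moreover have "partial (s *\<^sub>R i) \<phi> y = partial i \<phi> y * s" for s y
      using linear_cmul[OF has_derivative_linear[OF differentiable_partial[OF Ck_differentiable[OF test_Ck[OF \<phi>]]]], of s i y] by simp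
    ultimately show ?thesis by (simp add: has_field_derivative_def mult_commute_abs)
  qed
  \<comment> \<open>The mean value theorem yields the uniform bound on the difference quotients of
    \<phi> and, as the derivative is continuous, also their limit.\<close>
  have b_mvt: "\<exists>z. - h n < z \<and> z < 0 \<and> b n x = partial i \<phi> (x + z *\<^sub>R i)" for n x
  proof -
    obtain z where z: "- h n < z" "z < 0" "\<phi> (x + 0 *\<^sub>R i) - \<phi> (x + (- h n) *\<^sub>R i) = (0 - (- h n)) * partial i \<phi> (x + z *\<^sub>R i)"
      using MVT2[of "- h n" 0 "\<lambda>t. \<phi> (x + t *\<^sub>R i)" "\<lambda>t. partial i \<phi> (x + t *\<^sub>R i)"] h[of n] der by auto
    have "b n x = real (Suc n) * (h n * partial i \<phi> (x + z *\<^sub>R i))" using z(3) by (simp add: b_def)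
    also have "\<dots> = partial i \<phi> (x + z *\<^sub>R i)" by (simp add: h_def del: of_nat_Suc)
    finally show ?thesis using z by blast
  qed
  have b_le: "\<bar>b n x\<bar> \<le> D" for n x
    using b_mvt[of n x] D(2) by auto
  have b_lim: "(\<lambda>n. b n x) \<longlonglongrightarrow> partial i \<phi> x" for x
  proof -
    obtain z where z: "\<And>n. - h n < z n" "\<And>n. z n < 0" "\<And>n. b n x = partial i \<phi> (x + z n *\<^sub>R i)"
      using b_mvt[of _ x] by metis
    have h0: "h \<longlonglongrightarrow> 0" unfolding h_def using LIMSEQ_Suc[OF lim_const_over_n[of 1]] by simp
    have "z \<longlonglongrightarrow> 0"
      by (rule tendsto_sandwich[where f = "\<lambda>n. - h n" and h = "\<lambda>_. 0"])
        (use z tendsto_minus[OF h0] in \<open>auto intro!: always_eventually less_imp_le\<close>)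
    then have "(\<lambda>n. x + z n *\<^sub>R i) \<longlonglongrightarrow> x + 0 *\<^sub>R i" by (intro tendsto_intros)
    then have "(\<lambda>n. partial i \<phi> (x + z n *\<^sub>R i)) \<longlonglongrightarrow> partial i \<phi> x"
      using continuous_on_tendsto_compose[OF test_partial_continuous[OF \<phi> i], of "\<lambda>n. x + z n *\<^sub>R i" x sequentially] by simp
    then show ?thesis by (simp only: z(3))
  qed
  have ma [measurable]: "a n \<in> borel_measurable borel" for n unfolding a_def by measurable
  have mb [measurable]: "b n \<in> borel_measurable borel" for n unfolding b_def by measurable
  \<comment> \<open>Translating one of the products by the step turns the forward difference of
    \<eta> into the backward difference of \<phi>.\<close>
  have disc: "(\<integral>x. a n x * \<phi> x \<partial>lborel) = - (\<integral>x. \<eta> x * b n x \<partial>lborel)" for n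
  proof -
    have i1: "integrable lborel (\<lambda>x. \<eta> (x + h n *\<^sub>R i) * \<phi> x)"
      by (rule integrable_dom_product[of _ _ B C]) (use B C test_outside[OF \<phi>] in auto)
    have i2: "integrable lborel (\<lambda>x. \<eta> x * \<phi> x)"
      by (rule integrable_dom_product[of _ _ B C]) (use B C test_outside[OF \<phi>] in auto)
    have i3: "integrable lborel (\<lambda>x. \<phi> (x - h n *\<^sub>R i) * \<eta> x)"
      by (rule integrable_dom_product[of _ _ C B]) (use B C X_outside[OF \<eta>] in auto)
    have shift: "(\<integral>x. \<eta> (x + h n *\<^sub>R i) * \<phi> x \<partial>lborel) = (\<integral>x. \<phi> (x - h n *\<^sub>R i) * \<eta> x \<partial>lborel)"
      using lborel_integral_shift[of "\<lambda>x. \<phi> (x - h n *\<^sub>R i) * \<eta> x" "h n *\<^sub>R i"] by (simp add: mult.commute)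
    have "(\<integral>x. a n x * \<phi> x \<partial>lborel) = (\<integral>x. real (Suc n) * (\<eta> (x + h n *\<^sub>R i) * \<phi> x - \<eta> x * \<phi> x) \<partial>lborel)"
      by (simp only: a_def left_diff_distrib mult.assoc)
    also have "\<dots> = real (Suc n) * ((\<integral>x. \<phi> (x - h n *\<^sub>R i) * \<eta> x \<partial>lborel) - (\<integral>x. \<eta> x * \<phi> x \<partial>lborel))"
      by (simp only: integral_mult_right_zero Bochner_Integration.integral_diff[OF i1 i2] shift)
    finally have l: "(\<integral>x. a n x * \<phi> x \<partial>lborel) =
        real (Suc n) * ((\<integral>x. \<phi> (x - h n *\<^sub>R i) * \<eta> x \<partial>lborel) - (\<integral>x. \<eta> x * \<phi> x \<partial>lborel))" .
    have "(\<lambda>x. \<eta> x * b n x) = (\<lambda>x. real (Suc n) * (\<eta> x * \<phi> x - \<phi> (x - h n *\<^sub>R i) * \<eta> x))"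
      by (rule ext) (simp only: b_def, simp add: algebra_simps)
    then have "(\<integral>x. \<eta> x * b n x \<partial>lborel) = real (Suc n) * ((\<integral>x. \<eta> x * \<phi> x \<partial>lborel) - (\<integral>x. \<phi> (x - h n *\<^sub>R i) * \<eta> x \<partial>lborel))"
      by (simp only: integral_mult_right_zero Bochner_Integration.integral_diff[OF i2 i3])
    with l show ?thesis by (simp only: mult_minus_right[symmetric] minus_diff_eq)
  qed
  have \<phi>L2: "\<phi> \<in> L2 \<Omega>" "\<eta> \<in> L2 \<Omega>"
    using B C by (auto intro!: bounded_L2 measurable_dom m)
  have dom1: "L2_inner \<Omega> \<phi> (a n) = (\<integral>x. a n x * \<phi> x \<partial>lborel)" for n
    unfolding L2_inner_def by (subst integral_dom) (auto simp: test_outside[OF \<phi>] mult.commute)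
  have dom2: "L2_inner \<Omega> \<eta> (b n) = (\<integral>x. \<eta> x * b n x \<partial>lborel)" for n
    unfolding L2_inner_def by (subst integral_dom) (auto simp: X_outside[OF \<eta>])
  have "(\<lambda>n. L2_inner \<Omega> \<phi> (a n)) \<longlonglongrightarrow> L2_inner \<Omega> \<phi> (grad i \<eta>)"
  proof (rule L2_dominated[OF \<phi>L2(1) _ _ a_le])
    show "AE x in lebesgue_on \<Omega>. (\<lambda>n. a n x) \<longlonglongrightarrow> grad i \<eta> x"
      using AE_cells by (rule AE_mp) (auto intro!: AE_I2 simp: a_def h_def intro: grad_tendsto(1)[OF \<eta>] simp del: of_nat_Suc)
  qed (auto intro!: measurable_dom)
  moreover have "(\<lambda>n. L2_inner \<Omega> \<eta> (b n)) \<longlonglongrightarrow> L2_inner \<Omega> \<eta> (partial i \<phi>)"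
    by (rule L2_dominated[OF \<phi>L2(2) _ _ b_le]) (auto intro!: measurable_dom b_lim)
  then have "(\<lambda>n. L2_inner \<Omega> \<phi> (a n)) \<longlonglongrightarrow> - L2_inner \<Omega> \<eta> (partial i \<phi>)"
    unfolding dom1 disc dom2[symmetric] by (rule tendsto_minus)
  ultimately have "L2_inner \<Omega> \<phi> (grad i \<eta>) = - L2_inner \<Omega> \<eta> (partial i \<phi>)"
    by (rule LIMSEQ_unique)
  then show "L2_inner \<Omega> \<eta> (partial i \<phi>) = - L2_inner \<Omega> (grad i \<eta>) \<phi>"
    by (simp add: L2_inner_def mult.commute)
qed

text \<open>The defining identity of the weak derivative passes from test functions to \<eta> along
  \<open>X_approximation\<close>, whose gradients are bounded and converge off the null set between
  the cells.\<close>

lemma weak_partial_test_X: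
  assumes w: "w \<in> L2 \<Omega>" and g: "g \<in> L2 \<Omega>" and wg: "is_weak_partial \<Omega> i w g" and \<eta>: "\<eta> \<in> X" and i: "i \<in> Basis"
  shows "L2_inner \<Omega> w (grad i \<eta>) = - L2_inner \<Omega> g \<eta>"
proof -
  obtain \<psi> B where \<psi>: "\<And>n. \<psi> n \<in> test_functions \<Omega>" "0 < B"
    "\<And>n x. \<bar>\<psi> n x\<bar> \<le> B" "\<And>n x i. i \<in> Basis \<Longrightarrow> \<bar>partial i (\<psi> n) x\<bar> \<le> B"
    "\<And>x. (\<lambda>n. \<psi> n x) \<longlonglongrightarrow> \<eta> x"
    "\<And>x i. x \<in> cells \<Longrightarrow> i \<in> Basis \<Longrightarrow> (\<lambda>n. partial i (\<psi> n) x) \<longlonglongrightarrow> grad i \<eta> x"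
    by (rule X_approximation[OF \<eta>]) blast
  have "(\<lambda>n. L2_inner \<Omega> w (partial i (\<psi> n))) \<longlonglongrightarrow> L2_inner \<Omega> w (grad i \<eta>)"
  proof (rule L2_dominated[OF w])
    show "AE x in lebesgue_on \<Omega>. (\<lambda>n. partial i (\<psi> n) x) \<longlonglongrightarrow> grad i \<eta> x"
      using AE_cells by (rule AE_mp) (intro AE_I2 impI \<psi>(6) i)
    show "\<bar>partial i (\<psi> n) x\<bar> \<le> B" for n x by (rule \<psi>(4)[OF i])
  qed (intro measurable_dom borel_measurable_continuous_onI test_partial_continuous[OF \<psi>(1) i] grad_measurable[OF \<eta>])+
  moreover have "(\<lambda>n. L2_inner \<Omega> g (\<psi> n)) \<longlonglongrightarrow> L2_inner \<Omega> g \<eta>"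
  proof (rule L2_dominated[OF g])
    show "AE x in lebesgue_on \<Omega>. (\<lambda>n. \<psi> n x) \<longlonglongrightarrow> \<eta> x" by (intro AE_I2 \<psi>(5))
    show "\<bar>\<psi> n x\<bar> \<le> B" for n x by (rule \<psi>(3))
  qed (intro measurable_dom borel_measurable_continuous_onI test_continuous[OF \<psi>(1)] X_continuous[OF \<eta>])+
  then have "(\<lambda>n. - L2_inner \<Omega> g (\<psi> n)) \<longlonglongrightarrow> - L2_inner \<Omega> g \<eta>" by (rule tendsto_minus)
  moreover have "- L2_inner \<Omega> g (\<psi> n) = L2_inner \<Omega> w (partial i (\<psi> n))" for n
    using wg \<psi>(1)[of n] unfolding is_weak_partial_def by simp
  ultimately show ?thesis using LIMSEQ_unique by (simp only:) 
qed

end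

section \<open>The fundamental lemma of the calculus of variations\<close>

context fe_space
begin

text \<open>The fundamental lemma: test functions detect compact sets, and these exhaust \<open>{g > 0}\<close>.\<close>

lemma compact_indicator_approx:
  assumes K: "compact K" "K \<subseteq> \<Omega>"
  shows "\<exists>\<psi>. (\<forall>n. \<psi> n \<in> test_functions \<Omega>) \<and> (\<forall>n x. \<bar>\<psi> n x\<bar> \<le> 2) \<and>
    (\<forall>x. (\<lambda>n. \<psi> n x) \<longlonglongrightarrow> indicator K x)"
proof (cases "K = {}")
  case True
  have "(\<lambda>_. 0) \<in> test_functions \<Omega>" by (simp add: test_functions_def Ck_const)
  then show ?thesis using True by (intro exI[of _ "\<lambda>_ _. 0"]) auto
next
  case False
  obtain e where e: "0 < e" "(\<Union>x\<in>K. cball x e) \<subseteq> \<Omega>"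
    using compact_subset_open_imp_cball_epsilon_subset[OF K(1) open_dom K(2)] by metis
  \<comment> \<open>From index N on, a collar of width 2 / m around K stays in \<Omega>: 1 / m for
    the tent function and 1 / m for its mollification.\<close>
  obtain N :: nat where N: "2 / e < real N" using reals_Archimedean2 by blast
  have N0: "0 < N" using N e by (cases N) (auto simp: divide_less_0_iff not_less)
  define m where "m n = real (N + n)" for n
  have m: "0 < m n" "2 / m n < e" "1 \<le> m n" for n
  proof -
    have "real N \<le> m n" "1 \<le> real N" using N0 by (auto simp: m_def)
    then show "0 < m n" "1 \<le> m n" by linarith+
    have "2 / e < m n" using N \<open>real N \<le> m n\<close> by linarith
    then show "2 / m n < e" using e \<open>0 < m n\<close> by (simp add: field_simps)
  qed
  define f where "f n x = max 0 (1 - m n * infdist x K)" for n x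
  have lip: "\<bar>f n x - f n y\<bar> \<le> m n * dist x y" for n x y
  proof -
    have "\<bar>f n x - f n y\<bar> \<le> \<bar>m n * infdist x K - m n * infdist y K\<bar>" unfolding f_def by linarith
    also have "\<dots> = m n * \<bar>infdist x K - infdist y K\<bar>" using m(1)[of n] by (simp add: abs_mult flip: right_diff_distrib)
    also have "\<bar>infdist x K - infdist y K\<bar> \<le> dist x y"
      using infdist_triangle[of x K y] infdist_triangle[of y K x] by (simp add: dist_commute abs_le_iff)
    finally show ?thesis using m(1)[of n] by simp
  qed
  have fz: "infdist x K < 1 / m n" if "f n x \<noteq> 0" for n x
  proof -
    have "m n * infdist x K < 1" using that by (auto simp: f_def max_def split: if_splits)
    then show ?thesis using m(1)[of n] by (simp add: field_simps)
  qed
  have near: "\<exists>z\<in>K. dist x z < 1 / m n" if "f n x \<noteq> 0" for n x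
  proof -
    obtain z where "z \<in> K" "infdist x K = dist x z"
      using infdist_attains_inf[OF compact_imp_closed[OF K(1)] False] by metis
    then show ?thesis using fz[OF that] by auto
  qed
  have supp: "norm x \<le> dom_bound" if "f n x \<noteq> 0" for n x
  proof -
    obtain z where z: "z \<in> K" "dist x z < 1 / m n" using near[OF \<open>f n x \<noteq> 0\<close>] by blast
    have "1 / m n \<le> 2 / m n" using m(1)[of n] by (intro divide_right_mono) auto
    then have "x \<in> cball z e" using z m(2)[of n] by (simp add: dist_commute)
    then have "x \<in> \<Omega>" using e z by blast
    then show ?thesis using closure_subset by (intro dom_bound(2)) blast
  qed
  \<comment> \<open>\<open>f n\<close> has Lipschitz constant \<open>m n\<close>, so the radius 1 /
    m^2 leaves a mollification error of 1 / m.\<close>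
  define d where "d n = 1 / (m n * m n)" for n
  have d: "0 < d n" "d n \<le> 1 / m n" "m n * d n = 1 / m n" for n
    using m(1,3)[of n] by (auto simp: d_def field_simps)
  have "\<exists>\<psi>. (\<forall>k. Ck k \<psi>) \<and> (\<forall>x. \<bar>\<psi> x - f n x\<bar> \<le> m n * d n) \<and>
      (\<forall>x. \<psi> x \<noteq> 0 \<longrightarrow> (\<exists>y. f n y \<noteq> 0 \<and> dist x y \<le> d n))" for n
  proof (rule mollification[of "f n" "m n" dom_bound "d n", OF lip supp d(1)])
    fix \<psi> assume a: "\<And>k. Ck k \<psi>" "\<And>x. \<bar>\<psi> x - f n x\<bar> \<le> m n * d n"
      "\<And>x. \<psi> x \<noteq> 0 \<Longrightarrow> \<exists>y. f n y \<noteq> 0 \<and> dist x y \<le> d n"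
    show ?thesis
      by (intro exI[of _ \<psi>] conjI allI impI) (fact a(1) a(2) | rule a(3), assumption)+
  qed
  then obtain \<psi> where \<psi>1: "\<And>n k. Ck k (\<psi> n)" and \<psi>2: "\<And>n x. \<bar>\<psi> n x - f n x\<bar> \<le> m n * d n"
    and \<psi>3: "\<And>n x. \<psi> n x \<noteq> 0 \<Longrightarrow> \<exists>y. f n y \<noteq> 0 \<and> dist x y \<le> d n"
    by metis
  have lim0: "(\<lambda>n. 1 / m n) \<longlonglongrightarrow> 0"
    using LIMSEQ_ignore_initial_segment[OF lim_const_over_n[of 1], of N] by (simp add: m_def add.commute)
  show ?thesis
  proof (intro exI[of _ \<psi>] conjI allI)
    fix n
    let ?S = "{x + y | x y. x \<in> K \<and> y \<in> cball 0 (2 / m n)}"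
    have S: "compact ?S" by (intro compact_sums K) auto
    have "{x. \<psi> n x \<noteq> 0} \<subseteq> ?S"
    proof
      fix x assume "x \<in> {x. \<psi> n x \<noteq> 0}"
      then obtain y where y: "f n y \<noteq> 0" "dist x y \<le> d n" using \<psi>3 by blast
      obtain z where z: "z \<in> K" "dist y z < 1 / m n" using near[OF y(1)] by blast
      have "dist x z \<le> 1 / m n + 1 / m n"
        using y z d(2)[of n] dist_triangle[of x z y] by linarith
      then have "x = z + (x - z)" "x - z \<in> cball 0 (2 / m n)" by (auto simp: dist_norm norm_minus_commute)
      then show "x \<in> ?S" using z(1) by blast
    qed
    then have cl: "closure {x. \<psi> n x \<noteq> 0} \<subseteq> ?S"
      using S by (intro closure_minimal compact_imp_closed)
    have "?S \<subseteq> \<Omega>"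
    proof
      fix z assume "z \<in> ?S"
      then obtain x y where "z = x + y" "x \<in> K" "y \<in> cball 0 (2 / m n)" by blast
      then have "z \<in> cball x e" "x \<in> K" using m(2)[of n] by (auto simp: dist_norm)
      then show "z \<in> \<Omega>" using e(2) by blast
    qed
    with cl have "closure {x. \<psi> n x \<noteq> 0} \<subseteq> \<Omega>" by blast
    moreover have "compact (closure {x. \<psi> n x \<noteq> 0})"
      using cl S by (meson bounded_subset closed_closure compact_eq_bounded_closed)
    ultimately show "\<psi> n \<in> test_functions \<Omega>" using \<psi>1 by (auto simp: test_functions_def)
  next
    fix n x
    have "f n x \<le> 1" "0 \<le> f n x"
      unfolding f_def using m(1)[of n] infdist_nonneg[of x K] by (auto simp: mult_nonneg_nonneg less_imp_le)
    moreover have "1 / m n \<le> 1" using m(3)[of n] by simp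
    ultimately show "\<bar>\<psi> n x\<bar> \<le> 2" using \<psi>2[of n x] unfolding d(3) by linarith
  next
    fix x
    have ev: "eventually (\<lambda>n. f n x = indicator K x) sequentially"
    proof (cases "x \<in> K")
      case True
      then show ?thesis by (simp add: f_def)
    next
      case x: False
      have pos: "0 < infdist x K"
        using x False compact_imp_closed[OF K(1)] by (simp add: infdist_pos_not_in_closed)
      have "eventually (\<lambda>n. 1 / m n < infdist x K) sequentially"
        by (rule order_tendstoD(2)[OF lim0 pos])
      then show ?thesis
      proof eventually_elim
        case (elim n)
        then have "1 < m n * infdist x K" using m(1)[of n] by (simp add: field_simps)
        then show ?case using x by (simp add: f_def)
      qed
    qed
    have "(\<lambda>n. \<psi> n x - f n x) \<longlonglongrightarrow> 0"
      by (rule Lim_null_comparison[OF _ lim0]) (use \<psi>2[of _ x] in \<open>auto simp: d(3)\<close>)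
    moreover have "(\<lambda>n. f n x) \<longlonglongrightarrow> indicator K x"
      by (rule tendsto_eventually[OF ev])
    ultimately have "(\<lambda>n. (\<psi> n x - f n x) + f n x) \<longlonglongrightarrow> 0 + indicator K x" by (rule tendsto_add)
    then show "(\<lambda>n. \<psi> n x) \<longlonglongrightarrow> indicator K x" by simp
  qed
qed

lemma fundamental_lemma_pos:
  assumes g: "g \<in> L2 \<Omega>" and z: "\<And>\<phi>. \<phi> \<in> test_functions \<Omega> \<Longrightarrow> L2_inner \<Omega> g \<phi> = 0"
  shows "AE x in lebesgue_on \<Omega>. g x \<le> 0"
proof -
  have comp: "L2_inner \<Omega> g (indicator K) = 0" if K: "compact K" "K \<subseteq> \<Omega>" for K
  proof -
    obtain \<psi> where \<psi>: "\<forall>n. \<psi> n \<in> test_functions \<Omega>" "\<forall>n x. \<bar>\<psi> n x\<bar> \<le> 2" "\<forall>x. (\<lambda>n. \<psi> n x) \<longlonglongrightarrow> indicator K x"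
      using compact_indicator_approx[OF K] by blast
    have "(\<lambda>n. L2_inner \<Omega> g (\<psi> n)) \<longlonglongrightarrow> L2_inner \<Omega> g (indicator K)"
    proof (rule L2_dominated[OF g])
      show "\<psi> n \<in> borel_measurable (lebesgue_on \<Omega>)" for n
        using \<psi>(1) by (intro measurable_dom borel_measurable_continuous_onI test_continuous) auto
      show "indicator K \<in> borel_measurable (lebesgue_on \<Omega>)"
        using compact_imp_closed[OF K(1)] by (intro measurable_dom borel_measurable_indicator) auto
      show "\<bar>\<psi> n x\<bar> \<le> 2" for n x using \<psi>(2) by simp
      show "AE x in lebesgue_on \<Omega>. (\<lambda>n. \<psi> n x) \<longlonglongrightarrow> indicator K x" using \<psi>(3) by simp
    qed
    then have "(\<lambda>n. 0) \<longlonglongrightarrow> L2_inner \<Omega> g (indicator K)" using z \<psi>(1) by simp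
    then show ?thesis by (simp add: LIMSEQ_const_iff)
  qed
  have gm: "g \<in> borel_measurable (lebesgue_on \<Omega>)" using g by (simp add: L2_def)
  have O: "\<Omega> \<in> sets lebesgue" using open_dom by auto
  define P where "P = {x \<in> \<Omega>. 0 < g x}"
  have "P \<in> sets (lebesgue_on \<Omega>)"
  proof -
    have "{x \<in> space (lebesgue_on \<Omega>). 0 < g x} \<in> sets (lebesgue_on \<Omega>)"
      using gm by (intro borel_measurable_less) auto
    then show ?thesis by (simp add: P_def space_restrict_space)
  qed
  then have P: "P \<in> sets lebesgue" using O by (subst (asm) sets_restrict_space_iff) auto
  \<comment> \<open>Inner regularity: up to a null set, P is a countable union of compact sets, on
    each of which g is positive and has integral 0.\<close>
  obtain N C where NC: "negligible N" "\<And>n::nat. compact (C n)" "P = (\<Union>n. C n) \<union> N"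
    using lebesgue_regular_inner[OF P] by metis
  have Cn: "C n \<in> null_sets lebesgue" for n
  proof -
    have sub: "C n \<subseteq> P" using NC(3) by blast
    have CO: "C n \<subseteq> \<Omega>" using sub by (auto simp: P_def)
    have Cs: "C n \<in> sets borel" using compact_imp_closed[OF NC(2)] by auto
    have ind: "indicator (C n) \<in> borel_measurable (lebesgue_on \<Omega>)"
      using Cs by (intro measurable_dom borel_measurable_indicator) auto
    have int: "integrable (lebesgue_on \<Omega>) (\<lambda>x. g x * indicator (C n) x)"
      by (rule L2_times_bounded[OF g ind, of 1]) (simp add: indicator_def)
    have nn: "AE x in lebesgue_on \<Omega>. 0 \<le> g x * indicator (C n) x"
      using sub by (intro AE_I2) (auto simp: P_def indicator_def less_imp_le)
    have "(\<integral>x. g x * indicator (C n) x \<partial>(lebesgue_on \<Omega>)) = 0"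
      using comp[OF NC(2) CO] by (simp add: L2_inner_def)
    then have "AE x in lebesgue_on \<Omega>. g x * indicator (C n) x = 0"
      using integral_nonneg_eq_0_iff_AE[OF int nn] by simp
    then have "AE x in lebesgue_on \<Omega>. x \<notin> C n"
      by (rule AE_mp) (use sub in \<open>auto intro!: AE_I2 simp: P_def indicator_def\<close>)
    then have "AE x in lebesgue. x \<in> \<Omega> \<longrightarrow> x \<notin> C n"
      using O by (subst (asm) AE_restrict_space_iff) auto
    then have "AE x in lebesgue. x \<notin> C n"
      by (rule AE_mp) (use CO in \<open>auto intro!: AE_I2\<close>)
    then show ?thesis using Cs by (subst AE_iff_null_sets) auto
  qed
  have "(\<Union>n. C n) \<in> null_sets lebesgue" using Cn by (rule null_sets_UN)
  then have "P \<in> null_sets lebesgue"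
    using NC(1,3) by (simp add: negligible_iff_null_sets null_sets.Un)
  then have "AE x in lebesgue. x \<notin> P" by (rule AE_not_in)
  then have "AE x in lebesgue. x \<in> \<Omega> \<longrightarrow> g x \<le> 0"
    by (rule AE_mp) (auto intro!: AE_I2 simp: P_def)
  then show ?thesis using O by (subst AE_restrict_space_iff) auto
qed

lemma fundamental_lemma:
  assumes g: "g \<in> L2 \<Omega>" and z: "\<And>\<phi>. \<phi> \<in> test_functions \<Omega> \<Longrightarrow> L2_inner \<Omega> g \<phi> = 0"
  shows "AE x in lebesgue_on \<Omega>. g x = 0"
proof -
  have "(\<lambda>x. - g x) \<in> L2 \<Omega>" using g by (simp add: L2_def)
  moreover have "L2_inner \<Omega> (\<lambda>x. - g x) \<phi> = 0" if "\<phi> \<in> test_functions \<Omega>" for \<phi>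
    using z[OF that] by (simp add: L2_inner_def)
  ultimately have "AE x in lebesgue_on \<Omega>. - g x \<le> 0" by (rule fundamental_lemma_pos)
  moreover have "AE x in lebesgue_on \<Omega>. g x \<le> 0" by (rule fundamental_lemma_pos[OF g z])
  ultimately show ?thesis by eventually_elim simp
qed

section \<open>Weak derivatives agree with the piecewise gradient\<close>

lemma L2_diff:
  assumes "f \<in> L2 \<Omega>" "g \<in> L2 \<Omega>"
  shows "(\<lambda>x. f x - g x) \<in> L2 \<Omega>"
proof -
  have "integrable (lebesgue_on \<Omega>) (\<lambda>x. (f x - g x)\<^sup>2)"
  proof (rule Bochner_Integration.integrable_bound)
    show "integrable (lebesgue_on \<Omega>) (\<lambda>x. 2 * (f x)\<^sup>2 + 2 * (g x)\<^sup>2)"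
      using assms by (intro Bochner_Integration.integrable_add integrable_mult_right) (auto simp: L2_def)
    have "(a - b)\<^sup>2 \<le> 2 * a\<^sup>2 + 2 * b\<^sup>2" for a b :: real
    proof -
      have "0 \<le> (a + b)\<^sup>2" by simp
      then show ?thesis by (simp add: power2_sum power2_diff)
    qed
    then show "AE x in lebesgue_on \<Omega>. norm ((f x - g x)\<^sup>2) \<le> norm (2 * (f x)\<^sup>2 + 2 * (g x)\<^sup>2)"
      by (auto intro!: AE_I2 order_trans[OF _ abs_ge_self])
  qed (use assms in \<open>auto simp: L2_def\<close>)
  then show ?thesis using assms by (auto simp: L2_def)
qed

lemma grad_L2:
  assumes \<eta>: "\<eta> \<in> X" and i: "i \<in> Basis"
  shows "grad i \<eta> \<in> L2 \<Omega>"
proof -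
  obtain L where L: "0 < L" and lip: "\<And>x y. \<bar>\<eta> x - \<eta> y\<bar> \<le> L * dist x y" using X_lipschitz[OF \<eta>] by auto
  show ?thesis
    using grad_bounded[OF lip \<eta> i] L by (intro bounded_L2[of _ L] measurable_dom grad_measurable \<eta>) auto
qed

lemma X_L2: "\<eta> \<in> X \<Longrightarrow> \<eta> \<in> L2 \<Omega>"
proof -
  assume \<eta>: "\<eta> \<in> X"
  obtain B where B: "0 < B" "\<And>x. \<bar>\<eta> x\<bar> \<le> B" using X_bounded[OF \<eta>] by auto
  show ?thesis
    using B by (intro bounded_L2[of _ B] measurable_dom borel_measurable_continuous_onI X_continuous \<eta>)
qed

lemma test_bounded:
  assumes "\<phi> \<in> test_functions \<Omega>"
  shows "\<exists>C>0. \<forall>x. \<bar>\<phi> x\<bar> \<le> C"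
  using bounded_continuous_supported[OF test_continuous[OF assms] test_outside[OF assms]] .

text \<open>\<open>weak_partial\<close> is a \<open>SOME\<close>; the fundamental lemma identifies
  whatever was chosen with \<open>grad\<close> almost everywhere.\<close>

lemma weak_partial_X:
  assumes \<eta>: "\<eta> \<in> X" and i: "i \<in> Basis"
  shows "weak_partial \<Omega> i \<eta> \<in> L2 \<Omega>" "AE x in lebesgue_on \<Omega>. weak_partial \<Omega> i \<eta> x = grad i \<eta> x"
proof -
  have "\<exists>g. g \<in> L2 \<Omega> \<and> is_weak_partial \<Omega> i \<eta> g"
    using grad_L2[OF \<eta> i] X_weak_partial[OF \<eta> i] by blast
  from someI_ex[OF this] have w: "weak_partial \<Omega> i \<eta> \<in> L2 \<Omega>" "is_weak_partial \<Omega> i \<eta> (weak_partial \<Omega> i \<eta>)"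
    by (simp_all add: weak_partial_def)
  then show "weak_partial \<Omega> i \<eta> \<in> L2 \<Omega>" by simp
  let ?w = "weak_partial \<Omega> i \<eta>" and ?g = "grad i \<eta>"
  have "AE x in lebesgue_on \<Omega>. ?w x - ?g x = 0"
  proof (rule fundamental_lemma)
    show "(\<lambda>x. ?w x - ?g x) \<in> L2 \<Omega>" by (intro L2_diff w grad_L2 \<eta> i)
    fix \<phi> assume \<phi>: "\<phi> \<in> test_functions \<Omega>"
    obtain C where C: "0 < C" "\<And>x. \<bar>\<phi> x\<bar> \<le> C" using test_bounded[OF \<phi>] by auto
    have m: "\<phi> \<in> borel_measurable (lebesgue_on \<Omega>)"
      by (intro measurable_dom borel_measurable_continuous_onI test_continuous \<phi>)
    have "L2_inner \<Omega> (\<lambda>x. ?w x - ?g x) \<phi> = L2_inner \<Omega> ?w \<phi> - L2_inner \<Omega> ?g \<phi>"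
      unfolding L2_inner_def left_diff_distrib
      by (rule Bochner_Integration.integral_diff)
        (rule L2_times_bounded[OF w(1) m C(2)], rule L2_times_bounded[OF grad_L2[OF \<eta> i] m C(2)])
    also have "\<dots> = 0"
    proof -
      have "L2_inner \<Omega> \<eta> (partial i \<phi>) = - L2_inner \<Omega> ?w \<phi>" "L2_inner \<Omega> \<eta> (partial i \<phi>) = - L2_inner \<Omega> ?g \<phi>"
        using w(2) X_weak_partial[OF \<eta> i] \<phi> unfolding is_weak_partial_def by auto
      then show ?thesis by simp
    qed
    finally show "L2_inner \<Omega> (\<lambda>x. ?w x - ?g x) \<phi> = 0" .
  qed
  then show "AE x in lebesgue_on \<Omega>. ?w x = ?g x" by (rule AE_mp) (auto intro!: AE_I2)
qed

lemma L2_measurable: "f \<in> L2 \<Omega> \<Longrightarrow> f \<in> borel_measurable (lebesgue_on \<Omega>)"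
  by (simp add: L2_def)

lemma L2_inner_cong_AE:
  assumes "f \<in> L2 \<Omega>" "f' \<in> L2 \<Omega>" "g \<in> L2 \<Omega>" "g' \<in> L2 \<Omega>"
    "AE x in lebesgue_on \<Omega>. f x = f' x" "AE x in lebesgue_on \<Omega>. g x = g' x"
  shows "L2_inner \<Omega> f g = L2_inner \<Omega> f' g'"
  unfolding L2_inner_def
proof (rule integral_cong_AE)
  note m = L2_measurable[OF assms(1)] L2_measurable[OF assms(2)] L2_measurable[OF assms(3)] L2_measurable[OF assms(4)]
  show "(\<lambda>x. f x * g x) \<in> borel_measurable (lebesgue_on \<Omega>)" "(\<lambda>x. f' x * g' x) \<in> borel_measurable (lebesgue_on \<Omega>)"
    by (intro borel_measurable_times m)+
  show "AE x in lebesgue_on \<Omega>. f x * g x = f' x * g' x"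
    using assms(5,6) by eventually_elim simp
qed

text \<open>The counterpart of \<open>grad_inner\<close> with the concrete gradients, for which
  linearity can be argued pointwise.\<close>

definition energy :: "('a \<Rightarrow> real) \<Rightarrow> ('a \<Rightarrow> real) \<Rightarrow> real" where
  "energy \<eta> \<zeta> = (\<Sum>i\<in>Basis. L2_inner \<Omega> (grad i \<eta>) (grad i \<zeta>))"

lemma grad_inner_X: "\<eta> \<in> X \<Longrightarrow> \<zeta> \<in> X \<Longrightarrow> grad_inner \<Omega> \<eta> \<zeta> = energy \<eta> \<zeta>"
  unfolding grad_inner_def energy_def
  by (rule sum.cong[OF refl], rule L2_inner_cong_AE) (auto intro: weak_partial_X grad_L2)

text \<open>There are no boundary terms because \<open>\<eta>\<close> vanishes on the boundary.\<close>

lemma grad_inner_dom_A: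
  assumes v: "v \<in> dom_A \<Omega>" and \<eta>: "\<eta> \<in> X"
  shows "op_A \<Omega> v \<in> L2 \<Omega>" "grad_inner \<Omega> v \<eta> = L2_inner \<Omega> (op_A \<Omega> v) \<eta>"
proof -
  obtain B where B: "0 < B" "\<And>x. \<bar>\<eta> x\<bar> \<le> B" using X_bounded[OF \<eta>] by auto
  have m\<eta>: "\<eta> \<in> borel_measurable (lebesgue_on \<Omega>)" by (rule L2_measurable[OF X_L2[OF \<eta>]])
  let ?w = "\<lambda>i. weak_partial \<Omega> i v" and ?ww = "\<lambda>i. weak_partial \<Omega> i (weak_partial \<Omega> i v)"
  have w: "?w i \<in> L2 \<Omega>" "?w i \<in> H1 \<Omega>" if "i \<in> Basis" for i
    using v that by (auto simp: dom_A_def H2_def H1_def)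
  have ww: "?ww i \<in> L2 \<Omega>" "is_weak_partial \<Omega> i (?w i) (?ww i)" if i: "i \<in> Basis" for i
  proof -
    have "\<exists>g. g \<in> L2 \<Omega> \<and> is_weak_partial \<Omega> i (?w i) g" using w(2)[OF i] i by (auto simp: H1_def)
    from someI_ex[OF this] show "?ww i \<in> L2 \<Omega>" "is_weak_partial \<Omega> i (?w i) (?ww i)"
      by (simp_all add: weak_partial_def[of \<Omega> i "?w i"])
  qed
  have zero: "(\<lambda>_. 0) \<in> L2 \<Omega>" by (simp add: L2_def)
  have "(\<lambda>x. - (\<Sum>i\<in>J. ?ww i x)) \<in> L2 \<Omega>" if "finite J" "J \<subseteq> Basis" for J
    using that
  proof (induction J rule: finite_induct)
    case (insert i J)
    then have "(\<lambda>x. - (\<Sum>i\<in>J. ?ww i x) - ?ww i x) \<in> L2 \<Omega>" by (intro L2_diff ww) auto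
    moreover have "(\<lambda>x. - (\<Sum>i\<in>insert i J. ?ww i x)) = (\<lambda>x. - (\<Sum>i\<in>J. ?ww i x) - ?ww i x)"
      using insert.hyps by (intro ext) simp
    ultimately show ?case by simp
  qed (simp add: zero)
  from this[OF finite_Basis order_refl] show "op_A \<Omega> v \<in> L2 \<Omega>" by (simp add: op_A_def)
  have int: "integrable (lebesgue_on \<Omega>) (\<lambda>x. ?ww i x * \<eta> x)" if "i \<in> Basis" for i
    by (rule L2_times_bounded[OF ww(1)[OF that] m\<eta> B(2)])
  have "grad_inner \<Omega> v \<eta> = (\<Sum>i\<in>Basis. L2_inner \<Omega> (?w i) (grad i \<eta>))"
    unfolding grad_inner_def
    by (rule sum.cong[OF refl], rule L2_inner_cong_AE) (auto intro: weak_partial_X grad_L2 w \<eta>)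
  also have "\<dots> = (\<Sum>i\<in>Basis. - L2_inner \<Omega> (?ww i) \<eta>)"
    by (rule sum.cong[OF refl], rule weak_partial_test_X) (auto intro: w ww \<eta>)
  also have "\<dots> = L2_inner \<Omega> (op_A \<Omega> v) \<eta>"
    unfolding L2_inner_def op_A_def by (simp add: sum_distrib_right sum_negf int)
  finally show "grad_inner \<Omega> v \<eta> = L2_inner \<Omega> (op_A \<Omega> v) \<eta>" .
qed

end

section \<open>The discrete operators\<close>

context fe_space
begin

lemma X_zero: "(\<lambda>_. 0) \<in> X"
  by (auto simp: Xh_def intro!: exI[of _ "0::'a"])

lemma X_comb:
  assumes "\<phi> \<in> X" "\<psi> \<in> X"
  shows "(\<lambda>x. a * \<phi> x + b * \<psi> x) \<in> X"
  unfolding Xh_def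
proof (intro CollectI conjI ballI allI impI)
  show "continuous_on (closure \<Omega>) (\<lambda>x. a * \<phi> x + b * \<psi> x)"
    using assms by (auto simp: Xh_def intro!: continuous_intros)
  show "a * \<phi> x + b * \<psi> x = 0" if "x \<notin> \<Omega>" for x
    using X_outside[OF assms(1) that] X_outside[OF assms(2) that] by simp
  fix K assume K: "K \<in> \<T>"
  have "\<exists>a b. \<forall>x\<in>K. \<phi> x = a \<bullet> x + b" "\<exists>a b. \<forall>x\<in>K. \<psi> x = a \<bullet> x + b"
    using assms K by (simp_all add: Xh_def)
  then obtain c d c' d' where cd: "\<forall>x\<in>K. \<phi> x = c \<bullet> x + d" and cd': "\<forall>x\<in>K. \<psi> x = c' \<bullet> x + d'" by blast
  show "\<exists>p q. \<forall>x\<in>K. a * \<phi> x + b * \<psi> x = p \<bullet> x + q"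
    by (intro exI[of _ "a *\<^sub>R c + b *\<^sub>R c'"] exI[of _ "a * d + b * d'"] ballI)
      (simp add: cd cd' inner_add_left algebra_simps)
qed

lemma L2_product_integrable:
  assumes "f \<in> L2 \<Omega>" "\<eta> \<in> X"
  shows "integrable (lebesgue_on \<Omega>) (\<lambda>x. f x * \<eta> x)"
proof -
  obtain B where B: "0 < B" "\<And>x. \<bar>\<eta> x\<bar> \<le> B" using X_bounded[OF assms(2)] by auto
  show ?thesis by (rule L2_times_bounded[OF assms(1) L2_measurable[OF X_L2[OF assms(2)]] B(2)])
qed

lemma open_null_empty:
  assumes "open S" "S \<subseteq> \<Omega>" "AE x in lebesgue_on \<Omega>. x \<notin> S"
  shows "S = {}"
proof -
  have "AE x in lebesgue. x \<in> \<Omega> \<longrightarrow> x \<notin> S"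
    using assms(3) open_dom by (subst (asm) AE_restrict_space_iff) auto
  then have "AE x in lebesgue. x \<notin> S"
    by (rule AE_mp) (use assms(2) in \<open>auto intro!: AE_I2\<close>)
  then have "S \<in> null_sets lebesgue"
    using assms(1) by (subst AE_iff_null_sets) auto
  then show ?thesis
    using open_not_negligible[OF assms(1)] by (auto simp: negligible_iff_null_sets)
qed

lemma X_inner_definite:
  assumes \<phi>: "\<phi> \<in> X" and z: "L2_inner \<Omega> \<phi> \<phi> = 0"
  shows "\<phi> = (\<lambda>_. 0)"
proof -
  have "AE x in lebesgue_on \<Omega>. \<phi> x * \<phi> x = 0"
    using integral_nonneg_eq_0_iff_AE[OF L2_product_integrable[OF X_L2[OF \<phi>] \<phi>]] z
    by (simp add: L2_inner_def)
  then have "AE x in lebesgue_on \<Omega>. x \<notin> {x. \<phi> x \<noteq> 0}"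
    by (rule AE_mp) (auto intro!: AE_I2)
  moreover have "open {x. \<phi> x \<noteq> 0}"
    by (intro open_Collect_neq X_continuous \<phi> continuous_on_const)
  moreover have "{x. \<phi> x \<noteq> 0} \<subseteq> \<Omega>" using X_outside[OF \<phi>] by auto
  ultimately have "{x. \<phi> x \<noteq> 0} = {}" using open_null_empty by blast
  then show ?thesis by auto
qed

end

sublocale fe_space \<subseteq> fun_inner_space X "L2_inner \<Omega>"
proof
  show "(\<lambda>_. 0) \<in> X" by (rule X_zero)
  show "(\<lambda>x. a * \<phi> x + b * \<psi> x) \<in> X" if "\<phi> \<in> X" "\<psi> \<in> X" for \<phi> \<psi> a b
    by (rule X_comb[OF that])
  show "L2_inner \<Omega> (\<lambda>x. a * \<phi> x + b * \<psi> x) \<zeta> = a * L2_inner \<Omega> \<phi> \<zeta> + b * L2_inner \<Omega> \<psi> \<zeta>"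
    if "\<phi> \<in> X" "\<psi> \<in> X" "\<zeta> \<in> X" for \<phi> \<psi> \<zeta> a b
    unfolding L2_inner_def
    using L2_product_integrable[OF X_L2[OF that(1)] that(3)] L2_product_integrable[OF X_L2[OF that(2)] that(3)]
    by (simp add: distrib_right mult.assoc)
  show "L2_inner \<Omega> \<phi> \<psi> = L2_inner \<Omega> \<psi> \<phi>" for \<phi> \<psi> by (simp add: L2_inner_def mult.commute)
  show "0 \<le> L2_inner \<Omega> \<phi> \<phi>" for \<phi> by (simp add: L2_inner_def)
  show "\<phi> = (\<lambda>_. 0)" if "\<phi> \<in> X" "L2_inner \<Omega> \<phi> \<phi> = 0" for \<phi> by (rule X_inner_definite[OF that])
qed

context fe_space
begin

lemma grad_comb:
  assumes \<phi>: "\<phi> \<in> X" and \<psi>: "\<psi> \<in> X"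
  shows "grad i (\<lambda>x. a * \<phi> x + b * \<psi> x) = (\<lambda>x. a * grad i \<phi> x + b * grad i \<psi> x)"
proof
  fix x
  show "grad i (\<lambda>x. a * \<phi> x + b * \<psi> x) x = a * grad i \<phi> x + b * grad i \<psi> x"
  proof (cases "x \<in> cells")
    case x: True
    obtain r c d where r: "0 < r" and cd: "\<forall>y\<in>ball x r. \<phi> y = c \<bullet> y + d"
      using X_locally_affine[OF \<phi> x] by blast
    obtain s c' d' where s: "0 < s" and cd': "\<forall>y\<in>ball x s. \<psi> y = c' \<bullet> y + d'"
      using X_locally_affine[OF \<psi> x] by blast
    have "grad i (\<lambda>x. a * \<phi> x + b * \<psi> x) x = (a *\<^sub>R c + b *\<^sub>R c') \<bullet> i"
      by (rule grad_affine[OF x, of "min r s" _ _ "a * d + b * d'"])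
        (use r s cd cd' in \<open>auto simp: inner_add_left algebra_simps\<close>)
    moreover have "grad i \<phi> x = c \<bullet> i" by (rule grad_affine[OF x r]) (use cd in auto)
    moreover have "grad i \<psi> x = c' \<bullet> i" by (rule grad_affine[OF x s]) (use cd' in auto)
    ultimately show ?thesis by (simp add: inner_add_left)
  qed (simp add: grad_def)
qed

lemma grad_product_integrable:
  assumes "\<phi> \<in> X" "\<psi> \<in> X" "i \<in> Basis"
  shows "integrable (lebesgue_on \<Omega>) (\<lambda>x. grad i \<phi> x * grad i \<psi> x)"
proof -
  obtain L where L: "0 < L" and lip: "\<And>x y. \<bar>\<psi> x - \<psi> y\<bar> \<le> L * dist x y" using X_lipschitz[OF assms(2)] by auto
  show ?thesis
    using L grad_bounded[OF lip assms(2,3)]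
    by (intro L2_times_bounded[OF grad_L2[OF assms(1,3)] L2_measurable[OF grad_L2[OF assms(2,3)]], of L]) auto
qed

lemma cell_interior: "K \<in> \<T> \<Longrightarrow> interior K \<noteq> {}"
proof -
  assume K: "K \<in> \<T>"
  have "aff_dim K = int DIM('a)" using simplex_tri[OF K] by (rule aff_dim_simplex)
  then have "affine hull K = UNIV" "K \<noteq> {}" using aff_dim_eq_full by auto
  then show ?thesis
    using rel_interior_interior[of K] rel_interior_eq_empty[OF convex_cell[OF K]] by simp
qed

text \<open>In place of a Poincare inequality: the set where a gradient component differs from 0 is
  open and null, hence empty. So \<phi> is constant on every cell, takes finitely many values, is
  therefore constant by continuity, and vanishes outside the bounded \<Omega>.\<close>

lemma energy_definite:
  assumes \<phi>: "\<phi> \<in> X" and z: "energy \<phi> \<phi> = 0"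
  shows "\<phi> = (\<lambda>_. 0)"
proof -
  have nn: "0 \<le> L2_inner \<Omega> f f" for f :: "'a \<Rightarrow> real" by (simp add: L2_inner_def)
  have gz: "grad i \<phi> x = 0" if i: "i \<in> Basis" for i x
  proof -
    have "L2_inner \<Omega> (grad i \<phi>) (grad i \<phi>) = 0"
      using z i nn by (simp add: energy_def sum_nonneg_eq_0_iff)
    then have ae: "AE x in lebesgue_on \<Omega>. grad i \<phi> x * grad i \<phi> x = 0"
      using integral_nonneg_eq_0_iff_AE[OF grad_product_integrable[OF \<phi> \<phi> i]] by (simp add: L2_inner_def)
    let ?S = "{x \<in> \<Omega>. grad i \<phi> x \<noteq> 0}"
    have "open ?S"
      unfolding open_contains_ball
    proof
      fix x assume x: "x \<in> ?S"
      then have xc: "x \<in> cells" by (auto simp: grad_def split: if_splits)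
      obtain r a b where r: "0 < r" and ab: "\<forall>y\<in>ball x r. \<phi> y = a \<bullet> y + b"
        using X_locally_affine[OF \<phi> xc] by blast
      obtain s where s: "0 < s" "ball x s \<subseteq> \<Omega> \<inter> cells"
        using open_contains_ball[of "\<Omega> \<inter> cells"] open_dom open_cells x xc by blast
      have "grad i \<phi> y = a \<bullet> i" if y: "y \<in> ball x (min r s)" for y
      proof (rule grad_affine[where r = "r - dist x y" and b = b])
        show "y \<in> cells" using y s by auto
        show "0 < r - dist x y" using y by simp
        show "\<phi> z = a \<bullet> z + b" if "z \<in> ball y (r - dist x y)" for z
          using that dist_triangle[of x z y] ab by (intro bspec[OF ab]) auto
      qed
      moreover then have "grad i \<phi> x = a \<bullet> i" using r s by simp
      ultimately have "ball x (min r s) \<subseteq> ?S" using x s by auto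
      then show "\<exists>e>0. ball x e \<subseteq> ?S" using r s by (intro exI[of _ "min r s"]) auto
    qed
    moreover have "AE x in lebesgue_on \<Omega>. x \<notin> ?S" using ae by (rule AE_mp) (auto intro!: AE_I2)
    ultimately have e: "?S = {}" by (intro open_null_empty) auto
    show ?thesis
    proof (cases "x \<in> \<Omega> \<or> x \<notin> cells")
      case True
      then show ?thesis using e by (auto simp: grad_def)
    next
      case False
      then obtain r a b where r: "0 < r" and ab: "\<forall>y\<in>ball x r. \<phi> y = a \<bullet> y + b"
        using X_locally_affine[OF \<phi>, of x] by blast
      \<comment> \<open>A point interior to a cell is interior to the closure of \<Omega>, and for
        an open convex set that interior is \<Omega> itself.\<close>
      have "x \<notin> closure \<Omega>"
      proof
        assume "x \<in> closure \<Omega>"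
        then obtain K where "K \<in> \<T>" "x \<in> interior K" using False by (auto simp: cells_def)
        then have "x \<in> interior (closure \<Omega>)" using Union_tri interior_mono[of K "closure \<Omega>"] by blast
        then have "x \<in> \<Omega>" using convex_interior_closure[OF convex_dom] interior_open[OF open_dom] by simp
        then show False using False by simp
      qed
      then obtain s where s: "0 < s" "ball x s \<subseteq> - closure \<Omega>"
        by (meson ComplI closed_closure open_Compl open_contains_ball)
      have "\<phi> y = (0::'a) \<bullet> y + 0" if "y \<in> ball x s" for y
      proof -
        have "y \<notin> \<Omega>" using s that closure_subset[of \<Omega>] by blast
        then show ?thesis using X_outside[OF \<phi>] by simp
      qed
      from grad_affine[OF _ s(1) this] False show ?thesis by simp
    qed
  qed
  obtain a b where ab: "\<forall>K\<in>\<T>. \<forall>x\<in>K. \<phi> x = a K \<bullet> x + b K" using X_affine[OF \<phi>] by auto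
  have a0: "a K = 0" if K: "K \<in> \<T>" for K
  proof (rule euclidean_eqI)
    fix i :: 'a assume i: "i \<in> Basis"
    obtain x where x: "x \<in> interior K" using cell_interior[OF K] by blast
    then obtain r where r: "0 < r" "ball x r \<subseteq> K" by (auto simp: mem_interior)
    have xc: "x \<in> cells" using x K by (auto simp: cells_def)
    have "grad i \<phi> x = a K \<bullet> i" by (rule grad_affine[OF xc r(1)]) (use ab K r in auto)
    then show "a K \<bullet> i = 0 \<bullet> i" using gz[OF i] by simp
  qed
  \<comment> \<open>A finite range makes a continuous function on the connected whole space
    constant.\<close>
  have "range \<phi> \<subseteq> insert 0 (b ` \<T>)"
  proof
    fix y assume "y \<in> range \<phi>"
    then obtain x where x: "y = \<phi> x" by blast
    show "y \<in> insert 0 (b ` \<T>)"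
    proof (cases "x \<in> \<Omega>")
      case True
      then have "x \<in> \<Union>\<T>" using Union_tri closure_subset by blast
      then obtain K where K: "K \<in> \<T>" "x \<in> K" by blast
      then have "\<phi> x = b K" using ab a0 by simp
      then show ?thesis using K x by blast
    qed (use X_outside[OF \<phi>] x in auto)
  qed
  then have fin: "finite (range \<phi>)" using finite_tri finite_subset by blast
  have "\<phi> constant_on UNIV"
    using continuous_finite_range_constant[OF connected_UNIV X_continuous[OF \<phi>] fin] .
  then obtain c where c: "\<And>x. \<phi> x = c" by (auto simp: constant_on_def)
  have "\<exists>x. x \<notin> \<Omega>" using bounded_dom not_bounded_UNIV[where 'a = 'a] by (metis UNIV_eq_I)
  then have "c = 0" using X_outside[OF \<phi>] c by metis
  then show ?thesis using c by auto
qed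

lemma energy_comb:
  assumes "\<phi> \<in> X" "\<psi> \<in> X" "\<zeta> \<in> X"
  shows "energy (\<lambda>x. a * \<phi> x + b * \<psi> x) \<zeta> = a * energy \<phi> \<zeta> + b * energy \<psi> \<zeta>"
proof -
  have "L2_inner \<Omega> (grad i (\<lambda>x. a * \<phi> x + b * \<psi> x)) (grad i \<zeta>) =
      a * L2_inner \<Omega> (grad i \<phi>) (grad i \<zeta>) + b * L2_inner \<Omega> (grad i \<psi>) (grad i \<zeta>)" if i: "i \<in> Basis" for i
    unfolding grad_comb[OF assms(1,2)] L2_inner_def
    using grad_product_integrable[OF assms(1,3) i] grad_product_integrable[OF assms(2,3) i]
    by (simp add: distrib_right mult.assoc)
  then show ?thesis by (simp add: energy_def sum.distrib sum_distrib_left)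
qed

lemma energy_sym: "energy \<phi> \<psi> = energy \<psi> \<phi>"
  by (simp add: energy_def L2_inner_def mult.commute)

lemma energy_nonneg: "0 \<le> energy \<phi> \<phi>"
  by (simp add: energy_def L2_inner_def sum_nonneg)

lemma energy_space: "fun_inner_space X energy"
  by unfold_locales (auto intro: energy_comb energy_sym energy_nonneg energy_definite)

text \<open>The vertices do it: an affine function that vanishes at the vertices of a cell vanishes
  on their convex hull.\<close>

lemma separating_points:
  "\<exists>P. finite P \<and> (\<forall>\<phi>\<in>X. (\<forall>p\<in>P. \<phi> p = 0) \<longrightarrow> \<phi> = (\<lambda>_. 0))"
proof -
  have "\<forall>K\<in>\<T>. \<exists>C. finite C \<and> K = convex hull C"
    using simplex_tri unfolding simplex by blast
  from bchoice[OF this] obtain C where C: "\<forall>K\<in>\<T>. finite (C K) \<and> K = convex hull (C K)" ..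
  show ?thesis
  proof (intro exI[of _ "\<Union>K\<in>\<T>. C K"] conjI ballI impI)
    show "finite (\<Union>K\<in>\<T>. C K)" using C finite_tri by auto
    fix \<phi> assume \<phi>: "\<phi> \<in> X" and z: "\<forall>p\<in>(\<Union>K\<in>\<T>. C K). \<phi> p = 0"
    obtain a b where ab: "\<forall>K\<in>\<T>. \<forall>x\<in>K. \<phi> x = a K \<bullet> x + b K" using X_affine[OF \<phi>] by auto
    have zK: "\<phi> x = 0" if K: "K \<in> \<T>" and x: "x \<in> K" for K x
    proof -
      have hull: "K = convex hull (C K)" using C K by blast
      have "C K \<subseteq> {x. a K \<bullet> x = - b K}"
      proof
        fix p assume p: "p \<in> C K"
        then have "p \<in> K" using hull hull_subset[of "C K" convex] by blast
        then have "\<phi> p = a K \<bullet> p + b K" using ab K by blast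
        moreover have "\<phi> p = 0" using z K p by blast
        ultimately show "p \<in> {x. a K \<bullet> x = - b K}" by simp
      qed
      then have "convex hull (C K) \<subseteq> {x. a K \<bullet> x = - b K}" by (intro hull_minimal convex_hyperplane)
      then have "a K \<bullet> x = - b K" using x hull by blast
      then show ?thesis using ab K x by simp
    qed
    show "\<phi> = (\<lambda>_. 0)"
    proof
      fix x
      show "\<phi> x = 0"
      proof (cases "x \<in> \<Omega>")
        case True
        then have "x \<in> \<Union>\<T>" using Union_tri closure_subset by blast
        then show ?thesis using zK by blast
      qed (rule X_outside[OF \<phi>])
    qed
  qed
qed

text \<open>For the identity operator the spectral theorem yields an orthonormal basis with respect
  to whichever inner product is at hand.\<close>

lemma riesz_X:
  assumes "fun_inner_space X ip" "functional g"
  shows "\<exists>!p. p \<in> X \<and> (\<forall>\<eta>\<in>X. ip p \<eta> = g \<eta>)"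
proof -
  obtain P where P: "finite P" "\<forall>\<phi>\<in>X. (\<forall>p\<in>P. \<phi> p = 0) \<longrightarrow> \<phi> = (\<lambda>_. 0)" using separating_points by blast
  have id: "operator (\<lambda>\<phi>. \<phi>)" by (simp add: operator_def)
  obtain n e l where "orthonormal_eigenbasis X ip (\<lambda>\<phi>. \<phi>) n e l"
    using exists_eigenbasis[OF assms(1) P(1) _ id] P(2) by blast
  then have "eigenbasis X ip (\<lambda>\<phi>. \<phi>) n e l"
    using assms(1) id by (simp add: eigenbasis_def eigenbasis_axioms_def)
  from eigenbasis.riesz[OF this assms(2)] show ?thesis .
qed

lemma op_Ah_spec:
  assumes \<phi>: "\<phi> \<in> X"
  shows "op_Ah \<Omega> \<T> \<phi> \<in> X" "\<eta> \<in> X \<Longrightarrow> L2_inner \<Omega> (op_Ah \<Omega> \<T> \<phi>) \<eta> = energy \<phi> \<eta>"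
proof -
  have "functional (\<lambda>\<eta>. energy \<phi> \<eta>)"
    unfolding functional_def energy_sym[of \<phi>] using energy_comb[OF _ _ \<phi>] by simp
  from riesz_X[OF fun_inner_space_axioms this]
  have "\<exists>!p. p \<in> X \<and> (\<forall>\<eta>\<in>X. L2_inner \<Omega> p \<eta> = grad_inner \<Omega> \<phi> \<eta>)"
    using grad_inner_X[OF \<phi>] by simp
  from theI'[OF this] show "op_Ah \<Omega> \<T> \<phi> \<in> X" "\<eta> \<in> X \<Longrightarrow> L2_inner \<Omega> (op_Ah \<Omega> \<T> \<phi>) \<eta> = energy \<phi> \<eta>"
    using grad_inner_X[OF \<phi>] by (auto simp: op_Ah_def)
qed

lemma op_Ah_operator: "operator (op_Ah \<Omega> \<T>)"
  unfolding operator_def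
proof (intro conjI ballI allI)
  fix \<phi> \<psi> a b assume \<phi>: "\<phi> \<in> X" and \<psi>: "\<psi> \<in> X"
  show "op_Ah \<Omega> \<T> (\<lambda>x. a * \<phi> x + b * \<psi> x) = (\<lambda>x. a * op_Ah \<Omega> \<T> \<phi> x + b * op_Ah \<Omega> \<T> \<psi> x)"
  proof (rule ip_eqI)
    fix \<zeta> assume \<zeta>: "\<zeta> \<in> X"
    show "L2_inner \<Omega> (op_Ah \<Omega> \<T> (\<lambda>x. a * \<phi> x + b * \<psi> x)) \<zeta> =
        L2_inner \<Omega> (\<lambda>x. a * op_Ah \<Omega> \<T> \<phi> x + b * op_Ah \<Omega> \<T> \<psi> x) \<zeta>"
      by (simp only: ip_comb[OF op_Ah_spec(1)[OF \<phi>] op_Ah_spec(1)[OF \<psi>] \<zeta>] op_Ah_spec(2)[OF \<phi> \<zeta>]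
        op_Ah_spec(2)[OF \<psi> \<zeta>] op_Ah_spec(2)[OF X_comb[OF \<phi> \<psi>] \<zeta>] energy_comb[OF \<phi> \<psi> \<zeta>])
  qed (intro op_Ah_spec X_comb \<phi> \<psi>)+
qed (rule op_Ah_spec)

lemma op_Ah_sym: "\<phi> \<in> X \<Longrightarrow> \<psi> \<in> X \<Longrightarrow> L2_inner \<Omega> (op_Ah \<Omega> \<T> \<phi>) \<psi> = L2_inner \<Omega> \<phi> (op_Ah \<Omega> \<T> \<psi>)"
  using op_Ah_spec(2)[of \<phi> \<psi>] op_Ah_spec(2)[of \<psi> \<phi>] energy_sym[of \<phi> \<psi>] ip_sym[of \<phi> "op_Ah \<Omega> \<T> \<psi>"]
    op_Ah_spec(1)[of \<psi>] by simp

lemma eigenbasis_exists: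
  "\<exists>n e l. eigenbasis X (L2_inner \<Omega>) (op_Ah \<Omega> \<T>) n e l \<and> (\<forall>i<n. 0 < l i)"
proof -
  obtain P where P: "finite P" "\<forall>\<phi>\<in>X. (\<forall>p\<in>P. \<phi> p = 0) \<longrightarrow> \<phi> = (\<lambda>_. 0)" using separating_points by blast
  obtain n e l where eb: "orthonormal_eigenbasis X (L2_inner \<Omega>) (op_Ah \<Omega> \<T>) n e l"
    using exists_eigenbasis[OF fun_inner_space_axioms P(1) _ op_Ah_operator op_Ah_sym] P(2) by blast
  then have E: "eigenbasis X (L2_inner \<Omega>) (op_Ah \<Omega> \<T>) n e l"
    using fun_inner_space_axioms op_Ah_operator by (simp add: eigenbasis_def eigenbasis_axioms_def)
  interpret E: eigenbasis X "L2_inner \<Omega>" "op_Ah \<Omega> \<T>" n e l by (rule E)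
  have pos: "0 < l i" if i: "i < n" for i
  proof -
    note e = E.e_closed[OF i]
    have "energy (e i) (e i) = L2_inner \<Omega> (\<lambda>x. l i * e i x) (e i)"
      using op_Ah_spec(2)[OF e e] E.S_e[OF i] by simp
    also have "\<dots> = l i" using ip_scale[OF e e] E.orthonormal[OF i i] by simp
    finally have "energy (e i) (e i) = l i" .
    moreover have "energy (e i) (e i) \<noteq> 0"
    proof
      assume "energy (e i) (e i) = 0"
      then have "e i = (\<lambda>_. 0)" by (rule energy_definite[OF e])
      then show False using E.orthonormal[OF i i] ip_zero[OF X_zero] by simp
    qed
    ultimately show ?thesis using energy_nonneg[of "e i"] by linarith
  qed
  show ?thesis using E pos by (intro exI[of _ n] exI[of _ e] exI[of _ l]) simp
qed

text \<open>For v in the domain of A the functional (grad v, grad \<eta>) is the L2 product of A v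
  with \<eta> and hence visibly linear, so it has a Riesz representer in the energy product.\<close>

lemma Ritz_spec:
  assumes v: "v \<in> dom_A \<Omega>"
  shows "Ritz_projection \<Omega> \<T> v \<in> X"
    "\<eta> \<in> X \<Longrightarrow> energy (Ritz_projection \<Omega> \<T> v) \<eta> = L2_inner \<Omega> (op_A \<Omega> v) \<eta>"
proof -
  have "functional (\<lambda>\<eta>. L2_inner \<Omega> (op_A \<Omega> v) \<eta>)"
    unfolding functional_def
  proof (intro ballI allI)
    fix \<phi> \<psi> a b assume \<phi>: "\<phi> \<in> X" and \<psi>: "\<psi> \<in> X"
    note i = L2_product_integrable[OF grad_inner_dom_A(1)[OF v \<phi>]]
    show "L2_inner \<Omega> (op_A \<Omega> v) (\<lambda>x. a * \<phi> x + b * \<psi> x) = a * L2_inner \<Omega> (op_A \<Omega> v) \<phi> + b * L2_inner \<Omega> (op_A \<Omega> v) \<psi>"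
      unfolding L2_inner_def using i[OF \<phi>] i[OF \<psi>]
      by (simp add: distrib_left mult.left_commute[of "op_A \<Omega> v _"])
  qed
  from riesz_X[OF energy_space this]
  have ex: "\<exists>!p. p \<in> X \<and> (\<forall>\<eta>\<in>X. energy p \<eta> = L2_inner \<Omega> (op_A \<Omega> v) \<eta>)" .
  have iff: "(p \<in> X \<and> (\<forall>\<eta>\<in>X. grad_inner \<Omega> p \<eta> = grad_inner \<Omega> v \<eta>)) \<longleftrightarrow>
      (p \<in> X \<and> (\<forall>\<eta>\<in>X. energy p \<eta> = L2_inner \<Omega> (op_A \<Omega> v) \<eta>))" for p
    using grad_inner_X grad_inner_dom_A(2)[OF v] by auto
  have "Ritz_projection \<Omega> \<T> v = (THE p. p \<in> X \<and> (\<forall>\<eta>\<in>X. energy p \<eta> = L2_inner \<Omega> (op_A \<Omega> v) \<eta>))"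
    unfolding Ritz_projection_def iff ..
  with theI'[OF ex] show "Ritz_projection \<Omega> \<T> v \<in> X"
    "\<eta> \<in> X \<Longrightarrow> energy (Ritz_projection \<Omega> \<T> v) \<eta> = L2_inner \<Omega> (op_A \<Omega> v) \<eta>" by auto
qed

text \<open>The left-hand function g is the L2 projection of f = A v, both having the same products
  with X. Hence (f, g) = (g, g), and the bound follows from the square of f - g having a nonnegative
  integral.\<close>

lemma op_Ah_Ritz_bound:
  assumes v: "v \<in> dom_A \<Omega>"
  shows "L2_norm \<Omega> (op_Ah \<Omega> \<T> (Ritz_projection \<Omega> \<T> v)) \<le> L2_norm \<Omega> (op_A \<Omega> v)"
proof -
  let ?r = "Ritz_projection \<Omega> \<T> v" and ?f = "op_A \<Omega> v"
  let ?g = "op_Ah \<Omega> \<T> ?r"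
  note r = Ritz_spec(1)[OF v]
  note g = op_Ah_spec(1)[OF r]
  have gg: "L2_inner \<Omega> ?g ?g = L2_inner \<Omega> ?f ?g"
    using op_Ah_spec(2)[OF r g] Ritz_spec(2)[OF v g] by simp
  note fL2 = grad_inner_dom_A(1)[OF v g]
  have i1: "integrable (lebesgue_on \<Omega>) (\<lambda>x. ?f x * ?f x)"
    using fL2 by (simp add: L2_def power2_eq_square)
  note i2 = L2_product_integrable[OF fL2 g] and i3 = L2_product_integrable[OF X_L2[OF g] g]
  have "0 \<le> (\<integral>x. (?f x - ?g x)\<^sup>2 \<partial>(lebesgue_on \<Omega>))" by simp
  also have "(\<lambda>x. (?f x - ?g x)\<^sup>2) = (\<lambda>x. ?f x * ?f x - 2 * (?f x * ?g x) + ?g x * ?g x)"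
    by (rule ext) (simp add: power2_eq_square algebra_simps)
  also have "(\<integral>x. ?f x * ?f x - 2 * (?f x * ?g x) + ?g x * ?g x \<partial>(lebesgue_on \<Omega>)) =
      L2_inner \<Omega> ?f ?f - 2 * L2_inner \<Omega> ?f ?g + L2_inner \<Omega> ?g ?g"
    unfolding L2_inner_def using i1 i2 i3 by simp
  finally have "L2_inner \<Omega> ?g ?g \<le> L2_inner \<Omega> ?f ?f" using gg by linarith
  then show ?thesis unfolding L2_norm_def by (rule real_sqrt_le_mono)
qed

lemma L2_projection_zero: "L2_projection \<Omega> \<T> (\<lambda>_. 0) = (\<lambda>_. 0)"
  unfolding L2_projection_def
proof (rule the_equality)
  have z: "L2_inner \<Omega> (\<lambda>_. 0) \<eta> = 0" for \<eta> by (simp add: L2_inner_def)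
  show "(\<lambda>_. 0) \<in> X \<and> (\<forall>\<eta>\<in>X. L2_inner \<Omega> (\<lambda>_. 0) \<eta> = L2_inner \<Omega> (\<lambda>_. 0) \<eta>)" using X_zero by simp
  fix p assume "p \<in> X \<and> (\<forall>\<eta>\<in>X. L2_inner \<Omega> p \<eta> = L2_inner \<Omega> (\<lambda>_. 0) \<eta>)"
  then have "p \<in> X" "L2_inner \<Omega> p p = 0" using z by auto
  then show "p = (\<lambda>_. 0)" by (rule X_inner_definite)
qed

end

section \<open>The error bound\<close>

lemma scheme_levels_in_Xh:
  assumes sch: "incomplete_scheme \<Omega> \<T> \<alpha> \<tau> N f vh {1, 2} U Ubar W M"
    and "n \<le> N"
  shows "U n \<in> Xh \<Omega> \<T>"
proof (cases "n = 0")
  case True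
  then show ?thesis using sch by (simp add: incomplete_scheme_def)
next
  case False
  then have n: "n \<in> {1..N}" using assms(2) by auto
  have "Ubar n \<in> Xh \<Omega> \<T> \<and> (if n \<in> {1, 2} then U n = Ubar n
      else W n 0 = (\<lambda>x. 2 * U (n - 1) x - U (n - 2) x) \<and> (\<forall>m\<ge>1. W n m \<in> Xh \<Omega> \<T>) \<and> 1 \<le> M n \<and> U n = W n (M n))"
    using sch n unfolding incomplete_scheme_def by blast
  then show ?thesis by (auto split: if_splits)
qed

context fractional_order
begin

text \<open>Abel's inversion applied to the equation. The remaining work identifies the Lebesgue
  integral over the open interval with the gauge integral used for the quadrature.\<close>

lemma caputo_volterra:
  assumes cont: "continuous_on {0..} y"
    and diff: "\<And>t. 0 < t \<Longrightarrow> y field_differentiable (at t)"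
    and int: "\<And>t. 0 < t \<Longrightarrow> set_integrable lborel {0<..<t} (\<lambda>s. (t - s) powr (- \<alpha>) * deriv y s)"
    and eq: "\<And>t. 0 < t \<Longrightarrow> caputo \<alpha> y t = - (lam * y t)"
    and t: "0 < t"
  shows "y t + lam / Gamma \<alpha> * integral {0..t} (\<lambda>s. (t - s) powr (\<alpha> - 1) * y s) = y 0"
proof -
  let ?g = "\<lambda>s. (t - s) powr (\<alpha> - 1) * y s"
  have c: "continuous_on {0..t} y" by (rule continuous_on_subset[OF cont]) auto
  have "(LINT s:{0<..<t}|lborel. (t - s) powr (\<alpha> - 1) * caputo \<alpha> y s) = (LINT s:{0<..<t}|lborel. - lam * ?g s)"
    by (rule set_lebesgue_integral_cong) (auto simp: eq)
  also have "\<dots> = - lam * (LINT s:{0<..<t}|lborel. ?g s)"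
    by (rule set_integral_mult_right)
  also have "(LINT s:{0<..<t}|lborel. ?g s) = integral {0..t} ?g"
  proof -
    have "?g absolutely_integrable_on {0..t}"
      using t c by (intro kernel_absolutely_integrable) auto
    then have ai: "?g absolutely_integrable_on {0<..<t}"
      by (rule set_integrable_subset) auto
    have cy: "(\<lambda>s. indicator {0<..<t} s *\<^sub>R y s) \<in> borel_measurable borel"
      by (rule borel_measurable_continuous_on_indicator) (auto intro: continuous_on_subset[OF cont])
    have "(\<lambda>s. (t - s) powr (\<alpha> - 1) * (indicator {0<..<t} s *\<^sub>R y s)) \<in> borel_measurable borel"
      using cy by measurable
    also have "(\<lambda>s. (t - s) powr (\<alpha> - 1) * (indicator {0<..<t} s *\<^sub>R y s)) = (\<lambda>s. indicator {0<..<t} s *\<^sub>R ?g s)"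
      by (auto simp: indicator_def)
    finally have m: "(\<lambda>s. indicator {0<..<t} s *\<^sub>R ?g s) \<in> borel_measurable borel" .
    have "(LINT s:{0<..<t}|lborel. ?g s) = (LINT s:{0<..<t}|lebesgue. ?g s)"
      unfolding set_lebesgue_integral_def using m by (intro integral_completion[symmetric]) simp
    also have "\<dots> = integral {0<..<t} ?g"
      by (rule set_lebesgue_integral_eq_integral(2)[OF ai])
    also have "\<dots> = integral {0..t} ?g" by (rule integral_open_interval_real[symmetric])
    finally show ?thesis .
  qed
  finally have "- lam * integral {0..t} ?g = Gamma \<alpha> * (y t - y 0)"
    using abel_inversion[OF order_pos order_less_1 t c diff int] by simp
  moreover have "Gamma \<alpha> \<noteq> 0" using Gamma_order_pos by linarith
  ultimately show ?thesis by (simp add: field_simps)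
qed

end

section \<open>Diagonalisation of the finite element scheme\<close>

locale fe_scheme = fe_space + fractional_order +
  fixes \<tau> :: real and N :: nat and u :: "real \<Rightarrow> 'a \<Rightarrow> real" and v vh :: "'a \<Rightarrow> real"
    and U Ubar :: "nat \<Rightarrow> 'a \<Rightarrow> real" and W :: "nat \<Rightarrow> nat \<Rightarrow> 'a \<Rightarrow> real" and M :: "nat \<Rightarrow> nat" and c0 \<kappa> :: real
  assumes \<tau>: "0 < \<tau>" and v: "v \<in> dom_A \<Omega>" and vh: "vh = Ritz_projection \<Omega> \<T> v"
    and semidiscrete: "semidiscrete_solution \<Omega> \<T> \<alpha> vh u"
    and scheme: "incomplete_scheme \<Omega> \<T> \<alpha> \<tau> N (\<lambda>_ _. 0) vh {1, 2} U Ubar W M"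
    and contraction: "contraction_property \<Omega> \<T> \<alpha> \<tau> {3..N} c0 \<kappa> Ubar W"
    and c0: "0 < c0" and \<kappa>: "0 < \<kappa>"
    and tolerance: "n \<in> {3..N} \<Longrightarrow> c0 * \<kappa> ^ M n \<le> solver_tol"
begin

lemma U_closed: "n \<le> N \<Longrightarrow> U n \<in> X"
  by (rule scheme_levels_in_Xh[OF scheme])

lemma U_0: "U 0 = vh"
  using scheme by (simp add: incomplete_scheme_def)

lemma level:
  assumes n: "n \<in> {1..N}"
  shows "Ubar n \<in> X"
    "shifted_op \<Omega> \<T> \<alpha> \<tau> (Ubar n) = (\<lambda>x. (- 1) * (\<Sum>j=1..n. cq_weight \<alpha> j * U (n - j) x) + 1 * (\<Sum>j=0..n. cq_weight \<alpha> j * U 0 x))"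
    "n \<in> {1, 2} \<Longrightarrow> U n = Ubar n"
    "n \<notin> {1, 2} \<Longrightarrow> W n 0 = (\<lambda>x. 2 * U (n - 1) x - U (n - 2) x) \<and> (\<forall>m\<ge>1. W n m \<in> X) \<and> 1 \<le> M n \<and> U n = W n (M n)"
proof -
  have s: "Ubar n \<in> X \<and>
        shifted_op \<Omega> \<T> \<alpha> \<tau> (Ubar n) =
          (\<lambda>x. \<tau> powr \<alpha> * L2_projection \<Omega> \<T> (\<lambda>_. 0) x
               - (\<Sum>j=1..n. cq_weight \<alpha> j * U (n - j) x)
               + (\<Sum>j=0..n. cq_weight \<alpha> j * U 0 x)) \<and>
        (if n \<in> {1, 2} then U n = Ubar n
         else W n 0 = (\<lambda>x. 2 * U (n - 1) x - U (n - 2) x) \<and>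
              (\<forall>m\<ge>1. W n m \<in> X) \<and>
              1 \<le> M n \<and> U n = W n (M n))"
    using scheme n unfolding incomplete_scheme_def by blast
  then show "Ubar n \<in> X" by blast
  show "shifted_op \<Omega> \<T> \<alpha> \<tau> (Ubar n) = (\<lambda>x. (- 1) * (\<Sum>j=1..n. cq_weight \<alpha> j * U (n - j) x) + 1 * (\<Sum>j=0..n. cq_weight \<alpha> j * U 0 x))"
    using s by (simp add: L2_projection_zero)
  show "n \<in> {1, 2} \<Longrightarrow> U n = Ubar n" using s by simp
  show "n \<notin> {1, 2} \<Longrightarrow> W n 0 = (\<lambda>x. 2 * U (n - 1) x - U (n - 2) x) \<and> (\<forall>m\<ge>1. W n m \<in> X) \<and> 1 \<le> M n \<and> U n = W n (M n)"
    using s by simp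
qed

lemma u_closed: "0 \<le> t \<Longrightarrow> u t \<in> X"
  using semidiscrete by (simp add: semidiscrete_solution_def)

theorem error_bound:
  assumes n: "n \<in> {1..N}"
  shows "L2_norm \<Omega> (\<lambda>x. U n x - u (real n * \<tau>) x) \<le>
    (perturb_const + err_const) * (\<tau> powr \<alpha> * real n powr (\<alpha> - 1)) * L2_norm \<Omega> (op_A \<Omega> v)"
proof -
  obtain d e l where eb: "eigenbasis X (L2_inner \<Omega>) (op_Ah \<Omega> \<T>) d e l" and l: "\<And>i. i < d \<Longrightarrow> 0 < l i"
    using eigenbasis_exists by auto
  interpret E: eigenbasis X "L2_inner \<Omega>" "op_Ah \<Omega> \<T>" d e l by (rule eb)
  define co where "co \<phi> i = L2_inner \<Omega> \<phi> (e i)" for \<phi> i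
  let ?I = "{..<d}"
  have norm_eq: "L2_norm \<Omega> \<phi> = L2_set (co \<phi>) ?I" if "\<phi> \<in> X" for \<phi>
    by (simp add: L2_norm_def L2_set_def co_def E.parseval[OF that that] power2_eq_square)
  have fco: "functional (\<lambda>\<phi>. co \<phi> i)" if "i < d" for i
    unfolding co_def by (rule ip_functional[OF E.e_closed[OF that]])
  have co_comb: "co (\<lambda>x. a * \<phi> x + b * \<psi> x) i = a * co \<phi> i + b * co \<psi> i" if "i < d" "\<phi> \<in> X" "\<psi> \<in> X" for \<phi> \<psi> a b i
    by (rule functionalD[OF fco[OF that(1)] that(2,3)])
  have co_diff: "co (\<lambda>x. \<phi> x - \<psi> x) i = co \<phi> i - co \<psi> i" if "i < d" "\<phi> \<in> X" "\<psi> \<in> X" for \<phi> \<psi> i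
    using co_comb[OF that, of 1 "-1"] by simp
  have co_sum: "co (\<lambda>x. \<Sum>j\<in>J. c j * f j x) i = (\<Sum>j\<in>J. c j * co (f j) i)" if "i < d" "finite J" "\<And>j. j \<in> J \<Longrightarrow> f j \<in> X"
    for J :: "nat set" and c f i
    by (rule functional_sum[OF fco[OF that(1)] that(2,3)])
  have co_Ah: "co (op_Ah \<Omega> \<T> \<phi>) i = l i * co \<phi> i" if "i < d" "\<phi> \<in> X" for \<phi> i
    unfolding co_def by (rule E.coeff_S[OF that(2,1)])
  let ?S = "shifted_op \<Omega> \<T> \<alpha> \<tau>"
  have S_eq: "?S \<phi> = (\<lambda>x. 1 * \<phi> x + \<tau> powr \<alpha> * op_Ah \<Omega> \<T> \<phi> x)" for \<phi>
    by (simp add: shifted_op_def)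
  have co_S: "co (?S \<phi>) i = (1 + \<tau> powr \<alpha> * l i) * co \<phi> i" if "i < d" "\<phi> \<in> X" for \<phi> i
    unfolding S_eq using co_comb[OF that(1,2) op_Ah_spec(1)[OF that(2)], of 1 "\<tau> powr \<alpha>"] co_Ah[OF that]
    by (simp add: algebra_simps)
  have energy_eq: "energy_norm \<Omega> \<T> \<alpha> \<tau> \<psi> = L2_set (\<lambda>i. sqrt (1 + \<tau> powr \<alpha> * l i) * co \<psi> i) ?I" if \<psi>: "\<psi> \<in> X" for \<psi>
  proof -
    have Sop: "operator ?S"
      unfolding operator_def
    proof (intro conjI ballI allI)
      fix \<phi> assume "\<phi> \<in> X"
      then show "?S \<phi> \<in> X" unfolding S_eq by (intro X_comb op_Ah_spec)
    next
      fix \<phi> \<psi> a b assume p: "\<phi> \<in> X" "\<psi> \<in> X"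
      show "?S (\<lambda>x. a * \<phi> x + b * \<psi> x) = (\<lambda>x. a * ?S \<phi> x + b * ?S \<psi> x)"
        by (rule ext) (simp add: shifted_op_def operatorD(2)[OF op_Ah_operator p] algebra_simps)
    qed
    have "orthonormal_eigenbasis X (L2_inner \<Omega>) ?S d e (\<lambda>i. 1 + \<tau> powr \<alpha> * l i)"
      unfolding orthonormal_eigenbasis_def
    proof (intro conjI allI impI ballI)
      fix i assume i: "i < d"
      show "?S (e i) = (\<lambda>x. (1 + \<tau> powr \<alpha> * l i) * e i x)"
        by (rule ext) (simp add: shifted_op_def E.S_e[OF i] algebra_simps)
    qed (use E.e_closed E.orthonormal E.expansion in auto)
    then have "eigenbasis X (L2_inner \<Omega>) ?S d e (\<lambda>i. 1 + \<tau> powr \<alpha> * l i)"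
      using fun_inner_space_axioms Sop by (simp add: eigenbasis_def eigenbasis_axioms_def)
    then have "\<exists>B. is_pos_sqrt \<Omega> X ?S B"
    proof (rule exists_pos_sqrt)
      show "0 \<le> 1 + \<tau> powr \<alpha> * l i" if "i < d" for i using l[OF that] by simp
    qed
    \<comment> \<open>The energy norm uses a chosen root. Its specification shows that the squared
      norm is the product of \<open>?S \<psi>\<close> with \<psi>, whichever root was
      chosen.\<close>
    then have B: "is_pos_sqrt \<Omega> X ?S (pos_sqrt \<Omega> X ?S)"
      unfolding pos_sqrt_def by (rule someI_ex)
    let ?B = "pos_sqrt \<Omega> X ?S"
    have B1: "?B \<psi> \<in> X" and B2: "?B (?B \<psi>) = ?S \<psi>"
      using B \<psi> unfolding is_pos_sqrt_def by auto
    have "L2_inner \<Omega> (?B (?B \<psi>)) \<psi> = L2_inner \<Omega> (?B \<psi>) (?B \<psi>)"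
      using B \<psi> B1 unfolding is_pos_sqrt_def by blast
    then have "L2_inner \<Omega> (?B \<psi>) (?B \<psi>) = L2_inner \<Omega> (?S \<psi>) \<psi>" by (simp add: B2)
    also have "\<dots> = (\<Sum>i<d. co (?S \<psi>) i * co \<psi> i)"
      unfolding co_def by (rule E.parseval[OF operatorD(1)[OF Sop \<psi>] \<psi>])
    also have "\<dots> = (\<Sum>i<d. (sqrt (1 + \<tau> powr \<alpha> * l i) * co \<psi> i)\<^sup>2)"
    proof (rule sum.cong[OF refl])
      fix i assume "i \<in> {..<d}"
      then have i: "i < d" by simp
      have "0 \<le> 1 + \<tau> powr \<alpha> * l i" using l[OF i] by simp
      then show "co (?S \<psi>) i * co \<psi> i = (sqrt (1 + \<tau> powr \<alpha> * l i) * co \<psi> i)\<^sup>2"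
        by (simp add: co_S[OF i \<psi>] power_mult_distrib power2_eq_square)
    qed
    finally show ?thesis by (simp add: energy_norm_def L2_norm_def L2_set_def)
  qed
  interpret sch: spectral_scheme \<alpha> ?I l \<tau> N "\<lambda>n. co (U n)" "\<lambda>n. co (Ubar n)" "\<lambda>n. c0 * \<kappa> ^ M n"
  proof
    show "finite ?I" by simp
    show "0 \<le> l i" if "i \<in> ?I" for i using l that by (simp add: less_imp_le)
    show "0 < \<tau>" by (rule \<tau>)
    show "(1 + \<tau> powr \<alpha> * l i) * co (Ubar n) i =
      - (\<Sum>j=1..n. cq_weight \<alpha> j * co (U (n - j)) i) + (\<Sum>j=0..n. cq_weight \<alpha> j * co (U 0) i)"
      if n: "n \<in> {1..N}" and i: "i \<in> ?I" for n i
    proof -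
      have i': "i < d" using i by simp
      have U1: "U (n - j) \<in> X" for j using n by (intro U_closed) auto
      have U0: "U 0 \<in> X" by (rule U_closed) simp
      have "(1 + \<tau> powr \<alpha> * l i) * co (Ubar n) i = co (?S (Ubar n)) i"
        by (rule co_S[OF i' level(1)[OF n], symmetric])
      also have "\<dots> = (- 1) * co (\<lambda>x. \<Sum>j=1..n. cq_weight \<alpha> j * U (n - j) x) i + 1 * co (\<lambda>x. \<Sum>j=0..n. cq_weight \<alpha> j * U 0 x) i"
        unfolding level(2)[OF n] by (rule co_comb[OF i']) (intro sum_closed finite_atLeastAtMost U1 U0)+
      also have "co (\<lambda>x. \<Sum>j=1..n. cq_weight \<alpha> j * U (n - j) x) i = (\<Sum>j=1..n. cq_weight \<alpha> j * co (U (n - j)) i)"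
        by (rule co_sum[OF i' finite_atLeastAtMost U1])
      also have "co (\<lambda>x. \<Sum>j=0..n. cq_weight \<alpha> j * U 0 x) i = (\<Sum>j=0..n. cq_weight \<alpha> j * co (U 0) i)"
        by (rule co_sum[OF i' finite_atLeastAtMost U0])
      finally show ?thesis by simp
    qed
    show "co (U n) i = co (Ubar n) i" if "n \<in> {1, 2}" "n \<le> N" "i \<in> ?I" for n i
      using level(3)[of n] that by auto
    show "L2_set (\<lambda>i. sqrt (1 + \<tau> powr \<alpha> * l i) * (co (U n) i - co (Ubar n) i)) ?I \<le>
      c0 * \<kappa> ^ M n * L2_set (\<lambda>i. sqrt (1 + \<tau> powr \<alpha> * l i) * (2 * co (U (n - 1)) i - co (U (n - 2)) i - co (Ubar n) i)) ?I"
      if n: "n \<in> {3..N}" for n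
    proof -
      have n1: "n \<in> {1..N}" "n \<notin> {1, 2}" using n by auto
      note lv = level(4)[OF n1]
      note Ub = level(1)[OF n1(1)]
      have Un: "U n \<in> X" "U (n - 1) \<in> X" "U (n - 2) \<in> X" using n by (auto intro: U_closed)
      have W0: "W n 0 = (\<lambda>x. 2 * U (n - 1) x + (- 1) * U (n - 2) x)" using lv by simp
      have W0X: "W n 0 \<in> X" unfolding W0 by (rule X_comb[OF Un(2,3)])
      have "energy_norm \<Omega> \<T> \<alpha> \<tau> (\<lambda>x. U n x - Ubar n x) \<le> c0 * \<kappa> ^ M n * energy_norm \<Omega> \<T> \<alpha> \<tau> (\<lambda>x. W n 0 x - Ubar n x)"
      proof -
        have M1: "1 \<le> M n" and U_eq: "U n = W n (M n)" using lv by blast+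
        show ?thesis
          unfolding U_eq by (rule contraction[unfolded contraction_property_def, rule_format, OF n M1])
      qed
      moreover have "energy_norm \<Omega> \<T> \<alpha> \<tau> (\<lambda>x. U n x - Ubar n x) =
          L2_set (\<lambda>i. sqrt (1 + \<tau> powr \<alpha> * l i) * (co (U n) i - co (Ubar n) i)) ?I"
        unfolding energy_eq[OF diff_closed[OF Un(1) Ub]]
        by (rule L2_set_cong[OF refl]) (simp add: co_diff Un Ub)
      moreover have "energy_norm \<Omega> \<T> \<alpha> \<tau> (\<lambda>x. W n 0 x - Ubar n x) =
          L2_set (\<lambda>i. sqrt (1 + \<tau> powr \<alpha> * l i) * (2 * co (U (n - 1)) i - co (U (n - 2)) i - co (Ubar n) i)) ?I"
        unfolding energy_eq[OF diff_closed[OF W0X Ub]]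
      proof (rule L2_set_cong[OF refl])
        fix i assume "i \<in> ?I"
        then have i: "i < d" by simp
        have "co (W n 0) i = 2 * co (U (n - 1)) i + (- 1) * co (U (n - 2)) i"
          unfolding W0 by (rule co_comb[OF i Un(2,3)])
        then show "sqrt (1 + \<tau> powr \<alpha> * l i) * co (\<lambda>x. W n 0 x - Ubar n x) i =
            sqrt (1 + \<tau> powr \<alpha> * l i) * (2 * co (U (n - 1)) i - co (U (n - 2)) i - co (Ubar n) i)"
          by (simp add: co_diff[OF i W0X Ub])
      qed
      ultimately show ?thesis by simp
    qed
    show "0 \<le> c0 * \<kappa> ^ M n" for n using c0 \<kappa> by simp
    show "c0 * \<kappa> ^ M n \<le> solver_tol" if "n \<in> {3..N}" for n by (rule tolerance[OF that])
  qed
  \<comment> \<open>The semidiscrete equation is given pointwise in x. Every spectral coefficient is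
    a fixed finite combination of nodal values, which carries continuity, derivative and Caputo
    integral over to the coefficients.\<close>
  obtain P where P: "finite P" "\<forall>\<phi>\<in>X. (\<forall>p\<in>P. \<phi> p = 0) \<longrightarrow> \<phi> = (\<lambda>_. 0)" using separating_points by blast
  have nb: "\<exists>Q f. Q \<subseteq> P \<and> (\<forall>q\<in>Q. f q \<in> X) \<and> (\<forall>\<phi>\<in>X. \<phi> = (\<lambda>x. \<Sum>q\<in>Q. \<phi> q * f q x)) \<and>
    (\<forall>q\<in>Q. \<forall>p\<in>Q. f q p = (if p = q then 1 else 0))"
    by (rule nodal_basis[OF P(1) fun_space_axioms]) (use P(2) in blast)
  obtain Q f where Q: "Q \<subseteq> P" "\<forall>q\<in>Q. f q \<in> X" "\<forall>\<phi>\<in>X. \<phi> = (\<lambda>x. \<Sum>q\<in>Q. \<phi> q * f q x)"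
    using nb by (elim exE conjE)
  have fQ: "finite Q" using Q(1) P(1) finite_subset by blast
  have co_nodal: "co \<phi> i = (\<Sum>q\<in>Q. co (f q) i * \<phi> q)" if "i < d" "\<phi> \<in> X" for \<phi> i
  proof -
    have "co \<phi> i = co (\<lambda>x. \<Sum>q\<in>Q. \<phi> q * f q x) i" by (rule arg_cong[where f = "\<lambda>\<phi>. co \<phi> i"]) (rule bspec[OF Q(3) that(2)])
    also have "\<dots> = (\<Sum>q\<in>Q. \<phi> q * co (f q) i)"
      by (rule functional_sum[OF fco[OF that(1)] fQ]) (rule bspec[OF Q(2)])
    finally show ?thesis by (simp only: mult.commute)
  qed
  \<comment> \<open>Defined through nodal values for all t; it is the spectral coefficient of
    \<open>u t\<close> for t \<ge> 0, where \<open>u t\<close> is known to lie in X.\<close>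
  define y where "y i t = (\<Sum>q\<in>Q. co (f q) i * u t q)" for i t
  have y_co: "y i t = co (u t) i" if "i < d" "0 \<le> t" for i t
    unfolding y_def by (rule co_nodal[OF that(1) u_closed[OF that(2)], symmetric])
  have uc: "continuous_on {0..} (\<lambda>t. u t x)" for x
    using semidiscrete by (simp add: semidiscrete_solution_def)
  have ud: "(\<lambda>s. u s x) field_differentiable (at t)" and
    ui: "set_integrable lborel {0<..<t} (\<lambda>s. (t - s) powr (- \<alpha>) * deriv (\<lambda>r. u r x) s)" and
    ue: "caputo \<alpha> (\<lambda>s. u s x) t = - op_Ah \<Omega> \<T> (u t) x" if "0 < t" for t x
    using semidiscrete that by (auto simp: semidiscrete_solution_def add_eq_0_iff)
  have yd: "(y i has_real_derivative (\<Sum>q\<in>Q. co (f q) i * deriv (\<lambda>r. u r q) t)) (at t)" if "0 < t" for i t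
    unfolding y_def using ud[OF that]
    by (intro DERIV_sum DERIV_cmult) (simp add: DERIV_deriv_iff_field_differentiable)
  have dy: "deriv (y i) t = (\<Sum>q\<in>Q. co (f q) i * deriv (\<lambda>r. u r q) t)" if "0 < t" for i t
    by (rule DERIV_imp_deriv[OF yd[OF that]])
  have kernel_y: "indicator {0<..<t} s *\<^sub>R ((t - s) powr (- \<alpha>) * deriv (y i) s) =
      (\<Sum>q\<in>Q. co (f q) i * (indicator {0<..<t} s *\<^sub>R ((t - s) powr (- \<alpha>) * deriv (\<lambda>r. u r q) s)))" for t s i
    by (cases "s \<in> {0<..<t}") (simp_all add: dy sum_distrib_left mult_ac)
  have yi: "set_integrable lborel {0<..<t} (\<lambda>s. (t - s) powr (- \<alpha>) * deriv (y i) s)" if "0 < t" for t i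
    unfolding set_integrable_def kernel_y
    using ui[OF that] unfolding set_integrable_def by (intro Bochner_Integration.integrable_sum integrable_mult_right)
  have ye: "caputo \<alpha> (y i) t = - (l i * y i t)" if "i < d" "0 < t" for t i
  proof -
    have "(LINT s:{0<..<t}|lborel. (t - s) powr (- \<alpha>) * deriv (y i) s) =
        (\<Sum>q\<in>Q. co (f q) i * (LINT s:{0<..<t}|lborel. (t - s) powr (- \<alpha>) * deriv (\<lambda>r. u r q) s))"
      unfolding set_lebesgue_integral_def kernel_y
      using ui[OF that(2)] unfolding set_integrable_def
      by (subst Bochner_Integration.integral_sum) (auto intro: integrable_mult_right)
    then have "caputo \<alpha> (y i) t = (\<Sum>q\<in>Q. co (f q) i * caputo \<alpha> (\<lambda>s. u s q) t)"
      by (simp add: caputo_def sum_distrib_left sum_divide_distrib mult_ac)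
    also have "\<dots> = - (\<Sum>q\<in>Q. co (f q) i * op_Ah \<Omega> \<T> (u t) q)"
      by (simp add: ue[OF that(2)] sum_negf)
    also have "(\<Sum>q\<in>Q. co (f q) i * op_Ah \<Omega> \<T> (u t) q) = co (op_Ah \<Omega> \<T> (u t)) i"
      by (rule co_nodal[OF that(1) op_Ah_spec(1)[OF u_closed], symmetric]) (use that in simp)
    also have "\<dots> = l i * y i t"
      using co_Ah[OF that(1) u_closed] y_co[OF that(1)] that(2) by simp
    finally show ?thesis .
  qed
  have y0: "y i 0 = co (U 0) i" if "i < d" for i
    using y_co[OF that, of 0] semidiscrete by (simp add: U_0 semidiscrete_solution_def)
  have exact: "\<bar>y i (real n * \<tau>) - co (U 0) i * fps_nth (exact_fps (\<tau> powr \<alpha> * l i)) n\<bar> \<le>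
      err_const * \<tau> powr \<alpha> * real n powr (\<alpha> - 1) * \<bar>l i * co (U 0) i\<bar>" if i: "i < d" for i
  proof -
    interpret vol: volterra \<alpha> "l i" "co (U 0) i" "y i"
    proof
      show "0 < l i" by (rule l[OF i])
      show cy: "continuous_on {0..} (y i)" unfolding y_def by (intro continuous_intros uc)
      show "y i 0 = co (U 0) i" by (rule y0[OF i])
      show "y i t + l i / Gamma \<alpha> * integral {0..t} (\<lambda>s. (t - s) powr (\<alpha> - 1) * y i s) = co (U 0) i" if "0 < t" for t
        unfolding y0[OF i, symmetric]
        by (rule caputo_volterra[OF cy _ yi ye[OF i] that])
          (use yd in \<open>auto simp: field_differentiable_def\<close>)
    qed
    have "\<bar>y i (real n * \<tau>) - co (U 0) i * fps_nth (exact_fps (\<tau> powr \<alpha> * l i)) n\<bar> \<le>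
        err_const * (\<tau> powr \<alpha> * l i) * real n powr (\<alpha> - 1) * \<bar>co (U 0) i\<bar>"
      by (rule vol.solution_err_bound[OF \<tau>]) (use n in simp)
    also have "\<dots> = err_const * \<tau> powr \<alpha> * real n powr (\<alpha> - 1) * \<bar>l i * co (U 0) i\<bar>"
      using l[OF i] by (simp add: abs_mult)
    finally show ?thesis .
  qed
  have AU: "L2_set (\<lambda>i. l i * co (U 0) i) ?I \<le> L2_norm \<Omega> (op_A \<Omega> v)"
  proof -
    have U0: "U 0 \<in> X" by (rule U_closed) simp
    have "L2_set (\<lambda>i. l i * co (U 0) i) ?I = L2_set (co (op_Ah \<Omega> \<T> (U 0))) ?I"
      by (rule L2_set_cong[OF refl]) (simp add: co_Ah U0)
    also have "\<dots> = L2_norm \<Omega> (op_Ah \<Omega> \<T> (U 0))" by (rule norm_eq[OF op_Ah_spec(1)[OF U0], symmetric])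
    also have "\<dots> \<le> L2_norm \<Omega> (op_A \<Omega> v)" unfolding U_0 vh by (rule op_Ah_Ritz_bound[OF v])
    finally show ?thesis .
  qed
  have t0: "0 \<le> real n * \<tau>" using \<tau> by simp
  have UX: "U n \<in> X" using n by (intro U_closed) simp
  let ?R = "\<tau> powr \<alpha> * real n powr (\<alpha> - 1)" and ?V = "\<lambda>i. co (U 0) i * fps_nth (exact_fps (\<tau> powr \<alpha> * l i)) n"
  have "L2_norm \<Omega> (\<lambda>x. U n x - u (real n * \<tau>) x) = L2_set (co (\<lambda>x. U n x - u (real n * \<tau>) x)) ?I"
    by (rule norm_eq[OF diff_closed[OF UX u_closed[OF t0]]])
  \<comment> \<open>The exactly solved scheme is inserted: one difference contains the solver
    residuals, the other the time discretisation.\<close>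
  also have "\<dots> = L2_set (\<lambda>i. (co (U n) i - ?V i) + (?V i - y i (real n * \<tau>))) ?I"
    by (rule L2_set_cong[OF refl]) (simp add: co_diff UX u_closed[OF t0] y_co t0)
  also have "\<dots> \<le> L2_set (\<lambda>i. co (U n) i - ?V i) ?I + L2_set (\<lambda>i. ?V i - y i (real n * \<tau>)) ?I"
    by (rule L2_set_triangle_ineq)
  also have "L2_set (\<lambda>i. co (U n) i - ?V i) ?I \<le> perturb_const * sch.\<Lambda> * real n powr (\<alpha> - 1)"
    by (rule sch.deviation_bound[OF n])
  also have "perturb_const * sch.\<Lambda> * real n powr (\<alpha> - 1) \<le> perturb_const * (\<tau> powr \<alpha> * L2_norm \<Omega> (op_A \<Omega> v)) * real n powr (\<alpha> - 1)"
    unfolding sch.\<Lambda>_def using perturb_const_pos AU by (intro mult_right_mono mult_left_mono) auto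
  also have "L2_set (\<lambda>i. ?V i - y i (real n * \<tau>)) ?I \<le> (err_const * ?R) * L2_set (\<lambda>i. l i * co (U 0) i) ?I"
  proof (rule L2_set_bound)
    fix i assume "i \<in> ?I"
    then show "\<bar>?V i - y i (real n * \<tau>)\<bar> \<le> (err_const * ?R) * \<bar>l i * co (U 0) i\<bar>"
      using exact[of i] by (simp add: abs_minus_commute mult.assoc)
  qed (use err_const_pos in simp)
  also have "(err_const * ?R) * L2_set (\<lambda>i. l i * co (U 0) i) ?I \<le> (err_const * ?R) * L2_norm \<Omega> (op_A \<Omega> v)"
    using AU err_const_pos by (intro mult_left_mono) auto
  finally show ?thesis by (simp add: algebra_simps)
qed

end

theorem theorem4p1:
  fixes \<Omega> :: "'a::euclidean_space set"
    and F :: "'a set set set"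
    and T \<alpha> c0 \<kappa> :: real
  assumes "DIM('a) \<in> {1, 2, 3}"
    and "convex_polyhedral_domain \<Omega>"
    and "T > 0"
    and "0 < \<alpha>" and "\<alpha> < 1"
    and "\<forall>\<T>\<in>F. triangulation_of \<Omega> \<T>"
    and "shape_regular F"
    and "quasi_uniform F"
    and "c0 > 0"
    and "0 < \<kappa>" and "\<kappa> < 1"
  shows "\<exists>\<delta>>0. \<exists>c>0. \<forall>\<T>\<in>F. \<forall>N\<ge>1. \<forall>v u U Ubar W M.
    let \<tau> = T / real N;
        t = (\<lambda>n. real n * \<tau>);
        l = (\<lambda>n. ln (1 + t n / \<tau>));
        vh = Ritz_projection \<Omega> \<T> v
    in v \<in> dom_A \<Omega> \<longrightarrow>
       semidiscrete_solution \<Omega> \<T> \<alpha> vh u \<longrightarrow>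
       incomplete_scheme \<Omega> \<T> \<alpha> \<tau> N (\<lambda>_ _. 0) vh {1, 2} U Ubar W M \<longrightarrow>
       contraction_property \<Omega> \<T> \<alpha> \<tau> {3..N} c0 \<kappa> Ubar W \<longrightarrow>
       (\<forall>n\<in>{3..N}. c0 * \<kappa> ^ M n \<le> \<delta> * inverse (l n) * min (t n powr (\<alpha> / 2)) 1) \<longrightarrow>
       (\<forall>n\<in>{1..N}. L2_norm \<Omega> (\<lambda>x. U n x - u (t n) x)
          \<le> c * \<tau> * t n powr (\<alpha> - 1) * l n * L2_norm \<Omega> (op_A \<Omega> v))"
proof -
  interpret fractional_order \<alpha> by unfold_locales fact+
  let ?c = "perturb_const + err_const"
  have c: "0 < ?c" using perturb_const_pos err_const_pos by simp
  show ?thesis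
    unfolding Let_def
  \<comment> \<open>The factor 2 in the constant comes from 1 \<le> 2 ln (1 + n).\<close>
  proof (rule exI[of _ solver_tol], rule conjI, rule solver_tol_pos, rule exI[of _ "2 * ?c"], intro conjI ballI allI impI)
    show "0 < 2 * ?c" using c by simp
    fix \<T> N v u U Ubar W M n
    assume A: "\<T> \<in> F" "1 \<le> (N::nat)" "v \<in> dom_A \<Omega>"
      "semidiscrete_solution \<Omega> \<T> \<alpha> (Ritz_projection \<Omega> \<T> v) u"
      "incomplete_scheme \<Omega> \<T> \<alpha> (T / real N) N (\<lambda>_ _. 0) (Ritz_projection \<Omega> \<T> v) {1, 2} U Ubar W M"
      "contraction_property \<Omega> \<T> \<alpha> (T / real N) {3..N} c0 \<kappa> Ubar W"
      and tol: "\<forall>n\<in>{3..N}. c0 * \<kappa> ^ M n \<le> solver_tol * inverse (ln (1 + real n * (T / real N) / (T / real N))) *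
        min ((real n * (T / real N)) powr (\<alpha> / 2)) 1"
      and n: "n \<in> {1..N}"
    define \<tau> where "\<tau> = T / real N"
    have \<tau>: "0 < \<tau>" using assms(3) A(2) by (simp add: \<tau>_def)
    have ln_eq: "ln (1 + real n * \<tau> / \<tau>) = ln (1 + real n)" for n using \<tau> by simp
    interpret fe: fe_scheme \<Omega> \<T> \<alpha> \<tau> N u v "Ritz_projection \<Omega> \<T> v" U Ubar W M c0 \<kappa>
    proof unfold_locales
      show "c0 * \<kappa> ^ M n \<le> solver_tol" if n3: "n \<in> {3..N}" for n
      proof -
        \<comment> \<open>At these levels the logarithm exceeds 1, so the prescribed tolerance is at
          most \<open>solver_tol\<close>.\<close>
        have "ln 3 \<le> ln (1 + real n)" using n3 by (subst ln_le_cancel_iff) auto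
        then have "1 \<le> ln (1 + real n)" using ln3_gt_1 by linarith
        then have "inverse (ln (1 + real n)) \<le> 1" by (simp add: inverse_le_1_iff)
        moreover have "0 \<le> inverse (ln (1 + real n))" by simp
        ultimately have "inverse (ln (1 + real n)) * min ((real n * \<tau>) powr (\<alpha> / 2)) 1 \<le> 1 * 1"
          by (intro mult_mono) auto
        then have "solver_tol * (inverse (ln (1 + real n)) * min ((real n * \<tau>) powr (\<alpha> / 2)) 1) \<le> solver_tol * (1 * 1)"
          using solver_tol_pos by (intro mult_left_mono) auto
        moreover have "c0 * \<kappa> ^ M n \<le> solver_tol * inverse (ln (1 + real n)) * min ((real n * \<tau>) powr (\<alpha> / 2)) 1"
          using bspec[OF tol n3] unfolding \<tau>_def[symmetric] ln_eq .
        ultimately show ?thesis by (simp only: mult.assoc mult_1_right)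
      qed
    qed (use assms A \<tau> in \<open>auto simp: \<tau>_def[symmetric]\<close>)
    have n1: "1 \<le> real n" using n by simp
    \<comment> \<open>Back from step numbers to times: one factor \<tau> is split off and the rest
      combines with n to the time level.\<close>
    have "\<tau> powr \<alpha> * real n powr (\<alpha> - 1) = \<tau> * (real n * \<tau>) powr (\<alpha> - 1)"
      using \<tau> n1 powr_mult_base[of \<tau> "\<alpha> - 1"] by (simp add: powr_mult)
    then have "L2_norm \<Omega> (\<lambda>x. U n x - u (real n * \<tau>) x) \<le>
        ?c * (\<tau> * (real n * \<tau>) powr (\<alpha> - 1)) * L2_norm \<Omega> (op_A \<Omega> v) * 1"
      using fe.error_bound[OF n] by simp
    also have "\<dots> \<le> ?c * (\<tau> * (real n * \<tau>) powr (\<alpha> - 1)) * L2_norm \<Omega> (op_A \<Omega> v) * (2 * ln (1 + real n))"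
    proof (intro mult_left_mono)
      have "ln 2 \<le> ln (1 + real n)" using n1 by (subst ln_le_cancel_iff) auto
      moreover have "1 / 2 \<le> ln (2::real)" using ln2_ge_two_thirds by linarith
      ultimately show "1 \<le> 2 * ln (1 + real n)" by linarith
      show "0 \<le> ?c * (\<tau> * (real n * \<tau>) powr (\<alpha> - 1)) * L2_norm \<Omega> (op_A \<Omega> v)"
        using c \<tau> by (intro mult_nonneg_nonneg) (auto simp: L2_norm_def L2_inner_def)
    qed
    finally show "L2_norm \<Omega> (\<lambda>x. U n x - u (real n * (T / real N)) x)
        \<le> 2 * ?c * (T / real N) * (real n * (T / real N)) powr (\<alpha> - 1) * ln (1 + real n * (T / real N) / (T / real N)) * L2_norm \<Omega> (op_A \<Omega> v)"
      unfolding \<tau>_def[symmetric] ln_eq by (simp only: mult_ac)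
  qed
qed

end
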